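(* Let $f:\mathbb T\to\mathbb R$ be piecewise H\"older and let $\omega\in\mathbb R\setminus\mathbb Q$. Suppose that the Lyapunov exponent $\mathcal L(E)$ is positive for every $E$ in a Borel set $U\subset\mathbb R$ with $N(U)>0$. Then: 1. For any irrational $\omega$, $\underline\xi=0$ for a.e. $\theta$. 2. If $\omega$ is Diophantine, then $\overline\xi=0$ for a.e. $\theta$. 3. There is a constant $C>0$ such that for all $\theta$ and all $\zeta>0$ there is a sequence $T_k\to\infty$ with $P_{T_k}(T_k^{\zeta})>C\mu_\theta(U)$ for all $k$; moreover, if $\omega$ is Diophantine, then $P_T(T^{\zeta})>C\mu_\theta(U)$ for all sufficiently large $T$.
   Context: $\mathbb T=\mathbb R/\mathbb Z$. For $f:\mathbb T\to\mathbb R$, $\omega\in\mathbb R\setminus\mathbb Q$ and $\theta\in\mathbb R$, let $\mathfrak h_\theta$ be the Schr\"odinger operator on $\ell^2(\mathbb Z)$, $(\mathfrak h_\theta u)(n)=u(n-1)+u(n+1)+f(n\omega+\theta)u(n)$. Piecewise H\"older: $f$ has a finite set of discontinuities $J_f$ and there is $\gamma>0$ such that $\|f\|_{PL_\gamma}=\|f\|_\infty+\sup_{h>0}\sup_{t\in\mathbb T;\,\mathrm{dist}(t,J_f)>|h|}\frac{|f(t+h)-f(t)|}{|h|^\gamma}<\infty$, where $\|f\|_\infty=\sup|f|$ (if $J_f=\emptyset$ the distance condition is void). Lyapunov exponent: for $z\in\mathbb C$ let $A^{f,z}(\theta)=\begin{pmatrix}z-f(\theta)&-1\\1&0\end{pmatrix}$,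 $A^{f,z}_k(\theta)=A^{f,z}(\theta+(k-1)\omega)\cdots A^{f,z}(\theta+\omega)A^{f,z}(\theta)$ for $k\ge1$, and $\mathcal L(z)=\lim_{k\to\infty}\frac1k\int_{\mathbb T}\ln\|A^{f,z}_k(\theta)\|\,d\theta$. Diophantine: let $p_n/q_n$ be the continued fraction approximants of $\omega$; $\omega$ is Diophantine if for some $\kappa>0$, $q_{n+1}<q_n^{1+\kappa}$ for all large $n$. $\mu_\theta$ is the spectral measure of $\mathfrak h_\theta$ and $\delta_0$, i.e. $\langle(\mathfrak h_\theta-z)^{-1}\delta_0,\delta_0\rangle=\int_{\mathbb R}\frac{d\mu_\theta(x)}{x-z}$ for $z$ in the upper half plane; $N=\int_{\mathbb T}\mu_\theta\,d\theta$ is the integrated density of states measure. Dynamics: $a(n,t)=\frac12\left(|\langle e^{-it\mathfrak h_\theta}\delta_0,\delta_n\rangle|^2+|\langle e^{-it\mathfrak h_\theta}\delta_1,\delta_n\rangle|^2\right)$, $a_T(n)=\frac2T\int_0^\infty e^{-2t/T}a(n,t)\,dt$, $P_T(L)=\sum_{|n|\le L}a_T(n)$. The scaling exponents (depending on $\omega,\theta$) are $$\overline\xi=\lim_{\delta\to0^+}\limsup_{T\to\infty}\frac{\ln(\inf\{L\ge1:\ P_T(L)>\delta\})}{\ln T},\qquad \underline\xi=\lim_{\delta\to0^+}\liminf_{T\to\infty}\frac{\ln(\inf\{L\ge1:\ P_T(L)>\delta\})}{\ln T}.$$ *)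

theory Defs
  imports "HOL-Analysis.Analysis"
begin

(* Functions on the circle R/Z are represented by 1-periodic functions on the real line;
   integrals over the circle are Lebesgue integrals over [0,1). *)

definition periodic1 :: "(real \<Rightarrow> 'a) \<Rightarrow> bool" where
  "periodic1 f \<longleftrightarrow> (\<forall>t. f (t + 1) = f t)"

(* The preimage in the real line of the set of discontinuities on the circle. *)
definition discont :: "(real \<Rightarrow> real) \<Rightarrow> real set" where
  "discont f = {t. \<not> isCont f t}"

(* As discont f is invariant under integer translations, infdist t (discont f) is the distance
   on the circle. The empty set needs its own clause because infdist t {} = 0. *)
definition PL_norm :: "real \<Rightarrow> (real \<Rightarrow> real) \<Rightarrow> ennreal" where
  "PL_norm \<gamma> f =
     (SUP t. ennreal \<bar>f t\<bar>) +
     (SUP h\<in>{0<..}. SUP t\<in>{t. discont f = {} \<or> infdist t (discont f) > \<bar>h\<bar>}.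
        ennreal (\<bar>f (t + h) - f t\<bar> / \<bar>h\<bar> powr \<gamma>))"

definition piecewise_Hoelder :: "(real \<Rightarrow> real) \<Rightarrow> bool" where
  "piecewise_Hoelder f \<longleftrightarrow>
     periodic1 f \<and> finite (discont f \<inter> {0..<1}) \<and> (\<exists>\<gamma>>0. PL_norm \<gamma> f < \<infinity>)"


(* Complete quotients x_n of the continued fraction x = [a_0; a_1, a_2, ...] of an irrational x,
   with a_n = floor x_n. *)
fun cf_rem :: "real \<Rightarrow> nat \<Rightarrow> real" where
  "cf_rem x 0 = x"
| "cf_rem x (Suc n) = 1 / frac (cf_rem x n)"

definition cf_digit :: "real \<Rightarrow> nat \<Rightarrow> int" where
  "cf_digit x n = \<lfloor>cf_rem x n\<rfloor>"

(* Denominators q_n of the convergents p_n / q_n. *)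
fun cf_denom :: "real \<Rightarrow> nat \<Rightarrow> int" where
  "cf_denom x 0 = 1"
| "cf_denom x (Suc 0) = cf_digit x 1"
| "cf_denom x (Suc (Suc n)) = cf_digit x (Suc (Suc n)) * cf_denom x (Suc n) + cf_denom x n"

definition diophantine :: "real \<Rightarrow> bool" where
  "diophantine \<omega> \<longleftrightarrow>
     (\<exists>\<kappa>>0. \<forall>\<^sub>F n in sequentially.
        real_of_int (cf_denom \<omega> (Suc n)) < real_of_int (cf_denom \<omega> n) powr (1 + \<kappa>))"


definition transfer_matrix :: "(real \<Rightarrow> real) \<Rightarrow> complex \<Rightarrow> real \<Rightarrow> complex ^ 2 ^ 2" where
  "transfer_matrix f z \<theta> =
     vector [vector [z - complex_of_real (f \<theta>), - 1], vector [1, 0]]"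

fun cocycle :: "(real \<Rightarrow> real) \<Rightarrow> real \<Rightarrow> complex \<Rightarrow> nat \<Rightarrow> real \<Rightarrow> complex ^ 2 ^ 2" where
  "cocycle f \<omega> z 0 \<theta> = mat 1"
| "cocycle f \<omega> z (Suc k) \<theta> = transfer_matrix f z (\<theta> + real k * \<omega>) ** cocycle f \<omega> z k \<theta>"

(* The matrix norm is the operator norm for the Euclidean norm on C^2; the library's norm on the
   type complex^2^2 is the Frobenius norm. *)
definition lyapunov :: "(real \<Rightarrow> real) \<Rightarrow> real \<Rightarrow> complex \<Rightarrow> real" where
  "lyapunov f \<omega> z =
     lim (\<lambda>k. (1 / real k) *
       set_lebesgue_integral lborel {0..<1}
         (\<lambda>\<theta>. ln (onorm (\<lambda>v. cocycle f \<omega> z k \<theta> *v v))))"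


definition l2 :: "(int \<Rightarrow> complex) set" where
  "l2 = {u. (\<lambda>n. (cmod (u n))\<^sup>2) summable_on UNIV}"

(* Linear in the first argument. *)
definition l2_inner :: "(int \<Rightarrow> complex) \<Rightarrow> (int \<Rightarrow> complex) \<Rightarrow> complex" where
  "l2_inner u v = (\<Sum>\<^sub>\<infinity>n. u n * cnj (v n))"

definition delta :: "int \<Rightarrow> int \<Rightarrow> complex" where
  "delta k = (\<lambda>n. if n = k then 1 else 0)"

definition schroedinger ::
  "(real \<Rightarrow> real) \<Rightarrow> real \<Rightarrow> real \<Rightarrow> (int \<Rightarrow> complex) \<Rightarrow> int \<Rightarrow> complex" where
  "schroedinger f \<omega> \<theta> u n =
     u (n - 1) + u (n + 1) + complex_of_real (f (real_of_int n * \<omega> + \<theta>)) * u n"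

definition resolvent ::
  "((int \<Rightarrow> complex) \<Rightarrow> int \<Rightarrow> complex) \<Rightarrow> complex \<Rightarrow> (int \<Rightarrow> complex) \<Rightarrow> int \<Rightarrow> complex" where
  "resolvent A z = inv_into l2 (\<lambda>u n. A u n - z * u n)"

(* The vector exp (c A) v for a bounded operator A on l2. The exponential series converges in
   l2, so its sum may be computed coordinatewise. *)
definition op_exp ::
  "((int \<Rightarrow> complex) \<Rightarrow> int \<Rightarrow> complex) \<Rightarrow> complex \<Rightarrow> (int \<Rightarrow> complex) \<Rightarrow> int \<Rightarrow> complex" where
  "op_exp A c v n = (\<Sum>k. c ^ k / fact k * (A ^^ k) v n)"

(* A finite Borel measure on the line is determined by its Stieltjes transform. *)
definition spectral_measure :: "(real \<Rightarrow> real) \<Rightarrow> real \<Rightarrow> real \<Rightarrow> real measure" where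
  "spectral_measure f \<omega> \<theta> =
     (THE \<mu>. finite_measure \<mu> \<and> sets \<mu> = sets borel \<and>
        (\<forall>z. Im z > 0 \<longrightarrow>
           l2_inner (resolvent (schroedinger f \<omega> \<theta>) z (delta 0)) (delta 0) =
             (\<integral>x. 1 / (complex_of_real x - z) \<partial>\<mu>)))"

definition ids_measure :: "(real \<Rightarrow> real) \<Rightarrow> real \<Rightarrow> real measure" where
  "ids_measure f \<omega> =
     measure_of UNIV (sets borel)
       (\<lambda>B. \<integral>\<^sup>+ \<theta>\<in>{0..<1}. emeasure (spectral_measure f \<omega> \<theta>) B \<partial>lborel)"


definition site_prob :: "(real \<Rightarrow> real) \<Rightarrow> real \<Rightarrow> real \<Rightarrow> int \<Rightarrow> real \<Rightarrow> real" where
  "site_prob f \<omega> \<theta> n t =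
     (1 / 2) *
       ((cmod (l2_inner (op_exp (schroedinger f \<omega> \<theta>) (- \<i> * complex_of_real t) (delta 0)) (delta n)))\<^sup>2 +
        (cmod (l2_inner (op_exp (schroedinger f \<omega> \<theta>) (- \<i> * complex_of_real t) (delta 1)) (delta n)))\<^sup>2)"

definition avg_site_prob :: "(real \<Rightarrow> real) \<Rightarrow> real \<Rightarrow> real \<Rightarrow> real \<Rightarrow> int \<Rightarrow> real" where
  "avg_site_prob f \<omega> \<theta> T n =
     (2 / T) * set_lebesgue_integral lborel {0..} (\<lambda>t. exp (- 2 * t / T) * site_prob f \<omega> \<theta> n t)"

definition box_prob :: "(real \<Rightarrow> real) \<Rightarrow> real \<Rightarrow> real \<Rightarrow> real \<Rightarrow> real \<Rightarrow> real" where
  "box_prob f \<omega> \<theta> T L = (\<Sum>n\<in>{n::int. \<bar>real_of_int n\<bar> \<le> L}. avg_site_prob f \<omega> \<theta> T n)"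

definition log_spread :: "(real \<Rightarrow> real) \<Rightarrow> real \<Rightarrow> real \<Rightarrow> real \<Rightarrow> real \<Rightarrow> real" where
  "log_spread f \<omega> \<theta> \<delta> T = ln (Inf {L::real. L \<ge> 1 \<and> box_prob f \<omega> \<theta> T L > \<delta>}) / ln T"

definition upper_xi :: "(real \<Rightarrow> real) \<Rightarrow> real \<Rightarrow> real \<Rightarrow> ereal" where
  "upper_xi f \<omega> \<theta> =
     Lim (at_right 0) (\<lambda>\<delta>. Limsup at_top (\<lambda>T. ereal (log_spread f \<omega> \<theta> \<delta> T)))"

definition lower_xi :: "(real \<Rightarrow> real) \<Rightarrow> real \<Rightarrow> real \<Rightarrow> ereal" where
  "lower_xi f \<omega> \<theta> =
     Lim (at_right 0) (\<lambda>\<delta>. Liminf at_top (\<lambda>T. ereal (log_spread f \<omega> \<theta> \<delta> T)))"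

end

theory Submission
  imports Defs "HOL-Probability.Probability"
begin

text \<open>
  Let \<open>\<epsilon> = 1/T\<close>. By Plancherel, \<open>P\<^sub>T(L)\<close> equals \<open>\<epsilon>/2\<pi>\<close> times the integral over the energy \<open>E\<close> of the mass which
  the Green functions \<open>G(n, E + i\<epsilon>)\<close> of the phases \<open>\<theta>\<close> and \<open>\<theta> + \<omega>\<close> put on the box \<open>|n| \<le> L\<close>, while their total
  mass is \<open>Im G(0, E + i\<epsilon>) / \<epsilon>\<close>. A solution of the eigenvalue equation which starts from a Dirichlet condition
  next to the origin and is large at some site \<open>k\<close> forces \<open>G\<close> to be small beyond \<open>k\<close>, so the box contains almost
  the total mass as soon as the cocycle reaches a large power of \<open>T\<close> within \<open>L\<close> steps. Integrating
  \<open>Im G(0, E + i\<epsilon>)\<close> over the energies for which this happens gives, by Fatou's lemma, at least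
  \<open>(\<pi>/2) \<mu>\<^sub>\<theta>(U)\<close> in the limit.

  If the Lyapunov exponent is positive, then for a typical phase all the cocycles over consecutive blocks of length
  \<open>c ln N\<close> grow at the expected rate, and the avalanche principle makes a bounded number of blocks larger than any
  power of \<open>N\<close>. For small \<open>c\<close> this survives perturbations of phase and energy of size \<open>N\<^sup>-\<^sup>a\<close>, by the
  Hoelder condition away from the discontinuities. When the first \<open>N\<close> points of the orbit of \<open>\<omega>\<close> are
  \<open>N\<^sup>-\<^sup>a\<close>-dense, every phase comes close to a typical one, and the norm is large either at the start or at the
  end of the block. Such density holds for infinitely many \<open>N\<close> if \<open>\<omega>\<close> is irrational, and for all large \<open>N\<close> if
  \<open>\<omega>\<close> is Diophantine. Positivity of \<open>\<mu>\<^sub>\<theta>(U) + \<mu>\<^bsub>\<theta> + \<omega>\<^esub>(U)\<close> for almost every \<open>\<theta>\<close> follows from ergodicity,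
  because \<open>\<delta>\<^sub>0, \<delta>\<^sub>1\<close> is a cyclic pair.
\<close>

section \<open>Density of irrational rotation orbits\<close>

text \<open>No estimate is uniform in the energy: the exponent is only known to be positive at each
  point of \<open>U\<close>, and the scale from which the cocycle grows depends on that point.
  Growth is therefore proved near one fixed energy at a time, and the energies are put together only
  in the limit. Deviations of the cocycle are likewise controlled only in measure; it is the density
  of the orbit that turns a single typical phase into a statement about all phases.

  The logarithmic block length is forced. Errors of size \<open>N powr - a\<close> grow
  exponentially along a block, so its length must be a small multiple of \<open>ln N\<close>, and
  one block gains only a small power of \<open>N\<close>. The half line estimate, however, loses the
  fourth power of \<open>1 / Im z\<close>, which is \<open>T ^ 4\<close>. Chaining a fixed number of
  blocks bridges this gap.

  The evolution is a power series, the Green function its Laplace transform, and the spectral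
  measure is built from moments. They agree with the objects defined by inversion and by definite
  description because \<open>l2\<close> solutions off the real axis and Stieltjes transforms are
  unique.\<close>

lemma filterlim_powr_at_top:
  fixes a :: real assumes "a > 0"
  shows "filterlim (\<lambda>x. x powr a) at_top at_top"
proof -
  have lim: "filterlim (\<lambda>x. exp (a * ln x)) at_top at_top"
    by (intro filterlim_compose[OF exp_at_top] filterlim_tendsto_pos_mult_at_top[OF tendsto_const assms] ln_at_top)
  have "\<forall>\<^sub>F x in at_top. exp (a * ln x) = x powr a"
    using eventually_gt_at_top[of 0] by eventually_elim (simp add: powr_def)
  then show ?thesis by (rule filterlim_mono_eventually[OF lim order_refl order_refl])
qed

text \<open>Uniform in the starting point \<open>x\<close>, because the phase is arbitrary later on;
  \<open>m\<close> stands for reduction modulo 1.\<close>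

definition orbit_dense :: "real \<Rightarrow> nat \<Rightarrow> real \<Rightarrow> bool" where
  "orbit_dense \<omega> N r \<longleftrightarrow> (\<forall>x y. \<exists>j<N. \<exists>m::int. \<bar>x + real j * \<omega> + real_of_int m - y\<bar> \<le> r)"

lemma orbit_dense_mono: "orbit_dense \<omega> N r \<Longrightarrow> N \<le> M \<Longrightarrow> r \<le> s \<Longrightarrow> orbit_dense \<omega> M s"
  unfolding orbit_dense_def by (meson order_less_le_trans order_trans)

text \<open>Reflecting both points reverses the rotation. The left half line is treated with the
  frequency \<open>- \<omega>\<close>, so the density hypothesis has to pass to it.\<close>

lemma orbit_dense_uminus: "orbit_dense \<omega> N r \<Longrightarrow> orbit_dense (- \<omega>) N r"
  unfolding orbit_dense_def
proof (intro allI)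
  fix x y assume "\<forall>x y. \<exists>j<N. \<exists>m::int. \<bar>x + real j * \<omega> + real_of_int m - y\<bar> \<le> r"
  then obtain j m where "j < N" "\<bar>- x + real j * \<omega> + real_of_int m - (- y)\<bar> \<le> r" by blast
  then have "\<bar>x + real j * (- \<omega>) + real_of_int (- m) - y\<bar> \<le> r" by (simp add: abs_le_iff algebra_simps)
  then show "\<exists>j<N. \<exists>m::int. \<bar>x + real j * (- \<omega>) + real_of_int m - y\<bar> \<le> r" using \<open>j < N\<close> by blast
qed

text \<open>As \<open>p\<close> is invertible modulo \<open>q\<close>, the points
  \<open>j * p / q\<close> with \<open>j < q\<close> run through all multiples of
  \<open>1 / q\<close> modulo 1. One of them is within \<open>1 / (2 * q)\<close> of the target, and
  replacing \<open>p / q\<close> by \<open>\<omega>\<close> moves it by at most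
  \<open>1 / q\<close>.\<close>

lemma orbit_dense_of_approx:
  fixes p q :: int
  assumes q: "q > 0" and cop: "coprime p q" and approx: "\<bar>real_of_int q * \<omega> - real_of_int p\<bar> \<le> 1 / real_of_int q"
  shows "orbit_dense \<omega> (nat q) (2 / real_of_int q)"
  unfolding orbit_dense_def
proof (intro allI)
  fix x y :: real
  define u where "u = y - x"
  define r where "r = round (real_of_int q * u)"
  have r: "\<bar>real_of_int r - real_of_int q * u\<bar> \<le> 1 / 2" unfolding r_def by (rule of_int_round_abs_le)
  obtain a b where ab: "a * p + b * q = 1" using bezout_int[of p q] cop by auto
  \<comment> \<open>\<open>a\<close> inverts \<open>p\<close> modulo \<open>q\<close>, so
    \<open>j * p\<close> is congruent to \<open>r\<close>, the numerator of the grid point nearest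
    to \<open>u\<close>.\<close>
  define j where "j = (r * a) mod q"
  have j: "0 \<le> j" "j < q" using q by (auto simp: j_def)
  have "q dvd j * p - r"
  proof -
    have "j * p - r = (r * a - q * ((r * a) div q)) * p - r * (a * p + b * q)"
      by (simp add: j_def minus_mult_div_eq_mod ab)
    also have "\<dots> = q * (- ((r * a) div q) * p - r * b)" by (simp add: algebra_simps)
    finally show ?thesis by simp
  qed
  then obtain m where m: "j * p - r = q * m" by auto
  have jq: "real_of_int j / real_of_int q * real_of_int p = real_of_int r / real_of_int q + real_of_int m"
  proof -
    have "real_of_int j * real_of_int p = real_of_int r + real_of_int q * real_of_int m"
      using arg_cong[OF m, of real_of_int] by simp
    then show ?thesis using q by (simp add: field_simps)
  qed
  have "real_of_int j * \<omega> - real_of_int m - u =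
      real_of_int j / real_of_int q * (real_of_int q * \<omega> - real_of_int p) + (real_of_int r - real_of_int q * u) / real_of_int q"
    using q jq by (simp add: right_diff_distrib diff_divide_distrib)
  also have "\<bar>\<dots>\<bar> \<le> 1 * (1 / real_of_int q) + (1 / 2) / real_of_int q"
  proof (rule order_trans[OF abs_triangle_ineq], rule add_mono)
    show "\<bar>real_of_int j / real_of_int q * (real_of_int q * \<omega> - real_of_int p)\<bar> \<le> 1 * (1 / real_of_int q)"
      unfolding abs_mult by (intro mult_mono approx) (use j q in \<open>auto simp: divide_le_eq_1\<close>)
    show "\<bar>(real_of_int r - real_of_int q * u) / real_of_int q\<bar> \<le> (1 / 2) / real_of_int q"
      unfolding abs_divide using divide_right_mono[OF r, of "real_of_int q"] q by simp
  qed
  also have "\<dots> \<le> 2 / real_of_int q" using q by (simp add: field_simps)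
  finally have "\<bar>x + real (nat j) * \<omega> + real_of_int (- m) - y\<bar> \<le> 2 / real_of_int q"
    using j by (simp add: u_def algebra_simps)
  moreover have "nat j < nat q" using j by simp
  ultimately show "\<exists>j<nat q. \<exists>m::int. \<bar>x + real j * \<omega> + real_of_int m - y\<bar> \<le> 2 / real_of_int q" by blast
qed

text \<open>Dirichlet's theorem: an irrational number has infinitely many coprime approximants
  \<open>h / k\<close> with error below \<open>1 / k^2\<close>, hence some with arbitrarily large
  \<open>k\<close>.\<close>

lemma orbit_dense_frequently:
  assumes "\<omega> \<notin> \<rat>"
  shows "\<exists>q\<ge>K. q > 0 \<and> orbit_dense \<omega> q (2 / real q)"
proof -
  have "infinite (approx_set \<omega>)" using rational_iff_finite_approx_set assms by blast
  then obtain h k where hk: "(h, k) \<in> approx_set \<omega>" "k > int K" using infinite_approx_set by blast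
  then have k: "k > 0" "coprime h k" "\<bar>\<omega> - real_of_int h / real_of_int k\<bar> < 1 / (real_of_int k)\<^sup>2"
    by (auto simp: approx_set_def)
  have "\<bar>real_of_int k * \<omega> - real_of_int h\<bar> = real_of_int k * \<bar>\<omega> - real_of_int h / real_of_int k\<bar>"
    using k(1) by (simp add: abs_mult[symmetric, of "real_of_int k", simplified] abs_if field_simps)
  also have "\<dots> \<le> real_of_int k * (1 / (real_of_int k)\<^sup>2)"
    using k by (intro mult_left_mono) auto
  also have "\<dots> = 1 / real_of_int k" using k(1) by (simp add: power2_eq_square)
  finally have "orbit_dense \<omega> (nat k) (2 / real_of_int k)"
    using orbit_dense_of_approx[OF k(1,2)] by simp
  then show ?thesis using hk(2) k(1) by (intro exI[of _ "nat k"]) auto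
qed

lemma orbit_dense_frequently_powr:
  assumes "\<omega> \<notin> \<rat>"
  shows "\<exists>q\<ge>K. q > 0 \<and> orbit_dense \<omega> q (real q powr - (1 / 2))"
proof -
  \<comment> \<open>From 4 on, the constant 2 is at most \<open>sqrt q\<close>.\<close>
  obtain q where q: "q \<ge> max K 4" "q > 0" "orbit_dense \<omega> q (2 / real q)"
    using orbit_dense_frequently[OF assms] by blast
  have "sqrt 4 \<le> sqrt (real q)" using q(1) by (intro real_sqrt_le_mono) simp
  then have "2 / real q \<le> sqrt (real q) / real q" by (intro divide_right_mono) auto
  also have "\<dots> = 1 / sqrt (real q)" using q(2) by (simp add: real_div_sqrt field_simps)
  also have "\<dots> = real q powr - (1 / 2)" using q(2) by (simp add: powr_minus powr_half_sqrt inverse_eq_divide)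
  finally show ?thesis using q orbit_dense_mono by (intro exI[of _ q]) auto
qed

section \<open>Convergents of continued fractions\<close>

fun cf_num :: "real \<Rightarrow> nat \<Rightarrow> int" where
  "cf_num x 0 = cf_digit x 0"
| "cf_num x (Suc 0) = cf_digit x 1 * cf_digit x 0 + 1"
| "cf_num x (Suc (Suc n)) = cf_digit x (Suc (Suc n)) * cf_num x (Suc n) + cf_num x n"

lemma cf_rem_irrational: "x \<notin> \<rat> \<Longrightarrow> cf_rem x n \<notin> \<rat>"
proof (induction n)
  case (Suc n)
  show ?case
  proof
    assume "cf_rem x (Suc n) \<in> \<rat>"
    then have "1 / cf_rem x (Suc n) \<in> \<rat>" by (intro Rats_divide) auto
    then have "frac (cf_rem x n) \<in> \<rat>" by simp
    then have "frac (cf_rem x n) + of_int \<lfloor>cf_rem x n\<rfloor> \<in> \<rat>" by (intro Rats_add) auto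
    then show False using Suc by (simp add: frac_def)
  qed
qed simp

lemma cf_rem_eq:
  assumes "x \<notin> \<rat>"
  shows "cf_rem x (Suc n) > 1" "cf_rem x n = real_of_int (cf_digit x n) + 1 / cf_rem x (Suc n)"
proof -
  have "frac (cf_rem x n) \<noteq> 0"
    using cf_rem_irrational[OF assms, of n] by (auto simp: frac_eq_0_iff Ints_def)
  then have f: "0 < frac (cf_rem x n)" using frac_ge_0[of "cf_rem x n"] by linarith
  then show "cf_rem x (Suc n) > 1" using frac_lt_1[of "cf_rem x n"] by simp
  show "cf_rem x n = real_of_int (cf_digit x n) + 1 / cf_rem x (Suc n)"
    by (simp add: cf_digit_def frac_def)
qed

lemma cf_digit_ge_1: "x \<notin> \<rat> \<Longrightarrow> cf_digit x (Suc n) \<ge> 1"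
  using cf_rem_eq(1)[of x n] unfolding cf_digit_def by linarith

text \<open>Strict growth starts only at index 1: the denominators with index 0 and 1 coincide when
  the first digit is 1.\<close>

lemma cf_denom_ge:
  assumes "x \<notin> \<rat>"
  shows "cf_denom x n \<ge> 1 \<and> cf_denom x (Suc n) \<ge> 1 \<and> cf_denom x (Suc (Suc n)) > cf_denom x (Suc n)"
proof (induction n)
  case 0
  have "cf_digit x 2 * cf_digit x 1 \<ge> 1 * cf_digit x 1"
    using cf_digit_ge_1[OF assms, of 1] cf_digit_ge_1[OF assms, of 0] by (intro mult_right_mono) (auto simp: numeral_2_eq_2)
  then show ?case using cf_digit_ge_1[OF assms, of 0] by (simp add: numeral_2_eq_2)
next
  case (Suc n)
  have "cf_digit x (Suc (Suc (Suc n))) * cf_denom x (Suc (Suc n)) \<ge> 1 * cf_denom x (Suc (Suc n))"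
    using cf_digit_ge_1[OF assms, of "Suc (Suc n)"] Suc by (intro mult_right_mono) auto
  moreover have "cf_denom x (Suc (Suc (Suc n))) =
      cf_digit x (Suc (Suc (Suc n))) * cf_denom x (Suc (Suc n)) + cf_denom x (Suc n)" by simp
  moreover have "cf_denom x (Suc n) \<ge> 1" "cf_denom x (Suc (Suc n)) > cf_denom x (Suc n)" using Suc by auto
  ultimately show ?case by (intro conjI; linarith)
qed

lemma cf_denom_ge_index: "x \<notin> \<rat> \<Longrightarrow> cf_denom x (Suc n) \<ge> int n + 1"
proof (induction n)
  case (Suc n)
  then show ?case using cf_denom_ge[of x n] by linarith
qed (use cf_denom_ge[of x 0] in simp)

lemma cf_determinant: "cf_num x (Suc n) * cf_denom x n - cf_num x n * cf_denom x (Suc n) = (- 1) ^ n"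
  by (induction n) (auto simp: algebra_simps)

text \<open>The formula \<open>x = (y * p_{n+1} + p_n) / (y * q_{n+1} + q_n)\<close> for the
  complete quotient \<open>y\<close>, multiplied out.\<close>

lemma cf_value:
  assumes "x \<notin> \<rat>"
  shows "x * (cf_rem x (Suc (Suc n)) * real_of_int (cf_denom x (Suc n)) + real_of_int (cf_denom x n)) =
    cf_rem x (Suc (Suc n)) * real_of_int (cf_num x (Suc n)) + real_of_int (cf_num x n)"
proof (induction n)
  case 0
  define x1 x2 where "x1 = cf_rem x 1" and "x2 = cf_rem x 2"
  have "x1 > 1" "x2 > 1" and e: "x = real_of_int (cf_digit x 0) + 1 / x1" "x1 = real_of_int (cf_digit x 1) + 1 / x2"
    using cf_rem_eq(1)[OF assms, of 0] cf_rem_eq(1)[OF assms, of 1] cf_rem_eq(2)[OF assms, of 0] cf_rem_eq(2)[OF assms, of 1]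
    unfolding x1_def x2_def by (simp_all add: numeral_2_eq_2)
  have "x2 * real_of_int (cf_digit x 1) + 1 = x2 * x1" using e(2) \<open>x2 > 1\<close> by (simp add: field_simps)
  moreover have "x * x1 = real_of_int (cf_digit x 0) * x1 + 1"
  proof -
    have "(real_of_int (cf_digit x 0) + 1 / x1) * x1 = real_of_int (cf_digit x 0) * x1 + 1" using \<open>x1 > 1\<close> by (simp add: field_simps)
    then show ?thesis using e(1) by simp
  qed
  ultimately have AB: "x2 * real_of_int (cf_digit x 1) + 1 = x2 * x1" "x * x1 = real_of_int (cf_digit x 0) * x1 + 1"
    by blast+
  have "x * (x2 * real_of_int (cf_digit x 1) + 1) = x2 * (x * x1)" unfolding AB(1) by simp
  also have "\<dots> = x2 * (real_of_int (cf_digit x 0) * x1 + 1)" unfolding AB(2) ..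
  also have "\<dots> = real_of_int (cf_digit x 0) * (x2 * x1) + x2" by (simp add: algebra_simps)
  also have "x2 * x1 = x2 * real_of_int (cf_digit x 1) + 1" using e(2) \<open>x2 > 1\<close> by (simp add: field_simps)
  finally have "x * (x2 * real_of_int (cf_digit x 1) + 1) =
      x2 * (real_of_int (cf_digit x 1) * real_of_int (cf_digit x 0) + 1) + real_of_int (cf_digit x 0)"
    by (simp add: algebra_simps)
  then show ?case by (simp add: x2_def numeral_2_eq_2 del: cf_rem.simps)
next
  case (Suc n)
  define y z where "y = cf_rem x (Suc (Suc n))" and "z = cf_rem x (Suc (Suc (Suc n)))"
  have z: "z > 1" and y: "y = real_of_int (cf_digit x (Suc (Suc n))) + 1 / z"
    using cf_rem_eq[OF assms, of "Suc (Suc n)"] unfolding y_def z_def by auto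
  have yz: "z * y = z * real_of_int (cf_digit x (Suc (Suc n))) + 1" using y z by (simp add: field_simps)
  have "x * (z * y * real_of_int (cf_denom x (Suc n)) + z * real_of_int (cf_denom x n)) =
      z * y * real_of_int (cf_num x (Suc n)) + z * real_of_int (cf_num x n)"
    using arg_cong[OF Suc[folded y_def], of "\<lambda>v. z * v"] by (simp add: algebra_simps)
  then show ?case unfolding yz z_def[symmetric] by (simp add: algebra_simps)
qed

text \<open>By \<open>cf_value\<close> and \<open>cf_determinant\<close> the error
  \<open>q * x - p\<close> of a convergent is exactly \<open>1 / D\<close> in modulus, where
  \<open>D\<close> is the denominator in that formula and is at least \<open>q\<close>. The
  determinant also yields coprimality.\<close>

lemma cf_orbit_dense:
  assumes "x \<notin> \<rat>"
  shows "orbit_dense x (nat (cf_denom x (Suc n))) (2 / real_of_int (cf_denom x (Suc n)))"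
proof (rule orbit_dense_of_approx)
  let ?p = "cf_num x" and ?q = "cf_denom x"
  have q: "?q n \<ge> 1" "?q (Suc n) \<ge> 1" using cf_denom_ge[OF assms, of n] by auto
  then show "?q (Suc n) > 0" by simp
  show "coprime (?p (Suc n)) (?q (Suc n))"
  proof (rule coprimeI)
    fix d assume "d dvd ?p (Suc n)" "d dvd ?q (Suc n)"
    then have "d dvd ?p (Suc n) * ?q n - ?p n * ?q (Suc n)" by auto
    then have "d dvd (- 1) ^ n" unfolding cf_determinant .
    moreover have "(1::int) = (- 1) ^ n * (- 1) ^ n" by (simp add: power_mult_distrib[symmetric])
    ultimately show "is_unit d" by (metis dvd_mult2)
  qed
  define y where "y = cf_rem x (Suc (Suc n))"
  define D where "D = y * real_of_int (?q (Suc n)) + real_of_int (?q n)"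
  have y: "y > 1" using cf_rem_eq(1)[OF assms] unfolding y_def by blast
  have "1 * real_of_int (?q (Suc n)) \<le> y * real_of_int (?q (Suc n))" using y q by (intro mult_right_mono) auto
  moreover have "0 \<le> real_of_int (?q n)" using q by simp
  ultimately have D: "D \<ge> real_of_int (?q (Suc n))" unfolding D_def by linarith
  then have D0: "D > 0" using q by linarith
  have "(real_of_int (?q (Suc n)) * x - real_of_int (?p (Suc n))) * D =
      real_of_int (?q (Suc n)) * (x * D) - real_of_int (?p (Suc n)) * D" by (simp add: algebra_simps)
  also have "x * D = y * real_of_int (?p (Suc n)) + real_of_int (?p n)"
    using cf_value[OF assms, of n] unfolding D_def y_def .
  also have "real_of_int (?q (Suc n)) * \<dots> - real_of_int (?p (Suc n)) * D =
      - real_of_int (?p (Suc n) * ?q n - ?p n * ?q (Suc n))"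
    by (simp add: D_def algebra_simps)
  also have "\<bar>\<dots>\<bar> = 1" unfolding cf_determinant by (simp add: power_abs)
  finally have "\<bar>real_of_int (?q (Suc n)) * x - real_of_int (?p (Suc n))\<bar> * D = 1"
    using D0 by (simp add: abs_mult)
  then have "\<bar>real_of_int (?q (Suc n)) * x - real_of_int (?p (Suc n))\<bar> = 1 / D" using D0 by (simp add: field_simps)
  also have "\<dots> \<le> 1 / real_of_int (?q (Suc n))" using D q by (intro divide_left_mono) auto
  finally show "\<bar>real_of_int (?q (Suc n)) * x - real_of_int (?p (Suc n))\<bar> \<le> 1 / real_of_int (?q (Suc n))" .
qed

text \<open>\<open>N\<close> lies between consecutive denominators \<open>q \<le> N < q'\<close>,
  and \<open>q' < q powr (1 + \<kappa>)\<close>, so \<open>q\<close> is at least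
  \<open>N powr (2 * a)\<close>. One factor \<open>N powr a\<close> absorbs the constant 2 of the
  density radius, whence the 2 in the choice of \<open>a\<close>.\<close>

lemma orbit_dense_diophantine:
  assumes "x \<notin> \<rat>" "diophantine x"
  shows "\<exists>a. 0 < a \<and> a \<le> 1 / 2 \<and> (\<forall>\<^sub>F N in sequentially. orbit_dense x N (real N powr - a))"
proof -
  obtain \<kappa> where \<kappa>: "\<kappa> > 0" "\<forall>\<^sub>F n in sequentially. real_of_int (cf_denom x (Suc n)) < real_of_int (cf_denom x n) powr (1 + \<kappa>)"
    using assms(2) unfolding diophantine_def by blast
  then obtain n0 where n0: "\<And>n. n \<ge> n0 \<Longrightarrow> real_of_int (cf_denom x (Suc n)) < real_of_int (cf_denom x n) powr (1 + \<kappa>)"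
    unfolding eventually_sequentially by blast
  define a where "a = 1 / (2 * (1 + \<kappa>))"
  have a: "0 < a" "a \<le> 1 / 2" using \<kappa>(1) by (auto simp: a_def field_simps)
  have "filterlim (\<lambda>N. real N powr a) at_top sequentially"
    by (rule filterlim_compose[OF filterlim_powr_at_top[OF a(1)] filterlim_real_sequentially])
  then have "\<forall>\<^sub>F N in sequentially. real N powr a \<ge> 2" by (simp add: filterlim_at_top)
  moreover have "\<forall>\<^sub>F N in sequentially. int N \<ge> cf_denom x (Suc n0)"
    using eventually_ge_at_top[of "nat (cf_denom x (Suc n0))"] by eventually_elim linarith
  ultimately have "\<forall>\<^sub>F N in sequentially. orbit_dense x N (real N powr - a)"
  proof eventually_elim
    case (elim N)
    define n where "n = (GREATEST n. cf_denom x (Suc n) \<le> int N)"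
    have bd: "\<And>n. cf_denom x (Suc n) \<le> int N \<Longrightarrow> n \<le> N"
    proof -
      fix n assume "cf_denom x (Suc n) \<le> int N"
      then show "n \<le> N" using cf_denom_ge_index[OF assms(1), of n] by linarith
    qed
    have n: "cf_denom x (Suc n) \<le> int N"
      unfolding n_def by (rule GreatestI_nat[where b=N, of _ n0]) (use elim bd in auto)
    have nn: "n0 \<le> n"
      unfolding n_def by (rule Greatest_le_nat[where b=N]) (use elim bd in auto)
    have "\<not> cf_denom x (Suc (Suc n)) \<le> int N"
    proof
      assume "cf_denom x (Suc (Suc n)) \<le> int N"
      then have "Suc n \<le> n" unfolding n_def by (rule Greatest_le_nat[where b=N]) (use bd in auto)
      then show False by simp
    qed
    then have "real N < real_of_int (cf_denom x (Suc (Suc n)))" by linarith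
    also have "\<dots> < real_of_int (cf_denom x (Suc n)) powr (1 + \<kappa>)" using n0[of "Suc n"] nn by simp
    finally have Nq: "real N < real_of_int (cf_denom x (Suc n)) powr (1 + \<kappa>)" .
    define q where "q = real_of_int (cf_denom x (Suc n))"
    have q1: "q \<ge> 1" using cf_denom_ge[OF assms(1), of n] by (simp add: q_def)
    have "real N powr (1 / (1 + \<kappa>)) \<le> (q powr (1 + \<kappa>)) powr (1 / (1 + \<kappa>))"
      using Nq \<kappa>(1) by (intro powr_mono2) (auto simp: q_def)
    also have "\<dots> = q" using q1 \<kappa>(1) by (simp add: powr_powr)
    also have "1 / (1 + \<kappa>) = a + a" using \<kappa>(1) by (simp add: a_def field_simps)
    finally have "real N powr a * real N powr a \<le> q" by (simp only: powr_add)
    moreover have "real N powr a > 0" using elim(1) by linarith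
    ultimately have "2 * real N powr a \<le> q" using elim(1) by (meson mult_right_mono less_imp_le order_trans)
    then have "2 / q \<le> real N powr - a"
      using q1 \<open>real N powr a > 0\<close> by (simp add: powr_minus field_simps)
    moreover have "orbit_dense x (nat (cf_denom x (Suc n))) (2 / q)"
      unfolding q_def by (rule cf_orbit_dense[OF assms(1)])
    ultimately show ?case using n by (elim orbit_dense_mono) auto
  qed
  then show ?thesis using a by blast
qed

section \<open>Ergodicity of irrational rotations\<close>

lemma periodic1_int: "periodic1 \<phi> \<Longrightarrow> \<phi> (x + real_of_int k) = \<phi> x"
proof -
  assume p: "periodic1 \<phi>"
  have nat: "\<phi> (x + real n) = \<phi> x" for n x
  proof (induction n arbitrary: x)
    case (Suc n)
    have "\<phi> (x + real (Suc n)) = \<phi> ((x + real n) + 1)" by (simp add: algebra_simps)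
    also have "\<dots> = \<phi> (x + real n)" using p by (simp add: periodic1_def del: add.assoc)
    finally show ?case using Suc by simp
  qed simp
  show ?thesis
  proof (cases "k \<ge> 0")
    case True
    then show ?thesis using nat[of x "nat k"] by simp
  next
    case False
    then show ?thesis using nat[of "x + real_of_int k" "nat (- k)"] by simp
  qed
qed

text \<open>The space stays the whole line, so periodic functions and sets can be used without
  restriction to a period or passage to a quotient.\<close>

definition circ :: "real measure" where
  "circ = density lborel (indicator {0..<1})"

lemma sets_circ [simp, measurable_cong]: "sets circ = sets borel"
  by (simp add: circ_def)

lemma space_circ [simp]: "space circ = UNIV"
  by (simp add: circ_def)

lemma prob_space_circ: "prob_space circ"
  by (rule prob_spaceI) (simp add: circ_def emeasure_density)

interpretation circ: prob_space circ by (rule prob_space_circ)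

lemma circ_UNIV [simp]: "measure circ UNIV = 1" "emeasure circ UNIV = 1"
  using circ.prob_space circ.emeasure_space_1 by simp_all

lemma nn_integral_circ:
  "\<phi> \<in> borel_measurable borel \<Longrightarrow> (\<integral>\<^sup>+x. \<phi> x \<partial>circ) = (\<integral>\<^sup>+x\<in>{0..<1}. \<phi> x \<partial>lborel)"
  unfolding circ_def by (subst nn_integral_density) (auto simp: mult.commute)

lemma integral_circ:
  fixes \<phi> :: "real \<Rightarrow> real"
  shows "\<phi> \<in> borel_measurable borel \<Longrightarrow> (\<integral>x. \<phi> x \<partial>circ) = (LINT x:{0..<1}|lborel. \<phi> x)"
  unfolding circ_def set_lebesgue_integral_def
  by (subst integral_density[where g="indicator {0..<1}", symmetric]) (auto simp: ennreal_indicator)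

lemma nn_integral_shift:
  fixes \<phi> :: "real \<Rightarrow> ennreal"
  assumes "\<phi> \<in> borel_measurable borel"
  shows "(\<integral>\<^sup>+x. \<phi> (x + t) \<partial>lborel) = (\<integral>\<^sup>+x. \<phi> x \<partial>lborel)"
  using nn_integral_real_affine[OF assms, of 1 t] by (simp add: add.commute)

text \<open>After reduction to \<open>s = frac t\<close>, the shifted period is cut at 1 and its
  right piece is moved back by periodicity.\<close>

lemma circ_shift:
  fixes \<phi> :: "real \<Rightarrow> ennreal"
  assumes [measurable]: "\<phi> \<in> borel_measurable borel" and p: "periodic1 \<phi>"
  shows "(\<integral>\<^sup>+x. \<phi> (x + t) \<partial>circ) = (\<integral>\<^sup>+x. \<phi> x \<partial>circ)"
proof -
  define s where "s = frac t"
  have s: "0 \<le> s" "s < 1" by (auto simp: s_def frac_lt_1)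
  have pt: "\<phi> (x + t) = \<phi> (x + s)" for x
    using periodic1_int[OF p, of "x + s" "\<lfloor>t\<rfloor>"] by (simp add: s_def frac_def)
  have "(\<integral>\<^sup>+x. \<phi> (x + t) \<partial>circ) = (\<integral>\<^sup>+x. \<phi> (x + s) * indicator {s..<1 + s} (x + s) \<partial>lborel)"
    unfolding pt by (subst nn_integral_circ) (auto intro!: nn_integral_cong simp: indicator_def)
  also have "\<dots> = (\<integral>\<^sup>+x. \<phi> x * indicator {s..<1 + s} x \<partial>lborel)"
    by (rule nn_integral_shift[of "\<lambda>x. \<phi> x * indicator {s..<1 + s} x"]) measurable
  also have "\<dots> = (\<integral>\<^sup>+x. \<phi> x * indicator {s..<1} x + \<phi> x * indicator {1..<1 + s} x \<partial>lborel)"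
    using s by (intro nn_integral_cong) (auto simp: indicator_def)
  also have "\<dots> = (\<integral>\<^sup>+x. \<phi> x * indicator {s..<1} x \<partial>lborel) + (\<integral>\<^sup>+x. \<phi> x * indicator {1..<1 + s} x \<partial>lborel)"
    by (rule nn_integral_add) measurable
  also have "(\<integral>\<^sup>+x. \<phi> x * indicator {1..<1 + s} x \<partial>lborel) = (\<integral>\<^sup>+x. \<phi> (x + 1) * indicator {1..<1 + s} (x + 1) \<partial>lborel)"
    by (rule nn_integral_shift[symmetric, of "\<lambda>x. \<phi> x * indicator {1..<1 + s} x"]) measurable
  also have "\<dots> = (\<integral>\<^sup>+x. \<phi> x * indicator {0..<s} x \<partial>lborel)"
    using p by (intro nn_integral_cong) (auto simp: indicator_def periodic1_def)
  also have "(\<integral>\<^sup>+x. \<phi> x * indicator {s..<1} x \<partial>lborel) + (\<integral>\<^sup>+x. \<phi> x * indicator {0..<s} x \<partial>lborel) =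
      (\<integral>\<^sup>+x. \<phi> x * indicator {s..<1} x + \<phi> x * indicator {0..<s} x \<partial>lborel)"
    by (rule nn_integral_add[symmetric]) measurable
  also have "\<dots> = (\<integral>\<^sup>+x. \<phi> x * indicator {0..<1} x \<partial>lborel)"
    using s by (intro nn_integral_cong) (auto simp: indicator_def)
  also have "\<dots> = (\<integral>\<^sup>+x. \<phi> x \<partial>circ)"
    by (rule nn_integral_circ[symmetric]) measurable
  finally show ?thesis .
qed

lemma circ_integrable:
  fixes \<phi> :: "real \<Rightarrow> real"
  assumes "\<phi> \<in> borel_measurable borel" "\<And>x. \<bar>\<phi> x\<bar> \<le> B"
  shows "integrable circ \<phi>"
  by (rule circ.integrable_const_bound[where B=B]) (use assms in auto)

text \<open>Adding the bound \<open>B\<close> makes the function nonnegative and reduces the claim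
  to \<open>circ_shift\<close>.\<close>

lemma circ_integral_shift:
  fixes \<phi> :: "real \<Rightarrow> real"
  assumes [measurable]: "\<phi> \<in> borel_measurable borel" and p: "periodic1 \<phi>" and b: "\<And>x. \<bar>\<phi> x\<bar> \<le> B"
  shows "(\<integral>x. \<phi> (x + t) \<partial>circ) = (\<integral>x. \<phi> x \<partial>circ)"
proof -
  have nn: "(\<integral>x. \<phi> (x + t) + B \<partial>circ) = enn2real (\<integral>\<^sup>+x. ennreal (\<phi> x + B) \<partial>circ)" for t
  proof -
    have "periodic1 (\<lambda>x. ennreal (\<phi> x + B))" using p by (auto simp: periodic1_def)
    from circ_shift[OF _ this, of t] have "(\<integral>\<^sup>+x. ennreal (\<phi> (x + t) + B) \<partial>circ) = (\<integral>\<^sup>+x. ennreal (\<phi> x + B) \<partial>circ)"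
      by simp
    moreover have "0 \<le> \<phi> x + B" for x using b[of x] by linarith
    ultimately show ?thesis by (subst integral_eq_nn_integral) auto
  qed
  have "integrable circ (\<lambda>x. \<phi> (x + t))" for t
    by (rule circ_integrable[of _ B]) (use b in auto)
  then have "(\<integral>x. \<phi> (x + t) + B \<partial>circ) = (\<integral>x. \<phi> (x + t) \<partial>circ) + B" for t
    by simp
  then have "(\<integral>x. \<phi> (x + t) \<partial>circ) = enn2real (\<integral>\<^sup>+x. ennreal (\<phi> x + B) \<partial>circ) - B" for t
    using nn[of t] by simp
  from this[of t] this[of 0] show ?thesis by simp
qed

text \<open>A measurable function is almost everywhere a limit of continuous ones; truncating these
  at the bound \<open>B\<close> permits dominated convergence. The interval leaves room to move
  \<open>{0..<1}\<close> by up to 1 in either direction.\<close>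

lemma continuous_L1_approx:
  fixes \<phi> :: "real \<Rightarrow> real"
  assumes [measurable]: "\<phi> \<in> borel_measurable borel" and b: "\<And>x. \<bar>\<phi> x\<bar> \<le> B" and "e > 0"
  shows "\<exists>g. continuous_on UNIV g \<and> (\<integral>\<^sup>+x\<in>{-1..2}. ennreal \<bar>\<phi> x - g x\<bar> \<partial>lborel) \<le> ennreal e"
proof -
  have "\<phi> measurable_on {-1..2}"
    by (rule lebesgue_measurable_imp_measurable_on_real) (auto intro: measurable_completion)
  then obtain N g where N: "negligible N" and g: "\<And>n. continuous_on UNIV (g n)"
    and lim: "\<And>x. x \<notin> N \<Longrightarrow> (\<lambda>n. g n x) \<longlonglongrightarrow> (if x \<in> {-1..2} then \<phi> x else 0)"
    unfolding measurable_on_def by metis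
  let ?h = "\<lambda>n x. max (- B) (min B (g n x))"
  have hc: "continuous_on UNIV (?h n)" for n by (intro continuous_intros g)
  have [measurable]: "?h n \<in> borel_measurable borel" for n by (rule borel_measurable_continuous_onI[OF hc])
  have B: "B \<ge> 0" using b[of 0] by linarith
  have "AE x in lebesgue. x \<notin> N"
    using N unfolding negligible_iff_null_sets by (rule AE_not_in)
  then have AEN: "AE x in lborel. x \<notin> N" by (simp add: AE_completion_iff)
  have "(\<lambda>n. \<integral>x. indicator {-1..2} x * \<bar>\<phi> x - ?h n x\<bar> \<partial>lborel) \<longlonglongrightarrow> (\<integral>x. 0 \<partial>(lborel::real measure))"
  proof (rule integral_dominated_convergence[where w="\<lambda>x. indicator {-1..2} x * (2 * B)"])
    show "integrable lborel (\<lambda>x::real. indicator {-1..2} x * (2 * B))" by (intro integrable_mult_left) simp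
    show "AE x in lborel. (\<lambda>n. indicator {-1..2} x * \<bar>\<phi> x - ?h n x\<bar>) \<longlonglongrightarrow> 0"
      using AEN
    proof eventually_elim
      case (elim x)
      show ?case
      proof (cases "x \<in> {-1..2}")
        case True
        then have "(\<lambda>n. g n x) \<longlonglongrightarrow> \<phi> x" using lim[OF elim] by simp
        then have "(\<lambda>n. \<bar>\<phi> x - ?h n x\<bar>) \<longlonglongrightarrow> \<bar>\<phi> x - max (- B) (min B (\<phi> x))\<bar>"
          by (intro tendsto_intros)
        moreover have "max (- B) (min B (\<phi> x)) = \<phi> x" using b[of x] by (auto simp: min_def max_def)
        ultimately show ?thesis using True by simp
      qed simp
    qed
    show "AE x in lborel. norm (indicator {-1..2} x * \<bar>\<phi> x - ?h n x\<bar>) \<le> indicator {-1..2} x * (2 * B)" for n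
    proof (rule AE_I2)
      fix x
      have "\<bar>?h n x\<bar> \<le> B" using B by (auto simp: min_def max_def)
      then show "norm (indicator {-1..2} x * \<bar>\<phi> x - ?h n x\<bar>) \<le> indicator {-1..2} x * (2 * B)"
        using b[of x] by (auto simp: indicator_def)
    qed
  qed auto
  then have "\<forall>\<^sub>F n in sequentially. (\<integral>x. indicator {-1..2} x * \<bar>\<phi> x - ?h n x\<bar> \<partial>lborel) < e"
    using assms(3) by (intro order_tendstoD(2)) auto
  then obtain n where n: "(\<integral>x. indicator {-1..2} x * \<bar>\<phi> x - ?h n x\<bar> \<partial>lborel) < e"
    by (auto simp: eventually_sequentially)
  have int: "integrable lborel (\<lambda>x. indicator {-1..2} x * \<bar>\<phi> x - ?h n x\<bar>)"
  proof (rule Bochner_Integration.integrable_bound)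
    show "integrable lborel (\<lambda>x::real. indicator {-1..2} x * (2 * B))" by (intro integrable_mult_left) simp
    show "AE x in lborel. norm (indicator {-1..2} x * \<bar>\<phi> x - ?h n x\<bar>) \<le> norm (indicator {-1..2} x * (2 * B))"
    proof (rule AE_I2)
      fix x
      have "\<bar>?h n x\<bar> \<le> B" using B by (auto simp: min_def max_def)
      then show "norm (indicator {-1..2} x * \<bar>\<phi> x - ?h n x\<bar>) \<le> norm (indicator {-1..2} x * (2 * B))"
        using b[of x] B by (auto simp: indicator_def)
    qed
  qed measurable
  have "(\<integral>\<^sup>+x\<in>{-1..2}. ennreal \<bar>\<phi> x - ?h n x\<bar> \<partial>lborel) = (\<integral>\<^sup>+x. ennreal (indicator {-1..2} x * \<bar>\<phi> x - ?h n x\<bar>) \<partial>lborel)"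
    by (intro nn_integral_cong) (auto simp: indicator_def)
  also have "\<dots> = ennreal (\<integral>x. indicator {-1..2} x * \<bar>\<phi> x - ?h n x\<bar> \<partial>lborel)"
    by (rule nn_integral_eq_integral[OF int]) simp
  also have "\<dots> \<le> ennreal e" using n by (intro ennreal_leI) simp
  finally show ?thesis using hc by blast
qed

lemma circ_L1_translation:
  fixes \<phi> :: "real \<Rightarrow> real"
  assumes [measurable]: "\<phi> \<in> borel_measurable borel" and b: "\<And>x. \<bar>\<phi> x\<bar> \<le> B" and "e > 0"
  shows "\<exists>r>0. \<forall>s. \<bar>s\<bar> \<le> r \<longrightarrow> (\<integral>\<^sup>+x. ennreal \<bar>\<phi> (x + s) - \<phi> x\<bar> \<partial>circ) \<le> ennreal e"
proof -
  obtain g where g: "continuous_on UNIV g" and gl: "(\<integral>\<^sup>+x\<in>{-1..2}. ennreal \<bar>\<phi> x - g x\<bar> \<partial>lborel) \<le> ennreal (e / 3)"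
    using continuous_L1_approx[OF assms(1) b, of "e / 3"] \<open>e > 0\<close> by auto
  have [measurable]: "g \<in> borel_measurable borel" by (rule borel_measurable_continuous_onI[OF g])
  have "uniformly_continuous_on {-1..2} g"
    by (rule compact_uniformly_continuous) (use g in \<open>auto intro: continuous_on_subset\<close>)
  then obtain d where d: "d > 0" "\<And>x y. x \<in> {-1..2} \<Longrightarrow> y \<in> {-1..2} \<Longrightarrow> dist y x < d \<Longrightarrow> dist (g y) (g x) < e / 3"
    using \<open>e > 0\<close> unfolding uniformly_continuous_on_def by (metis divide_pos_pos zero_less_numeral)
  define r where "r = min 1 (d / 2)"
  have r: "r > 0" "r \<le> 1" "r < d" using d(1) by (auto simp: r_def)
  have "(\<integral>\<^sup>+x. ennreal \<bar>\<phi> (x + s) - \<phi> x\<bar> \<partial>circ) \<le> ennreal e" if s: "\<bar>s\<bar> \<le> r" for s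
  proof -
    let ?A = "\<lambda>x. ennreal \<bar>\<phi> x - g x\<bar> * indicator {-1..2} x"
    have Am [measurable]: "?A \<in> borel_measurable borel" by measurable
    have As: "(\<lambda>x. ?A (x + s)) \<in> borel_measurable borel"
      by (rule measurable_compose[OF _ Am]) measurable
    have "(\<integral>\<^sup>+x. ennreal \<bar>\<phi> (x + s) - \<phi> x\<bar> \<partial>circ) = (\<integral>\<^sup>+x\<in>{0..<1}. ennreal \<bar>\<phi> (x + s) - \<phi> x\<bar> \<partial>lborel)"
      by (rule nn_integral_circ) measurable
    also have "\<dots> \<le> (\<integral>\<^sup>+x. ?A (x + s) + (ennreal (e / 3) * indicator {0..<1} x + ?A x) \<partial>lborel)"
    proof (rule nn_integral_mono)
      fix x
      show "ennreal \<bar>\<phi> (x + s) - \<phi> x\<bar> * indicator {0..<1} x \<le> ?A (x + s) + (ennreal (e / 3) * indicator {0..<1} x + ?A x)"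
      proof (cases "x \<in> {0..<1}")
        case True
        have in_range: "x \<in> {-1..2}" "x + s \<in> {-1..2}" using True s r by auto
        have "dist (g (x + s)) (g x) < e / 3"
          by (rule d(2)) (use in_range s r in \<open>auto simp: dist_real_def\<close>)
        then have "\<bar>\<phi> (x + s) - \<phi> x\<bar> \<le> \<bar>\<phi> (x + s) - g (x + s)\<bar> + (e / 3 + \<bar>\<phi> x - g x\<bar>)"
          unfolding dist_real_def by linarith
        then have "ennreal \<bar>\<phi> (x + s) - \<phi> x\<bar> \<le> ennreal (\<bar>\<phi> (x + s) - g (x + s)\<bar> + (e / 3 + \<bar>\<phi> x - g x\<bar>))"
          by (rule ennreal_leI)
        also have "\<dots> = ennreal \<bar>\<phi> (x + s) - g (x + s)\<bar> + (ennreal (e / 3) + ennreal \<bar>\<phi> x - g x\<bar>)"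
          using \<open>e > 0\<close> by (simp add: ennreal_plus)
        finally show ?thesis using True in_range by simp
      qed simp
    qed
    also have "\<dots> = (\<integral>\<^sup>+x. ?A (x + s) \<partial>lborel) + ((\<integral>\<^sup>+x. ennreal (e / 3) * indicator {0..<1::real} x \<partial>lborel) + (\<integral>\<^sup>+x. ?A x \<partial>lborel))"
      by (subst nn_integral_add, simp add: As, simp, subst nn_integral_add, simp, simp add: Am, rule refl)
    also have "(\<integral>\<^sup>+x. ?A (x + s) \<partial>lborel) = (\<integral>\<^sup>+x. ?A x \<partial>lborel)"
      by (rule nn_integral_shift[OF Am])
    also have "(\<integral>\<^sup>+x. ennreal (e / 3) * indicator {0..<1::real} x \<partial>lborel) = ennreal (e / 3)"
      by (subst nn_integral_cmult_indicator) auto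
    also have "(\<integral>\<^sup>+x. ?A x \<partial>lborel) + (ennreal (e / 3) + (\<integral>\<^sup>+x. ?A x \<partial>lborel)) \<le> ennreal (e / 3) + (ennreal (e / 3) + ennreal (e / 3))"
      by (intro add_mono gl order_refl)
    also have "\<dots> = ennreal e" using \<open>e > 0\<close> by (simp flip: ennreal_plus)
    finally show ?thesis .
  qed
  then show ?thesis using r(1) by blast
qed

section \<open>Birkhoff averages and the mean ergodic theorem\<close>

definition birkhoff :: "real \<Rightarrow> (real \<Rightarrow> real) \<Rightarrow> nat \<Rightarrow> real \<Rightarrow> real" where
  "birkhoff \<omega> \<phi> k x = (\<Sum>j<k. \<phi> (x + real j * \<omega>)) / real k"

lemma birkhoff_measurable [measurable]:
  assumes [measurable]: "\<phi> \<in> borel_measurable borel"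
  shows "birkhoff \<omega> \<phi> k \<in> borel_measurable borel"
  unfolding birkhoff_def by measurable

lemma birkhoff_bound:
  assumes "\<And>x. \<bar>\<phi> x\<bar> \<le> B" "k > 0" shows "\<bar>birkhoff \<omega> \<phi> k x\<bar> \<le> B"
proof -
  have "\<bar>\<Sum>j<k. \<phi> (x + real j * \<omega>)\<bar> \<le> (\<Sum>j<k. B)"
    by (rule order_trans[OF sum_abs]) (intro sum_mono assms(1))
  then show ?thesis using assms(2) by (simp add: birkhoff_def abs_divide field_simps)
qed

text \<open>One step along the orbit exchanges only an end term of the sum at either side.\<close>

lemma birkhoff_orbit_shift:
  assumes b: "\<And>x. \<bar>\<phi> x\<bar> \<le> B"
  shows "\<bar>birkhoff \<omega> \<phi> k (x + real l * \<omega>) - birkhoff \<omega> \<phi> k x\<bar> \<le> 2 * real l * B / real k"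
proof -
  have "\<bar>(\<Sum>j<k. \<phi> (x + real l * \<omega> + real j * \<omega>)) - (\<Sum>j<k. \<phi> (x + real j * \<omega>))\<bar> \<le> 2 * real l * B"
  proof (induction l arbitrary: x)
    case (Suc l)
    let ?S = "\<lambda>x. \<Sum>j<k. \<phi> (x + real j * \<omega>)"
    have "?S (x + \<omega>) = (\<Sum>j<k. \<phi> (x + real (Suc j) * \<omega>))" by (simp add: algebra_simps)
    also have "\<dots> = (\<Sum>j<Suc k. \<phi> (x + real j * \<omega>)) - \<phi> (x + real 0 * \<omega>)"
      by (subst sum.lessThan_Suc_shift) simp
    also have "\<dots> = ?S x + \<phi> (x + real k * \<omega>) - \<phi> x" by simp
    finally have 1: "\<bar>?S (x + \<omega>) - ?S x\<bar> \<le> 2 * B" using b[of "x + real k * \<omega>"] b[of x] by linarith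
    have 2: "\<bar>?S (x + \<omega> + real l * \<omega>) - ?S (x + \<omega>)\<bar> \<le> 2 * real l * B"
      using Suc[of "x + \<omega>"] by simp
    have 3: "x + real (Suc l) * \<omega> = x + \<omega> + real l * \<omega>" by (simp add: algebra_simps)
    have 4: "2 * real (Suc l) * B = 2 * real l * B + 2 * B" by (simp add: algebra_simps)
    show ?case unfolding 3 4 using 1 2 by linarith
  qed simp
  then show ?thesis
    unfolding birkhoff_def diff_divide_distrib[symmetric] abs_divide by (simp add: divide_right_mono)
qed

lemma birkhoff_periodic: "periodic1 \<phi> \<Longrightarrow> periodic1 (birkhoff \<omega> \<phi> k)"
proof -
  assume p: "periodic1 \<phi>"
  have "\<phi> (t + 1 + real j * \<omega>) = \<phi> (t + real j * \<omega>)" for t j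
    using p unfolding periodic1_def by (metis add.assoc add.commute)
  then show ?thesis by (simp add: periodic1_def birkhoff_def)
qed

text \<open>The averages are almost invariant under translations along the orbit, hence, by density of the
  orbit and continuity of translations in the mean, under all translations.\<close>

theorem mean_ergodic:
  fixes \<phi> :: "real \<Rightarrow> real"
  assumes irr: "\<omega> \<notin> \<rat>" and [measurable]: "\<phi> \<in> borel_measurable borel" and p: "periodic1 \<phi>"
    and b: "\<And>x. \<bar>\<phi> x\<bar> \<le> B" and "e > 0"
  shows "\<forall>\<^sub>F k in sequentially. (\<integral>\<^sup>+x. ennreal \<bar>birkhoff \<omega> \<phi> k x - (\<integral>y. \<phi> y \<partial>circ)\<bar> \<partial>circ) \<le> ennreal e"
proof -
  let ?A = "birkhoff \<omega> \<phi>"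
  have B: "B \<ge> 0" using b[of 0] by linarith
  obtain r where r: "r > 0" "\<And>s. \<bar>s\<bar> \<le> r \<Longrightarrow> (\<integral>\<^sup>+x. ennreal \<bar>\<phi> (x + s) - \<phi> x\<bar> \<partial>circ) \<le> ennreal (e / 2)"
    using circ_L1_translation[OF assms(2) b, of "e / 2"] \<open>e > 0\<close> by auto
  obtain q where q: "q \<ge> nat \<lceil>2 / r\<rceil>" "q > 0" "orbit_dense \<omega> q (2 / real q)"
    using orbit_dense_frequently[OF irr] by blast
  have "2 / r \<le> real q" using q(1) by linarith
  then have qr: "2 / real q \<le> r" using r(1) q(2) by (simp add: field_simps)
  \<comment> \<open>The bound is uniform in \<open>k\<close>: by translation invariance every term
    of the average has the same mean displacement as \<open>\<phi>\<close>.\<close>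
  have s: "(\<integral>\<^sup>+x. ennreal \<bar>?A k (x + s) - ?A k x\<bar> \<partial>circ) \<le> ennreal (e / 2)" if "\<bar>s\<bar> \<le> r" "k > 0" for s k
  proof -
    have "(\<integral>\<^sup>+x. ennreal \<bar>?A k (x + s) - ?A k x\<bar> \<partial>circ) \<le>
        (\<integral>\<^sup>+x. (\<Sum>j<k. ennreal (1 / real k) * ennreal \<bar>\<phi> (x + real j * \<omega> + s) - \<phi> (x + real j * \<omega>)\<bar>) \<partial>circ)"
    proof (rule nn_integral_mono)
      fix x
      have c: "x + s + real j * \<omega> = x + real j * \<omega> + s" for j by simp
      have "\<bar>?A k (x + s) - ?A k x\<bar> = \<bar>\<Sum>j<k. (1 / real k) * (\<phi> (x + real j * \<omega> + s) - \<phi> (x + real j * \<omega>))\<bar>"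
        unfolding birkhoff_def c by (simp only: sum_distrib_left[symmetric] sum_subtractf) (simp add: diff_divide_distrib)
      also have "\<dots> \<le> (\<Sum>j<k. (1 / real k) * \<bar>\<phi> (x + real j * \<omega> + s) - \<phi> (x + real j * \<omega>)\<bar>)"
        by (rule order_trans[OF sum_abs]) (simp add: abs_mult)
      finally have "ennreal \<bar>?A k (x + s) - ?A k x\<bar> \<le> ennreal (\<Sum>j<k. (1 / real k) * \<bar>\<phi> (x + real j * \<omega> + s) - \<phi> (x + real j * \<omega>)\<bar>)"
        by (rule ennreal_leI)
      also have "\<dots> = (\<Sum>j<k. ennreal ((1 / real k) * \<bar>\<phi> (x + real j * \<omega> + s) - \<phi> (x + real j * \<omega>)\<bar>))"
        by (rule sum_ennreal[symmetric]) simp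
      finally show "ennreal \<bar>?A k (x + s) - ?A k x\<bar> \<le> (\<Sum>j<k. ennreal (1 / real k) * ennreal \<bar>\<phi> (x + real j * \<omega> + s) - \<phi> (x + real j * \<omega>)\<bar>)"
        by (simp only: ennreal_mult[OF divide_nonneg_nonneg[OF zero_le_one of_nat_0_le_iff] abs_ge_zero])
    qed
    also have "\<dots> = (\<Sum>j<k. ennreal (1 / real k) * (\<integral>\<^sup>+x. ennreal \<bar>\<phi> (x + real j * \<omega> + s) - \<phi> (x + real j * \<omega>)\<bar> \<partial>circ))"
      by (subst nn_integral_sum) (auto intro!: sum.cong nn_integral_cmult)
    also have "\<dots> = (\<Sum>j<k. ennreal (1 / real k) * (\<integral>\<^sup>+x. ennreal \<bar>\<phi> (x + s) - \<phi> x\<bar> \<partial>circ))"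
    proof (intro sum.cong refl arg_cong2[where f="(*)"])
      fix j
      have "periodic1 (\<lambda>x. ennreal \<bar>\<phi> (x + s) - \<phi> x\<bar>)"
        using p unfolding periodic1_def by (metis add.assoc add.commute)
      then show "(\<integral>\<^sup>+x. ennreal \<bar>\<phi> (x + real j * \<omega> + s) - \<phi> (x + real j * \<omega>)\<bar> \<partial>circ) = (\<integral>\<^sup>+x. ennreal \<bar>\<phi> (x + s) - \<phi> x\<bar> \<partial>circ)"
        using circ_shift[of "\<lambda>x. ennreal \<bar>\<phi> (x + s) - \<phi> x\<bar>" "real j * \<omega>"] by simp
    qed
    also have "\<dots> \<le> (\<Sum>j<k. ennreal (1 / real k) * ennreal (e / 2))"
      by (intro sum_mono mult_left_mono r that) auto
    also have "\<dots> = (\<Sum>j<k. ennreal ((1 / real k) * (e / 2)))"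
      using \<open>e > 0\<close> by (intro sum.cong refl ennreal_mult[symmetric]) auto
    also have "\<dots> = ennreal (\<Sum>j<k. (1 / real k) * (e / 2))"
      using \<open>e > 0\<close> by (intro sum_ennreal) auto
    also have "(\<Sum>j<k. (1 / real k) * (e / 2)) = e / 2" using that(2) by simp
    finally show ?thesis .
  qed
  \<comment> \<open>A general translation consists of \<open>j < q\<close> steps along the orbit and
    a small remainder \<open>u\<close>. As \<open>q\<close> is fixed before \<open>k\<close>, the
    orbit steps cost nothing in the limit.\<close>
  have D: "(\<integral>\<^sup>+x. ennreal \<bar>?A k (x + t) - ?A k x\<bar> \<partial>circ) \<le> ennreal (e / 2 + 2 * real q * B / real k)" if "k > 0" for k t
  proof -
    obtain j m where j: "j < q" "\<bar>0 + real j * \<omega> + real_of_int m - t\<bar> \<le> 2 / real q"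
      using q(3) unfolding orbit_dense_def by blast
    define u where "u = t - real j * \<omega> - real_of_int m"
    have u: "\<bar>u\<bar> \<le> r" using j(2) qr by (simp add: u_def abs_le_iff)
    have "?A k (x + t) = ?A k (x + u + real j * \<omega>)" for x
      using periodic1_int[OF birkhoff_periodic[OF p], of \<omega> k "x + u + real j * \<omega>" m] by (simp add: u_def algebra_simps)
    then have "\<bar>?A k (x + t) - ?A k x\<bar> \<le> 2 * real q * B / real k + \<bar>?A k (x + u) - ?A k x\<bar>" for x
    proof -
      have "\<bar>?A k (x + u + real j * \<omega>) - ?A k (x + u)\<bar> \<le> 2 * real j * B / real k"
        by (rule birkhoff_orbit_shift[OF b])
      also have "\<dots> \<le> 2 * real q * B / real k"
        using j(1) B by (intro divide_right_mono mult_right_mono) auto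
      finally show ?thesis using \<open>?A k (x + t) = ?A k (x + u + real j * \<omega>)\<close> by linarith
    qed
    then have "(\<integral>\<^sup>+x. ennreal \<bar>?A k (x + t) - ?A k x\<bar> \<partial>circ) \<le> (\<integral>\<^sup>+x. ennreal (2 * real q * B / real k) + ennreal \<bar>?A k (x + u) - ?A k x\<bar> \<partial>circ)"
      using B by (intro nn_integral_mono) (simp flip: ennreal_plus add: ennreal_leI)
    also have "\<dots> = ennreal (2 * real q * B / real k) + (\<integral>\<^sup>+x. ennreal \<bar>?A k (x + u) - ?A k x\<bar> \<partial>circ)"
      by (subst nn_integral_add) auto
    also have "\<dots> \<le> ennreal (2 * real q * B / real k) + ennreal (e / 2)"
      by (intro add_mono order_refl s u that)
    also have "\<dots> = ennreal (e / 2 + 2 * real q * B / real k)"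
      using B \<open>e > 0\<close> by (simp flip: ennreal_plus add: add.commute)
    finally show ?thesis .
  qed
  have main: "(\<integral>\<^sup>+x. ennreal \<bar>?A k x - (\<integral>y. \<phi> y \<partial>circ)\<bar> \<partial>circ) \<le> ennreal (e / 2 + 2 * real q * B / real k)" if k: "k > 0" for k
  proof -
    interpret CC: pair_sigma_finite circ circ ..
    have Ab: "\<bar>?A k x\<bar> \<le> B" for x by (rule birkhoff_bound[OF b k])
    \<comment> \<open>Averaged over all translations the Birkhoff average becomes the integral of
      \<open>\<phi>\<close>. Its deviation from that integral is thus dominated by the mean
      displacement over \<open>t\<close>, and exchanging the integrals brings in
      \<open>D\<close>.\<close>
    have mean: "(\<integral>t. ?A k (x + t) \<partial>circ) = (\<integral>y. \<phi> y \<partial>circ)" for x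
    proof -
      have i: "integrable circ (\<lambda>t. \<phi> (x + t + real j * \<omega>))" for j by (rule circ_integrable[of _ B]) (auto intro: b)
      have "(\<integral>t. ?A k (x + t) \<partial>circ) = (\<Sum>j<k. (\<integral>t. \<phi> (x + t + real j * \<omega>) \<partial>circ)) / real k"
        unfolding birkhoff_def using i by simp
      also have "\<dots> = (\<Sum>j<k. (\<integral>y. \<phi> y \<partial>circ)) / real k"
        using circ_integral_shift[OF assms(2) p b, of "x + real _ * \<omega>"] by (simp add: algebra_simps)
      finally show ?thesis using k by simp
    qed
    have "(\<integral>\<^sup>+x. ennreal \<bar>?A k x - (\<integral>y. \<phi> y \<partial>circ)\<bar> \<partial>circ) \<le> (\<integral>\<^sup>+x. (\<integral>\<^sup>+t. ennreal \<bar>?A k (x + t) - ?A k x\<bar> \<partial>circ) \<partial>circ)"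
    proof (rule nn_integral_mono)
      fix x
      have i: "integrable circ (\<lambda>t. ?A k (x + t))" by (rule circ_integrable[of _ B]) (auto intro: Ab)
      have "(\<integral>t. ?A k (x + t) - ?A k x \<partial>circ) = (\<integral>y. \<phi> y \<partial>circ) - ?A k x"
        using i mean by simp
      then have "ennreal \<bar>?A k x - (\<integral>y. \<phi> y \<partial>circ)\<bar> = ennreal (norm (\<integral>t. ?A k (x + t) - ?A k x \<partial>circ))"
        by (simp add: abs_minus_commute)
      also have "\<dots> \<le> (\<integral>\<^sup>+t. ennreal (norm (?A k (x + t) - ?A k x)) \<partial>circ)"
        by (rule integral_norm_bound_ennreal) (use i in simp)
      finally show "ennreal \<bar>?A k x - (\<integral>y. \<phi> y \<partial>circ)\<bar> \<le> (\<integral>\<^sup>+t. ennreal \<bar>?A k (x + t) - ?A k x\<bar> \<partial>circ)" by simp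
    qed
    also have "\<dots> = (\<integral>\<^sup>+t. (\<integral>\<^sup>+x. ennreal \<bar>?A k (x + t) - ?A k x\<bar> \<partial>circ) \<partial>circ)"
      by (rule CC.Fubini'[symmetric]) measurable
    also have "\<dots> \<le> (\<integral>\<^sup>+t. ennreal (e / 2 + 2 * real q * B / real k) \<partial>circ)"
      by (intro nn_integral_mono D k)
    also have "\<dots> = ennreal (e / 2 + 2 * real q * B / real k)"
      by simp
    finally show ?thesis .
  qed
  show ?thesis
    using eventually_gt_at_top[of "nat \<lceil>4 * real q * B / e\<rceil>"]
  proof eventually_elim
    case (elim k)
    then have k: "k > 0" "real k > 4 * real q * B / e" by linarith+
    then have "2 * real q * B / real k \<le> e / 2" using \<open>e > 0\<close> by (simp add: field_simps)
    then have "ennreal (e / 2 + 2 * real q * B / real k) \<le> ennreal e" by (intro ennreal_leI) simp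
    then show ?case using main[OF k(1)] by (rule order_trans[rotated])
  qed
qed

lemma periodic_AE_lborel:
  assumes [measurable]: "A \<in> sets borel" and p: "\<And>x. x + 1 \<in> A \<longleftrightarrow> x \<in> A" and ae: "AE x in circ. x \<in> A"
  shows "AE x in lborel. x \<in> A"
proof -
  have "periodic1 (\<lambda>x. x \<in> A)" using p by (simp add: periodic1_def)
  note pk = periodic1_int[OF this]
  have "AE x in lborel. x \<in> {0..<1} \<longrightarrow> x \<in> A"
    using ae unfolding circ_def by (subst (asm) AE_density) (auto simp: indicator_def elim!: eventually_mono split: if_splits)
  then have "AE x in lborel. x + real_of_int k \<in> {0..<1} \<longrightarrow> x + real_of_int k \<in> A" for k
    using AE_borel_affine[of 1 "\<lambda>x. x \<in> {0..<1} \<longrightarrow> x \<in> A" "real_of_int k"] by (simp add: add.commute)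
  then have "AE x in lborel. \<forall>k::int. x + real_of_int k \<in> {0..<1} \<longrightarrow> x + real_of_int k \<in> A"
    by (simp add: AE_all_countable)
  then show ?thesis
  proof eventually_elim
    case (elim x)
    have "x + real_of_int (- \<lfloor>x\<rfloor>) \<in> {0..<1}" by simp linarith
    then have "x + real_of_int (- \<lfloor>x\<rfloor>) \<in> A" using elim by blast
    then show ?case unfolding pk .
  qed
qed

text \<open>For an invariant set the averages equal the indicator itself, which by
  \<open>mean_ergodic\<close> is almost everywhere the constant \<open>c\<close>; since
  \<open>c > 0\<close>, the indicator does not vanish there.\<close>

theorem rotation_ergodic:
  assumes irr: "\<omega> \<notin> \<rat>" and [measurable]: "A \<in> sets borel" and p: "\<And>x. x + 1 \<in> A \<longleftrightarrow> x \<in> A"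
    and inv: "\<And>x. x + \<omega> \<in> A \<longleftrightarrow> x \<in> A" and pos: "emeasure circ A > 0"
  shows "AE x in lborel. x \<in> A"
proof (rule periodic_AE_lborel[OF assms(2) p])
  let ?\<phi> = "indicator A :: real \<Rightarrow> real"
  define c where "c = (\<integral>y. ?\<phi> y \<partial>circ)"
  have c: "c = measure circ A" by (simp add: c_def)
  have "x + real j * \<omega> \<in> A \<longleftrightarrow> x \<in> A" for x j
  proof (induction j)
    case (Suc j)
    have eq: "x + real (Suc j) * \<omega> = (x + real j * \<omega>) + \<omega>" by (simp add: algebra_simps)
    show ?case unfolding eq inv by (rule Suc)
  qed simp
  then have bk: "birkhoff \<omega> ?\<phi> k x = ?\<phi> x" if "k > 0" for k x
    using that by (simp add: birkhoff_def indicator_def)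
  have H: "(\<integral>\<^sup>+x. ennreal \<bar>?\<phi> x - c\<bar> \<partial>circ) \<le> ennreal e" if "e > 0" for e
  proof -
    have "\<forall>\<^sub>F k in sequentially. (\<integral>\<^sup>+x. ennreal \<bar>birkhoff \<omega> ?\<phi> k x - (\<integral>y. ?\<phi> y \<partial>circ)\<bar> \<partial>circ) \<le> ennreal e"
      by (rule mean_ergodic[OF irr _ _ _ that, where B=1]) (use p in \<open>auto simp: periodic1_def indicator_def\<close>)
    then obtain k where "k > 0" "(\<integral>\<^sup>+x. ennreal \<bar>birkhoff \<omega> ?\<phi> k x - c\<bar> \<partial>circ) \<le> ennreal e"
      unfolding c_def eventually_sequentially by (meson le_Suc_eq order_refl zero_less_Suc)
    then show ?thesis by (simp add: bk)
  qed
  have "(\<integral>\<^sup>+x. ennreal \<bar>?\<phi> x - c\<bar> \<partial>circ) \<le> 0"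
  proof (rule ennreal_le_epsilon)
    fix e :: real assume "e > 0"
    from H[OF this] show "(\<integral>\<^sup>+x. ennreal \<bar>?\<phi> x - c\<bar> \<partial>circ) \<le> 0 + ennreal e"
      unfolding add_0 .
  qed
  then have "AE x in circ. ennreal \<bar>?\<phi> x - c\<bar> = 0"
    by (subst (asm) le_zero_eq, subst (asm) nn_integral_0_iff_AE) auto
  then show "AE x in circ. x \<in> A"
  proof eventually_elim
    case (elim x)
    have "c > 0" using pos unfolding c by (simp add: circ.emeasure_eq_measure)
    then show ?case using elim by (auto simp: indicator_def split: if_splits)
  qed
qed

section \<open>Jacobi operators on the integers\<close>

lemma exp_decay_tendsto_0:
  fixes c :: real assumes "c > 0"
  shows "((\<lambda>t. exp (- c * t)) \<longlongrightarrow> 0) at_top"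
proof -
  have "filterlim (\<lambda>t. c * t) at_top at_top"
    by (intro filterlim_tendsto_pos_mult_at_top[OF tendsto_const assms] filterlim_ident)
  then have "filterlim (\<lambda>t. - c * t) at_bot at_top"
    by (simp add: filterlim_uminus_at_bot)
  then show ?thesis by (rule filterlim_compose[OF exp_at_bot])
qed

lemma set_integrable_exp_decay:
  fixes c :: real assumes "c > 0"
  shows "set_integrable lborel {0..} (\<lambda>t. exp (- c * t))"
    and "set_lebesgue_integral lborel {0..} (\<lambda>t. exp (- c * t)) = 1 / c"
proof -
  have 1: "(\<integral>\<^sup>+ t. ennreal (exp (- c * t)) * indicator {0..} t \<partial>lborel) = ennreal (0 - (- exp (- c * 0) / c))"
  proof (rule nn_integral_FTC_atLeast)
    fix x :: real
    show "((\<lambda>t. - exp (- c * t) / c) has_real_derivative exp (- c * x)) (at x)"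
      using assms by (auto intro!: derivative_eq_intros)
    have "((\<lambda>t. - exp (- c * t) / c) \<longlongrightarrow> - 0 / c) at_top"
      using assms by (intro tendsto_divide tendsto_minus tendsto_const exp_decay_tendsto_0) auto
    then show "((\<lambda>t. - exp (- c * t) / c) \<longlongrightarrow> 0) at_top" by simp
  qed (use assms in auto)
  have 2: "(\<integral>\<^sup>+ t. ennreal (indicator {0..} t *\<^sub>R exp (- c * t)) \<partial>lborel) = ennreal (1 / c)"
  proof -
    have "ennreal (indicator {0..} t *\<^sub>R exp (- c * t)) = ennreal (exp (- c * t)) * indicator {0..} t" for t :: real
      by (auto simp: indicator_def)
    then show ?thesis using 1 by simp
  qed
  show "set_integrable lborel {0..} (\<lambda>t. exp (- c * t))"
    unfolding set_integrable_def
    by (rule integrableI_nonneg) (use 2 in \<open>auto simp: indicator_def\<close>)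
  show "set_lebesgue_integral lborel {0..} (\<lambda>t. exp (- c * t)) = 1 / c"
    unfolding set_lebesgue_integral_def
    by (subst integral_eq_nn_integral) (use 2 assms in \<open>auto simp: indicator_def\<close>)
qed

lemma set_integrable_exp_dominated:
  fixes f :: "real \<Rightarrow> 'b :: {banach, second_countable_topology}"
  assumes "c > 0" and [measurable]: "f \<in> borel_measurable borel"
    and "\<And>t. t \<ge> 0 \<Longrightarrow> norm (f t) \<le> B * exp (- c * t)"
  shows "set_integrable lborel {0..} f"
    and "norm (set_lebesgue_integral lborel {0..} f) \<le> B / c"
proof -
  have i: "set_integrable lborel {0..} (\<lambda>t. B * exp (- c * t))"
    using set_integrable_exp_decay(1)[OF assms(1)] by simp
  show f: "set_integrable lborel {0..} f"
    unfolding set_integrable_def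
    by (rule Bochner_Integration.integrable_bound[OF i[unfolded set_integrable_def]])
       (use assms(3) in \<open>auto simp: indicator_def intro: order_trans[OF _ abs_ge_self]\<close>)
  have "norm (set_lebesgue_integral lborel {0..} f) \<le> set_lebesgue_integral lborel {0..} (\<lambda>t. B * exp (- c * t))"
    unfolding set_lebesgue_integral_def
    by (rule Bochner_Integration.integral_norm_bound_integral)
       (use f i assms(3) in \<open>auto simp: set_integrable_def indicator_def\<close>)
  also have "\<dots> = B / c"
    using set_integrable_exp_decay(2)[OF assms(1)] by simp
  finally show "norm (set_lebesgue_integral lborel {0..} f) \<le> B / c" .
qed

lemma set_integral_atLeast_FTC:
  fixes F f :: "real \<Rightarrow> complex"
  assumes "\<And>t. (F has_vector_derivative f t) (at t)" and "\<And>t. isCont f t"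
    and "set_integrable lborel {0..} f" and "(F \<longlongrightarrow> 0) at_top"
  shows "set_lebesgue_integral lborel {0..} f = - F 0"
proof -
  have sub: "set_integrable lborel {0<..} f"
    by (rule set_integrable_subset[OF assms(3)]) auto
  have "(LBINT x=0..\<infinity>. f x) = 0 - F 0"
  proof (rule interval_integral_FTC_integrable[where F = F])
    show "set_integrable lborel (einterval 0 \<infinity>) f"
      using sub by (simp add: einterval_def zero_ereal_def greaterThan_def)
    have "isCont F 0"
      using assms(1) has_vector_derivative_continuous by blast
    then have "(F \<longlongrightarrow> F 0) (at_right 0)"
      unfolding isCont_def by (rule filterlim_mono) (auto simp: at_le)
    then show "((F \<circ> real_of_ereal) \<longlongrightarrow> F 0) (at_right 0)"
      unfolding zero_ereal_def ereal_tendsto_simps by simp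
    show "((F \<circ> real_of_ereal) \<longlongrightarrow> 0) (at_left \<infinity>)"
      using assms(4) by (simp add: ereal_tendsto_simps)
  qed (use assms in auto)
  moreover have "(LBINT x=0..\<infinity>. f x) = set_lebesgue_integral lborel {0<..} f"
    unfolding interval_lebesgue_integral_def by (simp add: einterval_def zero_ereal_def greaterThan_def)
  moreover have "set_lebesgue_integral lborel {0<..} f = set_lebesgue_integral lborel {0..} f"
    unfolding set_lebesgue_integral_def
  proof (rule integral_cong_AE)
    show "AE x in lborel. indicator {0<..} x *\<^sub>R f x = indicator {0..} x *\<^sub>R f x"
      using AE_lborel_singleton[of 0] by eventually_elim (auto simp: indicator_def)
    show "(\<lambda>x. indicator {0<..} x *\<^sub>R f x) \<in> borel_measurable lborel"
      using sub unfolding set_integrable_def by (rule borel_measurable_integrable)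
    show "(\<lambda>x. indicator {0..} x *\<^sub>R f x) \<in> borel_measurable lborel"
      using assms(3) unfolding set_integrable_def by (rule borel_measurable_integrable)
  qed
  ultimately show ?thesis by simp
qed

text \<open>The Laplace transform of the evolution at a single spectral value;
  \<open>spectral_green\<close> integrates it against the spectral measure.\<close>

lemma set_integral_exp_complex:
  fixes w :: complex assumes "Im w > 0"
  shows "set_integrable lborel {0..} (\<lambda>t. exp (\<i> * w * complex_of_real t))"
    and "set_lebesgue_integral lborel {0..} (\<lambda>t. exp (\<i> * w * complex_of_real t)) = \<i> / w"
proof -
  have w: "w \<noteq> 0" using assms by auto
  have n: "norm (exp (\<i> * w * complex_of_real t)) = exp (- Im w * t)" for t
    by (simp add: norm_exp_eq_Re)
  show i: "set_integrable lborel {0..} (\<lambda>t. exp (\<i> * w * complex_of_real t))"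
    by (rule set_integrable_exp_dominated(1)[where B=1, OF assms])
       (auto simp: n intro!: borel_measurable_continuous_onI continuous_intros)
  have "set_lebesgue_integral lborel {0..} (\<lambda>t. exp (\<i> * w * complex_of_real t))
     = - ((\<lambda>t. exp (\<i> * w * complex_of_real t) / (\<i> * w)) 0)"
  proof (rule set_integral_atLeast_FTC[OF _ _ i])
    fix t :: real
    show "((\<lambda>t. exp (\<i> * w * complex_of_real t) / (\<i> * w)) has_vector_derivative
        exp (\<i> * w * complex_of_real t)) (at t)"
      using w by (auto intro!: has_vector_derivative_real_field derivative_eq_intros)
    show "((\<lambda>t. exp (\<i> * w * complex_of_real t) / (\<i> * w)) \<longlongrightarrow> 0) at_top"
    proof (rule tendsto_norm_zero_cancel)
      have "((\<lambda>t. exp (- Im w * t) / norm (\<i> * w)) \<longlongrightarrow> 0 / norm (\<i> * w)) at_top"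
        using assms w
        by (intro tendsto_divide tendsto_const exp_decay_tendsto_0) auto
      then show "((\<lambda>t. norm (exp (\<i> * w * complex_of_real t) / (\<i> * w))) \<longlongrightarrow> 0) at_top"
        by (simp add: norm_divide n)
    qed
  qed (auto intro!: continuous_intros)
  also have "\<dots> = \<i> / w"
    using w by (simp add: divide_simps)
  finally show "set_lebesgue_integral lborel {0..} (\<lambda>t. exp (\<i> * w * complex_of_real t)) = \<i> / w" .
qed

section \<open>Square summable sequences\<close>

lemma tendsto_0_l2:
  assumes "u \<in> l2" "inj h"
  shows "(\<lambda>N::nat. u (h N)) \<longlonglongrightarrow> 0"
proof -
  have "(\<lambda>n. (cmod (u n))\<^sup>2) summable_on range h"
    using assms(1) summable_on_subset_banach unfolding l2_def by blast
  then have "(\<lambda>N. (cmod (u (h N)))\<^sup>2) summable_on UNIV"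
    using summable_on_reindex[OF assms(2), of "\<lambda>n. (cmod (u n))\<^sup>2"] by (simp add: o_def)
  then have "(\<lambda>N. (cmod (u (h N)))\<^sup>2) \<longlonglongrightarrow> 0"
    by (intro summable_LIMSEQ_zero summable_on_imp_summable)
  then have "(\<lambda>N. sqrt ((cmod (u (h N)))\<^sup>2)) \<longlonglongrightarrow> sqrt 0"
    by (rule tendsto_real_sqrt)
  then show ?thesis by (simp add: tendsto_norm_zero_cancel)
qed

lemma l2_diff:
  assumes "u \<in> l2" "v \<in> l2" shows "(\<lambda>n. u n - v n) \<in> l2"
proof -
  have "(\<lambda>n. 2 * (cmod (u n))\<^sup>2 + 2 * (cmod (v n))\<^sup>2) summable_on UNIV"
    using assms unfolding l2_def by (auto intro!: summable_on_add summable_on_cmult_right)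
  moreover have "(cmod (u n - v n))\<^sup>2 \<le> 2 * (cmod (u n))\<^sup>2 + 2 * (cmod (v n))\<^sup>2" for n
  proof -
    have "(cmod (u n - v n))\<^sup>2 \<le> (cmod (u n) + cmod (v n))\<^sup>2"
      by (intro power_mono norm_triangle_ineq4) auto
    also have "\<dots> \<le> 2 * (cmod (u n))\<^sup>2 + 2 * (cmod (v n))\<^sup>2"
      using sum_squares_bound[of "cmod (u n)" "cmod (v n)"] by (simp add: power2_sum)
    finally show ?thesis .
  qed
  ultimately show ?thesis unfolding l2_def
    by (auto intro: summable_on_comparison_test)
qed

lemma l2_finite_sumI:
  assumes "\<And>A. finite A \<Longrightarrow> (\<Sum>n\<in>A. (cmod (u n))\<^sup>2) \<le> B"
  shows "u \<in> l2"
  unfolding l2_def by (auto intro!: nonneg_bdd_above_summable_on bdd_aboveI2 assms)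

text \<open>Infinite sums are evaluated along symmetric boxes because on these the flux identity
  telescopes.\<close>

lemma filterlim_symmetric_interval:
  "filterlim (\<lambda>N::nat. {- int N..int N}) (finite_subsets_at_top UNIV) sequentially"
  unfolding filterlim_finite_subsets_at_top
proof (intro allI impI)
  fix X :: "int set" assume X: "finite X \<and> X \<subseteq> UNIV"
  define M where "M = nat (\<Sum>x\<in>X. \<bar>x\<bar>)"
  have "\<bar>x\<bar> \<le> int M" if "x \<in> X" for x
    using member_le_sum[of x X abs] X that by (auto simp: M_def)
  then have "X \<subseteq> {- int N..int N}" if "N \<ge> M" for N
    using that by (force simp: subset_iff)
  then show "\<forall>\<^sub>F N in sequentially. finite {- int N..int N} \<and> X \<subseteq> {- int N..int N} \<and> {- int N..int N} \<subseteq> UNIV"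
    by (auto simp: eventually_sequentially)
qed

lemma l2_inner_delta: "l2_inner u (delta k) = u k"
proof -
  have "l2_inner u (delta k) = infsum (\<lambda>n. u n) {k}"
    unfolding l2_inner_def by (rule infsum_cong_neutral) (auto simp: delta_def)
  then show ?thesis by simp
qed

text \<open>Polymorphic so that one operator acts on complex sequences, for the dynamics, and on
  real ones, for the moments.\<close>

definition jacobi :: "(int \<Rightarrow> real) \<Rightarrow> (int \<Rightarrow> 'a::real_vector) \<Rightarrow> int \<Rightarrow> 'a" where
  "jacobi V u n = u (n - 1) + u (n + 1) + V n *\<^sub>R u n"

lemma schroedinger_eq_jacobi:
  "schroedinger f \<omega> \<theta> = jacobi (\<lambda>n. f (real_of_int n * \<omega> + \<theta>))"
  by (auto simp: fun_eq_iff schroedinger_def jacobi_def scaleR_conv_of_real)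

text \<open>The discrete Green identity: the real potential drops out of the imaginary part and the
  hopping terms telescope.\<close>

lemma jacobi_flux:
  fixes w :: "int \<Rightarrow> complex"
  assumes "a \<le> b"
  shows "(\<Sum>n\<in>{a..b}. Im (cnj (w n) * jacobi V w n)) =
    Im (cnj (w b) * w (b + 1)) - Im (cnj (w (a - 1)) * w a)"
  using assms
proof (induction b rule: int_ge_induct)
  case base
  show ?case by (simp add: jacobi_def algebra_simps)
next
  case (step b)
  have "{a..b + 1} = insert (b + 1) {a..b}" using step(1) by auto
  then show ?case using step by (simp add: jacobi_def algebra_simps)
qed

lemma jacobi_energy:
  fixes w :: "int \<Rightarrow> complex"
  assumes "a \<le> b"
  shows "(\<Sum>n\<in>{a..b}. Im (cnj (w n) * (jacobi V w n - z * w n))) =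
    Im (cnj (w b) * w (b + 1)) - Im (cnj (w (a - 1)) * w a) - Im z * (\<Sum>n\<in>{a..b}. (cmod (w n))\<^sup>2)"
proof -
  have "Im (cnj (w n) * (jacobi V w n - z * w n)) = Im (cnj (w n) * jacobi V w n) - Im z * (cmod (w n))\<^sup>2" for n
    unfolding cmod_power2 by (simp add: algebra_simps power2_eq_square)
  then show ?thesis
    by (simp only: sum_subtractf jacobi_flux[OF assms] sum_distrib_left[symmetric])
qed

text \<open>The fluxes through the ends vanish because an \<open>l2\<close> sequence tends to 0. The
  case \<open>c = 0\<close> excludes eigenvectors off the real axis; \<open>c = 1\<close> relates
  the total mass of the Green function to its imaginary part at 0.\<close>

lemma l2_energy:
  fixes w :: "int \<Rightarrow> complex"
  assumes "w \<in> l2" "\<And>n. jacobi V w n - z * w n = c * delta 0 n"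
  shows "Im z * (\<Sum>\<^sub>\<infinity>n. (cmod (w n))\<^sup>2) = - Im (cnj (w 0) * c)"
proof -
  have eq: "Im z * (\<Sum>n\<in>{- int N..int N}. (cmod (w n))\<^sup>2) =
      Im (cnj (w (int N)) * w (int N + 1)) - Im (cnj (w (- int N - 1)) * w (- int N)) - Im (cnj (w 0) * c)" for N
  proof -
    have "(\<Sum>n\<in>{- int N..int N}. Im (cnj (w n) * (jacobi V w n - z * w n))) =
       (\<Sum>n\<in>{- int N..int N}. if n = 0 then Im (cnj (w 0) * c) else 0)"
      by (rule sum.cong) (auto simp: assms(2) delta_def)
    also have "\<dots> = Im (cnj (w 0) * c)" by simp
    finally show ?thesis
      using jacobi_energy[of "- int N" "int N" w V z] by linarith
  qed
  have 1: "(\<lambda>N. w (int N)) \<longlonglongrightarrow> 0" by (rule tendsto_0_l2[OF assms(1)]) (auto simp: inj_def)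
  have 2: "(\<lambda>N. w (int N + 1)) \<longlonglongrightarrow> 0" by (rule tendsto_0_l2[OF assms(1)]) (auto simp: inj_def)
  have 3: "(\<lambda>N. w (- int N - 1)) \<longlonglongrightarrow> 0" by (rule tendsto_0_l2[OF assms(1)]) (auto simp: inj_def)
  have 4: "(\<lambda>N. w (- int N)) \<longlonglongrightarrow> 0" by (rule tendsto_0_l2[OF assms(1)]) (auto simp: inj_def)
  have "(\<lambda>N. Im (cnj (w (int N)) * w (int N + 1)) - Im (cnj (w (- int N - 1)) * w (- int N)) - Im (cnj (w 0) * c))
     \<longlonglongrightarrow> Im (cnj 0 * 0) - Im (cnj 0 * 0) - Im (cnj (w 0) * c)"
    by (intro tendsto_intros 1 2 3 4)
  moreover have "(\<lambda>N. Im z * (\<Sum>n\<in>{- int N..int N}. (cmod (w n))\<^sup>2)) \<longlonglongrightarrow> Im z * (\<Sum>\<^sub>\<infinity>n. (cmod (w n))\<^sup>2)"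
    by (intro tendsto_mult tendsto_const filterlim_compose[OF infsum_tendsto filterlim_symmetric_interval])
       (use assms(1) in \<open>simp add: l2_def\<close>)
  ultimately show ?thesis
    unfolding eq by (auto dest: LIMSEQ_unique)
qed

lemma l2_eigenvector_zero:
  fixes w :: "int \<Rightarrow> complex"
  assumes "w \<in> l2" "\<And>n. jacobi V w n - z * w n = 0" "Im z > 0"
  shows "w = (\<lambda>n. 0)"
proof
  fix n
  have "Im z * (\<Sum>\<^sub>\<infinity>n. (cmod (w n))\<^sup>2) = 0"
    using l2_energy[OF assms(1), of V z 0] assms(2) by simp
  then have "(\<Sum>\<^sub>\<infinity>n. (cmod (w n))\<^sup>2) \<le> 0" using assms(3) by simp
  then have "(cmod (w n))\<^sup>2 = 0"
    by (rule nonneg_infsum_le_0D) (use assms(1) in \<open>auto simp: l2_def\<close>)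
  then show "w n = 0" by simp
qed

text \<open>This is what gives the inverse in \<open>resolvent\<close> a definite value on the range
  of the operator.\<close>

lemma inj_on_jacobi:
  assumes "Im z > 0"
  shows "inj_on (\<lambda>u n. jacobi V u n - z * u n) l2"
proof (rule inj_onI)
  fix u v :: "int \<Rightarrow> complex"
  assume uv: "u \<in> l2" "v \<in> l2" "(\<lambda>n. jacobi V u n - z * u n) = (\<lambda>n. jacobi V v n - z * v n)"
  have "jacobi V (\<lambda>n. u n - v n) n - z * (u n - v n) = 0" for n
    using fun_cong[OF uv(3), of n] by (simp add: jacobi_def algebra_simps)
  then have "(\<lambda>n. u n - v n) = (\<lambda>n. 0)"
    by (intro l2_eigenvector_zero[OF l2_diff[OF uv(1,2)] _ assms])
  then show "u = v" by (auto simp: fun_eq_iff)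
qed

section \<open>Time evolution of a delta state\<close>

locale bounded_potential =
  fixes V :: "int \<Rightarrow> real" and F :: real
  assumes V_bound: "\<And>n. \<bar>V n\<bar> \<le> F"
begin

lemma F_nonneg: "F \<ge> 0" using V_bound[of 0] by linarith

text \<open>A move to a neighbouring site costs at most a factor 2 in the weight, so the two
  neighbours contribute 4 and the potential \<open>F\<close>. The weight makes the flux through
  distant bonds negligible.\<close>

lemma jacobi_pow_decay:
  "cmod ((jacobi V ^^ k) (delta 0) n) \<le> (4 + F) ^ k * (1 / 2) ^ nat \<bar>n\<bar>"
proof (induction k arbitrary: n)
  case 0
  show ?case by (simp add: delta_def)
next
  case (Suc k)
  let ?u = "(jacobi V ^^ k) (delta 0)"
  have s: "(1/2::real) ^ nat \<bar>m\<bar> \<le> 2 * (1 / 2) ^ nat \<bar>n\<bar>" if "\<bar>m - n\<bar> \<le> 1" for m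
  proof -
    have "(1/2::real) ^ nat \<bar>m\<bar> * (1/2) \<le> (1 / 2) ^ nat \<bar>n\<bar> * 1"
    proof -
      have "nat \<bar>n\<bar> \<le> Suc (nat \<bar>m\<bar>)" using that by linarith
      have "(1/2::real) ^ Suc (nat \<bar>m\<bar>) \<le> (1 / 2) ^ nat \<bar>n\<bar>"
        by (rule power_decreasing) (use that in auto)
      then show ?thesis by simp
    qed
    then show ?thesis by simp
  qed
  have K: "(4 + F) ^ k \<ge> 0" using F_nonneg by simp
  have "cmod (jacobi V ?u n) \<le> cmod (?u (n - 1)) + cmod (?u (n + 1)) + F * cmod (?u n)"
    unfolding jacobi_def
    by (intro order_trans[OF norm_triangle_ineq] add_mono norm_triangle_ineq)
       (auto intro!: mult_right_mono V_bound)
  also have "\<dots> \<le> (4 + F) ^ k * (1 / 2) ^ nat \<bar>n - 1\<bar> + (4 + F) ^ k * (1 / 2) ^ nat \<bar>n + 1\<bar>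
      + F * ((4 + F) ^ k * (1 / 2) ^ nat \<bar>n\<bar>)"
    by (intro add_mono mult_left_mono Suc F_nonneg)
  also have "\<dots> \<le> (4 + F) ^ k * (2 * (1 / 2) ^ nat \<bar>n\<bar>) + (4 + F) ^ k * (2 * (1 / 2) ^ nat \<bar>n\<bar>)
      + F * ((4 + F) ^ k * (1 / 2) ^ nat \<bar>n\<bar>)"
    by (intro add_mono mult_left_mono s K) (auto simp: F_nonneg)
  also have "\<dots> = (4 + F) ^ Suc k * (1 / 2) ^ nat \<bar>n\<bar>" by (simp add: algebra_simps)
  finally show ?case by simp
qed

text \<open>Other initial sites are reached by shifting the potential, see
  \<open>jacobi_pow_shift\<close>.\<close>

definition evol :: "real \<Rightarrow> int \<Rightarrow> complex" where
  "evol t = op_exp (jacobi V) (- \<i> * complex_of_real t) (delta 0)"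

lemma summable_evol:
  "summable (\<lambda>k. norm ((jacobi V ^^ (k + m)) (delta 0) n / fact k * (y::complex) ^ k))"
proof (rule summable_comparison_test')
  show "summable (\<lambda>k. (4 + F) ^ m * (1 / 2) ^ nat \<bar>n\<bar> * (((4 + F) * cmod y) ^ k /\<^sub>R fact k))"
    by (intro summable_mult summable_exp_generic)
  fix k :: nat assume "k \<ge> 0"
  have "cmod ((jacobi V ^^ (k + m)) (delta 0) n) * (cmod y ^ k / fact k) \<le>
        (4 + F) ^ (k + m) * (1 / 2) ^ nat \<bar>n\<bar> * (cmod y ^ k / fact k)"
    by (intro mult_right_mono jacobi_pow_decay) auto
  then show "norm (norm ((jacobi V ^^ (k + m)) (delta 0) n / fact k * y ^ k)) \<le>
      (4 + F) ^ m * (1 / 2) ^ nat \<bar>n\<bar> * (((4 + F) * cmod y) ^ k /\<^sub>R fact k)"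
    unfolding power_mult_distrib power_add
    by (simp add: norm_mult norm_divide norm_power field_simps)
qed

lemma evol_norm: "cmod (evol t n) \<le> exp ((4 + F) * \<bar>t\<bar>) * (1 / 2) ^ nat \<bar>n\<bar>"
proof -
  let ?g = "\<lambda>k. (- \<i> * complex_of_real t) ^ k / fact k * (jacobi V ^^ k) (delta 0) n"
  have g: "norm (?g k) \<le> (((4 + F) * \<bar>t\<bar>) ^ k /\<^sub>R fact k) * (1 / 2) ^ nat \<bar>n\<bar>" for k
  proof -
    have "(\<bar>t\<bar> ^ k / fact k) * cmod ((jacobi V ^^ k) (delta 0) n) \<le>
      (\<bar>t\<bar> ^ k / fact k) * ((4 + F) ^ k * (1 / 2) ^ nat \<bar>n\<bar>)"
      by (intro mult_left_mono jacobi_pow_decay) auto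
    then show ?thesis
      unfolding power_mult_distrib
      by (simp add: norm_mult norm_divide norm_power field_simps)
  qed
  have s: "summable (\<lambda>k. (((4 + F) * \<bar>t\<bar>) ^ k /\<^sub>R fact k) * (1 / 2) ^ nat \<bar>n\<bar>)"
    by (intro summable_mult2 summable_exp_generic)
  have "cmod (evol t n) \<le> (\<Sum>k. (((4 + F) * \<bar>t\<bar>) ^ k /\<^sub>R fact k) * (1 / 2) ^ nat \<bar>n\<bar>)"
    unfolding evol_def op_exp_def by (rule norm_suminf_le[OF g s])
  also have "\<dots> = exp ((4 + F) * \<bar>t\<bar>) * (1 / 2) ^ nat \<bar>n\<bar>"
    unfolding exp_def by (rule suminf_mult2[symmetric]) (rule summable_exp_generic)
  finally show ?thesis .
qed

lemma evol_0: "evol 0 = delta 0"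
proof
  fix n
  have "evol 0 n = (\<Sum>k. if k = 0 then delta 0 n else 0)"
    unfolding evol_def op_exp_def by (intro suminf_cong) (auto simp: power_0_left)
  then show "evol 0 n = delta 0 n"
    using suminf_finite[of "{0}" "\<lambda>k. if k = 0 then delta 0 n else 0"] by simp
qed

text \<open>Termwise differentiation in the complex variable \<open>- \<i> * t\<close>: the
  coefficients of the derived series are \<open>jacobi V\<close> applied to the original
  ones.\<close>

lemma evol_deriv:
  "((\<lambda>t. evol t n) has_vector_derivative - \<i> * jacobi V (evol t) n) (at t)"
proof -
  define a where "a = (\<lambda>(m::int) k. (jacobi V ^^ k) (delta 0) m / fact k :: complex)"
  define y where "y = - \<i> * complex_of_real t"
  have e: "evol t m = (\<Sum>k. a m k * (- \<i> * complex_of_real t) ^ k)" for t m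
    unfolding evol_def op_exp_def a_def by (intro suminf_cong) (simp add: field_simps)
  have s: "summable (\<lambda>k. a m k * x ^ k)" for m x
    using summable_norm_cancel[OF summable_evol[of 0 m x]] by (simp add: a_def)
  have d: "((\<lambda>x. \<Sum>k. a n k * x ^ k) has_field_derivative (\<Sum>k. diffs (a n) k * x ^ k)) (at x)" for x
    by (rule termdiffs_strong_converges_everywhere) (rule s)
  have "diffs (a n) k = a (n - 1) k + a (n + 1) k + of_real (V n) * a n k" for k
    by (simp add: diffs_def a_def jacobi_def scaleR_conv_of_real field_simps del: of_nat_Suc)
  then have t: "(\<lambda>k. diffs (a n) k * x ^ k) =
      (\<lambda>k. a (n - 1) k * x ^ k + a (n + 1) k * x ^ k + of_real (V n) * (a n k * x ^ k))" for x
    by (auto simp: algebra_simps)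
  have "(\<lambda>k. diffs (a n) k * x ^ k) sums
      ((\<Sum>k. a (n - 1) k * x ^ k) + (\<Sum>k. a (n + 1) k * x ^ k) + of_real (V n) * (\<Sum>k. a n k * x ^ k))" for x
    unfolding t by (intro sums_add sums_mult summable_sums s)
  then have *: "(\<Sum>k. diffs (a n) k * y ^ k) = jacobi V (evol t) n"
    unfolding jacobi_def e y_def scaleR_conv_of_real by (rule sums_unique[symmetric])
  have "((\<lambda>w. \<Sum>k. a n k * (- \<i> * w) ^ k) has_field_derivative (\<Sum>k. diffs (a n) k * (- \<i> * of_real t) ^ k) * (- \<i>)) (at (of_real t))"
    by (rule DERIV_chain2[OF d]) (auto intro!: derivative_eq_intros)
  then have "((\<lambda>t. \<Sum>k. a n k * (- \<i> * complex_of_real t) ^ k) has_vector_derivative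
      (\<Sum>k. diffs (a n) k * (- \<i> * of_real t) ^ k) * (- \<i>)) (at t)"
    by (rule has_vector_derivative_real_field)
  then show ?thesis
    unfolding e *[unfolded y_def] by (simp only: mult.commute)
qed

lemma evol_cont: "isCont (\<lambda>t. evol t n) t"
  using evol_deriv has_vector_derivative_continuous by blast

lemma evol_measurable [measurable]: "(\<lambda>t. evol t n) \<in> borel_measurable borel"
  by (intro borel_measurable_continuous_onI continuous_at_imp_continuous_on ballI evol_cont)

text \<open>The flux through the ends of a box is the only source of change of the mass inside it, and
  it vanishes as the box grows.\<close>

lemma evol_mass:
  assumes "finite A" "t \<ge> 0"
  shows "(\<Sum>n\<in>A. (cmod (evol t n))\<^sup>2) \<le> 1"
proof -
  define S where "S = (\<lambda>N::nat. \<lambda>s. \<Sum>n\<in>{- int N..int N}. (cmod (evol s n))\<^sup>2)"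
  define c where "c = (\<lambda>s m. 2 * Im (cnj (evol s m) * evol s (m + 1)))"
  have d: "(S N has_real_derivative (c s (int N) - c s (- int N - 1))) (at s)" for N s
  proof -
    have "((\<lambda>s. (cmod (evol s n))\<^sup>2) has_real_derivative 2 * Im (cnj (evol s n) * jacobi V (evol s) n)) (at s)" for n
    proof -
      have h: "((\<lambda>s. Re (evol s n)) has_real_derivative Re (- \<i> * jacobi V (evol s) n)) (at s)"
        "((\<lambda>s. Im (evol s n)) has_real_derivative Im (- \<i> * jacobi V (evol s) n)) (at s)"
        unfolding has_real_derivative_iff_has_vector_derivative
        by (rule bounded_linear.has_vector_derivative[OF bounded_linear_Re evol_deriv]
            bounded_linear.has_vector_derivative[OF bounded_linear_Im evol_deriv])+
      then show ?thesis
        unfolding cmod_power2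
        by (intro DERIV_cong[OF DERIV_add[OF DERIV_power[OF h(1), of 2] DERIV_power[OF h(2), of 2]]])
           (simp add: algebra_simps)
    qed
    then have "(S N has_real_derivative (\<Sum>n\<in>{- int N..int N}. 2 * Im (cnj (evol s n) * jacobi V (evol s) n))) (at s)"
      unfolding S_def by (intro DERIV_sum)
    also have "(\<Sum>n\<in>{- int N..int N}. 2 * Im (cnj (evol s n) * jacobi V (evol s) n)) =
        2 * (\<Sum>n\<in>{- int N..int N}. Im (cnj (evol s n) * jacobi V (evol s) n))"
      by (rule sum_distrib_left[symmetric])
    also have "\<dots> = 2 * (Im (cnj (evol s (int N)) * evol s (int N + 1)) -
        Im (cnj (evol s (- int N - 1)) * evol s (- int N)))"
      by (subst jacobi_flux) auto
    also have "\<dots> = c s (int N) - c s (- int N - 1)"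
    proof -
      have "- int N - 1 + 1 = - int N" by simp
      then show ?thesis unfolding c_def by (simp only: right_diff_distrib)
    qed
    finally show ?thesis .
  qed
  define E where "E = exp ((4 + F) * t)"
  \<comment> \<open>Uniformly up to time \<open>t\<close>, the flux through a bond at distance at
    least \<open>N\<close> is of order \<open>(1 / 2) ^ N\<close>.\<close>
  have cb: "\<bar>c s m\<bar> \<le> 2 * (E * (1 / 2) ^ N * E)" if "0 \<le> s" "s \<le> t" "\<bar>m\<bar> \<ge> int N" for s m N
  proof -
    have b: "cmod (evol s k) \<le> E * (1 / 2) ^ nat \<bar>k\<bar>" for k
    proof -
      have "exp ((4 + F) * \<bar>s\<bar>) \<le> E"
        unfolding E_def using that F_nonneg by (auto intro!: mult_left_mono)
      then show ?thesis using order_trans[OF evol_norm[of s k]] by (simp add: mult_right_mono)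
    qed
    have b1: "cmod (evol s (m + 1)) \<le> E"
      by (rule order_trans[OF b]) (auto simp: E_def power_le_one intro!: mult_left_le)
    have b2: "cmod (evol s m) \<le> E * (1 / 2) ^ N"
      by (rule order_trans[OF b]) (use that in \<open>auto intro!: mult_left_mono power_decreasing simp: E_def\<close>)
    have "\<bar>c s m\<bar> \<le> 2 * cmod (cnj (evol s m) * evol s (m + 1))"
      unfolding c_def using abs_Im_le_cmod[of "cnj (evol s m) * evol s (m + 1)"] by simp
    also have "\<dots> \<le> 2 * (E * (1 / 2) ^ N * E)"
      unfolding norm_mult by (intro mult_left_mono mult_mono) (use b1 b2 in \<open>auto simp: E_def\<close>)
    finally show ?thesis .
  qed
  \<comment> \<open>The mass is 1 at time 0, and the mean value theorem bounds its increase by the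
    flux.\<close>
  have up: "S N t \<le> 1 + t * (4 * (E * (1 / 2) ^ N * E))" for N
  proof (cases "t = 0")
    case True
    have "S N 0 = (\<Sum>n\<in>{- int N..int N}. if n = 0 then 1 else 0)"
      unfolding S_def evol_0 by (rule sum.cong) (auto simp: delta_def)
    then show ?thesis using True by simp
  next
    case False
    then have "0 < t" using assms(2) by simp
    then obtain s where s: "0 < s" "s < t" "S N t - S N 0 = (t - 0) * (c s (int N) - c s (- int N - 1))"
      using MVT2[of 0 t "S N" "\<lambda>s. c s (int N) - c s (- int N - 1)"] d by blast
    have "c s (int N) - c s (- int N - 1) \<le> 2 * (E * (1 / 2) ^ N * E) + 2 * (E * (1 / 2) ^ N * E)"
    proof -
      have "\<bar>c s (int N)\<bar> \<le> 2 * (E * (1 / 2) ^ N * E)" "\<bar>c s (- int N - 1)\<bar> \<le> 2 * (E * (1 / 2) ^ N * E)"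
        by (rule cb; use s in auto)+
      then show ?thesis by linarith
    qed
    then have "t * (c s (int N) - c s (- int N - 1)) \<le> t * (4 * (E * (1 / 2) ^ N * E))"
      using \<open>0 < t\<close> by (intro mult_left_mono) (simp_all add: mult_ac)
    moreover have "S N 0 = (\<Sum>n\<in>{- int N..int N}. if n = 0 then 1 else 0)"
      unfolding S_def evol_0 by (rule sum.cong) (auto simp: delta_def)
    ultimately show ?thesis using s(3) by simp
  qed
  have "(\<lambda>N. 1 + t * (4 * (E * (1 / 2) ^ N * E))) \<longlonglongrightarrow> 1 + t * (4 * (E * 0 * E))"
    by (intro tendsto_intros LIMSEQ_power_zero) auto
  moreover have "\<forall>\<^sub>F N in sequentially. (\<Sum>n\<in>A. (cmod (evol t n))\<^sup>2) \<le> 1 + t * (4 * (E * (1 / 2) ^ N * E))"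
  proof -
    have "\<forall>\<^sub>F N in sequentially. A \<subseteq> {- int N..int N}"
      using filterlim_symmetric_interval assms(1) unfolding filterlim_finite_subsets_at_top
      by (auto elim: eventually_mono)
    then show ?thesis
    proof eventually_elim
      case (elim N)
      then have "(\<Sum>n\<in>A. (cmod (evol t n))\<^sup>2) \<le> S N t"
        unfolding S_def by (intro sum_mono2) auto
      then show ?case using up[of N] by simp
    qed
  qed
  ultimately show ?thesis
    using tendsto_lowerbound[of "\<lambda>N. 1 + t * (4 * (E * (1 / 2) ^ N * E))" _ sequentially] by simp
qed

lemma evol_le_1: "t \<ge> 0 \<Longrightarrow> cmod (evol t n) \<le> 1"
  using evol_mass[of "{n}" t] by (simp add: power_le_one_iff abs_square_le_1)

end

section \<open>Green functions\<close>

text \<open>The function \<open>g n = \<phi> (min n j) * w (max n j)\<close> is, up to the constant Wronskian of \<open>\<phi>\<close> and \<open>w\<close>, the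
  Green function at \<open>j\<close> of the half line to the right of \<open>b\<close>; its norm is controlled by the energy identity.\<close>

lemma halfline_decay:
  fixes w \<phi> :: "int \<Rightarrow> complex"
  assumes w: "w \<in> l2" "\<And>n. n > b \<Longrightarrow> jacobi V w n = z * w n"
    and phi: "\<phi> b = 0" "cmod (\<phi> (b + 1)) = 1" "\<And>n. n > b \<Longrightarrow> jacobi V \<phi> n = z * \<phi> n"
    and z: "Im z > 0" and j: "j > b"
  shows "(cmod (\<phi> j))\<^sup>2 * (\<Sum>n\<in>{j..N}. (cmod (w n))\<^sup>2) \<le> (cmod (w b) / Im z)\<^sup>2"
proof -
  \<comment> \<open>Two solutions of the same equation have constant Wronskian; its value is read
    off at \<open>b + 1\<close>, using \<open>\<phi> b = 0\<close>.\<close>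
  define Wr where "Wr = (\<lambda>n. \<phi> (n - 1) * w n - \<phi> n * w (n - 1))"
  have Wr: "Wr n = - \<phi> (b + 1) * w b" if "n \<ge> b + 1" for n
    using that
  proof (induction n rule: int_ge_induct)
    case base
    show ?case using phi(1) by (simp add: Wr_def)
  next
    case (step n)
    have "w (n + 1) = z * w n - w (n - 1) - of_real (V n) * w n"
      "\<phi> (n + 1) = z * \<phi> n - \<phi> (n - 1) - of_real (V n) * \<phi> n"
      using w(2)[of n] phi(3)[of n] step(1) by (auto simp: jacobi_def scaleR_conv_of_real algebra_simps)
    note eqs = this
    have "Wr (n + 1) = \<phi> n * w (n + 1) - \<phi> (n + 1) * w n" by (simp add: Wr_def)
    also have "\<dots> = Wr n" unfolding eqs Wr_def by (simp add: algebra_simps)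
    finally have "Wr (n + 1) = Wr n" .
    then show ?case using step by simp
  qed
  define g where "g = (\<lambda>n. if n \<le> j then \<phi> n * w j else \<phi> j * w n)"
  have gj: "g n = \<phi> j * w n" if "n \<ge> j" for n using that by (auto simp: g_def)
  have g0: "g b = 0" using phi(1) j by (simp add: g_def)
  \<comment> \<open>\<open>g\<close> solves the equation except at \<open>j\<close>, where its two
    pieces meet; the defect there is the Wronskian.\<close>
  have r: "jacobi V g n - z * g n = (if n = j then Wr j else 0)" if "n > b" for n
  proof -
    consider "n < j" | "n > j" | "n = j" by linarith
    then show ?thesis
    proof cases
      case 1
      then have "jacobi V g n = jacobi V \<phi> n * w j"
        by (simp add: jacobi_def g_def algebra_simps)
      then show ?thesis using 1 phi(3)[OF that] by (simp add: g_def)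
    next
      case 2
      then have "jacobi V g n = \<phi> j * jacobi V w n"
        by (simp add: jacobi_def gj algebra_simps)
      then show ?thesis using 2 w(2)[OF that] by (simp add: g_def)
    next
      case 3
      have "w (j + 1) = z * w j - w (j - 1) - of_real (V j) * w j"
        using w(2)[OF j] by (auto simp: jacobi_def scaleR_conv_of_real algebra_simps)
      note e = this
      have "jacobi V g j = \<phi> (j - 1) * w j + \<phi> j * w (j + 1) + of_real (V j) * (\<phi> j * w j)"
        by (simp add: jacobi_def g_def scaleR_conv_of_real)
      also have "\<dots> = z * g j + Wr j"
        unfolding e by (simp add: g_def Wr_def algebra_simps)
      finally show ?thesis using 3 by simp
    qed
  qed
  have e: "Im z * (\<Sum>n\<in>{b + 1..N}. (cmod (g n))\<^sup>2) = Im (cnj (g N) * g (N + 1)) - Im (cnj (g j) * Wr j)" if "N \<ge> j" for N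
  proof -
    have "(\<Sum>n\<in>{b + 1..N}. Im (cnj (g n) * (jacobi V g n - z * g n))) =
       (\<Sum>n\<in>{b + 1..N}. if n = j then Im (cnj (g j) * Wr j) else 0)"
      by (rule sum.cong) (auto simp: r)
    also have "\<dots> = Im (cnj (g j) * Wr j)" using that j by simp
    finally show ?thesis
      using jacobi_energy[of "b + 1" N g V z] that j g0 by simp
  qed
  have lim: "(\<lambda>M. cmod (\<phi> j * w (j + int M)) * cmod (\<phi> j * w (j + int M + 1))) \<longlonglongrightarrow> cmod (\<phi> j * 0) * cmod (\<phi> j * 0)"
    by (intro tendsto_intros tendsto_0_l2[OF w(1)]) (auto simp: inj_def)
  have bnd: "Im z * (\<Sum>n\<in>{b + 1..N}. (cmod (g n))\<^sup>2) \<le> cmod (g j) * cmod (w b)" for N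
  proof -
    have "Im z * (\<Sum>n\<in>{b + 1..N}. (cmod (g n))\<^sup>2) \<le>
        cmod (\<phi> j * w (j + int M)) * cmod (\<phi> j * w (j + int M + 1)) + cmod (g j) * cmod (w b)" if "int M \<ge> N - j" for M
    proof -
      have "Im z * (\<Sum>n\<in>{b + 1..N}. (cmod (g n))\<^sup>2) \<le> Im z * (\<Sum>n\<in>{b + 1..j + int M}. (cmod (g n))\<^sup>2)"
        using z that by (intro mult_left_mono sum_mono2) auto
      also have "\<dots> = Im (cnj (g (j + int M)) * g (j + int M + 1)) - Im (cnj (g j) * Wr j)"
        by (rule e) simp
      also have "\<dots> \<le> cmod (cnj (g (j + int M)) * g (j + int M + 1)) + cmod (cnj (g j) * Wr j)"
        using abs_Im_le_cmod[of "cnj (g (j + int M)) * g (j + int M + 1)"] abs_Im_le_cmod[of "cnj (g j) * Wr j"]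
        by linarith
      also have "\<dots> = cmod (\<phi> j * w (j + int M)) * cmod (\<phi> j * w (j + int M + 1)) + cmod (g j) * cmod (w b)"
        using Wr[of j] j phi(2) by (simp add: norm_mult gj)
      finally show ?thesis .
    qed
    then have ev: "\<forall>\<^sub>F M in sequentially. Im z * (\<Sum>n\<in>{b + 1..N}. (cmod (g n))\<^sup>2) \<le>
        cmod (\<phi> j * w (j + int M)) * cmod (\<phi> j * w (j + int M + 1)) + cmod (g j) * cmod (w b)"
      unfolding eventually_sequentially by (intro exI[of _ "nat (N - j)"]) auto
    have "(\<lambda>M. cmod (\<phi> j * w (j + int M)) * cmod (\<phi> j * w (j + int M + 1)) + cmod (g j) * cmod (w b))
        \<longlonglongrightarrow> 0 + cmod (g j) * cmod (w b)"
      using lim by (intro tendsto_add tendsto_const) simp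
    from tendsto_lowerbound[OF this ev] show ?thesis by simp
  qed
  \<comment> \<open>The term at \<open>j\<close> alone is at most the whole sum, so one factor
    \<open>cmod (g j)\<close> cancels. Inserting the result into \<open>bnd\<close> once more
    produces the square on the right.\<close>
  have "Im z * (cmod (g j))\<^sup>2 \<le> Im z * (\<Sum>n\<in>{b + 1..j}. (cmod (g n))\<^sup>2)"
    using z j by (intro mult_left_mono member_le_sum) auto
  also have "\<dots> \<le> cmod (g j) * cmod (w b)" by (rule bnd)
  finally have gjb: "cmod (g j) \<le> cmod (w b) / Im z"
    using z by (cases "cmod (g j) = 0") (auto simp: power2_eq_square field_simps)
  have "(cmod (\<phi> j))\<^sup>2 * (\<Sum>n\<in>{j..N}. (cmod (w n))\<^sup>2) = (\<Sum>n\<in>{j..N}. (cmod (g n))\<^sup>2)"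
    unfolding sum_distrib_left by (rule sum.cong) (auto simp: gj norm_mult power_mult_distrib)
  also have "\<dots> \<le> (\<Sum>n\<in>{b + 1..N}. (cmod (g n))\<^sup>2)"
    using j by (intro sum_mono2) auto
  also have "\<dots> \<le> cmod (g j) * cmod (w b) / Im z"
    using bnd[of N] z by (simp add: field_simps)
  also have "\<dots> \<le> cmod (w b) / Im z * cmod (w b) / Im z"
    using gjb z by (intro divide_right_mono mult_right_mono) auto
  finally show ?thesis by (simp add: power2_eq_square)
qed

context bounded_potential begin

text \<open>The resolvent applied to \<open>delta 0\<close>: integrating
  \<open>exp (\<i> * (z - x) * t)\<close> over time gives \<open>\<i> / (z - x)\<close>, and the
  prefactor \<open>\<i>\<close> turns this into \<open>1 / (x - z)\<close>.\<close>

definition green :: "complex \<Rightarrow> int \<Rightarrow> complex" where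
  "green z n = \<i> * (CLBINT t:{0..}. exp (\<i> * z * complex_of_real t) * evol t n)"

lemma green_integrable:
  assumes "Im z > 0"
  shows "set_integrable lborel {0..} (\<lambda>t. exp (\<i> * z * complex_of_real t) * evol t n)"
proof (rule set_integrable_exp_dominated(1)[where B=1, OF assms])
  show "(\<lambda>t. exp (\<i> * z * complex_of_real t) * evol t n) \<in> borel_measurable borel"
    by (intro borel_measurable_times evol_measurable borel_measurable_continuous_onI continuous_intros)
  show "norm (exp (\<i> * z * complex_of_real t) * evol t n) \<le> 1 * exp (- Im z * t)" if "t \<ge> 0" for t
    using evol_le_1[OF that, of n] by (simp add: norm_mult norm_exp_eq_Re mult_left_le)
qed

text \<open>\<open>?f\<close> is the time derivative of the evolution damped by
  \<open>exp (\<i> * z * t)\<close>; it integrates to minus the initial value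
  \<open>delta 0\<close>.\<close>

lemma green_eq:
  assumes "Im z > 0"
  shows "jacobi V (green z) n - z * green z n = delta 0 n"
proof -
  let ?e = "\<lambda>t. exp (\<i> * z * complex_of_real t)"
  let ?I = "\<lambda>n. CLBINT t:{0..}. ?e t * evol t n"
  let ?f = "\<lambda>t. \<i> * z * (?e t * evol t n) - \<i> * (?e t * evol t (n - 1) + ?e t * evol t (n + 1) + V n *\<^sub>R (?e t * evol t n))"
  have i: "set_integrable lborel {0..} ?f"
    by (intro set_integral_diff set_integrable_mult_right set_integral_add set_integrable_scaleR_right green_integrable assms)
  have "set_lebesgue_integral lborel {0..} ?f = - (?e 0 * evol 0 n)"
  proof (rule set_integral_atLeast_FTC[OF _ _ i])
    fix t
    have d: "((\<lambda>t. ?e t * evol t n) has_vector_derivative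
        ?e t * (- \<i> * jacobi V (evol t) n) + (\<i> * z * ?e t) * evol t n) (at t)"
      by (rule has_vector_derivative_mult[OF _ evol_deriv])
         (auto intro!: has_vector_derivative_real_field derivative_eq_intros)
    have eq: "?e t * (- \<i> * jacobi V (evol t) n) + (\<i> * z * ?e t) * evol t n = ?f t"
      by (simp add: jacobi_def scaleR_conv_of_real algebra_simps)
    show "((\<lambda>t. ?e t * evol t n) has_vector_derivative ?f t) (at t)" using d unfolding eq .
    show "isCont ?f t" by (intro continuous_intros evol_cont)
    show "((\<lambda>t. ?e t * evol t n) \<longlongrightarrow> 0) at_top"
    proof (rule Lim_null_comparison[OF _ exp_decay_tendsto_0[OF assms]])
      show "\<forall>\<^sub>F t in at_top. norm (?e t * evol t n) \<le> exp (- Im z * t)"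
        using eventually_ge_at_top[of 0]
      proof eventually_elim
        case (elim t)
        then show ?case using evol_le_1[OF elim, of n] by (simp add: norm_mult norm_exp_eq_Re mult_left_le)
      qed
    qed
  qed
  moreover have "set_lebesgue_integral lborel {0..} ?f = \<i> * z * ?I n - \<i> * (?I (n - 1) + ?I (n + 1) + V n *\<^sub>R ?I n)"
    using green_integrable[OF assms]
    by (simp add: set_integral_diff set_integral_add set_integrable_mult_right set_integrable_scaleR_right)
  ultimately show ?thesis
    by (simp add: jacobi_def green_def evol_0 scaleR_conv_of_real algebra_simps)
qed

text \<open>By duality: the Green function on \<open>A\<close> is paired with itself and one copy is
  replaced by its integral. Cauchy-Schwarz and \<open>evol_mass\<close> bound \<open>S\<close> by
  \<open>sqrt S / Im z\<close>. This is what places \<open>green z\<close> in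
  \<open>l2\<close>.\<close>

lemma green_mass:
  assumes "Im z > 0" "finite A"
  shows "(\<Sum>n\<in>A. (cmod (green z n))\<^sup>2) \<le> (1 / Im z)\<^sup>2"
proof -
  let ?e = "\<lambda>t. exp (\<i> * z * complex_of_real t)"
  define f where "f = (\<lambda>n t. indicator {0..} t *\<^sub>R (cnj (green z n) * (?e t * evol t n)))"
  define S where "S = (\<Sum>n\<in>A. (cmod (green z n))\<^sup>2)"
  have S0: "S \<ge> 0" by (simp add: S_def sum_nonneg)
  have "complex_of_real S = (\<Sum>n\<in>A. cnj (green z n) * green z n)"
    by (simp add: S_def complex_norm_square mult.commute del: of_real_power)
  also have "\<dots> = (\<Sum>n\<in>A. \<i> * (CLBINT t:{0..}. cnj (green z n) * (?e t * evol t n)))"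
  proof -
    have "c * green z n = \<i> * (CLBINT t:{0..}. c * (?e t * evol t n))" for c n
      by (simp add: green_def)
    then show ?thesis by (intro sum.cong refl)
  qed
  also have "\<dots> = \<i> * (CLBINT t:{0..}. (\<Sum>n\<in>A. cnj (green z n) * (?e t * evol t n)))"
  proof -
    have "set_integrable lborel {0..} (\<lambda>t. cnj (green z n) * (?e t * evol t n))" for n
      by (intro set_integrable_mult_right green_integrable assms(1))
    then have i: "integrable lborel (f n)" for n
      unfolding set_integrable_def f_def .
    have "(CLBINT t:{0..}. (\<Sum>n\<in>A. cnj (green z n) * (?e t * evol t n))) = (LINT t|lborel. (\<Sum>n\<in>A. f n t))"
      unfolding set_lebesgue_integral_def f_def by (simp only: scaleR_sum_right)
    also have "\<dots> = (\<Sum>n\<in>A. integral\<^sup>L lborel (f n))"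
      by (rule Bochner_Integration.integral_sum) (rule i)
    finally show ?thesis
      unfolding set_lebesgue_integral_def by (simp only: sum_distrib_left f_def)
  qed
  finally have "S = cmod (CLBINT t:{0..}. (\<Sum>n\<in>A. cnj (green z n) * (?e t * evol t n)))"
  proof -
    assume "complex_of_real S = \<i> * (CLBINT t:{0..}. (\<Sum>n\<in>A. cnj (green z n) * (?e t * evol t n)))"
    from arg_cong[OF this, of cmod] show ?thesis using S0 by (simp add: norm_mult)
  qed
  also have "\<dots> \<le> sqrt S / Im z"
  proof (rule set_integrable_exp_dominated(2)[OF assms(1)])
    show "(\<lambda>t. \<Sum>n\<in>A. cnj (green z n) * (?e t * evol t n)) \<in> borel_measurable borel"
      by (intro borel_measurable_sum borel_measurable_times evol_measurable borel_measurable_const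
          borel_measurable_continuous_onI continuous_intros)
    fix t :: real assume t: "t \<ge> 0"
    have "cmod (\<Sum>n\<in>A. cnj (green z n) * (?e t * evol t n)) \<le> (\<Sum>n\<in>A. \<bar>cmod (green z n)\<bar> * \<bar>cmod (evol t n)\<bar>) * exp (- Im z * t)"
      unfolding sum_distrib_right
      by (rule order_trans[OF norm_sum]) (auto intro!: sum_mono simp: norm_mult norm_exp_eq_Re)
    also have "\<dots> \<le> (L2_set (\<lambda>n. cmod (green z n)) A * L2_set (\<lambda>n. cmod (evol t n)) A) * exp (- Im z * t)"
      by (intro mult_right_mono L2_set_mult_ineq) auto
    also have "\<dots> \<le> (sqrt S * 1) * exp (- Im z * t)"
      by (rule mult_right_mono, rule mult_mono)
         (auto simp: L2_set_def S_def sum_nonneg evol_mass[OF assms(2) t])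
    finally show "cmod (\<Sum>n\<in>A. cnj (green z n) * (?e t * evol t n)) \<le> sqrt S * exp (- Im z * t)" by simp
  qed
  finally have "sqrt S * sqrt S \<le> sqrt S * (1 / Im z)" using S0 by simp
  then have "sqrt S \<le> 1 / Im z"
    using S0 assms(1) mult_left_le_imp_le[of "sqrt S" "sqrt S" "1 / Im z"] by (cases "S = 0") auto
  then have "(sqrt S)\<^sup>2 \<le> (1 / Im z)\<^sup>2"
    using S0 by (intro power_mono) auto
  then show ?thesis using S0 by (simp add: S_def)
qed

lemma green_l2: "Im z > 0 \<Longrightarrow> green z \<in> l2"
  using green_mass by (rule l2_finite_sumI)

lemma green_norm_le: "Im z > 0 \<Longrightarrow> cmod (green z n) \<le> 1 / Im z"
  using green_mass[of z "{n}"] by (simp add: power2_le_iff_abs_le)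

lemma green_summable: "Im z > 0 \<Longrightarrow> (\<lambda>n. (cmod (green z n))\<^sup>2) summable_on A"
  using green_l2 summable_on_subset_banach unfolding l2_def by blast

lemma green_energy:
  "Im z > 0 \<Longrightarrow> Im (green z 0) = Im z * (\<Sum>\<^sub>\<infinity>n. (cmod (green z n))\<^sup>2)"
  using l2_energy[OF green_l2, of z V z 1] green_eq by simp

lemma green_unique:
  assumes "Im z > 0" "w \<in> l2" "\<And>n. jacobi V w n - z * w n = delta 0 n"
  shows "w = green z"
  using inj_onD[OF inj_on_jacobi[OF assms(1)], of V w "green z"] assms green_l2 green_eq by auto

lemma resolvent_eq_green:
  assumes "Im z > 0"
  shows "resolvent (jacobi V) z (delta 0) = green z"
proof -
  have "resolvent (jacobi V) z (\<lambda>n. jacobi V (green z) n - z * green z n) = green z"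
    unfolding resolvent_def
    by (rule inv_into_f_f[OF inj_on_jacobi[OF assms] green_l2[OF assms], of V])
  then show ?thesis using green_eq[OF assms] by simp
qed

end

lemma bounded_potential_shift:
  "bounded_potential V F \<Longrightarrow> bounded_potential (\<lambda>n. V (n + k)) F"
  "bounded_potential V F \<Longrightarrow> bounded_potential (\<lambda>n. V (- n)) F"
  by (auto simp: bounded_potential_def)

lemma jacobi_pow_shift:
  "(jacobi V ^^ k) (delta m) n = (jacobi (\<lambda>n. V (n + m)) ^^ k) (delta 0) (n - m)"
proof (induction k arbitrary: n)
  case 0
  show ?case by (simp add: delta_def)
next
  case (Suc k)
  then show ?case by (simp add: jacobi_def algebra_simps)
qed

text \<open>It lets estimates on the right half line serve on the left one. The reflected sequence
  solves the reflected equation, and \<open>l2\<close> solutions are unique.\<close>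

lemma (in bounded_potential) green_reflect:
  assumes "Im z > 0"
  shows "bounded_potential.green (\<lambda>n. V (- n)) z n = green z (- n)"
proof -
  interpret R: bounded_potential "\<lambda>n. V (- n)" F
    using bounded_potential_axioms by (rule bounded_potential_shift)
  have "(\<lambda>n. green z (- n)) = R.green z"
  proof (rule R.green_unique[OF assms])
    show "(\<lambda>n. green z (- n)) \<in> l2"
      by (rule l2_finite_sumI[where B="(1 / Im z)\<^sup>2"])
         (use green_mass[OF assms, of "uminus ` _"] in \<open>simp add: sum.reindex inj_on_def\<close>)
    fix n :: int
    have "- (n - 1) = - n + 1" by simp
    moreover have "- (n + 1) = - n - 1" by simp
    ultimately have "jacobi (\<lambda>n. V (- n)) (\<lambda>n. green z (- n)) n = jacobi V (green z) (- n)"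
      by (simp only: jacobi_def add.commute)
    then show "jacobi (\<lambda>n. V (- n)) (\<lambda>n. green z (- n)) n - z * green z (- n) = delta 0 n"
      using green_eq[OF assms, of "- n"] by (simp add: delta_def)
  qed
  then show ?thesis by (metis)
qed

section \<open>Plancherel inequality\<close>

lemma nn_integral_gauss:
  fixes \<tau> s :: real assumes "\<tau> > 0"
  shows "(\<integral>\<^sup>+t. ennreal (exp (- (\<tau>\<^sup>2 * (s - t)\<^sup>2 / 2))) \<partial>lborel) = ennreal (sqrt (2 * pi) / \<tau>)"
proof -
  interpret prob_space "density lborel (normal_density s (1 / \<tau>))"
    by (rule prob_space_normal_density) (use assms in simp)
  have "normal_density s (1 / \<tau>) t * (sqrt (2 * pi) / \<tau>) = exp (- (\<tau>\<^sup>2 * (s - t)\<^sup>2 / 2))" for t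
    using assms by (simp add: normal_density_def real_sqrt_mult real_sqrt_divide power2_commute field_simps)
  then have "(\<integral>\<^sup>+t. ennreal (exp (- (\<tau>\<^sup>2 * (s - t)\<^sup>2 / 2))) \<partial>lborel) =
     (\<integral>\<^sup>+t. ennreal (normal_density s (1 / \<tau>) t) * ennreal (sqrt (2 * pi) / \<tau>) \<partial>lborel)"
    using assms by (intro nn_integral_cong) (simp add: ennreal_mult[symmetric])
  also have "\<dots> = (\<integral>\<^sup>+t. ennreal (normal_density s (1 / \<tau>) t) \<partial>lborel) * ennreal (sqrt (2 * pi) / \<tau>)"
    by (rule nn_integral_multc) simp
  also have "(\<integral>\<^sup>+t. ennreal (normal_density s (1 / \<tau>) t) \<partial>lborel) = 1"
    using emeasure_space_1 by (simp add: emeasure_density)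
  finally show ?thesis by simp
qed

text \<open>A Gaussian average over the energy replaces the oscillating kernel by the characteristic
  function \<open>K\<close>, which is positive and has integral
  \<open>sqrt (2 * pi) / \<tau>\<close> in either variable. The bound of a product by half the sum
  of squares then finishes, as in Schur's test.\<close>

lemma gaussian_plancherel:
  fixes G :: "real \<Rightarrow> complex" and \<tau> :: real
  assumes G: "integrable lborel G" and G2: "integrable lborel (\<lambda>t. (cmod (G t))\<^sup>2)" and \<tau>: "\<tau> > 0"
  defines "h \<equiv> \<lambda>E. (LINT t|lborel. exp (\<i> * complex_of_real (E * t)) * G t)"
  shows "(LINT x|std_normal_distribution. (cmod (h (\<tau> * x)))\<^sup>2) \<le> sqrt (2 * pi) / \<tau> * (LINT t|lborel. (cmod (G t))\<^sup>2)"
proof -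
  let ?\<gamma> = "std_normal_distribution"
  let ?e = "\<lambda>y. exp (\<i> * complex_of_real y)"
  interpret \<gamma>: real_distribution ?\<gamma> by (rule real_dist_normal_dist)
  interpret P: sigma_finite_measure "lborel \<Otimes>\<^sub>M (lborel :: real measure)" by (rule sigma_finite_pair_measure) unfold_locales
  interpret GP: pair_sigma_finite ?\<gamma> "lborel \<Otimes>\<^sub>M (lborel :: real measure)" ..
  have Gm [measurable]: "G \<in> borel_measurable borel" using borel_measurable_integrable[OF G] by simp
  have [measurable]: "cnj \<in> borel_measurable borel"
    by (intro borel_measurable_continuous_onI continuous_intros)
  have em [measurable]: "?e \<in> borel_measurable borel" by (intro borel_measurable_continuous_onI continuous_intros)
  have ie: "integrable lborel (\<lambda>t. ?e (E * t) * G t)" for E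
    by (rule Bochner_Integration.integrable_bound[OF G]) (auto simp: norm_mult)
  have ig: "integrable (lborel \<Otimes>\<^sub>M lborel) (\<lambda>(s,t). G s * cnj (G t))"
  proof (rule lborel_pair.Fubini_integrable)
    show "(\<lambda>(s,t). G s * cnj (G t)) \<in> borel_measurable (lborel \<Otimes>\<^sub>M lborel)" by measurable
    have "integrable lborel (\<lambda>x. cmod (G x) * (LINT y|lborel. cmod (G y)))"
      by (intro integrable_mult_left integrable_norm G)
    then show "integrable lborel (\<lambda>x. LINT y|lborel. norm (case (x, y) of (s, t) \<Rightarrow> G s * cnj (G t)))"
      by (simp add: norm_mult)
    show "AE x in lborel. integrable lborel (\<lambda>y. case (x, y) of (s, t) \<Rightarrow> G s * cnj (G t))"
      using G by (auto intro!: AE_I2 integrable_mult_right)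
  qed
  have sq: "complex_of_real ((cmod (h E))\<^sup>2) = (LINT p|(lborel \<Otimes>\<^sub>M lborel). (case p of (s,t) \<Rightarrow> ?e (E * (s - t)) * (G s * cnj (G t))))" for E
  proof -
    have i2: "integrable (lborel \<Otimes>\<^sub>M lborel) (\<lambda>(s,t). ?e (E * (s - t)) * (G s * cnj (G t)))"
      by (rule Bochner_Integration.integrable_bound[OF ig]) (auto simp: norm_mult)
    have "complex_of_real ((cmod (h E))\<^sup>2) = h E * cnj (h E)"
      by (simp add: complex_norm_square del: of_real_power)
    also have "cnj (h E) = (LINT t|lborel. ?e (- (E * t)) * cnj (G t))"
      unfolding h_def by (subst Bochner_Integration.integral_cnj[symmetric]) (simp add: exp_cnj)
    also have "h E * \<dots> = (LINT s|lborel. (LINT t|lborel. (?e (E * s) * G s) * (?e (- (E * t)) * cnj (G t))))"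
      unfolding h_def by simp
    also have "\<dots> = (LINT s|lborel. (LINT t|lborel. ?e (E * (s - t)) * (G s * cnj (G t))))"
      by (intro Bochner_Integration.integral_cong refl) (simp add: exp_add[symmetric] algebra_simps exp_diff exp_minus field_simps)
    also have "\<dots> = (LINT p|(lborel \<Otimes>\<^sub>M lborel). (case p of (s,t) \<Rightarrow> ?e (E * (s - t)) * (G s * cnj (G t))))"
      using lborel_pair.integral_fst'[OF i2] by simp
    finally show ?thesis .
  qed
  have i3: "integrable (?\<gamma> \<Otimes>\<^sub>M (lborel \<Otimes>\<^sub>M lborel)) (\<lambda>(x,s,t). ?e (\<tau> * x * (s - t)) * (G s * cnj (G t)))"
  proof (rule GP.Fubini_integrable)
    have "(\<lambda>(x::real,s,t). ?e (\<tau> * x * (s - t)) * (G s * cnj (G t))) \<in> borel_measurable (borel \<Otimes>\<^sub>M (borel \<Otimes>\<^sub>M borel))"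
      by measurable
    then show "(\<lambda>(x,s,t). ?e (\<tau> * x * (s - t)) * (G s * cnj (G t))) \<in> borel_measurable (?\<gamma> \<Otimes>\<^sub>M (lborel \<Otimes>\<^sub>M lborel))"
      by (simp cong: measurable_cong_sets sets_pair_measure_cong)
    show "integrable ?\<gamma> (\<lambda>x. LINT y|(lborel \<Otimes>\<^sub>M lborel). norm (case (x, y) of (x, s, t) \<Rightarrow> ?e (\<tau> * x * (s - t)) * (G s * cnj (G t))))"
      by (simp add: norm_mult split_beta')
    show "AE x in ?\<gamma>. integrable (lborel \<Otimes>\<^sub>M lborel) (\<lambda>y. case (x, y) of (x, s, t) \<Rightarrow> ?e (\<tau> * x * (s - t)) * (G s * cnj (G t)))"
    proof (rule AE_I2)
      fix x
      show "integrable (lborel \<Otimes>\<^sub>M lborel) (\<lambda>y. case (x, y) of (x, s, t) \<Rightarrow> ?e (\<tau> * x * (s - t)) * (G s * cnj (G t)))"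
        by (rule Bochner_Integration.integrable_bound[OF ig]) (auto simp: norm_mult split_beta')
    qed
  qed
  define K where "K = (\<lambda>s t :: real. exp (- (\<tau>\<^sup>2 * (s - t)\<^sup>2 / 2)))"
  have char: "(LINT x|?\<gamma>. ?e (\<tau> * x * (s - t))) = complex_of_real (K s t)" for s t
    using fun_cong[OF char_std_normal_distribution, of "\<tau> * (s - t)"]
    by (simp add: char_def K_def mult_ac power_mult_distrib)
  have "complex_of_real (LINT x|?\<gamma>. (cmod (h (\<tau> * x)))\<^sup>2) = (LINT x|?\<gamma>. complex_of_real ((cmod (h (\<tau> * x)))\<^sup>2))"
    by (rule integral_complex_of_real[symmetric])
  also have "\<dots> = (LINT x|?\<gamma>. (LINT p|(lborel \<Otimes>\<^sub>M lborel). (case p of (s,t) \<Rightarrow> ?e (\<tau> * x * (s - t)) * (G s * cnj (G t)))))"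
    unfolding sq ..
  also have "\<dots> = (LINT p|(lborel \<Otimes>\<^sub>M lborel). (LINT x|?\<gamma>. (case p of (s,t) \<Rightarrow> ?e (\<tau> * x * (s - t)) * (G s * cnj (G t)))))"
    using GP.Fubini_integral[OF i3] by (simp add: split_beta')
  also have "\<dots> = (LINT p|(lborel \<Otimes>\<^sub>M lborel). (case p of (s,t) \<Rightarrow> K s t * (G s * cnj (G t))))"
  proof -
    have "(LINT x|?\<gamma>. ?e (\<tau> * x * (s - t)) * c) = K s t * c" for s t and c :: complex
      by (simp only: integral_mult_left_zero char)
    then show ?thesis
      by (simp only: split_beta')
  qed
  finally have E: "complex_of_real (LINT x|?\<gamma>. (cmod (h (\<tau> * x)))\<^sup>2) = (LINT p|(lborel \<Otimes>\<^sub>M lborel). (case p of (s,t) \<Rightarrow> K s t * (G s * cnj (G t))))" .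
  have "(LINT x|?\<gamma>. (cmod (h (\<tau> * x)))\<^sup>2) \<le> cmod (complex_of_real (LINT x|?\<gamma>. (cmod (h (\<tau> * x)))\<^sup>2))"
    by simp
  then have "(LINT x|?\<gamma>. (cmod (h (\<tau> * x)))\<^sup>2) \<le> cmod (LINT p|(lborel \<Otimes>\<^sub>M lborel). (case p of (s,t) \<Rightarrow> K s t * (G s * cnj (G t))))"
    unfolding E .
  then have "ennreal (LINT x|?\<gamma>. (cmod (h (\<tau> * x)))\<^sup>2) \<le>
      ennreal (cmod (LINT p|(lborel \<Otimes>\<^sub>M lborel). (case p of (s,t) \<Rightarrow> K s t * (G s * cnj (G t)))))"
    by (rule ennreal_leI)
  also have "\<dots> \<le> (\<integral>\<^sup>+p. ennreal (norm (case p of (s,t) \<Rightarrow> K s t * (G s * cnj (G t)))) \<partial>(lborel \<Otimes>\<^sub>M lborel))"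
    by (rule integral_norm_bound_ennreal)
       (rule Bochner_Integration.integrable_bound[OF ig], auto simp: norm_mult K_def mult_left_le_one_le)
  also have "\<dots> \<le> (\<integral>\<^sup>+p. (case p of (s,t) \<Rightarrow> ennreal (K s t * ((cmod (G s))\<^sup>2 / 2)) + ennreal (K s t * ((cmod (G t))\<^sup>2 / 2))) \<partial>(lborel \<Otimes>\<^sub>M lborel))"
  proof (rule nn_integral_mono)
    fix p :: "real \<times> real"
    obtain s t where p: "p = (s, t)" by (cases p)
    have "cmod (G s) * cmod (G t) \<le> (cmod (G s))\<^sup>2 / 2 + (cmod (G t))\<^sup>2 / 2"
      using sum_squares_bound[of "cmod (G s)" "cmod (G t)"] by simp
    then have "K s t * (cmod (G s) * cmod (G t)) \<le> K s t * ((cmod (G s))\<^sup>2 / 2 + (cmod (G t))\<^sup>2 / 2)"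
      by (rule mult_left_mono) (simp add: K_def)
    moreover have "norm (K s t * (G s * cnj (G t))) = K s t * (cmod (G s) * cmod (G t))"
      by (simp add: norm_mult K_def)
    ultimately have "ennreal (norm (K s t * (G s * cnj (G t)))) \<le>
        ennreal (K s t * ((cmod (G s))\<^sup>2 / 2) + K s t * ((cmod (G t))\<^sup>2 / 2))"
      by (intro ennreal_leI) (simp add: distrib_left)
    also have "\<dots> = ennreal (K s t * ((cmod (G s))\<^sup>2 / 2)) + ennreal (K s t * ((cmod (G t))\<^sup>2 / 2))"
      by (rule ennreal_plus) (auto simp: K_def)
    finally show "ennreal (norm (case p of (s,t) \<Rightarrow> K s t * (G s * cnj (G t)))) \<le>
        (case p of (s,t) \<Rightarrow> ennreal (K s t * ((cmod (G s))\<^sup>2 / 2)) + ennreal (K s t * ((cmod (G t))\<^sup>2 / 2)))"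
      by (simp add: p)
  qed
  also have "\<dots> = (\<integral>\<^sup>+p. (case p of (s,t) \<Rightarrow> ennreal (K s t * ((cmod (G s))\<^sup>2 / 2))) \<partial>(lborel \<Otimes>\<^sub>M lborel)) +
      (\<integral>\<^sup>+p. (case p of (s,t) \<Rightarrow> ennreal (K s t * ((cmod (G t))\<^sup>2 / 2))) \<partial>(lborel \<Otimes>\<^sub>M lborel))"
    unfolding split_beta' K_def by (rule nn_integral_add) measurable
  also have "(\<integral>\<^sup>+p. (case p of (s,t) \<Rightarrow> ennreal (K s t * ((cmod (G s))\<^sup>2 / 2))) \<partial>(lborel \<Otimes>\<^sub>M lborel)) =
      (\<integral>\<^sup>+s. (\<integral>\<^sup>+t. ennreal (K s t) * ennreal ((cmod (G s))\<^sup>2 / 2) \<partial>lborel) \<partial>lborel)"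
    by (subst lborel.nn_integral_fst[symmetric]) (auto simp: K_def ennreal_mult[symmetric])
  also have "\<dots> = ennreal (sqrt (2 * pi) / \<tau>) * (\<integral>\<^sup>+s. ennreal ((cmod (G s))\<^sup>2 / 2) \<partial>lborel)"
    unfolding K_def by (subst nn_integral_multc) (auto simp: nn_integral_gauss[OF \<tau>] nn_integral_cmult)
  also have "(\<integral>\<^sup>+p. (case p of (s,t) \<Rightarrow> ennreal (K s t * ((cmod (G t))\<^sup>2 / 2))) \<partial>(lborel \<Otimes>\<^sub>M lborel)) =
      (\<integral>\<^sup>+t. (\<integral>\<^sup>+s. ennreal (K t s) * ennreal ((cmod (G t))\<^sup>2 / 2) \<partial>lborel) \<partial>lborel)"
    by (subst lborel_pair.nn_integral_snd[symmetric]) (auto simp: K_def ennreal_mult[symmetric] power2_commute)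
  also have "\<dots> = ennreal (sqrt (2 * pi) / \<tau>) * (\<integral>\<^sup>+s. ennreal ((cmod (G s))\<^sup>2 / 2) \<partial>lborel)"
    unfolding K_def by (subst nn_integral_multc) (auto simp: nn_integral_gauss[OF \<tau>] nn_integral_cmult)
  also have "(\<integral>\<^sup>+s. ennreal ((cmod (G s))\<^sup>2 / 2) \<partial>lborel) = ennreal ((LINT t|lborel. (cmod (G t))\<^sup>2) / 2)"
    using G2 by (subst nn_integral_eq_integral) auto
  also have "ennreal (sqrt (2 * pi) / \<tau>) * ennreal ((LINT t|lborel. (cmod (G t))\<^sup>2) / 2) + ennreal (sqrt (2 * pi) / \<tau>) * ennreal ((LINT t|lborel. (cmod (G t))\<^sup>2) / 2)
     = ennreal (sqrt (2 * pi) / \<tau> * (LINT t|lborel. (cmod (G t))\<^sup>2))"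
    using \<tau> by (simp add: ennreal_mult[symmetric] ennreal_plus[symmetric] field_simps del: ennreal_plus)
  finally show ?thesis
    using \<tau> by (subst (asm) ennreal_le_iff) auto
qed

text \<open>On \<open>{-R..R}\<close> the Gaussian weight of width \<open>\<tau>\<close> is nearly
  constant: it costs at most the factor \<open>exp (R^2 / (2 * \<tau>^2))\<close>, which tends to 1
  as \<open>\<tau>\<close> grows.\<close>

lemma plancherel_le:
  fixes G :: "real \<Rightarrow> complex"
  assumes G: "integrable lborel G" and G2: "integrable lborel (\<lambda>t. (cmod (G t))\<^sup>2)"
    and S [measurable]: "S \<in> sets borel" and SR: "S \<subseteq> {-R..R}"
  defines "h \<equiv> \<lambda>E. (LINT t|lborel. exp (\<i> * complex_of_real (E * t)) * G t)"
  shows "(\<integral>\<^sup>+E\<in>S. ennreal ((cmod (h E))\<^sup>2) \<partial>lborel) \<le> ennreal (2 * pi * (LINT t|lborel. (cmod (G t))\<^sup>2))"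
proof -
  let ?\<gamma> = "std_normal_distribution"
  let ?I = "LINT t|lborel. (cmod (G t))\<^sup>2"
  interpret \<gamma>: real_distribution ?\<gamma> by (rule real_dist_normal_dist)
  have Gm [measurable]: "G \<in> borel_measurable borel" using borel_measurable_integrable[OF G] by simp
  have em [measurable]: "(\<lambda>y. exp (\<i> * complex_of_real y)) \<in> borel_measurable borel"
    by (intro borel_measurable_continuous_onI continuous_intros)
  have hm [measurable]: "h \<in> borel_measurable borel"
    unfolding h_def by measurable
  have hb: "cmod (h E) \<le> (LINT t|lborel. cmod (G t))" for E
  proof -
    have "cmod (h E) \<le> (LINT t|lborel. cmod (exp (\<i> * complex_of_real (E * t)) * G t))"
      unfolding h_def by (rule integral_norm_bound)
    then show ?thesis by (simp add: norm_mult)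
  qed
  have ih: "integrable ?\<gamma> (\<lambda>x. (cmod (h (\<tau> * x)))\<^sup>2)" for \<tau>
    by (rule \<gamma>.integrable_const_bound[where B="(LINT t|lborel. cmod (G t))\<^sup>2"])
       (auto intro!: AE_I2 power_mono hb)
  have b: "(\<integral>\<^sup>+E\<in>S. ennreal ((cmod (h E))\<^sup>2) \<partial>lborel) \<le> ennreal (2 * pi * exp (R\<^sup>2 / (2 * \<tau>\<^sup>2)) * ?I)" if \<tau>: "\<tau> > 0" for \<tau> :: real
  proof -
    define B where "B = \<tau> * (sqrt (2 * pi) * exp (R\<^sup>2 / (2 * \<tau>\<^sup>2)))"
    have "(\<integral>\<^sup>+E\<in>S. ennreal ((cmod (h E))\<^sup>2) \<partial>lborel) =
        ennreal \<tau> * (\<integral>\<^sup>+x. ennreal ((cmod (h (\<tau> * x)))\<^sup>2) * indicator S (\<tau> * x) \<partial>lborel)"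
      using nn_integral_real_affine[of "\<lambda>E. ennreal ((cmod (h E))\<^sup>2) * indicator S E" \<tau> 0] \<tau> by simp
    also have "\<dots> = (\<integral>\<^sup>+x. ennreal \<tau> * (ennreal ((cmod (h (\<tau> * x)))\<^sup>2) * indicator S (\<tau> * x)) \<partial>lborel)"
      by (rule nn_integral_cmult[symmetric]) measurable
    also have "\<dots> \<le> (\<integral>\<^sup>+x. ennreal B * (ennreal (std_normal_density x) * ennreal ((cmod (h (\<tau> * x)))\<^sup>2)) \<partial>lborel)"
    proof (rule nn_integral_mono)
      fix x :: real
      show "ennreal \<tau> * (ennreal ((cmod (h (\<tau> * x)))\<^sup>2) * indicator S (\<tau> * x)) \<le>
          ennreal B * (ennreal (std_normal_density x) * ennreal ((cmod (h (\<tau> * x)))\<^sup>2))"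
      proof (cases "\<tau> * x \<in> S")
        case True
        then have "\<bar>\<tau> * x\<bar> \<le> R" using SR by (auto simp: abs_le_iff)
        then have "(\<tau> * x)\<^sup>2 \<le> R\<^sup>2" by (metis abs_ge_zero power2_abs power_mono)
        then have "x\<^sup>2 / 2 \<le> R\<^sup>2 / (2 * \<tau>\<^sup>2)"
          using \<tau> by (simp add: power_mult_distrib field_simps)
        then have "1 \<le> exp (R\<^sup>2 / (2 * \<tau>\<^sup>2) + - x\<^sup>2 / 2)" by simp
        then have "1 \<le> exp (R\<^sup>2 / (2 * \<tau>\<^sup>2)) * exp (- x\<^sup>2 / 2)" by (simp only: exp_add)
        also have "\<dots> = sqrt (2 * pi) * exp (R\<^sup>2 / (2 * \<tau>\<^sup>2)) * std_normal_density x"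
          by (simp add: std_normal_density_def)
        finally have "\<tau> * 1 \<le> B * std_normal_density x"
          using \<tau> unfolding B_def mult.assoc by (intro mult_left_mono) (auto simp: mult.assoc)
        then have "\<tau> * (cmod (h (\<tau> * x)))\<^sup>2 \<le> B * std_normal_density x * (cmod (h (\<tau> * x)))\<^sup>2"
          by (intro mult_right_mono) auto
        then show ?thesis using True \<tau>
          by (simp add: ennreal_mult[symmetric] B_def mult.assoc ennreal_leI)
      qed simp
    qed
    also have "\<dots> = ennreal B * (\<integral>\<^sup>+x. ennreal ((cmod (h (\<tau> * x)))\<^sup>2) \<partial>?\<gamma>)"
      by (subst nn_integral_density) (auto intro!: nn_integral_cmult)
    also have "(\<integral>\<^sup>+x. ennreal ((cmod (h (\<tau> * x)))\<^sup>2) \<partial>?\<gamma>) = ennreal (LINT x|?\<gamma>. (cmod (h (\<tau> * x)))\<^sup>2)"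
      by (rule nn_integral_eq_integral[OF ih]) auto
    also have "ennreal B * \<dots> \<le> ennreal B * ennreal (sqrt (2 * pi) / \<tau> * ?I)"
      unfolding h_def by (intro mult_left_mono ennreal_leI gaussian_plancherel[OF G G2 \<tau>]) simp
    also have "\<dots> = ennreal (B * (sqrt (2 * pi) / \<tau> * ?I))"
      using \<tau> by (intro ennreal_mult[symmetric]) (auto simp: B_def)
    also have "B * (sqrt (2 * pi) / \<tau> * ?I) = 2 * pi * exp (R\<^sup>2 / (2 * \<tau>\<^sup>2)) * ?I"
      using \<tau> by (simp add: B_def)
    finally show ?thesis .
  qed
  have "((\<lambda>\<tau>. 2 * pi * exp (R\<^sup>2 / (2 * \<tau>\<^sup>2)) * ?I) \<longlongrightarrow> 2 * pi * exp 0 * ?I) at_top"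
  proof (intro tendsto_intros)
    have "filterlim (\<lambda>\<tau>::real. 2 * \<tau>\<^sup>2) at_infinity at_top"
      by (intro filterlim_at_top_imp_at_infinity filterlim_tendsto_pos_mult_at_top[OF tendsto_const]
          filterlim_pow_at_top filterlim_ident) auto
    then show "((\<lambda>\<tau>. R\<^sup>2 / (2 * \<tau>\<^sup>2)) \<longlongrightarrow> 0) at_top"
      by (intro tendsto_divide_0[OF tendsto_const])
  qed
  then have "((\<lambda>\<tau>. ennreal (2 * pi * exp (R\<^sup>2 / (2 * \<tau>\<^sup>2)) * ?I)) \<longlongrightarrow> ennreal (2 * pi * exp 0 * ?I)) at_top"
    by (rule tendsto_ennrealI)
  moreover have "\<forall>\<^sub>F \<tau> in at_top. (\<integral>\<^sup>+E\<in>S. ennreal ((cmod (h E))\<^sup>2) \<partial>lborel) \<le> ennreal (2 * pi * exp (R\<^sup>2 / (2 * \<tau>\<^sup>2)) * ?I)"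
    using eventually_gt_at_top[of 0] by eventually_elim (rule b)
  ultimately have "(\<integral>\<^sup>+E\<in>S. ennreal ((cmod (h E))\<^sup>2) \<partial>lborel) \<le> ennreal (2 * pi * exp 0 * ?I)"
    by (rule tendsto_lowerbound) simp
  then show ?thesis by simp
qed

section \<open>The Hausdorff moment problem\<close>

lemma sum_choose_Suc:
  fixes f :: "nat \<Rightarrow> real"
  shows "(\<Sum>k\<le>Suc N. real (Suc N choose k) * f k) = (\<Sum>k\<le>N. real (N choose k) * (f k + f (Suc k)))"
proof -
  have 1: "(\<Sum>k\<le>Suc N. real (N choose k) * f k) = f 0 + (\<Sum>k\<le>N. real (N choose Suc k) * f (Suc k))"
    by (subst sum.atMost_Suc_shift) simp
  have "(\<Sum>k\<le>Suc N. real (Suc N choose k) * f k) = f 0 + (\<Sum>k\<le>N. real (Suc N choose Suc k) * f (Suc k))"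
    by (subst sum.atMost_Suc_shift) simp
  also have "\<dots> = f 0 + (\<Sum>k\<le>N. real (N choose Suc k) * f (Suc k)) + (\<Sum>k\<le>N. real (N choose k) * f (Suc k))"
    by (simp add: algebra_simps sum.distrib)
  also have "\<dots> = (\<Sum>k\<le>N. real (N choose k) * f k) + (\<Sum>k\<le>N. real (N choose k) * f (Suc k))"
    unfolding 1[symmetric] by (simp add: binomial_eq_0)
  finally show ?thesis by (simp add: algebra_simps sum.distrib)
qed

text \<open>Sampling without and with replacement: the ratio is the product of
  \<open>(k - i) / (N - i)\<close> over \<open>i < m\<close>. Each factor is close to
  \<open>k / N\<close>, and all factors have modulus at most 1.\<close>

lemma choose_ratio_bound:
  assumes "k \<le> N" "2 * m < N"
  shows "\<bar>real (k choose m) / real (N choose m) - (real k / real N) ^ m\<bar> \<le> real m * (real m / (real N - real m))"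
proof -
  let ?a = "\<lambda>i. (real k - real i) / (real N - real i)"
  have N: "real N - real i > 0" if "i < m" for i using that assms by linarith
  have eq: "real (k choose m) / real (N choose m) = (\<Prod>i=0..<m. ?a i)"
    by (simp add: binomial_gbinomial gbinomial_prod_rev prod_dividef)
  have p: "(real k / real N) ^ m = (\<Prod>i=0..<m. real k / real N)" by simp
  have a1: "\<bar>?a i\<bar> \<le> 1" if "i < m" for i
  proof -
    have "\<bar>real k - real i\<bar> \<le> real N - real i" using that assms by linarith
    then show ?thesis using N[OF that] by (simp add: abs_divide)
  qed
  have "\<bar>(\<Prod>i=0..<m. ?a i) - (\<Prod>i=0..<m. real k / real N)\<bar> \<le> (\<Sum>i=0..<m. \<bar>?a i - real k / real N\<bar>)"
    using norm_prod_diff[of "{0..<m}" ?a "\<lambda>_. real k / real N"] a1 assms by simp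
  also have "\<dots> \<le> (\<Sum>i=0..<m. real m / (real N - real m))"
  proof (rule sum_mono)
    fix i assume "i \<in> {0..<m}"
    then have i: "i < m" by simp
    have "?a i - real k / real N = - (real i * ((real N - real k) / real N)) / (real N - real i)"
      using N[OF i] assms by (simp add: field_simps)
    then have "\<bar>?a i - real k / real N\<bar> = real i * ((real N - real k) / real N) / (real N - real i)"
      using N[OF i] assms by (simp add: abs_mult abs_divide)
    also have "\<dots> \<le> real m * 1 / (real N - real m)"
      using N[OF i] i assms by (intro frac_le mult_mono) auto
    finally show "\<bar>?a i - real k / real N\<bar> \<le> real m / (real N - real m)" by simp
  qed
  finally show ?thesis unfolding eq p by simp
qed

lemma weak_conv_integral:
  fixes f :: "real \<Rightarrow> real"
  assumes "\<And>n. real_distribution (\<mu> n)" "real_distribution M" "weak_conv_m \<mu> M"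
    "continuous_on UNIV f" "\<And>x. \<bar>f x\<bar> \<le> B"
  shows "(\<lambda>n. integral\<^sup>L (\<mu> n) f) \<longlonglongrightarrow> integral\<^sup>L M f"
  by (rule weak_conv_imp_integral_bdd_continuous_conv[where B=B])
     (use assms in \<open>auto simp: continuous_on_eq_continuous_at\<close>)

text \<open>The array \<open>lam k l\<close> plays the role of the moments \<open>\<integral> x^k (1 - x)^l\<close>; the measure is obtained as a
  weak limit of the discrete measures carried by the grid \<open>k/N\<close> with the Bernstein weights.\<close>

theorem hausdorff_moments:
  fixes lam :: "nat \<Rightarrow> nat \<Rightarrow> real"
  assumes nonneg: "\<And>k l. lam k l \<ge> 0"
    and rec: "\<And>k l. lam k l = lam (Suc k) l + lam k (Suc l)"
    and one: "lam 0 0 = 1"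
  shows "\<exists>M. real_distribution M \<and> (AE x in M. 0 \<le> x \<and> x \<le> 1) \<and> (\<forall>m. (\<integral>x. x ^ m \<partial>M) = lam m 0)"
proof -
  \<comment> \<open>\<open>N\<close> applications of the recursion, the analogue of inserting
    \<open>(x + (1 - x)) ^ N\<close> into the integral.\<close>
  have S: "(\<Sum>k\<le>N. real (N choose k) * lam (m + k) (l + (N - k))) = lam m l" for N m l
  proof (induction N arbitrary: m l)
    case (Suc N)
    have "(\<Sum>k\<le>Suc N. real (Suc N choose k) * lam (m + k) (l + (Suc N - k))) =
       (\<Sum>k\<le>N. real (N choose k) * (lam (m + k) (l + (Suc N - k)) + lam (m + Suc k) (l + (Suc N - Suc k))))"
      by (rule sum_choose_Suc)
    also have "\<dots> = (\<Sum>k\<le>N. real (N choose k) * lam (m + k) (l + (N - k)))"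
    proof (rule sum.cong)
      fix k assume "k \<in> {..N}"
      then show "real (N choose k) * (lam (m + k) (l + (Suc N - k)) + lam (m + Suc k) (l + (Suc N - Suc k))) =
          real (N choose k) * lam (m + k) (l + (N - k))"
        using rec[of "m + k" "l + (N - k)"] by (simp add: Suc_diff_le)
    qed simp
    finally show ?case using Suc by simp
  qed simp
  define w where "w = (\<lambda>N k. real (N choose k) * lam k (N - k))"
  have w0: "w N k \<ge> 0" for N k using nonneg by (simp add: w_def)
  have w1: "(\<Sum>k\<le>N. w N k) = 1" for N using S[of N 0 0] one by (simp add: w_def)
  \<comment> \<open>The weights reproduce the moments exactly if powers of \<open>k / N\<close> are
    replaced by quotients of binomial coefficients; \<open>choose_ratio_bound\<close> controls the
    difference.\<close>
  have moment: "lam m 0 = (\<Sum>k\<le>N. w N k * (real (k choose m) / real (N choose m)))" if "m \<le> N" for m N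
  proof -
    have "(\<Sum>k\<le>N. w N k * (real (k choose m) / real (N choose m))) =
        (\<Sum>k\<in>{m..N}. w N k * (real (k choose m) / real (N choose m)))"
      by (rule sum.mono_neutral_right) (auto simp: binomial_eq_0)
    also have "\<dots> = (\<Sum>k\<in>{m..N}. real ((N - m) choose (k - m)) * lam k (N - k))"
    proof (rule sum.cong)
      fix k assume k: "k \<in> {m..N}"
      then have "real (N choose k) * real (k choose m) = real (N choose m) * real ((N - m) choose (k - m))"
        using choose_mult[of m k N] by (metis atLeastAtMost_iff of_nat_mult)
      moreover have "real (N choose m) \<noteq> 0" using that by simp
      ultimately have "real (N choose k) * (real (k choose m) / real (N choose m)) = real ((N - m) choose (k - m))"
        by (simp add: field_simps)
      then show "w N k * (real (k choose m) / real (N choose m)) = real ((N - m) choose (k - m)) * lam k (N - k)"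
        unfolding w_def by (metis mult.assoc mult.commute)
    qed simp
    also have "\<dots> = (\<Sum>j\<le>N - m. real ((N - m) choose j) * lam (m + j) (0 + (N - m - j)))"
      by (rule sum.reindex_bij_witness[where i="\<lambda>j. m + j" and j="\<lambda>k. k - m"]) (use that in auto)
    also have "\<dots> = lam m 0" by (rule S)
    finally show ?thesis ..
  qed
  define \<mu> where "\<mu> = (\<lambda>N. distr (point_measure {..N} (\<lambda>k. ennreal (w N k))) borel (\<lambda>k. real k / real N))"
  have integral: "(\<integral>x. f x \<partial>\<mu> N) = (\<Sum>k\<le>N. w N k * f (real k / real N))"
    if "continuous_on UNIV f" for f :: "real \<Rightarrow> real" and N
  proof -
    have [measurable]: "f \<in> borel_measurable borel" using that by (rule borel_measurable_continuous_onI)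
    show ?thesis
      unfolding \<mu>_def by (subst integral_distr) (auto simp: lebesgue_integral_point_measure_finite w0)
  qed
  have dist: "real_distribution (\<mu> N)" for N
  proof -
    have "prob_space (point_measure {..N} (\<lambda>k. ennreal (w N k)))"
      by (rule prob_spaceI)
         (simp add: space_point_measure emeasure_point_measure_finite w0 w1 flip: sum_ennreal, simp add: w0 w1)
    then interpret prob_space "point_measure {..N} (\<lambda>k. ennreal (w N k))" .
    have "prob_space (\<mu> N)" unfolding \<mu>_def by (rule prob_space_distr) simp
    then show ?thesis
      unfolding real_distribution_def real_distribution_axioms_def by (simp add: \<mu>_def)
  qed
  have supp: "AE x in \<mu> N. x \<in> {0..1}" for N
  proof -
    have "AE k in point_measure {..N} (\<lambda>k. ennreal (w N k)). real k / real N \<in> {0..1}"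
      by (rule AE_I2) (auto simp: space_point_measure divide_le_eq_1)
    then show ?thesis
      unfolding \<mu>_def by (subst AE_distr_iff) auto
  qed
  have "tight \<mu>"
    unfolding tight_def
  proof (intro conjI allI impI dist)
    fix e :: real assume "e > 0"
    have "measure (\<mu> n) {-1<..1} = 1" for n
    proof -
      interpret real_distribution "\<mu> n" by (rule dist)
      have "AE x in \<mu> n. x \<in> {-1<..1}" using supp[of n] by eventually_elim auto
      then show ?thesis by (subst prob_eq_1) auto
    qed
    then show "\<exists>a b. a < b \<and> (\<forall>n. 1 - e < measure (\<mu> n) {a<..b})"
      using \<open>e > 0\<close> by (intro exI[of _ "-1"] exI[of _ 1]) auto
  qed
  then obtain r M where r: "strict_mono (r :: nat \<Rightarrow> nat)" and M: "real_distribution M" "weak_conv_m (\<mu> \<circ> id \<circ> r) M"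
    using tight_imp_convergent_subsubsequence[of \<mu> id] strict_mono_id by auto
  interpret M: real_distribution M by (rule M(1))
  have lim: "(\<lambda>n. integral\<^sup>L (\<mu> (r n)) f) \<longlonglongrightarrow> integral\<^sup>L M f" if "continuous_on UNIV f" "\<And>x. \<bar>f x\<bar> \<le> B" for f :: "real \<Rightarrow> real" and B
    using weak_conv_integral[OF _ M that] dist by (simp add: o_def)
  \<comment> \<open>Clamping to the unit interval makes the powers bounded continuous test functions
    without changing them on the grid.\<close>
  define c where "c = (\<lambda>x::real. max 0 (min 1 x))"
  have c: "continuous_on UNIV c" "\<And>x. 0 \<le> c x" "\<And>x. c x \<le> 1" "\<And>x. 0 \<le> x \<Longrightarrow> x \<le> 1 \<Longrightarrow> c x = x"
    by (auto simp: c_def intro!: continuous_intros)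
  have grid: "0 \<le> real k / real N" "real k / real N \<le> 1" if "k \<le> N" for k N
    using that by (auto simp: divide_le_eq_1)
  have AEc: "AE x in M. 0 \<le> x \<and> x \<le> 1"
  proof -
    \<comment> \<open>A bounded continuous function that vanishes exactly on the unit interval,
      hence integrates to 0 over every grid measure.\<close>
    let ?g = "\<lambda>x. min 1 \<bar>x - c x\<bar>"
    have gc: "continuous_on UNIV ?g" by (intro continuous_intros c)
    have [measurable]: "?g \<in> borel_measurable borel" using gc by (rule borel_measurable_continuous_onI)
    have "integral\<^sup>L (\<mu> N) ?g = 0" for N
      unfolding integral[OF gc] by (rule sum.neutral) (auto simp: c grid)
    then have "integral\<^sup>L M ?g = 0"
      using lim[OF gc, of 1] by (simp add: LIMSEQ_const_iff)
    moreover have "integrable M ?g"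
      by (rule M.integrable_const_bound[where B=1]) auto
    ultimately have "AE x in M. ?g x = 0"
      by (subst (asm) integral_nonneg_eq_0_iff_AE) auto
    then show ?thesis by eventually_elim (auto simp: c_def min_def max_def split: if_splits)
  qed
  have "(\<integral>x. x ^ m \<partial>M) = lam m 0" for m
  proof -
    have fc: "continuous_on UNIV (\<lambda>x. c x ^ m)" by (intro continuous_intros c)
    have [measurable]: "c \<in> borel_measurable borel" using c(1) by (rule borel_measurable_continuous_onI)
    have "(\<integral>x. x ^ m \<partial>M) = (\<integral>x. c x ^ m \<partial>M)"
    proof (rule integral_cong_AE)
      show "AE x in M. x ^ m = c x ^ m" using AEc by eventually_elim (simp add: c)
    qed auto
    moreover have "(\<lambda>n. integral\<^sup>L (\<mu> (r n)) (\<lambda>x. c x ^ m)) \<longlonglongrightarrow> integral\<^sup>L M (\<lambda>x. c x ^ m)"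
      by (rule lim[OF fc, of 1]) (auto simp: c power_le_one)
    moreover have "(\<lambda>N. integral\<^sup>L (\<mu> N) (\<lambda>x. c x ^ m)) \<longlonglongrightarrow> lam m 0"
    proof (rule LIM_zero_cancel, rule Lim_null_comparison)
      show "\<forall>\<^sub>F N in sequentially. norm (integral\<^sup>L (\<mu> N) (\<lambda>x. c x ^ m) - lam m 0) \<le> real m * (real m / (real N - real m))"
        using eventually_gt_at_top[of "2 * m"]
      proof eventually_elim
        case (elim N)
        have "integral\<^sup>L (\<mu> N) (\<lambda>x. c x ^ m) - lam m 0 =
            (\<Sum>k\<le>N. w N k * ((real k / real N) ^ m - real (k choose m) / real (N choose m)))"
          using moment[of m N] elim unfolding integral[OF fc]
          by (simp add: c grid sum_subtractf right_diff_distrib)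
        also have "\<bar>\<dots>\<bar> \<le> (\<Sum>k\<le>N. w N k * (real m * (real m / (real N - real m))))"
        proof (rule order_trans[OF sum_abs], rule sum_mono)
          fix k assume "k \<in> {..N}"
          then have "\<bar>(real k / real N) ^ m - real (k choose m) / real (N choose m)\<bar> \<le> real m * (real m / (real N - real m))"
            using choose_ratio_bound[OF _ elim, of k] by (simp only: abs_minus_commute atMost_iff)
          then show "\<bar>w N k * ((real k / real N) ^ m - real (k choose m) / real (N choose m))\<bar> \<le> w N k * (real m * (real m / (real N - real m)))"
            unfolding abs_mult abs_of_nonneg[OF w0] by (rule mult_left_mono) (rule w0)
        qed
        also have "\<dots> = real m * (real m / (real N - real m))"
          unfolding sum_distrib_right[symmetric] w1 by simp
        finally show ?case by simp
      qed
      have "filterlim (\<lambda>N. real N - real m) at_top sequentially"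
        unfolding diff_conv_add_uminus add.commute[of _ "- real m"]
        by (rule filterlim_tendsto_add_at_top[OF tendsto_const filterlim_real_sequentially])
      then show "(\<lambda>N. real m * (real m / (real N - real m))) \<longlonglongrightarrow> 0"
        by (intro tendsto_mult_right_zero tendsto_divide_0[OF tendsto_const] filterlim_at_top_imp_at_infinity)
    qed
    then have "(\<lambda>n. integral\<^sup>L (\<mu> (r n)) (\<lambda>x. c x ^ m)) \<longlonglongrightarrow> lam m 0"
      using LIMSEQ_subseq_LIMSEQ[OF _ r] by (auto simp: o_def)
    ultimately show ?thesis using LIMSEQ_unique by metis
  qed
  then show ?thesis using M AEc by blast
qed

section \<open>Stieltjes transforms\<close>

lemma poisson_integral:
  fixes a b x e :: real assumes "a \<le> b" "e > 0"
  shows "(\<integral>\<^sup>+E. ennreal (e / ((x - E)\<^sup>2 + e\<^sup>2)) * indicator {a..b} E \<partial>lborel) =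
    ennreal (arctan ((b - x) / e) - arctan ((a - x) / e))"
proof (rule nn_integral_FTC_Icc)
  fix E :: real
  have eq: "e\<^sup>2 * (1 + ((E - x) / e)\<^sup>2) = (x - E)\<^sup>2 + e\<^sup>2"
    using assms(2) by (simp add: distrib_left power_divide power2_commute[of x])
  have e0: "e \<noteq> 0" using assms(2) by simp
  have "e / (e\<^sup>2 * D) = inverse D * (1 / e)" for D :: real
    using e0 by (simp add: power2_eq_square divide_inverse)
  from this[of "1 + ((E - x) / e)\<^sup>2"] have "inverse (1 + ((E - x) / e)\<^sup>2) * (1 / e) = e / ((x - E)\<^sup>2 + e\<^sup>2)"
    by (simp only: eq)
  then show "((\<lambda>E. arctan ((E - x) / e)) has_real_derivative e / ((x - E)\<^sup>2 + e\<^sup>2)) (at E)"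
    using e0 by (auto intro!: derivative_eq_intros)
qed (use assms in auto)

lemma Im_stieltjes:
  fixes x :: real
  shows "Im (1 / (complex_of_real x - Complex E e)) = e / ((x - E)\<^sup>2 + e\<^sup>2)"
  by (simp add: Im_divide)

lemma norm_stieltjes:
  fixes x :: real assumes "Im z > 0"
  shows "cmod (1 / (complex_of_real x - z)) \<le> 1 / Im z"
proof -
  have "Im z \<le> cmod (complex_of_real x - z)"
    using abs_Im_le_cmod[of "complex_of_real x - z"] assms by simp
  then show ?thesis using assms by (simp add: norm_divide frac_le)
qed

lemma stieltjes_integrable:
  assumes "finite_measure M" "sets M = sets borel" "Im z > 0"
  shows "integrable M (\<lambda>x. 1 / (complex_of_real x - z))"
proof -
  interpret finite_measure M by fact
  show ?thesis
    by (rule integrable_const_bound[where B="1 / Im z"])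
       (use assms(2) norm_stieltjes[OF assms(3)] in \<open>auto simp: measurable_cong_sets[OF assms(2) refl]\<close>)
qed

definition stieltjes :: "real measure \<Rightarrow> complex \<Rightarrow> complex" where
  "stieltjes M z = (\<integral>x. 1 / (complex_of_real x - z) \<partial>M)"

lemma Im_stieltjes_transform:
  assumes "finite_measure M" "sets M = sets borel" "e > 0"
  shows "ennreal (Im (stieltjes M (Complex E e))) = (\<integral>\<^sup>+x. ennreal (e / ((x - E)\<^sup>2 + e\<^sup>2)) \<partial>M)"
proof -
  have i: "integrable M (\<lambda>x. 1 / (complex_of_real x - Complex E e))"
    by (rule stieltjes_integrable) (use assms in auto)
  have "Im (stieltjes M (Complex E e)) = (\<integral>x. e / ((x - E)\<^sup>2 + e\<^sup>2) \<partial>M)"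
    unfolding stieltjes_def by (subst integral_Im[symmetric, OF i]) (simp only: Im_stieltjes)
  moreover have "integrable M (\<lambda>x. e / ((x - E)\<^sup>2 + e\<^sup>2))"
    using integrable_Im[OF i] by (simp only: Im_stieltjes)
  ultimately show ?thesis
    using assms(3) by (simp add: nn_integral_eq_integral)
qed

lemma stieltjes_window:
  assumes M: "finite_measure M" "sets M = sets borel" and "e > 0" and [measurable]: "S \<in> sets borel"
  shows "(\<integral>\<^sup>+E\<in>S. ennreal (Im (stieltjes M (Complex E e))) \<partial>lborel) =
    (\<integral>\<^sup>+x. (\<integral>\<^sup>+E\<in>S. ennreal (e / ((x - E)\<^sup>2 + e\<^sup>2)) \<partial>lborel) \<partial>M)"
proof -
  interpret finite_measure M by fact
  interpret pair_sigma_finite lborel M ..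
  note [measurable_cong] = M(2)
  have "(\<integral>\<^sup>+E\<in>S. ennreal (Im (stieltjes M (Complex E e))) \<partial>lborel) =
    (\<integral>\<^sup>+E. (\<integral>\<^sup>+x. ennreal (e / ((x - E)\<^sup>2 + e\<^sup>2)) * indicator S E \<partial>M) \<partial>lborel)"
    unfolding Im_stieltjes_transform[OF M \<open>e > 0\<close>] by (subst nn_integral_multc) auto
  also have "\<dots> = (\<integral>\<^sup>+x. (\<integral>\<^sup>+E\<in>S. ennreal (e / ((x - E)\<^sup>2 + e\<^sup>2)) \<partial>lborel) \<partial>M)"
    by (rule Fubini'[symmetric]) measurable
  finally show ?thesis .
qed

text \<open>The window of half width \<open>e\<close> carries half of the total mass
  \<open>pi\<close> of the Poisson kernel, since
  \<open>arctan 1 - arctan (- 1) = pi / 2\<close>.\<close>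

lemma poisson_window_ge:
  assumes "e > 0" "{x - e..x + e} \<subseteq> S"
  shows "ennreal (pi / 2) \<le> (\<integral>\<^sup>+E\<in>S. ennreal (e / ((x - E)\<^sup>2 + e\<^sup>2)) \<partial>lborel)"
proof -
  have "ennreal (pi / 2) = (\<integral>\<^sup>+E. ennreal (e / ((x - E)\<^sup>2 + e\<^sup>2)) * indicator {x - e..x + e} E \<partial>lborel)"
    using assms(1) by (subst poisson_integral) (auto simp: arctan_minus arctan_one)
  also have "\<dots> \<le> (\<integral>\<^sup>+E\<in>S. ennreal (e / ((x - E)\<^sup>2 + e\<^sup>2)) \<partial>lborel)"
    by (rule nn_integral_mono) (use assms(2) in \<open>auto simp: indicator_def\<close>)
  finally show ?thesis .
qed

lemma arctan_scaled_tendsto: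
  fixes y :: real
  shows "(\<lambda>n. arctan (y * real (Suc n))) \<longlonglongrightarrow> (pi / 2) * sgn y"
proof -
  have s: "filterlim (\<lambda>n. real (Suc n)) at_top sequentially"
    using filterlim_compose[OF filterlim_real_sequentially filterlim_Suc] .
  consider "y > 0" | "y < 0" | "y = 0" by linarith
  then show ?thesis
  proof cases
    case 1
    have "filterlim (\<lambda>n. y * real (Suc n)) at_top sequentially"
      by (rule filterlim_tendsto_pos_mult_at_top[OF tendsto_const 1 s])
    then show ?thesis using 1 filterlim_compose[OF tendsto_arctan_at_top] by fastforce
  next
    case 2
    have "filterlim (\<lambda>n. y * real (Suc n)) at_bot sequentially"
      by (rule filterlim_tendsto_neg_mult_at_bot[OF tendsto_const 2 s])
    then show ?thesis using 2 filterlim_compose[OF tendsto_arctan_at_bot] by fastforce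
  qed simp
qed

text \<open>The integrated Poisson kernel tends to \<open>pi\<close> inside the interval, to 0
  outside and to \<open>pi / 2\<close> at the end points; the sign functions express these three
  values.\<close>

lemma stieltjes_inversion:
  assumes M: "finite_measure M" "sets M = sets borel" and "a < b"
  shows "(\<lambda>n. enn2real (\<integral>\<^sup>+E\<in>{a..b}. ennreal (Im (stieltjes M (Complex E (1 / real (Suc n))))) \<partial>lborel))
     \<longlonglongrightarrow> (\<integral>x. (pi / 2) * (sgn (b - x) - sgn (a - x)) \<partial>M)"
proof -
  interpret finite_measure M by fact
  note [measurable_cong] = M(2)
  let ?g = "\<lambda>n x. arctan ((b - x) * real (Suc n)) - arctan ((a - x) * real (Suc n))"
  have g0: "?g n x \<ge> 0" for n x using assms(3) by (simp add: arctan_le_iff mult_right_mono)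
  have gb: "\<bar>?g n x\<bar> \<le> 2 * pi" for n x
    using arctan_bounded[of "(b - x) * real (Suc n)"] arctan_bounded[of "(a - x) * real (Suc n)"] pi_gt_zero by linarith
  have ig: "integrable M (?g n)" for n
    by (rule integrable_const_bound[where B="2 * pi"]) (use gb in auto)
  have "enn2real (\<integral>\<^sup>+E\<in>{a..b}. ennreal (Im (stieltjes M (Complex E (1 / real (Suc n))))) \<partial>lborel) = (\<integral>x. ?g n x \<partial>M)" for n
  proof -
    have pos: "0 < 1 / real (Suc n)" by simp
    have "(\<integral>\<^sup>+E\<in>{a..b}. ennreal (Im (stieltjes M (Complex E (1 / real (Suc n))))) \<partial>lborel) =
        (\<integral>\<^sup>+x. (\<integral>\<^sup>+E\<in>{a..b}. ennreal ((1 / real (Suc n)) / ((x - E)\<^sup>2 + (1 / real (Suc n))\<^sup>2)) \<partial>lborel) \<partial>M)"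
      by (rule stieltjes_window[OF M pos]) simp
    also have "\<dots> = (\<integral>\<^sup>+x. ennreal (?g n x) \<partial>M)"
    proof (rule nn_integral_cong)
      fix x
      show "(\<integral>\<^sup>+E\<in>{a..b}. ennreal ((1 / real (Suc n)) / ((x - E)\<^sup>2 + (1 / real (Suc n))\<^sup>2)) \<partial>lborel) = ennreal (?g n x)"
        using poisson_integral[OF less_imp_le[OF assms(3)] pos, of x] by (simp del: of_nat_Suc)
    qed
    also have "\<dots> = ennreal (\<integral>x. ?g n x \<partial>M)"
      by (rule nn_integral_eq_integral[OF ig]) (rule AE_I2, rule g0)
    finally have *: "(\<integral>\<^sup>+E\<in>{a..b}. ennreal (Im (stieltjes M (Complex E (1 / real (Suc n))))) \<partial>lborel) = ennreal (\<integral>x. ?g n x \<partial>M)" .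
    show ?thesis
      unfolding * by (rule enn2real_ennreal) (rule Bochner_Integration.integral_nonneg, rule g0)
  qed
  moreover have "(\<lambda>n. \<integral>x. ?g n x \<partial>M) \<longlonglongrightarrow> (\<integral>x. (pi / 2) * (sgn (b - x) - sgn (a - x)) \<partial>M)"
  proof (rule integral_dominated_convergence[where w="\<lambda>_. 2 * pi"])
    show "AE x in M. (\<lambda>n. ?g n x) \<longlonglongrightarrow> (pi / 2) * (sgn (b - x) - sgn (a - x))"
      unfolding right_diff_distrib by (intro AE_I2 tendsto_diff arctan_scaled_tendsto)
    show "AE x in M. norm (?g n x) \<le> 2 * pi" for n using gb by simp
  qed auto
  ultimately show ?thesis by simp
qed

text \<open>Intervals exhausting an open half line make the half weights at the end points disappear
  in the limit, and half lines determine the measure. This uniqueness evaluates the definite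
  description of \<open>spectral_measure\<close>.\<close>

lemma stieltjes_unique:
  assumes M: "finite_measure M" "sets M = sets borel" and N: "finite_measure N" "sets N = sets borel"
    and eq: "\<And>z. Im z > 0 \<Longrightarrow> stieltjes M z = stieltjes N z"
  shows "M = N"
proof (rule measure_eqI_lessThan)
  have 1: "(\<integral>x. (pi / 2) * (sgn (b - x) - sgn (a - x)) \<partial>M) = (\<integral>x. (pi / 2) * (sgn (b - x) - sgn (a - x)) \<partial>N)" if "a < b" for a b
  proof (rule LIMSEQ_unique[OF stieltjes_inversion[OF M that]])
    have "Im (Complex E (1 / real (Suc n))) > 0" for E n by simp
    from eq[OF this] show "(\<lambda>n. enn2real (\<integral>\<^sup>+E\<in>{a..b}. ennreal (Im (stieltjes M (Complex E (1 / real (Suc n))))) \<partial>lborel))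
       \<longlonglongrightarrow> (\<integral>x. (pi / 2) * (sgn (b - x) - sgn (a - x)) \<partial>N)"
      using stieltjes_inversion[OF N that] by simp
  qed
  \<comment> \<open>The left end uses \<open>Suc (Suc n)\<close> so that it is strictly below the
    right end already for \<open>n = 0\<close>.\<close>
  have lim: "(\<lambda>n. \<integral>x. (pi / 2) * (sgn (a + real (Suc n) - x) - sgn (a + 1 / real (Suc (Suc n)) - x)) \<partial>L) \<longlonglongrightarrow> (\<integral>x. pi * indicator {a<..} x \<partial>L)"
    if L: "finite_measure L" "sets L = sets borel" for L a
  proof -
    interpret finite_measure L by fact
    note [measurable_cong] = L(2)
    show ?thesis
    proof (rule integral_dominated_convergence[where w="\<lambda>_. 2 * pi"])
      show "AE x in L. (\<lambda>n. (pi / 2) * (sgn (a + real (Suc n) - x) - sgn (a + 1 / real (Suc (Suc n)) - x))) \<longlonglongrightarrow> pi * indicator {a<..} x"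
      proof (rule AE_I2)
        fix x
        have A: "\<forall>\<^sub>F n in sequentially. real (Suc n) > x - a"
          using eventually_gt_at_top[of "nat \<lceil>\<bar>x - a\<bar>\<rceil>"] by eventually_elim linarith
        show "(\<lambda>n. (pi / 2) * (sgn (a + real (Suc n) - x) - sgn (a + 1 / real (Suc (Suc n)) - x))) \<longlonglongrightarrow> pi * indicator {a<..} x"
        proof (rule tendsto_eventually)
          show "\<forall>\<^sub>F n in sequentially. (pi / 2) * (sgn (a + real (Suc n) - x) - sgn (a + 1 / real (Suc (Suc n)) - x)) = pi * indicator {a<..} x"
          proof (cases "a < x")
            case True
            then obtain m where m: "1 / real (Suc m) < x - a"
              using reals_Archimedean[of "x - a"] by (auto simp: inverse_eq_divide)
            show ?thesis using A eventually_ge_at_top[of m]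
            proof eventually_elim
              case (elim n)
              have "1 / real (Suc (Suc n)) \<le> 1 / real (Suc m)" using elim by (intro divide_left_mono) auto
              then show ?case using elim m True by (simp add: sgn_if)
            qed
          next
            case False
            show ?thesis using A
            proof eventually_elim
              case (elim n)
              have "1 / real (Suc (Suc n)) > 0" by simp
              then have "a + 1 / real (Suc (Suc n)) - x > 0" using False by linarith
              then show ?case using elim False by (simp add: sgn_if)
            qed
          qed
        qed
      qed
      show "AE x in L. norm ((pi / 2) * (sgn (a + real (Suc n) - x) - sgn (a + 1 / real (Suc (Suc n)) - x))) \<le> 2 * pi" for n
        by (rule AE_I2) (auto simp: sgn_if)
    qed auto
  qed
  have "(\<integral>x. pi * indicator {a<..} x \<partial>M) = (\<integral>x. pi * indicator {a<..} x \<partial>N)" for a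
  proof (rule LIMSEQ_unique[OF lim[OF M]])
    have "a + 1 / real (Suc (Suc n)) < a + real (Suc n)" for n
    proof -
      have "1 / real (Suc (Suc n)) < 1" by simp
      moreover have "1 \<le> real (Suc n)" by simp
      ultimately show ?thesis by linarith
    qed
    from 1[OF this] show "(\<lambda>n. \<integral>x. (pi / 2) * (sgn (a + real (Suc n) - x) - sgn (a + 1 / real (Suc (Suc n)) - x)) \<partial>M) \<longlonglongrightarrow> (\<integral>x. pi * indicator {a<..} x \<partial>N)"
      using lim[OF N, of a] by simp
  qed
  then have "measure M {a<..} = measure N {a<..}" for a
    using M(2) N(2) by simp
  then show "emeasure M {a<..} = emeasure N {a<..}" for a
    using finite_measure.emeasure_eq_measure[OF M(1)] finite_measure.emeasure_eq_measure[OF N(1)] by simp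
  show "emeasure M {x<..} < \<infinity>" for x
    using finite_measure.emeasure_finite[OF M(1)] by (simp add: less_top)
qed (use assms in auto)

section \<open>From polynomials to measures of Borel sets\<close>

lemma poly_approx:
  fixes g :: "real \<Rightarrow> real"
  assumes "continuous_on UNIV g"
  shows "\<exists>a n. \<forall>i. \<forall>x. \<bar>x\<bar> \<le> R \<longrightarrow> \<bar>g x - (\<Sum>j\<le>n i. a i j * x ^ j)\<bar> < 1 / real (Suc i)"
proof -
  have "\<exists>a n. \<forall>x. \<bar>x\<bar> \<le> R \<longrightarrow> \<bar>g x - (\<Sum>j\<le>n. a j * x ^ j)\<bar> < 1 / real (Suc i)" for i :: nat
  proof -
    obtain p where p: "real_polynomial_function p" "\<And>x. x \<in> {-R..R} \<Longrightarrow> \<bar>g x - p x\<bar> < 1 / real (Suc i)"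
      by (rule Stone_Weierstrass_real_polynomial_function[of "{-R..R}" g "1 / real (Suc i)"])
         (use assms in \<open>auto intro: continuous_on_subset\<close>)
    then obtain a n where "p = (\<lambda>x. \<Sum>j\<le>n. a j * x ^ j)"
      unfolding real_polynomial_function_iff_sum by blast
    then show ?thesis using p(2) by (intro exI[of _ a] exI[of _ n]) (auto simp: abs_le_iff)
  qed
  then show ?thesis by metis
qed

lemma bounded_power_integrable:
  assumes "prob_space M" "sets M = sets borel" "AE x in M. \<bar>x\<bar> \<le> R"
  shows "integrable M (\<lambda>x. x ^ k :: real)"
proof -
  interpret prob_space M by fact
  note [measurable_cong] = assms(2)
  show ?thesis
  proof (rule integrable_const_bound[where B="R ^ k"])
    show "AE x in M. norm (x ^ k) \<le> R ^ k"
      using assms(3) by eventually_elim (simp add: power_abs power_mono)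
  qed measurable
qed

lemma poly_integral:
  assumes "prob_space M" "sets M = sets borel" "AE x in M. \<bar>x\<bar> \<le> R"
  shows "integrable M (\<lambda>x. \<Sum>j\<le>n. a j * x ^ j :: real)"
    and "(\<integral>x. (\<Sum>j\<le>n. a j * x ^ j :: real) \<partial>M) = (\<Sum>j\<le>n. a j * (\<integral>x. x ^ j \<partial>M))"
  using bounded_power_integrable[OF assms] by auto

lemma continuous_integral_limit:
  fixes g :: "real \<Rightarrow> real" and M :: "real measure"
  assumes M: "prob_space M" "sets M = sets borel" "AE x in M. \<bar>x\<bar> \<le> R"
    and g: "continuous_on UNIV g"
    and f: "\<And>i. f i \<in> borel_measurable borel" "\<And>i x. \<bar>x\<bar> \<le> R \<Longrightarrow> \<bar>g x - f i x\<bar> < 1 / real (Suc i)"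
  shows "(\<lambda>i. \<integral>x. f i x \<partial>M) \<longlonglongrightarrow> (\<integral>x. g x \<partial>M)"
    and "(\<lambda>i. \<integral>x. (f i x)\<^sup>2 \<partial>M) \<longlonglongrightarrow> (\<integral>x. (g x)\<^sup>2 \<partial>M)"
proof -
  interpret prob_space M by fact
  note [measurable_cong] = M(2)
  note [measurable] = f(1) borel_measurable_continuous_onI[OF g]
  have "compact (g ` {-R..R})"
    by (rule compact_continuous_image) (use g in \<open>auto intro: continuous_on_subset\<close>)
  then obtain B where "\<And>x. x \<in> {-R..R} \<Longrightarrow> \<bar>g x\<bar> \<le> B"
    using compact_imp_bounded bounded_iff by (metis image_eqI real_norm_def)
  then have B: "\<bar>g x\<bar> \<le> B" if "\<bar>x\<bar> \<le> R" for x using that by (auto simp: abs_le_iff)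
  have fB: "\<bar>f i x\<bar> \<le> B + 1" if "\<bar>x\<bar> \<le> R" for i x
  proof -
    have "1 / real (Suc i) \<le> 1" by simp
    then show ?thesis using f(2)[OF that, of i] B[OF that] by linarith
  qed
  have conv: "(\<lambda>i. f i x) \<longlonglongrightarrow> g x" if "\<bar>x\<bar> \<le> R" for x
  proof (rule LIM_zero_cancel, rule Lim_null_comparison)
    show "\<forall>\<^sub>F i in sequentially. norm (f i x - g x) \<le> 1 / real (Suc i)"
      using f(2)[OF that] by (auto simp: abs_minus_commute less_imp_le)
    show "(\<lambda>i. 1 / real (Suc i)) \<longlonglongrightarrow> 0"
      using LIMSEQ_inverse_real_of_nat by (simp add: inverse_eq_divide)
  qed
  show "(\<lambda>i. \<integral>x. f i x \<partial>M) \<longlonglongrightarrow> (\<integral>x. g x \<partial>M)"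
  proof (rule integral_dominated_convergence[where w="\<lambda>_. B + 1"])
    show "AE x in M. (\<lambda>i. f i x) \<longlonglongrightarrow> g x"
      using M(3) by eventually_elim (rule conv)
    show "AE x in M. norm (f i x) \<le> B + 1" for i
      using M(3) by eventually_elim (simp add: fB)
  qed auto
  show "(\<lambda>i. \<integral>x. (f i x)\<^sup>2 \<partial>M) \<longlonglongrightarrow> (\<integral>x. (g x)\<^sup>2 \<partial>M)"
  proof (rule integral_dominated_convergence[where w="\<lambda>_. (B + 1)\<^sup>2"])
    show "AE x in M. (\<lambda>i. (f i x)\<^sup>2) \<longlonglongrightarrow> (g x)\<^sup>2"
      using M(3) by eventually_elim (intro tendsto_power conv)
    show "AE x in M. norm ((f i x)\<^sup>2) \<le> (B + 1)\<^sup>2" for i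
      using M(3)
    proof eventually_elim
      case (elim x)
      have "\<bar>f i x\<bar>\<^sup>2 \<le> (B + 1)\<^sup>2" by (intro power_mono fB elim) auto
      then show ?case by simp
    qed
  qed auto
qed

text \<open>Measurability passes from powers to polynomials, by Weierstrass to continuous functions,
  then to half lines and by a Dynkin argument to all Borel sets. It is applied to the spectral
  measure as a function of the phase.\<close>

lemma measure_measurable_of_moments:
  fixes M :: "'t \<Rightarrow> real measure"
  assumes M: "\<And>t. prob_space (M t)" "\<And>t. sets (M t) = sets borel" "\<And>t. AE x in M t. \<bar>x\<bar> \<le> R"
    and mom: "\<And>k. (\<lambda>t. \<integral>x. x ^ k \<partial>M t) \<in> borel_measurable P"
    and U: "U \<in> sets borel"
  shows "(\<lambda>t. measure (M t) U) \<in> borel_measurable P"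
proof -
  have cont: "(\<lambda>t. \<integral>x. g x \<partial>M t) \<in> borel_measurable P" if g: "continuous_on UNIV g" for g :: "real \<Rightarrow> real"
  proof -
    obtain a n where an: "\<And>i x. \<bar>x\<bar> \<le> R \<Longrightarrow> \<bar>g x - (\<Sum>j\<le>n i. a i j * x ^ j)\<bar> < 1 / real (Suc i)"
      using poly_approx[OF g, of R] by blast
    show ?thesis
    proof (rule borel_measurable_LIMSEQ_real)
      show "(\<lambda>i. \<integral>x. (\<Sum>j\<le>n i. a i j * x ^ j) \<partial>M t) \<longlonglongrightarrow> (\<integral>x. g x \<partial>M t)" for t
        by (rule continuous_integral_limit(1)[OF M g _ an]) auto
      show "(\<lambda>t. \<integral>x. (\<Sum>j\<le>n i. a i j * x ^ j) \<partial>M t) \<in> borel_measurable P" for i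
        unfolding poly_integral(2)[OF M] by (intro borel_measurable_sum borel_measurable_times borel_measurable_const mom)
    qed
  qed
  have U': "U \<in> sigma_sets UNIV (range (\<lambda>a::real. {..a}))"
    using U unfolding borel_eq_atMost by simp
  have sigma_eq: "sigma_sets UNIV (range (\<lambda>a::real. {..a})) = sets borel"
    unfolding borel_eq_atMost by simp
  have "Int_stable (range (\<lambda>a::real. {..a}))"
    by (auto simp: Int_stable_def)
  moreover have "range (\<lambda>a::real. {..a}) \<subseteq> Pow UNIV" by simp
  ultimately show ?thesis using U'
  proof (induction rule: sigma_sets_induct_disjoint)
    case (basic A)
    then obtain b where A: "A = {..b}" by auto
    \<comment> \<open>Continuous functions decreasing to the indicator of the half line.\<close>
    let ?g = "\<lambda>n x. max 0 (min 1 (1 - real n * (x - b)))"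
    show ?case
    proof (rule borel_measurable_LIMSEQ_real)
      fix t
      interpret prob_space "M t" by (rule M)
      note [measurable_cong] = M(2)[of t]
      have "(\<lambda>n. \<integral>x. ?g n x \<partial>M t) \<longlonglongrightarrow> (\<integral>x. indicator A x \<partial>M t)"
      proof (rule integral_dominated_convergence[where w="\<lambda>_. 1"])
        show "AE x in M t. (\<lambda>n. ?g n x) \<longlonglongrightarrow> indicator A x"
        proof (rule AE_I2, rule tendsto_eventually)
          fix x
          show "\<forall>\<^sub>F n in sequentially. ?g n x = indicator A x"
          proof (cases "x \<le> b")
            case True
            then have "?g n x = 1" for n by (simp add: mult_nonneg_nonpos)
            then show ?thesis using True A by simp
          next
            case False
            have "\<forall>\<^sub>F n in sequentially. real n \<ge> 1 / (x - b)"
              using eventually_ge_at_top[of "nat \<lceil>1 / (x - b)\<rceil>"] by eventually_elim linarith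
            then show ?thesis
            proof eventually_elim
              case (elim n)
              then have "real n * (x - b) \<ge> 1" using False by (simp add: field_simps)
              then show ?case using False A by simp
            qed
          qed
        qed
      qed (use A in auto)
      moreover have "A \<in> sets (M t)" using A M(2) by simp
      ultimately show "(\<lambda>n. \<integral>x. ?g n x \<partial>M t) \<longlonglongrightarrow> measure (M t) A" by simp
    next
      show "(\<lambda>t. \<integral>x. ?g n x \<partial>M t) \<in> borel_measurable P" for n
        by (rule cont) (intro continuous_intros)
    qed
  next
    case empty
    show ?case by simp
  next
    case (compl A)
    have "measure (M t) (UNIV - A) = 1 - measure (M t) A" for t
      using prob_space.prob_compl[OF M(1), of A t] compl(1) sigma_eq M(2) sets_eq_imp_space_eq[OF M(2)[of t]] by simp
    then show ?case using compl(2) by simp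
  next
    case (union A)
    have "(\<lambda>i. measure (M t) (A i)) sums measure (M t) (\<Union>i. A i)" for t
      using finite_measure.finite_measure_UNION[OF prob_space.finite_measure[OF M(1)], of A t] union(1,2) sigma_eq M(2) by auto
    then have "measure (M t) (\<Union>i. A i) = (\<Sum>i. measure (M t) (A i))" for t
      by (simp add: sums_unique)
    then show ?case using union(3) by simp
  qed
qed

text \<open>The inequality extends to continuous functions by Weierstrass, to compact sets by
  approximating their indicators, and from compact subsets to \<open>U\<close> by inner
  regularity.\<close>

lemma null_set_of_poly_domination:
  fixes M N1 N2 :: "real measure"
  assumes M: "prob_space M" "sets M = sets borel" "AE x in M. \<bar>x\<bar> \<le> R"
    and N1: "prob_space N1" "sets N1 = sets borel" "AE x in N1. \<bar>x\<bar> \<le> R"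
    and N2: "prob_space N2" "sets N2 = sets borel" "AE x in N2. \<bar>x\<bar> \<le> R"
    and dom: "\<And>a n. (\<integral>x. (\<Sum>j\<le>n. a j * x ^ j)\<^sup>2 \<partial>M) \<le>
      C * ((\<integral>x. (\<Sum>j\<le>n. a j * x ^ j)\<^sup>2 \<partial>N1) + (\<integral>x. (\<Sum>j\<le>n. a j * x ^ j)\<^sup>2 \<partial>N2))"
    and U: "U \<in> sets borel" "measure N1 U = 0" "measure N2 U = 0"
  shows "measure M U = 0"
proof -
  have cont: "(\<integral>x. (g x)\<^sup>2 \<partial>M) \<le> C * ((\<integral>x. (g x)\<^sup>2 \<partial>N1) + (\<integral>x. (g x)\<^sup>2 \<partial>N2))"
    if g: "continuous_on UNIV g" for g :: "real \<Rightarrow> real"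
  proof -
    obtain a n where an: "\<And>i x. \<bar>x\<bar> \<le> R \<Longrightarrow> \<bar>g x - (\<Sum>j\<le>n i. a i j * x ^ j)\<bar> < 1 / real (Suc i)"
      using poly_approx[OF g, of R] by blast
    show ?thesis
    proof (rule LIMSEQ_le)
      show "(\<lambda>i. \<integral>x. (\<Sum>j\<le>n i. a i j * x ^ j)\<^sup>2 \<partial>M) \<longlonglongrightarrow> (\<integral>x. (g x)\<^sup>2 \<partial>M)"
        by (rule continuous_integral_limit(2)[OF M g _ an]) auto
      show "(\<lambda>i. C * ((\<integral>x. (\<Sum>j\<le>n i. a i j * x ^ j)\<^sup>2 \<partial>N1) + (\<integral>x. (\<Sum>j\<le>n i. a i j * x ^ j)\<^sup>2 \<partial>N2)))
          \<longlonglongrightarrow> C * ((\<integral>x. (g x)\<^sup>2 \<partial>N1) + (\<integral>x. (g x)\<^sup>2 \<partial>N2))"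
        by (intro tendsto_intros continuous_integral_limit(2)[OF N1 g _ an] continuous_integral_limit(2)[OF N2 g _ an]) auto
    qed (use dom in blast)
  qed
  have cpt: "measure M K = 0" if K: "compact K" "K \<subseteq> U" for K
  proof (cases "K = {}")
    case False
    \<comment> \<open>The square root is taken because the domination concerns squares; it is
      \<open>(?g n x)^2\<close> that decreases to the indicator of \<open>K\<close>.\<close>
    let ?g = "\<lambda>n x. sqrt (max 0 (1 - real n * infdist x K))"
    have lim: "(\<lambda>n. \<integral>x. (?g n x)\<^sup>2 \<partial>L) \<longlonglongrightarrow> measure L K" if L: "prob_space L" "sets L = sets borel" for L
    proof -
      interpret prob_space L by fact
      note [measurable_cong] = L(2)
      have [measurable]: "K \<in> sets borel" using K by (simp add: compact_imp_closed)
      have [measurable]: "(\<lambda>x. infdist x K) \<in> borel_measurable borel"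
        by (intro borel_measurable_continuous_onI continuous_intros)
      have "(\<lambda>n. \<integral>x. (?g n x)\<^sup>2 \<partial>L) \<longlonglongrightarrow> (\<integral>x. indicator K x \<partial>L)"
      proof (rule integral_dominated_convergence[where w="\<lambda>_. 1"])
        show "AE x in L. (\<lambda>n. (?g n x)\<^sup>2) \<longlonglongrightarrow> indicator K x"
        proof (rule AE_I2, rule tendsto_eventually)
          fix x
          show "\<forall>\<^sub>F n in sequentially. (?g n x)\<^sup>2 = indicator K x"
          proof (cases "x \<in> K")
            case True
            then show ?thesis by simp
          next
            case F: False
            then have pos: "infdist x K > 0"
              using False K infdist_pos_not_in_closed[of K x] compact_imp_closed by blast
            have "\<forall>\<^sub>F n in sequentially. real n \<ge> 1 / infdist x K"
              using eventually_ge_at_top[of "nat \<lceil>1 / infdist x K\<rceil>"] by eventually_elim linarith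
            then show ?thesis
            proof eventually_elim
              case (elim n)
              then have "real n * infdist x K \<ge> 1" using pos by (simp add: field_simps)
              then show ?case using F by simp
            qed
          qed
        qed
        show "AE x in L. norm ((?g n x)\<^sup>2) \<le> 1" for n
          by (rule AE_I2) (simp add: infdist_nonneg)
      qed auto
      then show ?thesis using L(2) by simp
    qed
    have gc: "continuous_on UNIV (?g n)" for n by (intro continuous_intros)
    have "measure M K \<le> C * (measure N1 K + measure N2 K)"
      by (rule LIMSEQ_le[OF lim[OF M(1,2)] tendsto_mult[OF tendsto_const tendsto_add[OF lim[OF N1(1,2)] lim[OF N2(1,2)]]]])
         (use cont[OF gc] in blast)
    moreover have "measure N1 K \<le> measure N1 U"
      by (rule finite_measure.finite_measure_mono[OF prob_space.finite_measure[OF N1(1)] K(2)]) (simp add: N1 U)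
    moreover have "measure N2 K \<le> measure N2 U"
      by (rule finite_measure.finite_measure_mono[OF prob_space.finite_measure[OF N2(1)] K(2)]) (simp add: N2 U)
    moreover note U(2,3) measure_nonneg[of N1 K] measure_nonneg[of N2 K]
    ultimately have "measure M K \<le> 0" by (simp add: antisym)
    then show ?thesis using measure_nonneg[of M K] by (rule antisym)
  qed simp
  have "emeasure M U = (SUP K \<in> {K. K \<subseteq> U \<and> compact K}. emeasure M K)"
    by (rule inner_regular) (use M U prob_space.emeasure_space_1[OF M(1)] in auto)
  also have "\<dots> = (SUP K \<in> {K. K \<subseteq> U \<and> compact K}. 0)"
    using cpt finite_measure.emeasure_eq_measure[OF prob_space.finite_measure[OF M(1)]] by (intro SUP_cong) auto
  also have "\<dots> = 0" by (intro antisym SUP_least) auto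
  finally show ?thesis by (simp add: measure_def)
qed

section \<open>Spectral measures\<close>

definition fin_supp :: "(int \<Rightarrow> real) \<Rightarrow> bool" where
  "fin_supp u \<longleftrightarrow> finite {n. u n \<noteq> 0}"

text \<open>An infinite sum, employed where one argument has finite support, so that summation
  ranges need not be tracked.\<close>

definition ip :: "(int \<Rightarrow> real) \<Rightarrow> (int \<Rightarrow> real) \<Rightarrow> real" where
  "ip u v = (\<Sum>\<^sub>\<infinity>n. u n * v n)"

definition rdelta :: "int \<Rightarrow> int \<Rightarrow> real" where
  "rdelta k = (\<lambda>n. if n = k then 1 else 0)"

lemma fin_supp_rdelta [simp]: "fin_supp (rdelta k)"
  by (auto simp: fin_supp_def rdelta_def)

lemma fin_supp_lincomb [simp]:
  "fin_supp u \<Longrightarrow> fin_supp v \<Longrightarrow> fin_supp (\<lambda>n. a * u n + b * v n)"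
  unfolding fin_supp_def by (rule finite_subset[of _ "{n. u n \<noteq> 0} \<union> {n. v n \<noteq> 0}"]) auto

lemma fin_supp_shift: "fin_supp u \<Longrightarrow> fin_supp (\<lambda>n. u (n + k))"
proof -
  assume "fin_supp u"
  moreover have "{n. u (n + k) \<noteq> 0} \<subseteq> (\<lambda>n. n - k) ` {n. u n \<noteq> 0}"
    by (auto intro!: image_eqI[where x="_ + k"])
  ultimately show ?thesis unfolding fin_supp_def using finite_surj by blast
qed

lemma fin_supp_jacobi [simp]: "fin_supp u \<Longrightarrow> fin_supp (jacobi V u)"
proof -
  assume u: "fin_supp u"
  have "{n. jacobi V u n \<noteq> 0} \<subseteq> {n. u (n + - 1) \<noteq> 0} \<union> {n. u (n + 1) \<noteq> 0} \<union> {n. u n \<noteq> 0}"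
    by (auto simp: jacobi_def)
  then show ?thesis
    using u fin_supp_shift[OF u, of "- 1"] fin_supp_shift[OF u, of 1]
    unfolding fin_supp_def by (meson finite_UnI finite_subset)
qed

lemma ip_summable [simp]: "fin_supp u \<Longrightarrow> (\<lambda>n. u n * v n) summable_on UNIV"
  unfolding fin_supp_def by (rule finite_nonzero_values_imp_summable_on, rule finite_subset[of _ "{n. u n \<noteq> 0}"]) auto

lemma ip_summable2 [simp]: "fin_supp v \<Longrightarrow> (\<lambda>n. u n * v n) summable_on UNIV"
  using ip_summable[of v u] by (simp add: mult.commute)

lemma ip_commute: "ip u v = ip v u" by (simp add: ip_def mult.commute)

lemma ip_lincomb:
  "fin_supp u \<Longrightarrow> fin_supp v \<Longrightarrow> ip (\<lambda>n. a * u n + b * v n) w = a * ip u w + b * ip v w"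
proof -
  assume f: "fin_supp u" "fin_supp v"
  have "ip (\<lambda>n. a * u n + b * v n) w = (\<Sum>\<^sub>\<infinity>n. a * (u n * w n) + b * (v n * w n))"
    unfolding ip_def by (simp add: algebra_simps)
  also have "\<dots> = (\<Sum>\<^sub>\<infinity>n. a * (u n * w n)) + (\<Sum>\<^sub>\<infinity>n. b * (v n * w n))"
    by (rule infsum_add) (intro summable_on_cmult_right ip_summable f)+
  finally show ?thesis by (simp add: ip_def infsum_cmult_right')
qed

lemma ip_sum:
  "finite I \<Longrightarrow> (\<And>i. i \<in> I \<Longrightarrow> fin_supp (u i)) \<Longrightarrow>
    ip (\<lambda>n. \<Sum>i\<in>I. a i * u i n) w = (\<Sum>i\<in>I. a i * ip (u i) w) \<and> fin_supp (\<lambda>n. \<Sum>i\<in>I. a i * u i n)"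
proof (induction I rule: finite_induct)
  case empty
  show ?case by (simp add: ip_def fin_supp_def)
next
  case (insert x I)
  then have "ip (\<lambda>n. \<Sum>i\<in>I. a i * u i n) w = (\<Sum>i\<in>I. a i * ip (u i) w)" "fin_supp (\<lambda>n. \<Sum>i\<in>I. a i * u i n)" "fin_supp (u x)"
    by auto
  then show ?case
    using insert(1,2) ip_lincomb[of "u x" "\<lambda>n. \<Sum>i\<in>I. a i * u i n" "a x" 1 w]
      fin_supp_lincomb[of "u x" "\<lambda>n. \<Sum>i\<in>I. a i * u i n" "a x" 1] by simp
qed

lemma ip_rdelta: "ip u (rdelta k) = u k"
proof -
  have "ip u (rdelta k) = infsum (\<lambda>n. u n) {k}"
    unfolding ip_def by (rule infsum_cong_neutral) (auto simp: rdelta_def)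
  then show ?thesis by simp
qed

lemma ip_self_nonneg: "ip u u \<ge> 0"
  unfolding ip_def by (rule infsum_nonneg) simp

lemma infsum_shift_int:
  fixes h :: "int \<Rightarrow> real" shows "(\<Sum>\<^sub>\<infinity>n. h (n + k)) = (\<Sum>\<^sub>\<infinity>n. h n)"
proof (rule infsum_reindex_bij_betw)
  show "bij_betw (\<lambda>n. n + k) UNIV UNIV"
    by (rule bij_betwI[where g="\<lambda>n. n - k"]) auto
qed

lemma ip_jacobi_expand:
  assumes "fin_supp u"
  shows "ip (jacobi V u) v = (\<Sum>\<^sub>\<infinity>n. u n * v (n + 1)) + (\<Sum>\<^sub>\<infinity>n. u (n + 1) * v n) + (\<Sum>\<^sub>\<infinity>n. V n * u n * v n)"
proof -
  have s1: "(\<lambda>n. u (n - 1) * v n) summable_on UNIV"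
    using ip_summable[OF fin_supp_shift[OF assms, of "- 1"], of v] by simp
  have s2: "(\<lambda>n. u (n + 1) * v n) summable_on UNIV"
    by (rule ip_summable[OF fin_supp_shift[OF assms]])
  have s3: "(\<lambda>n. V n * u n * v n) summable_on UNIV"
    using ip_summable[OF assms, of "\<lambda>n. V n * v n"] by (simp add: mult_ac)
  have "ip (jacobi V u) v = (\<Sum>\<^sub>\<infinity>n. u (n - 1) * v n + u (n + 1) * v n + V n * u n * v n)"
    unfolding ip_def jacobi_def by (simp add: algebra_simps)
  also have "\<dots> = (\<Sum>\<^sub>\<infinity>n. u (n - 1) * v n + u (n + 1) * v n) + (\<Sum>\<^sub>\<infinity>n. V n * u n * v n)"
    by (rule infsum_add) (intro summable_on_add s1 s2 s3)+
  also have "(\<Sum>\<^sub>\<infinity>n. u (n - 1) * v n + u (n + 1) * v n) = (\<Sum>\<^sub>\<infinity>n. u (n - 1) * v n) + (\<Sum>\<^sub>\<infinity>n. u (n + 1) * v n)"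
    by (rule infsum_add[OF s1 s2])
  also have "(\<Sum>\<^sub>\<infinity>n. u (n - 1) * v n) = (\<Sum>\<^sub>\<infinity>n. u n * v (n + 1))"
    using infsum_shift_int[of "\<lambda>n. u (n - 1) * v n" 1] by simp
  finally show ?thesis .
qed

lemma ip_jacobi_sym:
  assumes "fin_supp u" "fin_supp v"
  shows "ip (jacobi V u) v = ip u (jacobi V v)"
  unfolding ip_commute[of u] ip_jacobi_expand[OF assms(1)] ip_jacobi_expand[OF assms(2)]
  by (simp add: mult_ac)

lemma fin_supp_jacobi_pow [simp]: "fin_supp u \<Longrightarrow> fin_supp ((jacobi V ^^ k) u)"
  by (induction k) auto

lemma ip_jacobi_pow_sym:
  assumes "fin_supp u" "fin_supp v"
  shows "ip ((jacobi V ^^ k) u) v = ip u ((jacobi V ^^ k) v)"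
  using assms
proof (induction k arbitrary: v)
  case (Suc k)
  have "ip ((jacobi V ^^ Suc k) u) v = ip ((jacobi V ^^ k) u) (jacobi V v)"
    using Suc.prems by (simp add: ip_jacobi_sym)
  also have "\<dots> = ip u ((jacobi V ^^ k) (jacobi V v))"
    using Suc by simp
  finally show ?case by (simp add: funpow_swap1)
qed simp

lemma jacobi_lincomb:
  fixes u v :: "int \<Rightarrow> real"
  shows "jacobi V (\<lambda>n. a * u n + b * v n) = (\<lambda>n. a * jacobi V u n + b * jacobi V v n)"
  by (auto simp: jacobi_def algebra_simps)

lemma jacobi_pow_lincomb:
  fixes u v :: "int \<Rightarrow> real"
  shows "(jacobi V ^^ k) (\<lambda>n. a * u n + b * v n) = (\<lambda>n. a * (jacobi V ^^ k) u n + b * (jacobi V ^^ k) v n)"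
  by (induction k) (simp_all add: jacobi_lincomb)

definition moment :: "(int \<Rightarrow> real) \<Rightarrow> nat \<Rightarrow> real" where
  "moment V k = (jacobi V ^^ k) (rdelta 0) 0"

lemma jacobi_pow_of_real: "(jacobi V ^^ k) (delta m) n = complex_of_real ((jacobi V ^^ k) (rdelta m) n)"
proof (induction k arbitrary: n)
  case 0
  show ?case by (simp add: delta_def rdelta_def)
next
  case (Suc k)
  then show ?case by (simp add: jacobi_def scaleR_conv_of_real)
qed

lemma moment_shift: "moment (\<lambda>n. V (n + m)) k = (jacobi V ^^ k) (rdelta m) m"
proof -
  have "complex_of_real ((jacobi V ^^ k) (rdelta m) m) = complex_of_real (moment (\<lambda>n. V (n + m)) k)"
    unfolding moment_def jacobi_pow_of_real[symmetric] using jacobi_pow_shift[of k V m m] by simp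
  then show ?thesis by simp
qed

context bounded_potential begin

text \<open>The two signs \<open>s\<close> together bound the quadratic form in modulus; hopping
  terms are estimated by half the sum of the squares of the neighbours.\<close>

lemma ip_jacobi_le:
  assumes u: "fin_supp u" and s: "\<bar>s\<bar> = 1"
  shows "s * ip (jacobi V u) u \<le> (2 + F) * ip u u"
proof -
  have s1: "(\<lambda>n. (u n)\<^sup>2) summable_on UNIV" using ip_summable[OF u, of u] by (simp add: power2_eq_square)
  have s2: "(\<lambda>n. (u (n + k))\<^sup>2) summable_on UNIV" for k
    using ip_summable[OF fin_supp_shift[OF u], of k "\<lambda>n. u (n + k)"] by (simp add: power2_eq_square)
  let ?g = "\<lambda>n. (1 + F) * (u n)\<^sup>2 + ((u (n + - 1))\<^sup>2 / 2 + (u (n + 1))\<^sup>2 / 2)"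
  have s3: "(\<lambda>n. (1 + F) * (u n)\<^sup>2) summable_on UNIV" by (intro summable_on_cmult_right s1)
  have s4: "(\<lambda>n. (u (n + k))\<^sup>2 / 2) summable_on UNIV" for k
    using summable_on_cmult_left[OF s2[of k], of "1/2"] by simp
  have gs: "?g summable_on UNIV" by (intro summable_on_add s3 s4)
  have "s * ip (jacobi V u) u = (\<Sum>\<^sub>\<infinity>n. s * (jacobi V u n * u n))"
    unfolding ip_def by (simp add: infsum_cmult_right')
  also have "\<dots> \<le> infsum ?g UNIV"
  proof (rule infsum_mono)
    show "(\<lambda>n. s * (jacobi V u n * u n)) summable_on UNIV"
      by (intro summable_on_cmult_right ip_summable2 u)
    show "?g summable_on UNIV" by (rule gs)
    fix n
    have a: "s * (a * b) \<le> a\<^sup>2 / 2 + b\<^sup>2 / 2" for a b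
    proof -
      have "s = 1 \<or> s = - 1" using s by (auto simp: abs_if split: if_splits)
      moreover have "0 \<le> (a - b)\<^sup>2" "0 \<le> (a + b)\<^sup>2" by auto
      ultimately show ?thesis by (auto simp: power2_diff power2_sum)
    qed
    have "s * (V n * (u n)\<^sup>2) \<le> \<bar>s * (V n * (u n)\<^sup>2)\<bar>" by simp
    also have "\<dots> = \<bar>V n\<bar> * (u n)\<^sup>2" using s by (simp add: abs_mult)
    also have "\<dots> \<le> F * (u n)\<^sup>2" by (intro mult_right_mono V_bound) auto
    finally have "s * (V n * (u n)\<^sup>2) \<le> F * (u n)\<^sup>2" .
    moreover have "s * (jacobi V u n * u n) = s * (u (n + - 1) * u n) + s * (u (n + 1) * u n) + s * (V n * (u n)\<^sup>2)"
      by (simp add: jacobi_def algebra_simps power2_eq_square)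
    ultimately show "s * (jacobi V u n * u n) \<le> ?g n"
      using a[of "u (n + - 1)" "u n"] a[of "u (n + 1)" "u n"] by (simp add: distrib_right)
  qed
  also have "\<dots> = (\<Sum>\<^sub>\<infinity>n. (1 + F) * (u n)\<^sup>2) + ((\<Sum>\<^sub>\<infinity>n. (u (n + - 1))\<^sup>2 / 2) + (\<Sum>\<^sub>\<infinity>n. (u (n + 1))\<^sup>2 / 2))"
    by (subst infsum_add, rule s3, intro summable_on_add s4, subst infsum_add, rule s4, rule s4, rule refl)
  also have "\<dots> = (1 + F) * ip u u + (ip u u / 2 + ip u u / 2)"
  proof -
    have h: "(\<Sum>\<^sub>\<infinity>n. (u (n + k))\<^sup>2 / 2) = ip u u / 2" for k
      using infsum_shift_int[of "\<lambda>n. (u n)\<^sup>2 / 2" k] infsum_cmult_left'[of "\<lambda>n. (u n)\<^sup>2" "1/2" UNIV]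
      by (simp add: ip_def power2_eq_square)
    show ?thesis unfolding h by (simp add: infsum_cmult_right' ip_def power2_eq_square)
  qed
  finally show ?thesis by (simp add: algebra_simps)
qed

definition Rad :: real where "Rad = 2 + F"

lemma Rad_pos: "Rad > 0" using F_nonneg by (simp add: Rad_def)

text \<open>\<open>opA\<close> rescales the operator so that its spectrum lies in \<open>[0, 1]\<close>, and \<open>opB\<close> is \<open>1 - opA\<close>; both are
  nonnegative, which makes \<open>lam\<close> a solvable moment array.\<close>

definition opA :: "(int \<Rightarrow> real) \<Rightarrow> int \<Rightarrow> real" where
  "opA u = (\<lambda>n. 1 / (2 * Rad) * jacobi V u n + 1 / 2 * u n)"

definition opB :: "(int \<Rightarrow> real) \<Rightarrow> int \<Rightarrow> real" where
  "opB u = (\<lambda>n. 1 * u n + - 1 * opA u n)"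

lemma fin_supp_opA [simp]: "fin_supp u \<Longrightarrow> fin_supp (opA u)"
  unfolding opA_def by (intro fin_supp_lincomb) auto

lemma fin_supp_opB [simp]: "fin_supp u \<Longrightarrow> fin_supp (opB u)"
  unfolding opB_def by (intro fin_supp_lincomb) auto

lemma fin_supp_opA_pow [simp]: "fin_supp u \<Longrightarrow> fin_supp ((opA ^^ k) u)" by (induction k) auto
lemma fin_supp_opB_pow [simp]: "fin_supp u \<Longrightarrow> fin_supp ((opB ^^ k) u)" by (induction k) auto

lemma opA_lincomb: "opA (\<lambda>n. a * u n + b * v n) = (\<lambda>n. a * opA u n + b * opA v n)"
  unfolding opA_def jacobi_lincomb by (auto simp: algebra_simps)

lemma opA_opB: "opA (opB u) = opB (opA u)"
  unfolding opB_def opA_lincomb by simp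

lemma opA_opB_pow: "opA ((opB ^^ l) u) = (opB ^^ l) (opA u)"
  by (induction l) (auto simp: opA_opB)

lemma opA_pow_opB_pow: "(opA ^^ k) ((opB ^^ l) u) = (opB ^^ l) ((opA ^^ k) u)"
  by (induction k) (auto simp: opA_opB_pow)

lemma ip_opA_expand:
  assumes "fin_supp u"
  shows "ip (opA u) v = 1 / (2 * Rad) * ip (jacobi V u) v + 1 / 2 * ip u v"
  unfolding opA_def by (rule ip_lincomb) (use assms in auto)

lemma ip_opB_expand:
  assumes "fin_supp u"
  shows "ip (opB u) v = 1 * ip u v + - 1 * ip (opA u) v"
  unfolding opB_def by (rule ip_lincomb) (use assms in auto)

lemma ip_opA:
  assumes u: "fin_supp u" and v: "fin_supp v"
  shows "ip (opA u) v = ip u (opA v)"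
  unfolding ip_commute[of u "opA v"] ip_opA_expand[OF u] ip_opA_expand[OF v]
  using ip_jacobi_sym[OF u v] ip_commute[of u "jacobi V v"] ip_commute[of u v] by simp

lemma ip_opB:
  assumes u: "fin_supp u" and v: "fin_supp v"
  shows "ip (opB u) v = ip u (opB v)"
  unfolding ip_commute[of u "opB v"] ip_opB_expand[OF u] ip_opB_expand[OF v]
  using ip_opA[OF u v] ip_commute[of u "opA v"] ip_commute[of u v] by simp

lemma ip_opA_nonneg: "fin_supp u \<Longrightarrow> ip (opA u) u \<ge> 0"
  using ip_jacobi_le[of u "- 1", folded Rad_def] Rad_pos
  by (simp add: ip_opA_expand field_simps)

lemma ip_opB_nonneg: "fin_supp u \<Longrightarrow> ip (opB u) u \<ge> 0"
  using ip_jacobi_le[of u 1, folded Rad_def] Rad_pos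
  by (simp add: ip_opA_expand ip_opB_expand field_simps)

text \<open>Stands for the integral of \<open>x ^ k * (1 - x) ^ l\<close> against the spectral
  measure of the rescaled operator, which is still to be constructed.\<close>

definition lam :: "nat \<Rightarrow> nat \<Rightarrow> real" where
  "lam k l = (opB ^^ l) ((opA ^^ k) (rdelta 0)) 0"

lemma lam_rec: "lam k l = lam (Suc k) l + lam k (Suc l)"
proof -
  let ?v = "(opB ^^ l) ((opA ^^ k) (rdelta 0))"
  have "lam (Suc k) l = opA ?v 0" by (simp add: lam_def opA_opB_pow)
  moreover have "lam k (Suc l) = opB ?v 0" by (simp add: lam_def)
  ultimately show ?thesis by (simp add: opB_def lam_def)
qed

lemma ip_pow_move:
  assumes "fin_supp u" "fin_supp w"
  shows "ip ((opB ^^ j) ((opA ^^ i) u)) w = ip u ((opA ^^ i) ((opB ^^ j) w))"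
proof -
  have A: "fin_supp u \<Longrightarrow> fin_supp w \<Longrightarrow> ip ((opA ^^ i) u) w = ip u ((opA ^^ i) w)" for u w
  proof (induction i arbitrary: w)
    case (Suc i)
    then have "ip ((opA ^^ Suc i) u) w = ip u ((opA ^^ i) (opA w))" by (simp add: ip_opA)
    then show ?case by (simp add: funpow_swap1)
  qed simp
  have B: "fin_supp u \<Longrightarrow> fin_supp w \<Longrightarrow> ip ((opB ^^ j) u) w = ip u ((opB ^^ j) w)" for u w
  proof (induction j arbitrary: w)
    case (Suc j)
    then have "ip ((opB ^^ Suc j) u) w = ip u ((opB ^^ j) (opB w))" by (simp add: ip_opB)
    then show ?case by (simp add: funpow_swap1)
  qed simp
  show ?thesis using assms by (simp add: A B)
qed

text \<open>By symmetry half of each even power moves to the other side of the inner product; only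
  \<open>opA ^^ a\<close> and \<open>opB ^^ b\<close> stay in the middle, where nonnegativity of the
  forms applies.\<close>

lemma lam_eq_ip:
  "lam (a + i + i) (b + j + j) = ip ((opB ^^ b) ((opA ^^ a) ((opB ^^ j) ((opA ^^ i) (rdelta 0))))) ((opB ^^ j) ((opA ^^ i) (rdelta 0)))"
proof -
  let ?v = "(opB ^^ j) ((opA ^^ i) (rdelta 0))"
  let ?w = "(opB ^^ b) ((opA ^^ a) ?v)"
  have "ip ?w ?v = ip ?v ?w" by (rule ip_commute)
  also have "\<dots> = ip (rdelta 0) ((opA ^^ i) ((opB ^^ j) ?w))"
    by (rule ip_pow_move) auto
  also have "\<dots> = (opA ^^ i) ((opB ^^ j) ?w) 0"
    by (subst ip_commute) (rule ip_rdelta)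
  also have "(opA ^^ i) ((opB ^^ j) ?w) = (opB ^^ (b + j + j)) ((opA ^^ (a + i + i)) (rdelta 0))"
  proof -
    have "(opA ^^ i) ((opB ^^ j) ?w) = (opB ^^ j) ((opB ^^ b) ((opB ^^ j) ((opA ^^ i) ((opA ^^ a) ((opA ^^ i) (rdelta 0))))))"
      by (simp only: opA_pow_opB_pow)
    also have "\<dots> = (opB ^^ (j + b + j)) ((opA ^^ (i + a + i)) (rdelta 0))"
      by (simp only: funpow_add o_apply)
    finally show ?thesis by (simp only: add.commute add.left_commute)
  qed
  finally show ?thesis by (simp add: lam_def)
qed

lemma lam_nonneg: "lam k l \<ge> 0"
proof -
  have e0: "lam (i + i) (j + j) \<ge> 0" for i j
    using lam_eq_ip[of 0 i 0 j] by (simp add: ip_self_nonneg)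
  have e1: "lam (Suc (i + i)) (j + j) \<ge> 0" for i j
    using lam_eq_ip[of 1 i 0 j] by (simp add: ip_opA_nonneg)
  have e2: "lam (i + i) (Suc (j + j)) \<ge> 0" for i j
    using lam_eq_ip[of 0 i 1 j] by (simp add: ip_opB_nonneg)
  \<comment> \<open>With both exponents odd the middle would be a product of the two operators; the
    recursion leads back to pairs with an even member.\<close>
  have e3: "lam (Suc (i + i)) (Suc (j + j)) \<ge> 0" for i j
    using lam_rec[of "Suc (i + i)" "Suc (j + j)"] e2[of "Suc i" j] e1[of i "Suc j"] by simp
  have par: "\<exists>i. k = i + i \<or> k = Suc (i + i)" for k :: nat by presburger
  obtain i j where "k = i + i \<or> k = Suc (i + i)" "l = j + j \<or> l = Suc (j + j)"
    using par[of k] par[of l] by blast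
  then show ?thesis using e0 e1 e2 e3 by auto
qed

text \<open>Characterised by moments and bounded support, which is what the Hausdorff construction
  provides; \<open>spectral_green\<close> recovers the Stieltjes transform.\<close>

definition is_spectral :: "real measure \<Rightarrow> bool" where
  "is_spectral \<mu> \<longleftrightarrow> prob_space \<mu> \<and> sets \<mu> = sets borel \<and> (AE x in \<mu>. \<bar>x\<bar> \<le> Rad) \<and> (\<forall>k. (\<integral>x. x ^ k \<partial>\<mu>) = moment V k)"

text \<open>The Hausdorff measure belonging to \<open>opA\<close>, transported by the affine map
  that undoes the rescaling.\<close>

lemma spectral_exists: "\<exists>\<mu>. is_spectral \<mu>"
proof -
  have "\<exists>M. real_distribution M \<and> (AE x in M. 0 \<le> x \<and> x \<le> 1) \<and> (\<forall>m. (\<integral>x. x ^ m \<partial>M) = lam m 0)"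
    by (rule hausdorff_moments[of lam, OF lam_nonneg lam_rec]) (simp add: lam_def rdelta_def)
  then obtain M where M: "real_distribution M" "AE x in M. 0 \<le> x \<and> x \<le> 1" "\<And>m. (\<integral>x. x ^ m \<partial>M) = lam m 0"
    by blast
  interpret M: real_distribution M by (rule M(1))
  let ?h = "\<lambda>x. 2 * Rad * x - Rad"
  let ?\<mu> = "distr M borel ?h"
  have hb: "AE x in M. \<bar>?h x\<bar> \<le> Rad"
    using M(2)
  proof eventually_elim
    case (elim x)
    have "0 \<le> Rad * x" "Rad * x \<le> Rad * 1" using elim Rad_pos by (auto intro: mult_left_mono)
    then show ?case by (simp add: abs_le_iff mult.commute)
  qed
  have int: "integrable M (\<lambda>x. ?h x ^ k * x ^ m)" for k m
  proof (rule M.integrable_const_bound[where B="Rad ^ k"])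
    show "AE x in M. norm (?h x ^ k * x ^ m) \<le> Rad ^ k"
      using hb M(2)
    proof eventually_elim
      case (elim x)
      have "\<bar>?h x\<bar> ^ k * \<bar>x\<bar> ^ m \<le> Rad ^ k * 1"
        using elim by (intro mult_mono power_mono power_le_one) auto
      then show ?case by (simp add: abs_mult power_abs)
    qed
  qed measurable
  \<comment> \<open>Mixed powers make the induction work, since each factor \<open>jacobi V\<close>
    is rewritten as \<open>2 * Rad * opA - Rad\<close>.\<close>
  have mom: "((jacobi V ^^ k) ((opA ^^ m) (rdelta 0))) 0 = (\<integral>x. ?h x ^ k * x ^ m \<partial>M)" for k m
  proof (induction k arbitrary: m)
    case 0
    show ?case using M(3)[of m] by (simp add: lam_def)
  next
    case (Suc k)
    let ?w = "(opA ^^ m) (rdelta 0)"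
    have "jacobi V ?w = (\<lambda>n. (2 * Rad) * opA ?w n + (- Rad) * ?w n)"
      using Rad_pos by (auto simp: opA_def fun_eq_iff algebra_simps)
    then have "(jacobi V ^^ Suc k) ?w 0 = (jacobi V ^^ k) (\<lambda>n. (2 * Rad) * opA ?w n + (- Rad) * ?w n) 0"
      by (simp add: funpow_swap1)
    also have "\<dots> = 2 * Rad * (jacobi V ^^ k) ((opA ^^ Suc m) (rdelta 0)) 0 + (- Rad) * (jacobi V ^^ k) ?w 0"
      by (simp only: jacobi_pow_lincomb funpow.simps o_apply)
    also have "\<dots> = 2 * Rad * (\<integral>x. ?h x ^ k * x ^ Suc m \<partial>M) + (- Rad) * (\<integral>x. ?h x ^ k * x ^ m \<partial>M)"
      unfolding Suc ..
    also have "\<dots> = (\<integral>x. 2 * Rad * (?h x ^ k * x ^ Suc m) + (- Rad) * (?h x ^ k * x ^ m) \<partial>M)"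
      by (subst Bochner_Integration.integral_add) (auto intro!: integrable_mult_right int simp del: power_Suc)
    also have "\<dots> = (\<integral>x. ?h x ^ Suc k * x ^ m \<partial>M)"
      by (intro Bochner_Integration.integral_cong) (auto simp: algebra_simps)
    finally show ?case .
  qed
  have "is_spectral ?\<mu>"
    unfolding is_spectral_def
  proof (intro conjI allI)
    show "prob_space ?\<mu>" by (rule M.prob_space_distr) simp
    show "AE x in ?\<mu>. \<bar>x\<bar> \<le> Rad" using hb by (subst AE_distr_iff) auto
    show "(\<integral>x. x ^ k \<partial>?\<mu>) = moment V k" for k
      using mom[of k 0] by (subst integral_distr) (auto simp: moment_def)
  qed simp
  then show ?thesis ..
qed

text \<open>Bounded support allows the exponential series to be integrated termwise against the
  moments.\<close>

lemma spectral_evol: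
  assumes "is_spectral \<mu>"
  shows "evol t 0 = (\<integral>x. exp (- \<i> * complex_of_real t * complex_of_real x) \<partial>\<mu>)"
proof -
  have \<mu>: "prob_space \<mu>" "sets \<mu> = sets borel" "AE x in \<mu>. \<bar>x\<bar> \<le> Rad" "\<And>k. (\<integral>x. x ^ k \<partial>\<mu>) = moment V k"
    using assms by (auto simp: is_spectral_def)
  interpret prob_space \<mu> by fact
  let ?f = "\<lambda>k x. ((- \<i> * complex_of_real t) ^ k / fact k) * complex_of_real (x ^ k)"
  have ip: "integrable \<mu> (\<lambda>x. x ^ k)" for k by (rule bounded_power_integrable[OF \<mu>(1-3)])
  have nf: "norm (?f k x) = (\<bar>t\<bar> * \<bar>x\<bar>) ^ k / fact k" for k x
    by (simp add: norm_mult norm_divide norm_power power_mult_distrib power_abs)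
  have "(\<lambda>k. integral\<^sup>L \<mu> (?f k)) sums (\<integral>x. (\<Sum>k. ?f k x) \<partial>\<mu>)"
  proof (rule sums_integral)
    show "integrable \<mu> (?f k)" for k
      by (intro integrable_mult_right integrable_of_real ip)
    show "AE x in \<mu>. summable (\<lambda>k. norm (?f k x))"
      unfolding nf using summable_exp_generic[of "\<bar>t\<bar> * \<bar>_\<bar>"] by (intro AE_I2) (simp add: divide_inverse mult.commute)
    show "summable (\<lambda>k. \<integral>x. norm (?f k x) \<partial>\<mu>)"
    proof (rule summable_comparison_test')
      show "summable (\<lambda>k. (\<bar>t\<bar> * Rad) ^ k /\<^sub>R fact k)" by (rule summable_exp_generic)
      fix k :: nat assume "k \<ge> 0"
      have "(\<integral>x. norm (?f k x) \<partial>\<mu>) \<le> (\<integral>x. (\<bar>t\<bar> * Rad) ^ k / fact k \<partial>\<mu>)"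
      proof (rule integral_mono_AE)
        show "integrable \<mu> (\<lambda>x. norm (?f k x))" by (intro integrable_norm integrable_mult_right integrable_of_real ip)
        show "AE x in \<mu>. norm (?f k x) \<le> (\<bar>t\<bar> * Rad) ^ k / fact k"
          unfolding nf using \<mu>(3) by eventually_elim (intro divide_right_mono power_mono mult_left_mono, auto)
      qed simp
      then show "norm (\<integral>x. norm (?f k x) \<partial>\<mu>) \<le> (\<bar>t\<bar> * Rad) ^ k /\<^sub>R fact k"
        by (simp add: prob_space divide_inverse mult.commute integral_nonneg)
    qed
  qed
  moreover have "integral\<^sup>L \<mu> (?f k) = (- \<i> * complex_of_real t) ^ k / fact k * (jacobi V ^^ k) (delta 0) 0" for k
    unfolding integral_mult_right_zero integral_complex_of_real \<mu>(4) by (simp add: moment_def jacobi_pow_of_real)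
  moreover have "(\<Sum>k. ?f k x) = exp (- \<i> * complex_of_real t * complex_of_real x)" for x
    unfolding exp_def
  proof (rule suminf_cong)
    fix k
    show "?f k x = (- \<i> * complex_of_real t * complex_of_real x) ^ k /\<^sub>R fact k"
      by (simp only: power_mult_distrib[of "- \<i> * complex_of_real t" "complex_of_real x"] of_real_power scaleR_conv_of_real)
         (simp add: divide_inverse)
  qed
  ultimately have "(\<lambda>k. (- \<i> * complex_of_real t) ^ k / fact k * (jacobi V ^^ k) (delta 0) 0) sums
      (\<integral>x. exp (- \<i> * complex_of_real t * complex_of_real x) \<partial>\<mu>)"
    by (simp only:)
  then show ?thesis
    unfolding evol_def op_exp_def by (rule sums_unique[symmetric])
qed

text \<open>The Laplace transform of \<open>spectral_evol\<close>; \<open>Im z > 0\<close> makes the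
  double integral absolutely convergent.\<close>

lemma spectral_green:
  assumes "is_spectral \<mu>" "Im z > 0"
  shows "green z 0 = stieltjes \<mu> z"
proof -
  have \<mu>: "prob_space \<mu>" "sets \<mu> = sets borel"
    using assms by (auto simp: is_spectral_def)
  interpret prob_space \<mu> by fact
  interpret P: pair_sigma_finite lborel \<mu> ..
  note [measurable_cong] = \<mu>(2)
  let ?k = "\<lambda>t x. indicator {0..} t *\<^sub>R exp (\<i> * (z - complex_of_real x) * complex_of_real t)"
  have em [measurable]: "(exp :: complex \<Rightarrow> complex) \<in> borel_measurable borel"
    by (intro borel_measurable_continuous_onI continuous_intros)
  have n: "norm (?k t x) = indicator {0..} t *\<^sub>R exp (- Im z * t)" for t x
    by (simp add: norm_exp_eq_Re)
  have int: "integrable (lborel \<Otimes>\<^sub>M \<mu>) (\<lambda>(t, x). ?k t x)"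
  proof (rule P.Fubini_integrable)
    show "(\<lambda>(t, x). ?k t x) \<in> borel_measurable (lborel \<Otimes>\<^sub>M \<mu>)" by measurable
    have "integrable lborel (\<lambda>t. indicator {0..} t *\<^sub>R exp (- Im z * t))"
      using set_integrable_exp_decay(1)[OF assms(2)] unfolding set_integrable_def .
    then show "integrable lborel (\<lambda>t. \<integral>x. norm (case (t, x) of (t, x) \<Rightarrow> ?k t x) \<partial>\<mu>)"
      by (simp only: prod.case n) (simp add: prob_space)
    show "AE t in lborel. integrable \<mu> (\<lambda>x. case (t, x) of (t, x) \<Rightarrow> ?k t x)"
    proof (rule AE_I2)
      fix t
      show "integrable \<mu> (\<lambda>x. case (t, x) of (t, x) \<Rightarrow> ?k t x)"
        by (rule integrable_const_bound[where B="indicator {0..} t *\<^sub>R exp (- Im z * t)"])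
           (auto simp: n simp del: norm_scaleR intro!: AE_I2)
    qed
  qed
  have "green z 0 = \<i> * (CLBINT t:{0..}. exp (\<i> * z * complex_of_real t) * (\<integral>x. exp (- \<i> * complex_of_real t * complex_of_real x) \<partial>\<mu>))"
    unfolding green_def spectral_evol[OF assms(1)] ..
  also have "\<dots> = \<i> * (\<integral>t. (\<integral>x. ?k t x \<partial>\<mu>) \<partial>lborel)"
  proof -
    have "exp (\<i> * z * complex_of_real t) * exp (- \<i> * complex_of_real t * complex_of_real x) = exp (\<i> * (z - complex_of_real x) * complex_of_real t)" for t x
      by (simp add: exp_add[symmetric] algebra_simps)
    then have "exp (\<i> * z * complex_of_real t) * (\<integral>x. exp (- \<i> * complex_of_real t * complex_of_real x) \<partial>\<mu>) = (\<integral>x. exp (\<i> * (z - complex_of_real x) * complex_of_real t) \<partial>\<mu>)" for t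
      unfolding integral_mult_right_zero[symmetric] by simp
    then show ?thesis unfolding set_lebesgue_integral_def by simp
  qed
  also have "(\<integral>t. (\<integral>x. ?k t x \<partial>\<mu>) \<partial>lborel) = (\<integral>x. (\<integral>t. ?k t x \<partial>lborel) \<partial>\<mu>)"
    by (rule P.Fubini_integral[OF int, symmetric])
  also have "\<dots> = (\<integral>x. \<i> / (z - complex_of_real x) \<partial>\<mu>)"
    using set_integral_exp_complex(2)[of "z - complex_of_real _"] assms(2) by (simp add: set_lebesgue_integral_def)
  also have "\<i> * \<dots> = (\<integral>x. \<i> * (\<i> / (z - complex_of_real x)) \<partial>\<mu>)"
    by (rule integral_mult_right_zero[symmetric])
  also have "\<dots> = stieltjes \<mu> z"
    unfolding stieltjes_def
  proof (rule Bochner_Integration.integral_cong[OF refl])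
    fix x
    have "z - complex_of_real x \<noteq> 0" "complex_of_real x - z \<noteq> 0" using assms(2) by (auto simp: complex_eq_iff)
    then show "\<i> * (\<i> / (z - complex_of_real x)) = 1 / (complex_of_real x - z)"
      by (simp add: divide_simps)
  qed
  finally show ?thesis .
qed

text \<open>Cyclicity in quantitative form. Since
  \<open>H \<delta>_0 = \<delta>_s + \<delta>_{-s} + V 0 * \<delta>_0\<close>, the vector
  \<open>p(H) \<delta>_s\<close> equals
  \<open>(H - V 0) p(H) \<delta>_0 - p(H) \<delta>_{-s}\<close>. Squaring these four terms costs a
  factor 4, and \<open>V n - V 0\<close> is at most \<open>2 * F\<close>.\<close>

lemma ip_poly_le:
  fixes s :: int and a :: "nat \<Rightarrow> real"
  assumes s: "\<bar>s\<bar> = 1" and n: "finite I"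
  defines "p \<equiv> \<lambda>m n. \<Sum>j\<in>I. a j * (jacobi V ^^ j) (rdelta m) n"
  shows "ip (p s) (p s) \<le> (8 + 16 * F\<^sup>2) * (ip (p 0) (p 0) + ip (p (- s)) (p (- s)))"
proof -
  have fp: "fin_supp (p m)" for m
    unfolding p_def using ip_sum[OF n, of "\<lambda>j. (jacobi V ^^ j) (rdelta m)"] by simp
  have d: "jacobi V (rdelta 0) = (\<lambda>n. 1 * (1 * rdelta s n + 1 * rdelta (- s) n) + V 0 * rdelta 0 n)"
    using s by (auto simp: jacobi_def rdelta_def fun_eq_iff)
  have eq: "p s n = p 0 (n - 1) + p 0 (n + 1) + (V n - V 0) * p 0 n - p (- s) n" for n
  proof -
    have "jacobi V (p 0) n = (\<Sum>j\<in>I. a j * jacobi V ((jacobi V ^^ j) (rdelta 0)) n)"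
      unfolding p_def jacobi_def by (simp add: sum_distrib_left algebra_simps sum.distrib)
    also have "\<dots> = (\<Sum>j\<in>I. a j * ((jacobi V ^^ j) (jacobi V (rdelta 0)) n))"
      by (simp add: funpow_swap1)
    also have "\<dots> = (\<Sum>j\<in>I. a j * ((jacobi V ^^ j) (rdelta s) n + (jacobi V ^^ j) (rdelta (- s)) n + V 0 * (jacobi V ^^ j) (rdelta 0) n))"
      unfolding d jacobi_pow_lincomb by simp
    also have "\<dots> = p s n + p (- s) n + V 0 * p 0 n"
      unfolding p_def by (simp add: sum_distrib_left algebra_simps sum.distrib)
    finally show ?thesis by (simp add: jacobi_def algebra_simps)
  qed
  have sq: "(p m (n + k))\<^sup>2 = p m (n + k) * p m (n + k)" for m n k by (simp add: power2_eq_square)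
  have s2: "(\<lambda>n. (p m (n + k))\<^sup>2) summable_on UNIV" for m k
    unfolding sq by (rule ip_summable[OF fin_supp_shift[OF fp]])
  have i2: "(\<Sum>\<^sub>\<infinity>n. (p m (n + k))\<^sup>2) = ip (p m) (p m)" for m k
    unfolding sq ip_def by (rule infsum_shift_int)
  let ?g = "\<lambda>n. 4 * (p 0 (n + - 1))\<^sup>2 + (4 * (p 0 (n + 1))\<^sup>2 + (16 * F\<^sup>2 * (p 0 (n + 0))\<^sup>2 + 4 * (p (- s) (n + 0))\<^sup>2))"
  have "ip (p s) (p s) = (\<Sum>\<^sub>\<infinity>n. (p s (n + 0))\<^sup>2)" unfolding i2 ..
  also have "\<dots> \<le> infsum ?g UNIV"
  proof (rule infsum_mono)
    show "(\<lambda>n. (p s (n + 0))\<^sup>2) summable_on UNIV" by (rule s2)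
    show "?g summable_on UNIV" by (intro summable_on_add summable_on_cmult_right s2)
    fix n
    have q: "(x + y + z - w)\<^sup>2 \<le> 4 * x\<^sup>2 + 4 * y\<^sup>2 + 4 * z\<^sup>2 + 4 * w\<^sup>2" for x y z w :: real
    proof -
      have "0 \<le> (x - y)\<^sup>2 + (x - z)\<^sup>2 + (x + w)\<^sup>2 + (y - z)\<^sup>2 + (y + w)\<^sup>2 + (z + w)\<^sup>2" by simp
      then show ?thesis by (simp add: power2_eq_square algebra_simps)
    qed
    have "\<bar>V n - V 0\<bar> \<le> 2 * F" using V_bound[of n] V_bound[of 0] by linarith
    then have "(V n - V 0)\<^sup>2 \<le> (2 * F)\<^sup>2" by (metis abs_ge_zero power2_abs power_mono)
    then have "((V n - V 0) * p 0 n)\<^sup>2 \<le> 4 * F\<^sup>2 * (p 0 n)\<^sup>2"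
      unfolding power_mult_distrib by (intro mult_right_mono) auto
    then show "(p s (n + 0))\<^sup>2 \<le> ?g n"
      using q[of "p 0 (n - 1)" "p 0 (n + 1)" "(V n - V 0) * p 0 n" "p (- s) n"] unfolding eq by simp
  qed
  also have "infsum ?g UNIV = 4 * ip (p 0) (p 0) + (4 * ip (p 0) (p 0) + (16 * F\<^sup>2 * ip (p 0) (p 0) + 4 * ip (p (- s)) (p (- s))))"
    by (subst infsum_add, (intro summable_on_add summable_on_cmult_right s2)+)+
       (simp only: infsum_cmult_right' i2)
  also have "\<dots> \<le> (8 + 16 * F\<^sup>2) * (ip (p 0) (p 0) + ip (p (- s)) (p (- s)))"
  proof -
    have "0 \<le> F\<^sup>2 * ip (p (- s)) (p (- s))" "0 \<le> ip (p 0) (p 0)" "0 \<le> ip (p (- s)) (p (- s))"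
      using ip_self_nonneg by auto
    then show ?thesis by (simp add: algebra_simps)
  qed
  finally show ?thesis .
qed

end

text \<open>Shifting the potential by \<open>m\<close> gives the spectral measure at the site
  \<open>m\<close>, so the integral of the squared polynomial is a squared norm of
  \<open>p(H) \<delta>_m\<close>.\<close>

lemma (in bounded_potential) spectral_poly_sq:
  assumes "bounded_potential.is_spectral (\<lambda>n. V (n + m)) F \<mu>"
  shows "(\<integral>x. (\<Sum>j\<le>n. a j * x ^ j)\<^sup>2 \<partial>\<mu>) =
    ip (\<lambda>i. \<Sum>j\<le>n. a j * (jacobi V ^^ j) (rdelta m) i) (\<lambda>i. \<Sum>j\<le>n. a j * (jacobi V ^^ j) (rdelta m) i)"
proof -
  interpret S: bounded_potential "\<lambda>n. V (n + m)" F
    using bounded_potential_axioms by (rule bounded_potential_shift)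
  have \<mu>: "prob_space \<mu>" "sets \<mu> = sets borel" "AE x in \<mu>. \<bar>x\<bar> \<le> Rad" "\<And>k. (\<integral>x. x ^ k \<partial>\<mu>) = moment (\<lambda>n. V (n + m)) k"
    using assms by (auto simp: S.is_spectral_def)
  let ?e = "\<lambda>j. (jacobi V ^^ j) (rdelta m)"
  have e: "ip (?e i) (?e j) = moment (\<lambda>n. V (n + m)) (i + j)" for i j
  proof -
    have "ip (?e i) (?e j) = ip ((jacobi V ^^ i) (?e j)) (rdelta m)"
      using ip_jacobi_pow_sym[of "rdelta m" "?e j" i V] ip_commute[of "rdelta m" "(jacobi V ^^ i) (?e j)"] by simp
    then show ?thesis by (simp add: ip_rdelta moment_shift funpow_add)
  qed
  have "(\<integral>x. (\<Sum>j\<le>n. a j * x ^ j)\<^sup>2 \<partial>\<mu>) = (\<integral>x. (\<Sum>i\<le>n. \<Sum>j\<le>n. a i * a j * x ^ (i + j)) \<partial>\<mu>)"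
    by (simp add: power2_eq_square sum_product power_add mult_ac)
  also have "\<dots> = (\<Sum>i\<le>n. \<Sum>j\<le>n. a i * a j * moment (\<lambda>n. V (n + m)) (i + j))"
    using bounded_power_integrable[OF \<mu>(1-3)] by (simp add: \<mu>(4))
  also have "\<dots> = (\<Sum>i\<le>n. a i * (\<Sum>j\<le>n. a j * ip (?e j) (?e i)))"
    by (simp add: e sum_distrib_left mult_ac add.commute)
  also have "\<dots> = (\<Sum>i\<le>n. a i * ip (?e i) (\<lambda>i. \<Sum>j\<le>n. a j * ?e j i))"
  proof (intro sum.cong refl arg_cong2[where f="(*)"])
    fix i
    show "(\<Sum>j\<le>n. a j * ip (?e j) (?e i)) = ip (?e i) (\<lambda>i. \<Sum>j\<le>n. a j * ?e j i)"
      unfolding ip_commute[of "?e i" "\<lambda>i. \<Sum>j\<le>n. a j * ?e j i"] using ip_sum[of "{..n}" ?e a "?e i"] by simp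
  qed
  also have "\<dots> = ip (\<lambda>i. \<Sum>j\<le>n. a j * ?e j i) (\<lambda>i. \<Sum>j\<le>n. a j * ?e j i)"
    using ip_sum[of "{..n}" ?e a "\<lambda>i. \<Sum>j\<le>n. a j * ?e j i"] by simp
  finally show ?thesis .
qed

text \<open>Two neighbouring sites control the next one, to the right for \<open>s = 1\<close> and
  to the left for \<open>s = - 1\<close>.\<close>

lemma (in bounded_potential) spectral_null_step:
  assumes s: "\<bar>s\<bar> = 1"
    and sp: "\<And>m. bounded_potential.is_spectral (\<lambda>n. V (n + m)) F (\<mu> m)"
    and U: "U \<in> sets borel" "measure (\<mu> 0) U = 0" "measure (\<mu> (- s)) U = 0"
  shows "measure (\<mu> s) U = 0"
proof -
  have "bounded_potential (\<lambda>n. V (n + m)) F" for m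
    using bounded_potential_axioms by (rule bounded_potential_shift)
  then have \<mu>: "prob_space (\<mu> m)" "sets (\<mu> m) = sets borel" "AE x in \<mu> m. \<bar>x\<bar> \<le> Rad" for m
    using sp[of m] bounded_potential.is_spectral_def by blast+
  show ?thesis
  proof (rule null_set_of_poly_domination[OF \<mu>[of s] \<mu>[of 0] \<mu>[of "- s"] _ U, where C="8 + 16 * F\<^sup>2"])
    fix a :: "nat \<Rightarrow> real" and n
    show "(\<integral>x. (\<Sum>j\<le>n. a j * x ^ j)\<^sup>2 \<partial>\<mu> s) \<le>
      (8 + 16 * F\<^sup>2) * ((\<integral>x. (\<Sum>j\<le>n. a j * x ^ j)\<^sup>2 \<partial>\<mu> 0) + (\<integral>x. (\<Sum>j\<le>n. a j * x ^ j)\<^sup>2 \<partial>\<mu> (- s)))"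
      unfolding spectral_poly_sq[OF sp] by (rule ip_poly_le[OF s]) simp
  qed
qed

section \<open>Potentials sampled along the rotation\<close>

abbreviation orbit_potential :: "(real \<Rightarrow> real) \<Rightarrow> real \<Rightarrow> real \<Rightarrow> int \<Rightarrow> real" where
  "orbit_potential f \<omega> \<theta> \<equiv> \<lambda>n. f (real_of_int n * \<omega> + \<theta>)"

locale bounded_sampling =
  fixes f :: "real \<Rightarrow> real" and F :: real
  assumes f_bound: "\<And>t. \<bar>f t\<bar> \<le> F" and f_measurable [measurable]: "f \<in> borel_measurable borel"
begin

lemma bounded_orbit: "bounded_potential (orbit_potential f \<omega> \<theta>) F"
  by unfold_locales (rule f_bound)

abbreviation "evolution \<omega> \<theta> \<equiv> bounded_potential.evol (orbit_potential f \<omega> \<theta>)"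
abbreviation "greens \<omega> \<theta> \<equiv> bounded_potential.green (orbit_potential f \<omega> \<theta>)"

text \<open>Existence comes from the moment construction and uniqueness from
  \<open>stieltjes_unique\<close>; together they evaluate the definite description.\<close>

lemma spectral_measure_spectral:
  "bounded_potential.is_spectral (orbit_potential f \<omega> \<theta>) F (spectral_measure f \<omega> \<theta>)"
proof -
  interpret B: bounded_potential "orbit_potential f \<omega> \<theta>" F by (rule bounded_orbit)
  obtain \<mu> where \<mu>: "B.is_spectral \<mu>" using B.spectral_exists by blast
  then have p: "prob_space \<mu>" "sets \<mu> = sets borel" by (auto simp: B.is_spectral_def)
  have g: "l2_inner (resolvent (schroedinger f \<omega> \<theta>) z (delta 0)) (delta 0) = stieltjes \<mu> z" if "Im z > 0" for z
    unfolding schroedinger_eq_jacobi l2_inner_delta B.resolvent_eq_green[OF that] B.spectral_green[OF \<mu> that] ..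
  have "spectral_measure f \<omega> \<theta> = \<mu>"
    unfolding spectral_measure_def
  proof (rule the_equality)
    show "finite_measure \<mu> \<and> sets \<mu> = sets borel \<and>
        (\<forall>z. Im z > 0 \<longrightarrow> l2_inner (resolvent (schroedinger f \<omega> \<theta>) z (delta 0)) (delta 0) = (\<integral>x. 1 / (complex_of_real x - z) \<partial>\<mu>))"
      using p g by (auto simp: stieltjes_def prob_space.finite_measure)
    fix \<nu> assume nu: "finite_measure \<nu> \<and> sets \<nu> = sets borel \<and>
        (\<forall>z. Im z > 0 \<longrightarrow> l2_inner (resolvent (schroedinger f \<omega> \<theta>) z (delta 0)) (delta 0) = (\<integral>x. 1 / (complex_of_real x - z) \<partial>\<nu>))"
    show "\<nu> = \<mu>"
    proof (rule stieltjes_unique)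
      fix z assume "Im z > 0"
      then show "stieltjes \<nu> z = stieltjes \<mu> z" using nu g[of z] by (simp add: stieltjes_def)
    qed (use nu p prob_space.finite_measure in auto)
  qed
  then show ?thesis using \<mu> by simp
qed

lemma spectral_measure_props:
  shows "prob_space (spectral_measure f \<omega> \<theta>)" "sets (spectral_measure f \<omega> \<theta>) = sets borel"
    "AE x in spectral_measure f \<omega> \<theta>. \<bar>x\<bar> \<le> 2 + F"
    "(\<integral>x. x ^ k \<partial>spectral_measure f \<omega> \<theta>) = moment (orbit_potential f \<omega> \<theta>) k"
proof -
  interpret B: bounded_potential "orbit_potential f \<omega> \<theta>" F by (rule bounded_orbit)
  show "prob_space (spectral_measure f \<omega> \<theta>)" "sets (spectral_measure f \<omega> \<theta>) = sets borel"
    "AE x in spectral_measure f \<omega> \<theta>. \<bar>x\<bar> \<le> 2 + F"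
    "(\<integral>x. x ^ k \<partial>spectral_measure f \<omega> \<theta>) = moment (orbit_potential f \<omega> \<theta>) k"
    using spectral_measure_spectral[of \<omega> \<theta>] unfolding B.is_spectral_def B.Rad_def by auto
qed

lemma jacobi_pow_measurable:
  "(\<lambda>\<theta>. (jacobi (orbit_potential f \<omega> \<theta>) ^^ k) (rdelta 0) n) \<in> borel_measurable borel"
proof (induction k arbitrary: n)
  case (Suc k)
  have "(\<lambda>\<theta>. f (real_of_int n * \<omega> + \<theta>)) \<in> borel_measurable borel" by measurable
  moreover have "(jacobi V ^^ Suc k) u n = (jacobi V ^^ k) u (n - 1) + (jacobi V ^^ k) u (n + 1) + V n * (jacobi V ^^ k) u n"
    for V and u :: "int \<Rightarrow> real" by (simp add: jacobi_def)
  ultimately show ?case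
    by (simp only:) (intro borel_measurable_add borel_measurable_times Suc)
qed simp

lemma spectral_measure_measurable:
  assumes "U \<in> sets borel"
  shows "(\<lambda>\<theta>. measure (spectral_measure f \<omega> \<theta>) U) \<in> borel_measurable borel"
  by (rule measure_measurable_of_moments[OF spectral_measure_props(1-3) _ assms])
     (simp add: spectral_measure_props(4) moment_def jacobi_pow_measurable)

text \<open>The pair \<open>\<delta>\<^sub>0, \<delta>\<^sub>1\<close> is cyclic.\<close>

lemma spectral_null_orbit:
  fixes n :: int
  assumes U: "U \<in> sets borel" and z: "measure (spectral_measure f \<omega> \<theta>) U = 0" "measure (spectral_measure f \<omega> (\<theta> + \<omega>)) U = 0"
  shows "measure (spectral_measure f \<omega> (\<theta> + real_of_int n * \<omega>)) U = 0"
proof -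
  let ?m = "\<lambda>\<theta>. measure (spectral_measure f \<omega> \<theta>) U"
  have step: "?m (\<theta> + real_of_int s * \<omega>) = 0" if "\<bar>s\<bar> = 1" "?m \<theta> = 0" "?m (\<theta> - real_of_int s * \<omega>) = 0" for \<theta> s
  proof -
    interpret B: bounded_potential "orbit_potential f \<omega> \<theta>" F by (rule bounded_orbit)
    show ?thesis
      by (rule B.spectral_null_step[OF that(1) _ U, where \<mu>="\<lambda>m. spectral_measure f \<omega> (\<theta> + real_of_int m * \<omega>)"])
         (use that spectral_measure_spectral[of \<omega> "\<theta> + real_of_int _ * \<omega>"] in \<open>auto simp: algebra_simps\<close>)
  qed
  \<comment> \<open>Each induction carries two consecutive phases, as the recursion has order
    two.\<close>
  have pos: "?m (\<theta> + real k * \<omega>) = 0 \<and> ?m (\<theta> + real (Suc k) * \<omega>) = 0" for k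
  proof (induction k)
    case (Suc k)
    then show ?case using step[of 1 "\<theta> + real (Suc k) * \<omega>"] by (simp add: algebra_simps)
  qed (use z in simp)
  have neg: "?m (\<theta> - real k * \<omega>) = 0 \<and> ?m (\<theta> + \<omega> - real k * \<omega>) = 0" for k
  proof (induction k)
    case (Suc k)
    then show ?case using step[of "- 1" "\<theta> - real k * \<omega>"] by (simp add: algebra_simps)
  qed (use z in simp)
  show ?thesis
  proof (cases "n \<ge> 0")
    case True
    then show ?thesis using pos[of "nat n"] by simp
  next
    case False
    then show ?thesis using neg[of "nat (- n)"] by simp
  qed
qed

end

context bounded_potential begin

text \<open>At height \<open>e\<close> above the real axis the Green function, as a function of the
  energy, is the Fourier transform of the damped evolution; in this form Plancherel applies.\<close>

lemma green_fourier:
  assumes "e > 0"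
  defines "G \<equiv> \<lambda>n t. indicator {0..} t *\<^sub>R (complex_of_real (exp (- e * t)) * evol t n)"
  shows "green (Complex E e) n = \<i> * (LINT t|lborel. exp (\<i> * complex_of_real (E * t)) * G n t)"
    and "integrable lborel (G n)"
    and "integrable lborel (\<lambda>t. (cmod (G n t))\<^sup>2)"
    and "(cmod (G n t))\<^sup>2 = indicator {0..} t *\<^sub>R (exp (- (2 * e) * t) * (cmod (evol t n))\<^sup>2)"
proof -
  have ex: "exp (\<i> * Complex E e * complex_of_real t) = exp (\<i> * complex_of_real (E * t)) * complex_of_real (exp (- e * t))" for t
  proof -
    have "\<i> * Complex E e * complex_of_real t = \<i> * complex_of_real (E * t) + complex_of_real (- e * t)"
      by (simp add: complex_eq_iff)
    then show ?thesis by (simp only: exp_add exp_of_real)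
  qed
  show "green (Complex E e) n = \<i> * (LINT t|lborel. exp (\<i> * complex_of_real (E * t)) * G n t)"
    unfolding green_def set_lebesgue_integral_def G_def
    unfolding ex by (intro arg_cong2[where f="(*)"] refl Bochner_Integration.integral_cong) (simp only: mult_scaleR_right mult.assoc)
  have Gm: "(\<lambda>t. complex_of_real (exp (- e * t)) * evol t n) \<in> borel_measurable borel" by measurable
  have b: "norm (complex_of_real (exp (- e * t)) * evol t n) \<le> 1 * exp (- e * t)" if "t \<ge> 0" for t
    using evol_le_1[OF that, of n] by (simp add: norm_mult mult_left_le)
  show "integrable lborel (G n)"
    using set_integrable_exp_dominated(1)[OF assms(1) Gm b] unfolding set_integrable_def G_def by simp
  show sq: "(cmod (G n t))\<^sup>2 = indicator {0..} t *\<^sub>R (exp (- (2 * e) * t) * (cmod (evol t n))\<^sup>2)" for t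
    unfolding G_def by (auto simp: norm_mult power_mult_distrib indicator_def power2_eq_square[of "exp _"] exp_add[symmetric])
  have "set_integrable lborel {0..} (\<lambda>t. exp (- (2 * e) * t) * (cmod (evol t n))\<^sup>2)"
  proof (rule set_integrable_exp_dominated(1)[of "2 * e" _ 1])
    fix t :: real assume "t \<ge> 0"
    then show "norm (exp (- (2 * e) * t) * (cmod (evol t n))\<^sup>2) \<le> 1 * exp (- (2 * e) * t)"
      using evol_le_1[of t n] by (simp add: mult_left_le power_le_one)
  qed (use assms(1) in auto)
  then show "integrable lborel (\<lambda>t. (cmod (G n t))\<^sup>2)"
    unfolding sq set_integrable_def .
qed

lemma green_measurable:
  assumes "e > 0"
  shows "(\<lambda>E. green (Complex E e) n) \<in> borel_measurable borel"
proof -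
  have [measurable]: "(exp :: complex \<Rightarrow> complex) \<in> borel_measurable borel"
    by (intro borel_measurable_continuous_onI continuous_intros)
  show ?thesis
    unfolding green_fourier(1)[OF assms] by measurable
qed

lemma green_plancherel:
  assumes "e > 0" "S \<in> sets borel" "S \<subseteq> {-R..R}"
  shows "(\<integral>\<^sup>+E\<in>S. ennreal ((cmod (green (Complex E e) n))\<^sup>2) \<partial>lborel) \<le>
    ennreal (2 * pi * (LINT t:{0..}|lborel. exp (- (2 * e) * t) * (cmod (evol t n))\<^sup>2))"
  unfolding green_fourier(1)[OF assms(1)] set_lebesgue_integral_def green_fourier(4)[OF assms(1), symmetric] norm_mult norm_ii mult_1
  by (rule plancherel_le[OF green_fourier(2,3)[OF assms(1)] assms(2,3)])

end

section \<open>Unimodular matrices\<close>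

text \<open>Submultiplicative and within a factor 4 of the operator norm
  (\<open>onorm_mnorm\<close>), so the exponential growth rate is the same while entrywise estimates
  become direct.\<close>

definition mnorm :: "complex ^ 2 ^ 2 \<Rightarrow> real" where
  "mnorm A = cmod (A $ 1 $ 1) + cmod (A $ 1 $ 2) + cmod (A $ 2 $ 1) + cmod (A $ 2 $ 2)"

lemma matrix_mult_2:
  fixes A B :: "complex ^ 2 ^ 2"
  shows "(A ** B) $ i $ j = A $ i $ 1 * B $ 1 $ j + A $ i $ 2 * B $ 2 $ j"
  by (simp add: matrix_matrix_mult_def sum_2)

lemma mnorm_nonneg: "mnorm A \<ge> 0" by (simp add: mnorm_def)

lemma mnorm_entry: "cmod (A $ i $ j) \<le> mnorm A"
  using exhaust_2[of i] exhaust_2[of j] by (auto simp: mnorm_def)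

lemma mnorm_triangle: "mnorm (A + B) \<le> mnorm A + mnorm B"
  unfolding mnorm_def vector_add_component
  using norm_triangle_ineq[of "A $ 1 $ 1" "B $ 1 $ 1"] norm_triangle_ineq[of "A $ 1 $ 2" "B $ 1 $ 2"]
    norm_triangle_ineq[of "A $ 2 $ 1" "B $ 2 $ 1"] norm_triangle_ineq[of "A $ 2 $ 2" "B $ 2 $ 2"] by linarith

lemma mnorm_triangle_sub: "mnorm A \<le> mnorm B + mnorm (A - B)"
  using mnorm_triangle[of B "A - B"] by simp

lemma mnorm_minus_commute: "mnorm (A - B) = mnorm (B - A)"
  by (simp add: mnorm_def norm_minus_commute)

lemma mnorm_mult: "mnorm (A ** B) \<le> mnorm A * mnorm B"
proof -
  have e: "cmod ((A ** B) $ i $ j) \<le> cmod (A $ i $ 1) * cmod (B $ 1 $ j) + cmod (A $ i $ 2) * cmod (B $ 2 $ j)" for i j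
    unfolding matrix_mult_2 using norm_triangle_ineq[of "A $ i $ 1 * B $ 1 $ j" "A $ i $ 2 * B $ 2 $ j"]
    by (simp add: norm_mult)
  let ?a = "\<lambda>i j. cmod (A $ i $ j)" and ?b = "\<lambda>i j. cmod (B $ i $ j)"
  have "mnorm A * mnorm B = (?a 1 1 * ?b 1 1 + ?a 1 2 * ?b 2 1) + (?a 1 1 * ?b 1 2 + ?a 1 2 * ?b 2 2)
      + (?a 2 1 * ?b 1 1 + ?a 2 2 * ?b 2 1) + (?a 2 1 * ?b 1 2 + ?a 2 2 * ?b 2 2)
      + ((?a 1 1 + ?a 2 1) * (?b 2 1 + ?b 2 2) + (?a 1 2 + ?a 2 2) * (?b 1 1 + ?b 1 2))"
    by (simp add: mnorm_def algebra_simps)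
  moreover have "0 \<le> (?a 1 1 + ?a 2 1) * (?b 2 1 + ?b 2 2) + (?a 1 2 + ?a 2 2) * (?b 1 1 + ?b 1 2)" by simp
  ultimately show ?thesis
    using e[of 1 1] e[of 1 2] e[of 2 1] e[of 2 2] unfolding mnorm_def[of "A ** B"] by linarith
qed

text \<open>With entries \<open>a\<close>, \<open>b\<close>, \<open>c\<close>, \<open>d\<close>,
  unimodularity gives \<open>1 \<le> |a d| + |b c|\<close>, and the squared norm is at least four
  times this. The bound keeps logarithms of norms nonnegative.\<close>

lemma mnorm_ge_2:
  assumes "det A = 1" shows "mnorm A \<ge> 2"
proof -
  let ?a = "cmod (A $ 1 $ 1)" and ?b = "cmod (A $ 1 $ 2)" and ?c = "cmod (A $ 2 $ 1)" and ?d = "cmod (A $ 2 $ 2)"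
  have "1 = cmod (A $ 1 $ 1 * A $ 2 $ 2 - A $ 1 $ 2 * A $ 2 $ 1)" using assms by (simp add: det_2)
  also have "\<dots> \<le> ?a * ?d + ?b * ?c"
    using norm_triangle_ineq4[of "A $ 1 $ 1 * A $ 2 $ 2" "A $ 1 $ 2 * A $ 2 $ 1"] by (simp add: norm_mult)
  finally have 1: "1 \<le> ?a * ?d + ?b * ?c" .
  define R where "R = (?a - ?d)\<^sup>2 + (?b - ?c)\<^sup>2 + 2 * (?a + ?d) * (?b + ?c)"
  define S where "S = ?a * ?d + ?b * ?c"
  have "(mnorm A)\<^sup>2 = 4 * S + R"
    by (simp add: mnorm_def power2_eq_square algebra_simps R_def S_def)
  moreover have "0 \<le> R" by (simp add: R_def)
  moreover have "1 \<le> S" using 1 by (simp add: S_def)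
  ultimately have "4 \<le> (mnorm A)\<^sup>2" by linarith
  then have "2\<^sup>2 \<le> (mnorm A)\<^sup>2" by simp
  then show ?thesis using mnorm_nonneg by (rule power2_le_imp_le)
qed

text \<open>The adjugate: for determinant 1 the inverse, and of the same
  \<open>mnorm\<close>.\<close>

definition adj2 :: "complex ^ 2 ^ 2 \<Rightarrow> complex ^ 2 ^ 2" where
  "adj2 A = vector [vector [A $ 2 $ 2, - A $ 1 $ 2], vector [- A $ 2 $ 1, A $ 1 $ 1]]"

lemma adj2_entries [simp]:
  "adj2 A $ 1 $ 1 = A $ 2 $ 2" "adj2 A $ 1 $ 2 = - A $ 1 $ 2" "adj2 A $ 2 $ 1 = - A $ 2 $ 1" "adj2 A $ 2 $ 2 = A $ 1 $ 1"
  by (simp_all add: adj2_def vector_2)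

lemma mat2_eqI:
  fixes A B :: "complex ^ 2 ^ 2"
  assumes "A $ 1 $ 1 = B $ 1 $ 1" "A $ 1 $ 2 = B $ 1 $ 2" "A $ 2 $ 1 = B $ 2 $ 1" "A $ 2 $ 2 = B $ 2 $ 2"
  shows "A = B"
  using assms by (simp add: vec_eq_iff forall_2)

lemma mnorm_adj2: "mnorm (adj2 A) = mnorm A" by (simp add: mnorm_def)

lemma adj2_mult: "adj2 (A ** B) = adj2 B ** adj2 A"
  by (rule mat2_eqI) (simp_all add: matrix_mult_2 algebra_simps)

lemma mat1_entries [simp]:
  "(mat 1 :: complex ^ 2 ^ 2) $ 1 $ 1 = 1" "(mat 1 :: complex ^ 2 ^ 2) $ 1 $ 2 = 0"
  "(mat 1 :: complex ^ 2 ^ 2) $ 2 $ 1 = 0" "(mat 1 :: complex ^ 2 ^ 2) $ 2 $ 2 = 1"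
  by (simp_all add: mat_def)

lemma mult_adj2: "det A = 1 \<Longrightarrow> A ** adj2 A = mat 1"
  by (rule mat2_eqI) (simp_all add: matrix_mult_2 det_2 algebra_simps)

text \<open>A unimodular matrix and its inverse have equal norm, so a large left factor forces the
  product or the right factor to be large.\<close>

lemma mnorm_left_factor:
  assumes "det B = 1" shows "mnorm A \<le> mnorm (A ** B) * mnorm B"
proof -
  have "A = (A ** B) ** adj2 B"
    by (simp add: matrix_mul_assoc[symmetric] mult_adj2[OF assms] matrix_mul_rid)
  then show ?thesis using mnorm_mult[of "A ** B" "adj2 B"] by (simp add: mnorm_adj2)
qed

definition outer2 :: "complex \<Rightarrow> complex \<Rightarrow> complex \<Rightarrow> complex \<Rightarrow> complex ^ 2 ^ 2" where
  "outer2 x1 x2 y1 y2 = vector [vector [x1 * y1, x1 * y2], vector [x2 * y1, x2 * y2]]"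

lemma outer2_entries [simp]:
  "outer2 x1 x2 y1 y2 $ 1 $ 1 = x1 * y1" "outer2 x1 x2 y1 y2 $ 1 $ 2 = x1 * y2"
  "outer2 x1 x2 y1 y2 $ 2 $ 1 = x2 * y1" "outer2 x1 x2 y1 y2 $ 2 $ 2 = x2 * y2"
  by (simp_all add: outer2_def vector_2)

lemma mnorm_outer2: "mnorm (outer2 x1 x2 y1 y2) = (cmod x1 + cmod x2) * (cmod y1 + cmod y2)"
  by (simp add: mnorm_def norm_mult algebra_simps)

text \<open>If \<open>b\<close> is an entry of a unimodular \<open>B\<close>, then \<open>b B\<close> differs from the product of the column and
  the row through \<open>b\<close> by a matrix with a single nonzero entry, which is \<open>\<plusminus> 1\<close>.\<close>

lemma rank_one_plus_unit:
  fixes B :: "complex ^ 2 ^ 2"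
  assumes "det B = 1"
  shows "\<exists>E. mnorm E = 1 \<and>
    (\<forall>i j. B $ r $ s * B $ i $ j = B $ i $ s * B $ r $ j + E $ i $ j)"
proof -
  define E where "E = (\<chi> i j. B $ r $ s * B $ i $ j - B $ i $ s * B $ r $ j)"
  have d: "B $ 1 $ 1 * B $ 2 $ 2 = 1 + B $ 1 $ 2 * B $ 2 $ 1" using assms by (simp add: det_2 algebra_simps)
  have "mnorm E = 1"
    using exhaust_2[of r] exhaust_2[of s] d by (auto simp: E_def mnorm_def algebra_simps)
  then show ?thesis by (intro exI[of _ E]) (simp add: E_def)
qed

lemma max_entry_exists:
  fixes B :: "complex ^ 2 ^ 2"
  shows "\<exists>r s. \<forall>i j. cmod (B $ i $ j) \<le> cmod (B $ r $ s)"
proof -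
  let ?S = "range (\<lambda>(i, j). cmod (B $ i $ j))"
  have "finite ?S" by simp
  moreover have "?S \<noteq> {}" by simp
  ultimately have "Max ?S \<in> ?S" by (rule Max_in)
  then obtain x where x: "Max ?S = (case x of (i, j) \<Rightarrow> cmod (B $ i $ j))" by blast
  obtain r s where "x = (r, s)" by (cases x)
  with x have "Max ?S = cmod (B $ r $ s)" by simp
  then have "cmod (B $ i $ j) \<le> cmod (B $ r $ s)" for i j
    using Max_ge[OF \<open>finite ?S\<close>, of "cmod (B $ i $ j)"] by force
  then show ?thesis by blast
qed

text \<open>Let \<open>b\<close> be the largest entry of \<open>B\<close>, at \<open>(r, s)\<close>.
  Then \<open>b A B P\<close> is column \<open>s\<close> of \<open>A B\<close> times row
  \<open>r\<close> of \<open>B P\<close>, up to \<open>A E P\<close>. Column and row inherit the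
  sizes of \<open>A B\<close> and \<open>B P\<close> up to a factor 1/4 each; half of the resulting
  1/16 pays for the error, whence 32, and \<open>cmod b \<le> \<beta>\<close> is divided
  out.\<close>

lemma avalanche_step:
  fixes A B P :: "complex ^ 2 ^ 2"
  assumes dB: "det B = 1"
    and nA: "mnorm A \<le> \<beta>" and nB: "mnorm B \<le> \<beta>" and nAB: "mnorm (A ** B) \<ge> \<alpha>"
    and \<alpha>: "\<alpha> \<ge> 32 * \<beta>" and \<beta>: "\<beta> > 0"
    and grow: "mnorm (B ** P) \<ge> \<alpha> / (32 * \<beta>) * mnorm P"
  shows "mnorm (A ** (B ** P)) \<ge> \<alpha> / (32 * \<beta>) * mnorm (B ** P)"
proof -
  obtain r s where max: "\<And>i j. cmod (B $ i $ j) \<le> cmod (B $ r $ s)" using max_entry_exists[of B] by blast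
  obtain E where E: "mnorm E = 1" "\<And>i j. B $ r $ s * B $ i $ j = B $ i $ s * B $ r $ j + E $ i $ j"
    using rank_one_plus_unit[OF dB, of r s] by blast
  define b where "b = B $ r $ s"
  define col where "col = cmod ((A ** B) $ 1 $ s) + cmod ((A ** B) $ 2 $ s)"
  define row where "row = cmod ((B ** P) $ r $ 1) + cmod ((B ** P) $ r $ 2)"
  define p where "p = mnorm (B ** P)"
  have \<alpha>0: "\<alpha> > 0" using \<alpha> \<beta> by linarith
  have b\<beta>: "cmod b \<le> \<beta>" using mnorm_entry[of B r s] nB by (simp add: b_def)
  have "\<alpha> \<le> mnorm A * mnorm B" using nAB mnorm_mult[of A B] by linarith
  also have "\<dots> \<le> \<beta> * mnorm B" using nA mnorm_nonneg[of B] by (rule mult_right_mono)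
  finally have "\<alpha> / \<beta> \<le> mnorm B" using \<beta> by (simp add: field_simps)
  also have "mnorm B \<le> 4 * cmod b" using max[of 1 1] max[of 1 2] max[of 2 1] max[of 2 2] by (simp add: mnorm_def b_def)
  finally have b4: "\<alpha> / (4 * \<beta>) \<le> cmod b" using \<beta> by (simp add: field_simps)
  have "0 < \<alpha> / (4 * \<beta>)" using \<alpha>0 \<beta> by simp
  then have b0: "cmod b > 0" using b4 by linarith
  have b8: "cmod b \<ge> 8"
  proof -
    have "8 = 32 * \<beta> / (4 * \<beta>)" using \<beta> by simp
    also have "\<dots> \<le> \<alpha> / (4 * \<beta>)" using \<alpha> \<beta> by (intro divide_right_mono) auto
    finally show ?thesis using b4 by linarith
  qed
  have sc: "mnorm (\<chi> i j. b * X $ i $ j) = cmod b * mnorm X" for X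
    by (simp add: mnorm_def norm_mult algebra_simps)
  have Eb: "b * B $ i $ j = B $ i $ s * B $ r $ j + E $ i $ j" for i j using E(2) by (simp add: b_def)
  have e1: "(\<chi> i j. b * (A ** B) $ i $ j) = outer2 ((A ** B) $ 1 $ s) ((A ** B) $ 2 $ s) (B $ r $ 1) (B $ r $ 2) + A ** E"
  proof -
    have "b * (A ** B) $ i $ j = (A ** B) $ i $ s * B $ r $ j + (A ** E) $ i $ j" for i j
    proof -
      have "b * (A ** B) $ i $ j = A $ i $ 1 * (b * B $ 1 $ j) + A $ i $ 2 * (b * B $ 2 $ j)"
        by (simp add: matrix_mult_2 algebra_simps)
      then show ?thesis unfolding Eb by (simp add: matrix_mult_2 algebra_simps)
    qed
    then show ?thesis by (intro mat2_eqI) simp_all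
  qed
  have e2: "(\<chi> i j. b * (B ** P) $ i $ j) = outer2 (B $ 1 $ s) (B $ 2 $ s) ((B ** P) $ r $ 1) ((B ** P) $ r $ 2) + E ** P"
  proof -
    have "b * (B ** P) $ i $ j = B $ i $ s * (B ** P) $ r $ j + (E ** P) $ i $ j" for i j
    proof -
      have "b * (B ** P) $ i $ j = (b * B $ i $ 1) * P $ 1 $ j + (b * B $ i $ 2) * P $ 2 $ j"
        by (simp add: matrix_mult_2 algebra_simps)
      then show ?thesis unfolding Eb by (simp add: matrix_mult_2 algebra_simps)
    qed
    then show ?thesis by (intro mat2_eqI) simp_all
  qed
  have e3: "(\<chi> i j. b * (A ** (B ** P)) $ i $ j) =
      outer2 ((A ** B) $ 1 $ s) ((A ** B) $ 2 $ s) ((B ** P) $ r $ 1) ((B ** P) $ r $ 2) + A ** (E ** P)"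
  proof -
    have k: "b * (B ** P) $ i $ j = B $ i $ s * (B ** P) $ r $ j + (E ** P) $ i $ j" for i j
    proof -
      have "b * (B ** P) $ i $ j = (b * B $ i $ 1) * P $ 1 $ j + (b * B $ i $ 2) * P $ 2 $ j"
        by (simp add: matrix_mult_2 algebra_simps)
      then show ?thesis unfolding Eb by (simp add: matrix_mult_2 algebra_simps)
    qed
    have "b * (A ** (B ** P)) $ i $ j = (A ** B) $ i $ s * (B ** P) $ r $ j + (A ** (E ** P)) $ i $ j" for i j
    proof -
      have "b * (A ** (B ** P)) $ i $ j = A $ i $ 1 * (b * (B ** P) $ 1 $ j) + A $ i $ 2 * (b * (B ** P) $ 2 $ j)"
        unfolding matrix_mult_2[of A "B ** P"] by (simp add: algebra_simps)
      then show ?thesis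
        unfolding k matrix_mult_2[of A B] matrix_mult_2[of A "E ** P"] by (simp add: algebra_simps)
    qed
    then show ?thesis by (intro mat2_eqI) simp_all
  qed
  \<comment> \<open>In the rank one expression for \<open>b * (A ** B)\<close> the row of
    \<open>B\<close> has size at most \<open>2 * cmod b\<close>, so the column has to be
    large.\<close>
  have col: "col \<ge> \<alpha> / 4"
  proof -
    have "cmod b * mnorm (A ** B) \<le> col * (cmod (B $ r $ 1) + cmod (B $ r $ 2)) + mnorm (A ** E)"
      unfolding sc[symmetric] e1 col_def mnorm_outer2[symmetric] by (rule mnorm_triangle)
    also have "\<dots> \<le> col * (2 * cmod b) + \<beta> * 1"
    proof (rule add_mono)
      show "col * (cmod (B $ r $ 1) + cmod (B $ r $ 2)) \<le> col * (2 * cmod b)"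
        using max[of r 1] max[of r 2] by (intro mult_left_mono) (auto simp: col_def b_def)
      show "mnorm (A ** E) \<le> \<beta> * 1"
        using mnorm_mult[of A E] nA E(1) by simp
    qed
    finally have "cmod b * \<alpha> \<le> cmod b * (2 * col) + \<beta>"
      using mult_left_mono[OF nAB, of "cmod b"] by (simp add: mult_ac)
    moreover have "\<beta> \<le> cmod b * (\<alpha> / 2)"
    proof -
      have "1 * \<beta> \<le> cmod b * (\<alpha> / 2)" using b8 \<alpha> \<beta> by (intro mult_mono) auto
      then show ?thesis by simp
    qed
    ultimately have "cmod b * (\<alpha> / 2) \<le> cmod b * (2 * col)" by (simp add: algebra_simps)
    then show ?thesis using b0 by simp
  qed
  \<comment> \<open>The growth hypothesis enters here: the error \<open>E ** P\<close> is at most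
    \<open>mnorm P\<close>, hence at most \<open>p\<close>, and \<open>cmod b \<ge> 8\<close> makes
    that negligible.\<close>
  have row: "row \<ge> p / 4"
  proof -
    have "cmod b * p \<le> (cmod (B $ 1 $ s) + cmod (B $ 2 $ s)) * row + mnorm (E ** P)"
      unfolding p_def sc[symmetric] e2 row_def mnorm_outer2[symmetric] by (rule mnorm_triangle)
    also have "\<dots> \<le> (2 * cmod b) * row + mnorm P"
    proof (rule add_mono)
      show "(cmod (B $ 1 $ s) + cmod (B $ 2 $ s)) * row \<le> (2 * cmod b) * row"
        using max[of 1 s] max[of 2 s] by (intro mult_right_mono) (auto simp: row_def b_def)
      show "mnorm (E ** P) \<le> mnorm P"
        using mnorm_mult[of E P] E(1) by simp
    qed
    also have "mnorm P \<le> cmod b * (p / 2)"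
    proof -
      have "1 * mnorm P \<le> \<alpha> / (32 * \<beta>) * mnorm P" using \<alpha> \<beta> mnorm_nonneg[of P] by (intro mult_right_mono) auto
      then have "mnorm P \<le> p" using grow by (simp add: p_def)
      also have "p = 2 * (p / 2)" by simp
      also have "\<dots> \<le> cmod b * (p / 2)"
        using b8 mnorm_nonneg[of "B ** P"] by (intro mult_right_mono) (auto simp: p_def)
      finally show ?thesis .
    qed
    finally have "cmod b * (p / 2) \<le> cmod b * (2 * row)" by (simp add: algebra_simps)
    then show ?thesis using b0 by simp
  qed
  have p0: "p \<ge> 0" by (simp add: p_def mnorm_nonneg)
  have "col * row - \<beta> * mnorm P \<le> cmod b * mnorm (A ** (B ** P))"
  proof -
    have "col * row = mnorm (outer2 ((A ** B) $ 1 $ s) ((A ** B) $ 2 $ s) ((B ** P) $ r $ 1) ((B ** P) $ r $ 2))"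
      by (simp add: mnorm_outer2 col_def row_def)
    also have "\<dots> \<le> mnorm (\<chi> i j. b * (A ** (B ** P)) $ i $ j) +
        mnorm (outer2 ((A ** B) $ 1 $ s) ((A ** B) $ 2 $ s) ((B ** P) $ r $ 1) ((B ** P) $ r $ 2) - (\<chi> i j. b * (A ** (B ** P)) $ i $ j))"
      by (rule mnorm_triangle_sub)
    also have "mnorm (outer2 ((A ** B) $ 1 $ s) ((A ** B) $ 2 $ s) ((B ** P) $ r $ 1) ((B ** P) $ r $ 2) - (\<chi> i j. b * (A ** (B ** P)) $ i $ j)) = mnorm (A ** (E ** P))"
      unfolding e3 by (subst mnorm_minus_commute) simp
    also have "\<dots> \<le> \<beta> * mnorm P"
    proof -
      have "mnorm (A ** (E ** P)) \<le> mnorm A * mnorm (E ** P)" by (rule mnorm_mult)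
      also have "\<dots> \<le> \<beta> * mnorm P"
        using nA mnorm_mult[of E P] E(1) \<beta> by (intro mult_mono) (auto simp: mnorm_nonneg)
      finally show ?thesis .
    qed
    finally show ?thesis unfolding sc by simp
  qed
  moreover have "cmod b * mnorm (A ** (B ** P)) \<le> \<beta> * mnorm (A ** (B ** P))"
    using b\<beta> mnorm_nonneg by (rule mult_right_mono)
  moreover have "(\<alpha> / 4) * (p / 4) \<le> col * row"
    using col row p0 \<alpha>0 by (intro mult_mono) (auto simp: col_def)
  moreover have "\<beta> * mnorm P \<le> \<alpha> * p / 32"
  proof -
    have "32 * mnorm P \<le> \<alpha> / \<beta> * mnorm P"
      using \<alpha> \<beta> mnorm_nonneg[of P] by (intro mult_right_mono) (auto simp: field_simps)
    also have "\<dots> \<le> 32 * p" using grow \<beta> by (simp add: p_def field_simps)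
    finally have "mnorm P \<le> p" by simp
    then have "\<beta> * mnorm P \<le> \<beta> * p" using \<beta> by (intro mult_left_mono) auto
    also have "\<dots> \<le> \<alpha> / 32 * p" using \<alpha> p0 by (intro mult_right_mono) auto
    finally show ?thesis by simp
  qed
  ultimately have "\<alpha> * p / 32 \<le> \<beta> * mnorm (A ** (B ** P))" by (simp add: field_simps)
  then show ?thesis using \<beta> by (simp add: p_def field_simps)
qed

text \<open>\<open>Q i\<close> is the product of the first \<open>i\<close> blocks.\<close>

lemma avalanche:
  fixes B Q :: "nat \<Rightarrow> complex ^ 2 ^ 2"
  assumes d: "\<And>i. i < M \<Longrightarrow> det (B i) = 1"
    and nB: "\<And>i. i < M \<Longrightarrow> mnorm (B i) \<le> \<beta>"
    and nBB: "\<And>i. i < M \<Longrightarrow> mnorm (C i ** B i) \<ge> \<alpha>" and nC: "\<And>i. i < M \<Longrightarrow> mnorm (C i) \<le> \<beta>"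
    and C: "\<And>i. Suc i < M \<Longrightarrow> C i = B (Suc i)"
    and Q: "Q 0 = mat 1" "\<And>i. i < M \<Longrightarrow> Q (Suc i) = B i ** Q i"
    and \<alpha>: "\<alpha> \<ge> 32 * \<beta>" and \<beta>: "\<beta> > 0"
  shows "i \<le> M \<Longrightarrow> mnorm (Q i) \<ge> (\<alpha> / (32 * \<beta>)) ^ i"
proof -
  have \<alpha>0: "\<alpha> > 0" using \<alpha> \<beta> by linarith
  have step: "mnorm (Q (Suc i)) \<ge> \<alpha> / (32 * \<beta>) * mnorm (Q i)" if "i < M" for i
    using that
  proof (induction i)
    case 0
    \<comment> \<open>\<open>C 0\<close> stands in for \<open>B 1\<close>, which for
      \<open>M = 1\<close> is outside the range of the hypotheses on \<open>B\<close>.\<close>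
    have "\<alpha> \<le> mnorm (C 0) * mnorm (B 0)" using nBB[OF 0] mnorm_mult[of "C 0" "B 0"] by linarith
    also have "\<dots> \<le> \<beta> * mnorm (B 0)" using nC[OF 0] mnorm_nonneg by (rule mult_right_mono)
    finally have "\<alpha> / \<beta> \<le> mnorm (B 0)" using \<beta> by (simp add: field_simps)
    moreover have "\<alpha> / (32 * \<beta>) * 2 \<le> \<alpha> / \<beta>" using \<alpha>0 \<beta> by (simp add: field_simps)
    moreover have "mnorm (mat 1) = 2" by (simp add: mnorm_def)
    ultimately show ?case using Q(1) Q(2)[OF 0] by (simp add: matrix_mul_rid)
  next
    case (Suc i)
    have i: "i < M" using Suc.prems by simp
    have "mnorm (B (Suc i) ** (B i ** Q i)) \<ge> \<alpha> / (32 * \<beta>) * mnorm (B i ** Q i)"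
    proof (rule avalanche_step[OF d[OF i] _ nB[OF i] _ \<alpha> \<beta>])
      show "mnorm (B (Suc i)) \<le> \<beta>" by (rule nB[OF Suc.prems])
      show "mnorm (B (Suc i) ** B i) \<ge> \<alpha>" using nBB[OF i] C[OF Suc.prems] by simp
      show "mnorm (B i ** Q i) \<ge> \<alpha> / (32 * \<beta>) * mnorm (Q i)" using Suc.IH[OF i] Q(2)[OF i] by simp
    qed
    then show ?case using Q(2)[OF i] Q(2)[OF Suc.prems] by simp
  qed
  show "i \<le> M \<Longrightarrow> mnorm (Q i) \<ge> (\<alpha> / (32 * \<beta>)) ^ i"
  proof (induction i)
    case 0
    show ?case using Q(1) by (simp add: mnorm_def)
  next
    case (Suc i)
    then have "(\<alpha> / (32 * \<beta>)) ^ Suc i \<le> \<alpha> / (32 * \<beta>) * mnorm (Q i)"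
      using \<alpha>0 \<beta> unfolding power_Suc by (intro mult_left_mono) auto
    also have "\<dots> \<le> mnorm (Q (Suc i))" using Suc.prems by (intro step) simp
    finally show ?case .
  qed
qed

section \<open>Comparison with the operator norm\<close>

lemma norm_mat2_vector: "norm (A *v v) \<le> mnorm A * norm v" for A :: "complex ^ 2 ^ 2"
proof -
  have c: "cmod ((A *v v) $ i) \<le> (cmod (A $ i $ 1) + cmod (A $ i $ 2)) * norm v" for i
  proof -
    have "(A *v v) $ i = A $ i $ 1 * v $ 1 + A $ i $ 2 * v $ 2"
      by (simp add: matrix_vector_mult_def sum_2)
    then have "cmod ((A *v v) $ i) \<le> cmod (A $ i $ 1) * cmod (v $ 1) + cmod (A $ i $ 2) * cmod (v $ 2)"
      using norm_triangle_ineq[of "A $ i $ 1 * v $ 1" "A $ i $ 2 * v $ 2"] by (simp add: norm_mult)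
    also have "\<dots> \<le> cmod (A $ i $ 1) * norm v + cmod (A $ i $ 2) * norm v"
      by (intro add_mono mult_left_mono Finite_Cartesian_Product.norm_nth_le) auto
    finally show ?thesis by (simp add: algebra_simps)
  qed
  have "norm (A *v v) \<le> (\<Sum>i\<in>UNIV. cmod ((A *v v) $ i))"
    unfolding norm_vec_def by (rule L2_set_le_sum) simp
  also have "\<dots> \<le> mnorm A * norm v"
    using c[of 1] c[of 2] by (simp add: sum_2 mnorm_def algebra_simps)
  finally show ?thesis .
qed

lemma bounded_linear_mat2: "bounded_linear (\<lambda>v. A *v v)" for A :: "complex ^ 2 ^ 2"
proof (rule bounded_linear_intro)
  show "A *v (x + y) = A *v x + A *v y" for x y by (simp add: matrix_vector_right_distrib)
  show "A *v (r *\<^sub>R x) = r *\<^sub>R (A *v x)" for r x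
    by (simp add: vec_eq_iff matrix_vector_mult_def scaleR_sum_right)
  show "norm (A *v x) \<le> norm x * mnorm A" for x using norm_mat2_vector[of A x] by (simp add: mult.commute)
qed

lemma onorm_mnorm:
  fixes A :: "complex ^ 2 ^ 2"
  shows "onorm (\<lambda>v. A *v v) \<le> mnorm A" "mnorm A \<le> 4 * onorm (\<lambda>v. A *v v)"
proof -
  show "onorm (\<lambda>v. A *v v) \<le> mnorm A" by (rule onorm_bound[OF mnorm_nonneg norm_mat2_vector])
  have e: "cmod (A $ i $ j) \<le> onorm (\<lambda>v. A *v v)" for i j
  proof -
    have "A $ i $ j = (A *v axis j 1) $ i"
      by (simp add: matrix_vector_mult_def axis_def if_distrib cong: if_cong)
    then have "cmod (A $ i $ j) \<le> norm (A *v axis j 1)"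
      using Finite_Cartesian_Product.norm_nth_le[of "A *v axis j 1" i] by simp
    also have "\<dots> \<le> onorm (\<lambda>v. A *v v) * norm (axis j 1 :: complex ^ 2)" by (rule onorm[OF bounded_linear_mat2])
    also have "norm (axis j 1 :: complex ^ 2) = 1"
      using exhaust_2[of j] by (auto simp: norm_vec_def L2_set_def sum_2 axis_def)
    finally show ?thesis by simp
  qed
  show "mnorm A \<le> 4 * onorm (\<lambda>v. A *v v)"
    using e[of 1 1] e[of 1 2] e[of 2 1] e[of 2 2] by (simp add: mnorm_def)
qed

lemma onorm_mat2_lipschitz:
  fixes A B :: "complex ^ 2 ^ 2"
  shows "\<bar>onorm (\<lambda>v. A *v v) - onorm (\<lambda>v. B *v v)\<bar> \<le> mnorm (A - B)"
proof -
  have h: "onorm (\<lambda>v. A *v v) \<le> onorm (\<lambda>v. B *v v) + mnorm (A - B)" for A B :: "complex ^ 2 ^ 2"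
  proof -
    have "onorm (\<lambda>v. A *v v) = onorm (\<lambda>v. B *v v + (A - B) *v v)"
      by (simp add: matrix_vector_mult_add_rdistrib[symmetric])
    also have "\<dots> \<le> onorm (\<lambda>v. B *v v) + onorm (\<lambda>v. (A - B) *v v)"
      by (rule onorm_triangle[OF bounded_linear_mat2 bounded_linear_mat2])
    finally show ?thesis using onorm_mnorm(1)[of "A - B"] by linarith
  qed
  show ?thesis using h[of A B] h[of B A] mnorm_minus_commute[of A B] by linarith
qed

lemma onorm_mat2_measurable:
  fixes A :: "'a \<Rightarrow> complex ^ 2 ^ 2"
  assumes m: "\<And>i j. (\<lambda>x. A x $ i $ j) \<in> borel_measurable M"
  shows "(\<lambda>x. onorm (\<lambda>v. A x *v v)) \<in> borel_measurable M"
proof -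
  \<comment> \<open>Matrices are parametrised by nested pairs, whose measurability follows from that
    of the entries; it remains to see that the norm is continuous in them.\<close>
  define T where "T = (\<lambda>p :: (complex \<times> complex) \<times> (complex \<times> complex).
    vector [vector [fst (fst p), snd (fst p)], vector [fst (snd p), snd (snd p)]] :: complex ^ 2 ^ 2)"
  have T: "T p $ 1 $ 1 = fst (fst p)" "T p $ 1 $ 2 = snd (fst p)" "T p $ 2 $ 1 = fst (snd p)" "T p $ 2 $ 2 = snd (snd p)" for p
    by (simp_all add: T_def vector_2)
  have "continuous_on UNIV (\<lambda>p. onorm (\<lambda>v. T p *v v))"
    unfolding continuous_on_def
  proof (intro ballI, rule LIM_zero_cancel, rule Lim_null_comparison)
    fix p :: "(complex \<times> complex) \<times> (complex \<times> complex)"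
    show "\<forall>\<^sub>F q in at p within UNIV. norm (onorm (\<lambda>v. T q *v v) - onorm (\<lambda>v. T p *v v)) \<le>
      cmod (fst (fst q) - fst (fst p)) + cmod (snd (fst q) - snd (fst p)) + cmod (fst (snd q) - fst (snd p)) + cmod (snd (snd q) - snd (snd p))"
      using onorm_mat2_lipschitz[of "T _" "T p"] by (intro always_eventually allI) (simp add: mnorm_def T)
    have "((\<lambda>q. cmod (fst (fst q) - fst (fst p)) + cmod (snd (fst q) - snd (fst p)) + cmod (fst (snd q) - fst (snd p)) + cmod (snd (snd q) - snd (snd p)))
      \<longlongrightarrow> cmod (fst (fst p) - fst (fst p)) + cmod (snd (fst p) - snd (fst p)) + cmod (fst (snd p) - fst (snd p)) + cmod (snd (snd p) - snd (snd p))) (at p within UNIV)"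
      by (intro tendsto_intros)
    then show "((\<lambda>q. cmod (fst (fst q) - fst (fst p)) + cmod (snd (fst q) - snd (fst p)) + cmod (fst (snd q) - fst (snd p)) + cmod (snd (snd q) - snd (snd p)))
      \<longlongrightarrow> 0) (at p within UNIV)" by simp
  qed
  then have "(\<lambda>x. onorm (\<lambda>v. T ((A x $ 1 $ 1, A x $ 1 $ 2), (A x $ 2 $ 1, A x $ 2 $ 2)) *v v)) \<in> borel_measurable M"
    by (rule borel_measurable_continuous_on) (intro borel_measurable_Pair m)
  moreover have "T ((A x $ 1 $ 1, A x $ 1 $ 2), (A x $ 2 $ 1, A x $ 2 $ 2)) = A x" for x
    by (rule mat2_eqI) (simp_all add: T)
  ultimately show ?thesis by simp
qed

section \<open>Lyapunov exponents\<close>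

text \<open>Fekete's lemma for nonnegative sequences, where the infimum is finite. That the limit is
  a lower bound at every index is used later for lower deviations.\<close>

lemma fekete:
  fixes a :: "nat \<Rightarrow> real"
  assumes nonneg: "\<And>k. a k \<ge> 0" and sub: "\<And>k l. a (k + l) \<le> a k + a l"
  shows "\<exists>L. (\<lambda>k. a k / real k) \<longlonglongrightarrow> L \<and> (\<forall>k>0. L \<le> a k / real k)"
proof -
  define S where "S = (\<lambda>k. a (Suc k) / real (Suc k)) ` UNIV"
  define L where "L = Inf S"
  have bdd: "bdd_below S" unfolding S_def by (rule bdd_belowI[of _ 0]) (auto simp: nonneg)
  have le: "L \<le> a k / real k" if "k > 0" for k
  proof -
    have "a k / real k \<in> S" using that unfolding S_def by (intro image_eqI[of _ _ "k - 1"]) auto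
    then show ?thesis unfolding L_def using bdd by (rule cInf_lower)
  qed
  have mult: "a (q * m + r) \<le> real q * a m + a r" for q m r
  proof (induction q)
    case (Suc q)
    have "a (Suc q * m + r) \<le> a m + a (q * m + r)" using sub[of m "q * m + r"] by (simp add: add.assoc)
    then show ?case using Suc by (simp add: algebra_simps)
  qed simp
  have "(\<lambda>k. a k / real k) \<longlonglongrightarrow> L"
  proof (rule LIMSEQ_I)
    fix e :: real assume e: "e > 0"
    obtain m where m: "m > 0" "a m / real m < L + e / 2"
    proof -
      have "Inf S < L + e / 2" using e by (simp add: L_def)
      then obtain y where "y \<in> S" "y < L + e / 2" using cInf_less_iff[of S "L + e / 2"] bdd by (auto simp: S_def)
      then obtain x where "a (Suc x) / real (Suc x) < L + e / 2" by (auto simp: S_def)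
      then show thesis using that[of "Suc x"] by simp
    qed
    define C where "C = (\<Sum>r<m. a r)"
    have C: "a r \<le> C" if "r < m" for r
      unfolding C_def by (rule member_le_sum) (use that nonneg in auto)
    have C0: "C \<ge> 0" unfolding C_def by (intro sum_nonneg nonneg)
    have "\<forall>\<^sub>F k in sequentially. norm (a k / real k - L) < e"
      using eventually_gt_at_top[of "nat \<lceil>2 * C / e\<rceil>"]
    proof eventually_elim
      case (elim k)
      then have k: "k > 0" "real k > 2 * C / e" by linarith+
      define q r where "q = k div m" and "r = k mod m"
      have kqr: "k = q * m + r" "r < m" using m(1) by (auto simp: q_def r_def)
      have "real q * a m = (real q * real m) * (a m / real m)" using m(1) by simp
      also have "\<dots> \<le> real k * (a m / real m)"
      proof (rule mult_right_mono)
        have "q * m \<le> k" using kqr(1) by linarith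
        then show "real q * real m \<le> real k" by (metis of_nat_le_iff of_nat_mult)
        show "0 \<le> a m / real m" by (simp add: nonneg)
      qed
      finally have "a k \<le> real k * (a m / real m) + C"
        using mult[of q m r] C[OF kqr(2)] kqr(1) by simp
      then have "a k / real k \<le> a m / real m + C / real k" using k(1) by (simp add: field_simps)
      moreover have "C / real k < e / 2" using k e by (simp add: field_simps)
      ultimately have "a k / real k < L + e" using m(2) by linarith
      then show ?case using le[OF k(1)] by simp
    qed
    then show "\<exists>no. \<forall>n\<ge>no. norm (a n / real n - L) < e" unfolding eventually_sequentially .
  qed
  then show ?thesis using le by blast
qed

lemma transfer_entries [simp]:
  "transfer_matrix f z \<theta> $ 1 $ 1 = z - complex_of_real (f \<theta>)" "transfer_matrix f z \<theta> $ 1 $ 2 = - 1"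
  "transfer_matrix f z \<theta> $ 2 $ 1 = 1" "transfer_matrix f z \<theta> $ 2 $ 2 = 0"
  by (simp_all add: transfer_matrix_def vector_2)

lemma det_cocycle: "det (cocycle f \<omega> z k \<theta>) = 1"
  by (induction k) (simp_all add: det_mul, simp add: det_2)

lemma cocycle_add:
  "cocycle f \<omega> z (k + l) \<theta> = cocycle f \<omega> z k (\<theta> + real l * \<omega>) ** cocycle f \<omega> z l \<theta>"
  by (induction k) (simp_all add: matrix_mul_lid matrix_mul_assoc algebra_simps)

definition swap2 :: "complex ^ 2 ^ 2 \<Rightarrow> complex ^ 2 ^ 2" where
  "swap2 A = vector [vector [A $ 2 $ 2, A $ 2 $ 1], vector [A $ 1 $ 2, A $ 1 $ 1]]"

lemma swap2_entries [simp]: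
  "swap2 A $ 1 $ 1 = A $ 2 $ 2" "swap2 A $ 1 $ 2 = A $ 2 $ 1" "swap2 A $ 2 $ 1 = A $ 1 $ 2" "swap2 A $ 2 $ 2 = A $ 1 $ 1"
  by (simp_all add: swap2_def vector_2)

lemma swap2_mult: "swap2 (A ** B) = swap2 A ** swap2 B"
  by (rule mat2_eqI) (simp_all add: matrix_mult_2 algebra_simps)

text \<open>Conjugation by the coordinate swap turns a transfer matrix into its inverse; so moving to the left
  along the orbit is the same as moving to the right with frequency \<open>-\<omega>\<close>.\<close>

lemma cocycle_uminus:
  "cocycle f (- \<omega>) z k (\<theta> - \<omega>) = swap2 (adj2 (cocycle f \<omega> z k (\<theta> - real k * \<omega>)))"
proof (induction k)
  case 0
  show ?case by (rule mat2_eqI) simp_all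
next
  case (Suc k)
  have T: "swap2 (adj2 (transfer_matrix f z \<theta>)) = transfer_matrix f z \<theta>" for \<theta>
    by (rule mat2_eqI) simp_all
  have "cocycle f \<omega> z (Suc k) (\<theta> - real (Suc k) * \<omega>) =
      cocycle f \<omega> z k (\<theta> - real k * \<omega>) ** transfer_matrix f z (\<theta> - real (Suc k) * \<omega>)"
    using cocycle_add[of f \<omega> z k 1 "\<theta> - real (Suc k) * \<omega>"] by (simp add: matrix_mul_rid algebra_simps)
  then show ?case
    by (simp add: adj2_mult swap2_mult T Suc algebra_simps)
qed

lemma mnorm_cocycle_uminus:
  "mnorm (cocycle f (- \<omega>) z k (\<theta> - \<omega>)) = mnorm (cocycle f \<omega> z k (\<theta> - real k * \<omega>))"
  unfolding cocycle_uminus by (simp add: mnorm_def)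

lemma mnorm_cocycle_ge: "mnorm (cocycle f \<omega> z k \<theta>) \<ge> 2"
  by (rule mnorm_ge_2[OF det_cocycle])

definition lognorm :: "(real \<Rightarrow> real) \<Rightarrow> real \<Rightarrow> complex \<Rightarrow> nat \<Rightarrow> real \<Rightarrow> real" where
  "lognorm f \<omega> z k \<theta> = ln (mnorm (cocycle f \<omega> z k \<theta>))"

lemma lognorm_nonneg: "lognorm f \<omega> z k \<theta> \<ge> 0"
  unfolding lognorm_def using mnorm_cocycle_ge[of f \<omega> z k \<theta>] by (intro ln_ge_zero) linarith

lemma exp_lognorm: "exp (lognorm f \<omega> z k \<theta>) = mnorm (cocycle f \<omega> z k \<theta>)"
  unfolding lognorm_def using mnorm_cocycle_ge[of f \<omega> z k \<theta>] by simp

lemma lognorm_add: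
  "lognorm f \<omega> z (k + l) \<theta> \<le> lognorm f \<omega> z k (\<theta> + real l * \<omega>) + lognorm f \<omega> z l \<theta>"
proof -
  have "exp (lognorm f \<omega> z (k + l) \<theta>) \<le> exp (lognorm f \<omega> z k (\<theta> + real l * \<omega>) + lognorm f \<omega> z l \<theta>)"
    unfolding exp_add exp_lognorm cocycle_add by (rule mnorm_mult)
  then show ?thesis by simp
qed

locale hoelder_sampling = bounded_sampling f F for f :: "real \<Rightarrow> real" and F :: real +
  fixes K g :: real
  assumes f_periodic: "periodic1 f" and finite_discont: "finite (discont f \<inter> {0..<1})" and K: "K \<ge> 0" and g: "g > 0"
    and hoelder: "\<And>t h. h > 0 \<Longrightarrow> discont f = {} \<or> infdist t (discont f) > h \<Longrightarrow> \<bar>f (t + h) - f t\<bar> \<le> K * h powr g"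
begin

lemma cocycle_periodic: "cocycle f \<omega> z k (\<theta> + real_of_int m) = cocycle f \<omega> z k \<theta>"
proof (induction k)
  case (Suc k)
  have "transfer_matrix f z (\<theta> + real_of_int m + real k * \<omega>) = transfer_matrix f z (\<theta> + real k * \<omega>)"
    using periodic1_int[OF f_periodic, of "\<theta> + real k * \<omega>" m] by (simp add: transfer_matrix_def algebra_simps)
  then show ?case using Suc by simp
qed simp

lemma lognorm_periodic: "periodic1 (lognorm f \<omega> z k)"
  unfolding periodic1_def lognorm_def using cocycle_periodic[of \<omega> z k _ 1] by simp

lemma cocycle_measurable: "(\<lambda>\<theta>. cocycle f \<omega> z k \<theta> $ i $ j) \<in> borel_measurable borel"
proof (induction k arbitrary: i j)
  case 0
  show ?case by simp
next
  case (Suc k)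
  have T: "(\<lambda>\<theta>. transfer_matrix f z (\<theta> + real k * \<omega>) $ i $ l) \<in> borel_measurable borel" for i l
  proof -
    have "(\<lambda>\<theta>. complex_of_real (f (\<theta> + real k * \<omega>))) \<in> borel_measurable borel" by measurable
    then show ?thesis using exhaust_2[of i] exhaust_2[of l] by auto
  qed
  show ?case
    unfolding cocycle.simps matrix_mult_2 by (intro borel_measurable_add borel_measurable_times T Suc)
qed

lemma lognorm_measurable [measurable]: "lognorm f \<omega> z k \<in> borel_measurable borel"
  unfolding lognorm_def mnorm_def
  by (intro borel_measurable_ln borel_measurable_add measurable_compose[OF cocycle_measurable borel_measurable_norm])

lemma F_nonneg: "F \<ge> 0" using f_bound[of 0] by linarith

lemma mnorm_transfer: "cmod z \<le> Z \<Longrightarrow> mnorm (transfer_matrix f z \<theta>) \<le> Z + F + 2"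
  using norm_triangle_ineq4[of z "complex_of_real (f \<theta>)"] f_bound[of \<theta>] by (simp add: mnorm_def)

lemma mnorm_cocycle_le: "cmod z \<le> Z \<Longrightarrow> mnorm (cocycle f \<omega> z k \<theta>) \<le> 2 * (Z + F + 2) ^ k"
proof (induction k)
  case 0
  show ?case by (simp add: mnorm_def)
next
  case (Suc k)
  have "Z \<ge> 0" using Suc.prems norm_ge_zero[of z] by linarith
  have "mnorm (cocycle f \<omega> z (Suc k) \<theta>) \<le> mnorm (transfer_matrix f z (\<theta> + real k * \<omega>)) * mnorm (cocycle f \<omega> z k \<theta>)"
    by (simp add: mnorm_mult)
  also have "\<dots> \<le> (Z + F + 2) * (2 * (Z + F + 2) ^ k)"
    using \<open>Z \<ge> 0\<close> F_nonneg by (intro mult_mono mnorm_transfer Suc) (auto simp: mnorm_nonneg)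
  finally show ?case by simp
qed

lemma lognorm_le: "cmod z \<le> Z \<Longrightarrow> lognorm f \<omega> z k \<theta> \<le> ln 2 + real k * ln (Z + F + 2)"
proof -
  assume z: "cmod z \<le> Z"
  then have pos: "Z + F + 2 > 0" using F_nonneg norm_ge_zero[of z] by linarith
  have "lognorm f \<omega> z k \<theta> \<le> ln (2 * (Z + F + 2) ^ k)"
    unfolding lognorm_def using mnorm_cocycle_le[OF z, of \<omega> k \<theta>] mnorm_cocycle_ge[of f \<omega> z k \<theta>] pos
    by (subst ln_le_cancel_iff) auto
  also have "\<dots> = ln 2 + real k * ln (Z + F + 2)" using pos by (simp add: ln_mult ln_realpow)
  finally show ?thesis .
qed

lemma lognorm_abs_le: "\<bar>lognorm f \<omega> z k \<theta>\<bar> \<le> ln 2 + real k * ln (cmod z + F + 2)"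
  using lognorm_le[of z "cmod z" \<omega> k \<theta>] lognorm_nonneg[of f \<omega> z k \<theta>] by simp

lemma lognorm_integrable: "integrable circ (\<lambda>x. lognorm f \<omega> z k (x + t))"
  by (rule circ_integrable[of _ "ln 2 + real k * ln (cmod z + F + 2)"]) (use lognorm_abs_le in auto)

definition mean_log :: "real \<Rightarrow> complex \<Rightarrow> nat \<Rightarrow> real" where
  "mean_log \<omega> z k = (\<integral>\<theta>. lognorm f \<omega> z k \<theta> \<partial>circ)"

lemma mean_log_shift: "(\<integral>\<theta>. lognorm f \<omega> z k (\<theta> + t) \<partial>circ) = mean_log \<omega> z k"
  unfolding mean_log_def by (rule circ_integral_shift[OF _ lognorm_periodic lognorm_abs_le]) simp

lemma mean_log_nonneg: "mean_log \<omega> z k \<ge> 0"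
  unfolding mean_log_def by (intro Bochner_Integration.integral_nonneg lognorm_nonneg)

lemma mean_log_add: "mean_log \<omega> z (k + l) \<le> mean_log \<omega> z k + mean_log \<omega> z l"
proof -
  have "mean_log \<omega> z (k + l) \<le> (\<integral>\<theta>. lognorm f \<omega> z k (\<theta> + real l * \<omega>) + lognorm f \<omega> z l \<theta> \<partial>circ)"
    unfolding mean_log_def
    by (intro integral_mono) (use lognorm_integrable[of \<omega> z _ 0] lognorm_integrable lognorm_add in auto)
  also have "\<dots> = mean_log \<omega> z k + mean_log \<omega> z l"
    using lognorm_integrable[of \<omega> z l 0] lognorm_integrable[of \<omega> z k "real l * \<omega>"] mean_log_shift[of \<omega> z k "real l * \<omega>"]
    by (simp add: mean_log_def)
  finally show ?thesis .
qed

text \<open>Reversing the frequency only shifts the phase of the cocycle, up to operations that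
  preserve \<open>mnorm\<close>.\<close>

lemma mean_log_uminus: "mean_log (- \<omega>) z k = mean_log \<omega> z k"
proof -
  have "mean_log (- \<omega>) z k = (\<integral>\<theta>. lognorm f (- \<omega>) z k (\<theta> + - \<omega>) \<partial>circ)"
    by (rule mean_log_shift[symmetric])
  also have "\<dots> = (\<integral>\<theta>. lognorm f \<omega> z k (\<theta> + - real k * \<omega>) \<partial>circ)"
    unfolding lognorm_def using mnorm_cocycle_uminus[of f \<omega> z k] by simp
  also have "\<dots> = mean_log \<omega> z k" by (rule mean_log_shift)
  finally show ?thesis .
qed

text \<open>Subadditivity makes the limit exist. Passing from \<open>mnorm\<close> to the operator
  norm changes the logarithm by at most \<open>ln 4\<close>, which disappears after division by
  \<open>k\<close>.\<close>

lemma lyapunov_limit: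
  "(\<lambda>k. mean_log \<omega> z k / real k) \<longlonglongrightarrow> lyapunov f \<omega> z"
  and lyapunov_le: "k > 0 \<Longrightarrow> lyapunov f \<omega> z \<le> mean_log \<omega> z k / real k"
proof -
  obtain L where L: "(\<lambda>k. mean_log \<omega> z k / real k) \<longlonglongrightarrow> L" "\<And>k. k > 0 \<Longrightarrow> L \<le> mean_log \<omega> z k / real k"
    using fekete[of "mean_log \<omega> z", OF mean_log_nonneg mean_log_add] by blast
  let ?o = "\<lambda>k \<theta>. onorm (\<lambda>v. cocycle f \<omega> z k \<theta> *v v)"
  let ?O = "\<lambda>k. set_lebesgue_integral lborel {0..<1} (\<lambda>\<theta>. ln (?o k \<theta>))"
  have o: "?o k \<theta> \<ge> 1 / 2" "\<bar>ln (?o k \<theta>) - lognorm f \<omega> z k \<theta>\<bar> \<le> ln 4" for k \<theta>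
  proof -
    let ?A = "cocycle f \<omega> z k \<theta>"
    have m: "mnorm ?A \<ge> 2" by (rule mnorm_cocycle_ge)
    show o: "?o k \<theta> \<ge> 1 / 2" using onorm_mnorm(2)[of ?A] m by linarith
    have "ln (?o k \<theta>) \<le> ln (mnorm ?A)" using onorm_mnorm(1)[of ?A] o m by (subst ln_le_cancel_iff) linarith+
    moreover have "ln (mnorm ?A) \<le> ln (4 * ?o k \<theta>)" using onorm_mnorm(2)[of ?A] o m by (subst ln_le_cancel_iff) linarith+
    moreover have "ln (4 * ?o k \<theta>) = ln 4 + ln (?o k \<theta>)" using o by (intro ln_mult_pos) linarith+
    moreover have "ln 4 \<ge> (0::real)" by simp
    ultimately show "\<bar>ln (?o k \<theta>) - lognorm f \<omega> z k \<theta>\<bar> \<le> ln 4" unfolding lognorm_def by linarith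
  qed
  have om: "?o k \<in> borel_measurable borel" for k
    by (rule onorm_mat2_measurable[OF cocycle_measurable])
  have lm: "(\<lambda>\<theta>. ln (?o k \<theta>)) \<in> borel_measurable borel" for k
    using om[of k] by measurable
  have lb: "\<bar>ln (?o k \<theta>)\<bar> \<le> ln 4 + (ln 2 + real k * ln (cmod z + F + 2))" for k \<theta>
    using o(2)[of k \<theta>] lognorm_abs_le[of \<omega> z k \<theta>] by linarith
  have "\<bar>?O k - mean_log \<omega> z k\<bar> \<le> ln 4" for k
  proof -
    have i: "integrable circ (\<lambda>\<theta>. ln (?o k \<theta>))" by (rule circ_integrable[OF lm lb])
    have "?O k - mean_log \<omega> z k = (\<integral>\<theta>. ln (?o k \<theta>) - lognorm f \<omega> z k \<theta> \<partial>circ)"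
      using i lognorm_integrable[of \<omega> z k 0] unfolding mean_log_def integral_circ[OF lm, symmetric] by simp
    also have "\<bar>\<dots>\<bar> \<le> (\<integral>\<theta>. ln 4 \<partial>circ)"
      using i lognorm_integrable[of \<omega> z k 0] o(2) unfolding real_norm_def[symmetric]
      by (intro Bochner_Integration.integral_norm_bound_integral) auto
    finally show ?thesis by simp
  qed
  then have d: "\<bar>?O k / real k - mean_log \<omega> z k / real k\<bar> \<le> ln 4 / real k" for k
    unfolding diff_divide_distrib[symmetric] abs_divide by (simp add: divide_right_mono)
  have "(\<lambda>k. ln 4 / real k) \<longlonglongrightarrow> 0"
    by (intro tendsto_divide_0[OF tendsto_const] filterlim_at_top_imp_at_infinity filterlim_real_sequentially)
  then have "(\<lambda>k. ?O k / real k - mean_log \<omega> z k / real k) \<longlonglongrightarrow> 0"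
    by (rule Lim_null_comparison[rotated]) (use d in auto)
  from tendsto_add[OF this L(1)] have "(\<lambda>k. (1 / real k) * ?O k) \<longlonglongrightarrow> L" by simp
  then have "lyapunov f \<omega> z = L" unfolding lyapunov_def by (rule limI)
  then show "(\<lambda>k. mean_log \<omega> z k / real k) \<longlonglongrightarrow> lyapunov f \<omega> z"
    "k > 0 \<Longrightarrow> lyapunov f \<omega> z \<le> mean_log \<omega> z k / real k" using L by auto
qed

lemma lyapunov_uminus: "lyapunov f (- \<omega>) z = lyapunov f \<omega> z"
  using LIMSEQ_unique[OF lyapunov_limit[of "- \<omega>" z]] lyapunov_limit[of \<omega> z] by (simp add: mean_log_uminus)

text \<open>The term \<open>ln 2\<close> is the logarithm of \<open>mnorm (mat 1)\<close>, from the
  empty product.\<close>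

lemma lognorm_mult_le:
  "lognorm f \<omega> z (q * m) \<theta> \<le> (\<Sum>i<q. lognorm f \<omega> z m (\<theta> + real i * (real m * \<omega>))) + ln 2"
proof (induction q)
  case 0
  show ?case by (simp add: lognorm_def mnorm_def)
next
  case (Suc q)
  have "lognorm f \<omega> z (m + q * m) \<theta> \<le> lognorm f \<omega> z m (\<theta> + real (q * m) * \<omega>) + lognorm f \<omega> z (q * m) \<theta>"
    by (rule lognorm_add)
  then show ?case using Suc by (simp add: mult.assoc)
qed

section \<open>Deviations of the cocycle in measure\<close>

lemma mean_ergodic_prob:
  assumes irr: "\<omega> \<notin> \<rat>" and [measurable]: "\<phi> \<in> borel_measurable borel" and p: "periodic1 \<phi>"
    and b: "\<And>x. \<bar>\<phi> x\<bar> \<le> B" and "d > 0" "e > 0"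
  shows "\<forall>\<^sub>F k in sequentially. measure circ {x. \<bar>birkhoff \<omega> \<phi> k x - (\<integral>y. \<phi> y \<partial>circ)\<bar> \<ge> d} \<le> e"
  using mean_ergodic[OF irr assms(2) p b, of "d * e"] assms(5,6)
proof (simp, elim eventually_mono)
  fix k
  let ?h = "\<lambda>x. \<bar>birkhoff \<omega> \<phi> k x - (\<integral>y. \<phi> y \<partial>circ)\<bar>"
  assume le: "(\<integral>\<^sup>+x. ennreal (?h x) \<partial>circ) \<le> ennreal (d * e)"
  have "ennreal d * emeasure circ {x. ?h x \<ge> d} = (\<integral>\<^sup>+x. ennreal d * indicator {x. ?h x \<ge> d} x \<partial>circ)"
    by (rule nn_integral_cmult_indicator[symmetric]) measurable
  also have "\<dots> \<le> (\<integral>\<^sup>+x. ennreal (?h x) \<partial>circ)"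
    by (intro nn_integral_mono) (auto simp: indicator_def intro: ennreal_leI)
  also note le
  finally have "ennreal (d * measure circ {x. ?h x \<ge> d}) \<le> ennreal (d * e)"
    using \<open>d > 0\<close> by (simp add: circ.emeasure_eq_measure ennreal_mult)
  then show "measure circ {x. d \<le> ?h x} \<le> e"
    using \<open>d > 0\<close> \<open>e > 0\<close> by (subst (asm) ennreal_le_iff) auto
qed

text \<open>Subadditivity over blocks of a fixed length \<open>m\<close>, whose normalised mean is
  already close to the exponent, reduces the claim to the mean ergodic theorem for the rotation by
  \<open>m * \<omega>\<close>.\<close>

lemma lognorm_upper_deviation:
  assumes irr: "\<omega> \<notin> \<rat>" and d: "d > 0" and e: "e > 0"
  shows "\<forall>\<^sub>F k in sequentially. measure circ {x. lognorm f \<omega> z k x > real k * (lyapunov f \<omega> z + d)} \<le> e"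
proof -
  let ?L = "lyapunov f \<omega> z" and ?G = "ln (cmod z + F + 2)"
  have G: "?G \<ge> 0" using F_nonneg by simp
  have "\<forall>\<^sub>F m in sequentially. mean_log \<omega> z m / real m < ?L + d / 4"
    using order_tendstoD(2)[OF lyapunov_limit, of \<omega> z "?L + d / 4"] d by simp
  then have "\<forall>\<^sub>F m in sequentially. m > 0 \<and> mean_log \<omega> z m / real m < ?L + d / 4"
    using eventually_gt_at_top[of 0] by eventually_elim simp
  then obtain m where m: "m > 0" "mean_log \<omega> z m / real m < ?L + d / 4"
    by (auto simp: eventually_sequentially)
  have irrm: "real m * \<omega> \<notin> \<rat>"
  proof
    assume "real m * \<omega> \<in> \<rat>"
    then have "real m * \<omega> / real m \<in> \<rat>" by (intro Rats_divide) auto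
    then show False using irr m(1) by simp
  qed
  let ?A = "birkhoff (real m * \<omega>) (lognorm f \<omega> z m)"
  \<comment> \<open>Pays for the incomplete block and for the \<open>ln 2\<close> of
    \<open>lognorm_mult_le\<close>.\<close>
  define C where "C = 2 * ln 2 + real m * ?G"
  have "\<forall>\<^sub>F q in sequentially. measure circ {x. \<bar>?A q x - mean_log \<omega> z m\<bar> \<ge> d / 2 * real m} \<le> e"
    unfolding mean_log_def using m(1) d e
    by (intro mean_ergodic_prob[OF irrm _ lognorm_periodic lognorm_abs_le]) auto
  then obtain Q where Q: "\<And>q. q \<ge> Q \<Longrightarrow> measure circ {x. \<bar>?A q x - mean_log \<omega> z m\<bar> \<ge> d / 2 * real m} \<le> e"
    unfolding eventually_sequentially by blast
  show ?thesis
    using eventually_ge_at_top[of "m * Suc Q"] eventually_gt_at_top[of "nat \<lceil>4 * C / d\<rceil>"]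
  proof eventually_elim
    case (elim k)
    define q r where "q = k div m" and "r = k mod m"
    have kqr: "k = r + q * m" "r < m" using m(1) by (auto simp: q_def r_def)
    have "Suc Q * m div m \<le> k div m" using elim(1) by (intro div_le_mono) (simp add: mult.commute)
    then have q: "q \<ge> Suc Q" using m(1) by (simp add: q_def)
    then have q0: "real q > 0" by simp
    have kC: "real k > 4 * C / d" using elim(2) by linarith
    have "{x. lognorm f \<omega> z k x > real k * (?L + d)} \<subseteq> {x. \<bar>?A q x - mean_log \<omega> z m\<bar> \<ge> d / 2 * real m}"
    proof (intro subsetI CollectI)
      fix x assume "x \<in> {x. lognorm f \<omega> z k x > real k * (?L + d)}"
      then have x: "lognorm f \<omega> z k x > real k * (?L + d)" by simp
      have "lognorm f \<omega> z k x \<le> lognorm f \<omega> z r (x + real (q * m) * \<omega>) + lognorm f \<omega> z (q * m) x"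
        unfolding kqr(1) by (rule lognorm_add)
      moreover have "lognorm f \<omega> z r (x + real (q * m) * \<omega>) \<le> ln 2 + real m * ?G"
      proof -
        have "real r * ?G \<le> real m * ?G" using kqr(2) G by (intro mult_right_mono) auto
        then show ?thesis using lognorm_abs_le[of \<omega> z r "x + real (q * m) * \<omega>"] by linarith
      qed
      moreover have "(\<Sum>i<q. lognorm f \<omega> z m (x + real i * (real m * \<omega>))) = real q * ?A q x"
        using q0 by (simp add: birkhoff_def)
      ultimately have 1: "real k * (?L + d) < real q * ?A q x + C"
        using x lognorm_mult_le[of \<omega> z q m x] unfolding C_def by linarith
      have "real q * mean_log \<omega> z m = real q * real m * (mean_log \<omega> z m / real m)" using m(1) by simp
      also have "\<dots> \<le> real k * (mean_log \<omega> z m / real m)"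
      proof (rule mult_right_mono)
        have "q * m \<le> k" using kqr(1) by linarith
        then show "real q * real m \<le> real k" by (metis of_nat_le_iff of_nat_mult)
        show "0 \<le> mean_log \<omega> z m / real m" by (simp add: mean_log_nonneg)
      qed
      also have "\<dots> \<le> real k * (?L + d / 4)" using m(2) by (intro mult_left_mono) auto
      finally have 2: "real q * mean_log \<omega> z m \<le> real k * (?L + d / 4)" .
      have 3: "C < real k * d / 4" using kC d by (simp add: field_simps)
      have "real q * (?A q x - mean_log \<omega> z m) > real k * (d / 2)"
        using 1 2 3 by (simp add: algebra_simps)
      moreover have "real k * (d / 2) \<ge> real q * real m * (d / 2)"
      proof (rule mult_right_mono)
        have "q * m \<le> k" using kqr(1) by linarith
        then show "real q * real m \<le> real k" by (metis of_nat_le_iff of_nat_mult)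
      qed (use d in simp)
      ultimately have "real q * (real m * (d / 2)) < real q * (?A q x - mean_log \<omega> z m)"
        by (simp add: mult.assoc)
      then have "real m * (d / 2) < ?A q x - mean_log \<omega> z m" using q0 by simp
      moreover have "d / 2 * real m = real m * (d / 2)" by simp
      ultimately show "\<bar>?A q x - mean_log \<omega> z m\<bar> \<ge> d / 2 * real m" by linarith
    qed
    then have "measure circ {x. lognorm f \<omega> z k x > real k * (?L + d)} \<le> measure circ {x. \<bar>?A q x - mean_log \<omega> z m\<bar> \<ge> d / 2 * real m}"
      by (rule circ.finite_measure_mono) measurable
    also have "\<dots> \<le> e" by (rule Q) (use q in simp)
    finally show ?case .
  qed
qed

text \<open>The mean of \<open>lognorm\<close> is at least \<open>k\<close> times the exponent,
  while values well above this are rare and bounded by \<open>k * G\<close>. Values far below must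
  then be rare too, or the mean would drop.\<close>

lemma lognorm_lower_deviation:
  assumes irr: "\<omega> \<notin> \<rat>" and d: "d > 0" and e: "e > 0"
  shows "\<forall>\<^sub>F k in sequentially. measure circ {x. lognorm f \<omega> z k x < real k * (lyapunov f \<omega> z - d)} \<le> e"
proof -
  let ?L = "lyapunov f \<omega> z"
  define G where "G = ln 2 + ln (cmod z + F + 2)"
  have G: "G > 0" using F_nonneg by (simp add: G_def add_pos_nonneg)
  define d' where "d' = d * e / 2"
  have d': "d' > 0" using d e by (simp add: d'_def)
  have L0: "0 \<le> ?L"
    using LIMSEQ_le_const[OF lyapunov_limit, of 0 \<omega> z] mean_log_nonneg by auto
  have "\<forall>\<^sub>F k in sequentially. measure circ {x. lognorm f \<omega> z k x > real k * (?L + d')} \<le> d * e / (2 * G)"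
    by (rule lognorm_upper_deviation[OF irr d']) (use d e G in simp)
  then show ?thesis using eventually_gt_at_top[of 0]
  proof eventually_elim
    case (elim k)
    then have k: "k > 0" by simp
    let ?low = "{x. lognorm f \<omega> z k x < real k * (?L - d)}" and ?high = "{x. real k * (?L + d') < lognorm f \<omega> z k x}"
    have h: "measure circ ?high \<le> d * e / (2 * G)" using elim by simp
    have sets [measurable]: "?low \<in> sets borel" "?high \<in> sets borel" by measurable
    define u where "u = (\<lambda>x. real k * ((?L + d') - (d + d') * indicator ?low x + G * indicator ?high x))"
    have ind: "integrable circ (indicator A :: real \<Rightarrow> real)" if "A \<in> sets borel" for A
      by (rule circ_integrable[of _ 1]) (use that in auto)
    note ii = ind[OF sets(1)] ind[OF sets(2)]
    have iu: "integrable circ u"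
      unfolding u_def
      by (intro integrable_mult_right Bochner_Integration.integrable_add Bochner_Integration.integrable_diff ii circ.integrable_const)
    have XG: "lognorm f \<omega> z k x \<le> real k * G" for x
    proof -
      have "1 * ln 2 \<le> real k * ln (2::real)" by (rule mult_right_mono) (use k in auto)
      moreover have "real k * G = real k * ln 2 + real k * ln (cmod z + F + 2)" by (simp add: G_def distrib_left)
      ultimately show ?thesis using lognorm_abs_le[of \<omega> z k x] by linarith
    qed
    have lh: "real k * (?L - d) \<le> real k * (?L + d')" using d d' by (intro mult_left_mono) auto
    have le: "lognorm f \<omega> z k x \<le> u x" for x
    proof -
      consider "x \<in> ?high" "x \<notin> ?low" | "x \<in> ?low" "x \<notin> ?high" | "x \<notin> ?low" "x \<notin> ?high" using lh by force
      then show ?thesis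
      proof cases
        case 1
        then have "u x = real k * (?L + d') + real k * G" by (simp add: u_def distrib_left)
        moreover have "0 \<le> real k * (?L + d')" using L0 d' by simp
        ultimately show ?thesis using XG[of x] by linarith
      next
        case 2
        then have "u x = real k * (?L - d)" by (simp add: u_def)
        then show ?thesis using 2 by simp
      next
        case 3
        then have "u x = real k * (?L + d')" by (simp add: u_def)
        then show ?thesis using 3 by simp
      qed
    qed
    have "mean_log \<omega> z k \<le> (\<integral>x. u x \<partial>circ)"
      unfolding mean_log_def by (rule integral_mono[OF _ iu le]) (use lognorm_integrable[of \<omega> z k 0] in simp)
    also have "\<dots> = real k * ((?L + d') - (d + d') * measure circ ?low + G * measure circ ?high)"
      unfolding u_def using ii sets by simp
    finally have "real k * ?L \<le> real k * ((?L + d') - (d + d') * measure circ ?low + G * measure circ ?high)"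
      using lyapunov_le[OF k, of \<omega> z] k by (simp add: field_simps)
    then have "?L \<le> (?L + d') - (d + d') * measure circ ?low + G * measure circ ?high" using k by simp
    moreover have "G * measure circ ?high \<le> d * e / 2"
      using mult_left_mono[OF h, of G] G by simp
    moreover have "d * measure circ ?low \<le> (d + d') * measure circ ?low" using d' by (intro mult_right_mono) auto
    ultimately have "d * measure circ ?low \<le> d * e" unfolding d'_def by linarith
    then show ?case using d by simp
  qed
qed

end

section \<open>Uniform growth of the cocycle\<close>

lemma discont_periodic:
  assumes "periodic1 f"
  shows "t + real_of_int m \<in> discont f \<longleftrightarrow> t \<in> discont f"
proof -
  have "f (t + real_of_int m + h) = f (t + h)" for h
    using periodic1_int[OF assms, of "t + h" m] by (simp add: algebra_simps)
  then have "isCont f (t + real_of_int m) = isCont f t"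
    using periodic1_int[OF assms, of t m] unfolding isCont_iff by simp
  then show ?thesis by (simp add: discont_def)
qed

context hoelder_sampling begin

lemma infdist_discont_periodic: "infdist (x + real_of_int m) (discont f) = infdist x (discont f)"
proof -
  have "dist (x + real_of_int m) ` discont f = dist x ` discont f"
  proof (intro equalityI subsetI)
    fix y assume "y \<in> dist (x + real_of_int m) ` discont f"
    then obtain t where t: "t \<in> discont f" "y = dist (x + real_of_int m) t" by auto
    then have "t + real_of_int (- m) \<in> discont f" using discont_periodic[OF f_periodic] by blast
    moreover have "y = dist x (t + real_of_int (- m))" using t by (simp add: dist_real_def)
    ultimately show "y \<in> dist x ` discont f" by blast
  next
    fix y assume "y \<in> dist x ` discont f"
    then obtain t where t: "t \<in> discont f" "y = dist x t" by auto
    then have "t + real_of_int m \<in> discont f" using discont_periodic[OF f_periodic] by blast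
    moreover have "y = dist (x + real_of_int m) (t + real_of_int m)" using t by (simp add: dist_real_def)
    ultimately show "y \<in> dist (x + real_of_int m) ` discont f" by blast
  qed
  then show ?thesis by (simp add: infdist_def)
qed

text \<open>The Hoelder hypothesis is based at the left point. If this is \<open>t'\<close>, its
  distance to the discontinuities is only known to exceed \<open>r\<close>; hence the margin
  \<open>2 * r\<close> at \<open>t\<close>.\<close>

lemma hoelder_close:
  assumes "\<bar>t' - t\<bar> \<le> r" "discont f = {} \<or> infdist t (discont f) > 2 * r" "r > 0"
  shows "\<bar>f t' - f t\<bar> \<le> K * r powr g"
proof -
  have mono: "K * h powr g \<le> K * r powr g" if "0 < h" "h \<le> r" for h
    using that K g by (intro mult_left_mono powr_mono2) auto
  consider "t' = t" | "t' > t" | "t' < t" by linarith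
  then show ?thesis
  proof cases
    case 1
    then show ?thesis using K by simp
  next
    case 2
    have "\<bar>f (t + (t' - t)) - f t\<bar> \<le> K * (t' - t) powr g"
      by (rule hoelder) (use 2 assms in auto)
    then show ?thesis using mono[of "t' - t"] 2 assms(1) by simp
  next
    case 3
    have "discont f = {} \<or> infdist t' (discont f) > t - t'"
      using assms infdist_triangle[of t "discont f" t'] 3 by (auto simp: dist_real_def)
    then have "\<bar>f (t' + (t - t')) - f t'\<bar> \<le> K * (t - t') powr g"
      by (intro hoelder) (use 3 in auto)
    then show ?thesis using mono[of "t - t'"] 3 assms(1) by (simp add: abs_minus_commute)
  qed
qed

text \<open>The first condition keeps the set empty for continuous \<open>f\<close>, where
  \<open>infdist x {} = 0\<close>.\<close>

definition near_discont :: "real \<Rightarrow> real set" where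
  "near_discont s = {x. discont f \<noteq> {} \<and> infdist x (discont f) \<le> s}"

lemma near_discont_borel [measurable]: "near_discont s \<in> sets borel"
proof (cases "discont f = {}")
  case False
  have "closed {x. infdist x (discont f) \<le> s}"
    by (intro closed_Collect_le continuous_intros)
  then show ?thesis using False by (simp add: near_discont_def)
qed (simp add: near_discont_def)

text \<open>Doubling the radius turns the infimum into the distance from an actual discontinuity. On
  one period only its translates by -1, 0 and 1 matter, giving three intervals of length
  \<open>4 * s\<close> each.\<close>

lemma measure_near_discont:
  assumes "0 < s" "s < 1 / 2"
  shows "measure circ (near_discont s) \<le> 12 * real (card (discont f \<inter> {0..<1})) * s"
proof (cases "discont f = {}")
  case False
  let ?J = "discont f \<inter> {0..<1}"
  let ?B = "\<lambda>d m. {d + m - 2 * s..d + m + 2 * s}"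
  have sub: "near_discont s \<inter> {0..<1} \<subseteq> (\<Union>d\<in>?J. \<Union>m\<in>{-1, 0, 1}. ?B d m)"
  proof
    fix x assume x: "x \<in> near_discont s \<inter> {0..<1}"
    then have "infdist x (discont f) < 2 * s" using assms by (auto simp: near_discont_def)
    then obtain t where t: "t \<in> discont f" "dist x t < 2 * s"
      using False infdist_notempty[of "discont f" x] cInf_less_iff[of "dist x ` discont f" "2 * s"]
      by (auto simp: bdd_below_image_dist infdist_def)
    define d where "d = t - real_of_int \<lfloor>t\<rfloor>"
    have d: "d \<in> ?J" using discont_periodic[OF f_periodic, of t "- \<lfloor>t\<rfloor>"] t(1) by (auto simp: d_def) linarith+
    have "-1 \<le> \<lfloor>t\<rfloor>" "\<lfloor>t\<rfloor> \<le> 1" using t(2) x assms unfolding dist_real_def by (auto simp: le_floor_iff floor_le_iff)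
    then have "\<lfloor>t\<rfloor> = -1 \<or> \<lfloor>t\<rfloor> = 0 \<or> \<lfloor>t\<rfloor> = 1" by linarith
    then have "real_of_int \<lfloor>t\<rfloor> \<in> {-1, 0, 1}" by auto
    moreover have "x \<in> ?B d (real_of_int \<lfloor>t\<rfloor>)" using t(2) by (auto simp: d_def dist_real_def)
    ultimately show "x \<in> (\<Union>d\<in>?J. \<Union>m\<in>{-1, 0, 1}. ?B d m)" using d by blast
  qed
  have "emeasure circ (near_discont s) = emeasure lborel (near_discont s \<inter> {0..<1})"
    unfolding circ_def by (subst emeasure_density) (auto intro!: nn_integral_cong simp: indicator_def simp flip: nn_integral_indicator)
  also have "\<dots> \<le> emeasure lborel (\<Union>d\<in>?J. \<Union>m\<in>{-1, 0, 1}. ?B d m)"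
    by (rule emeasure_mono[OF sub]) (use finite_discont in auto)
  also have "\<dots> \<le> (\<Sum>d\<in>?J. emeasure lborel (\<Union>m\<in>{-1, 0, 1}. ?B d m))"
    by (rule emeasure_subadditive_finite) (use finite_discont in auto)
  also have "\<dots> \<le> (\<Sum>d\<in>?J. ennreal (12 * s))"
  proof (rule sum_mono)
    fix d
    have "emeasure lborel (\<Union>m\<in>{-1, 0, 1}. ?B d m) \<le> (\<Sum>m\<in>{-1, 0, 1}. emeasure lborel (?B d m))"
      by (rule emeasure_subadditive_finite) auto
    also have "\<dots> = (\<Sum>m\<in>{-1, 0, 1::real}. ennreal (4 * s))"
      using assms by (intro sum.cong) auto
    also have "\<dots> = ennreal (\<Sum>m\<in>{-1, 0, 1::real}. 4 * s)" using assms by (intro sum_ennreal) auto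
    also have "\<dots> = ennreal (12 * s)" by simp
    finally show "emeasure lborel (\<Union>m\<in>{-1, 0, 1}. ?B d m) \<le> ennreal (12 * s)" .
  qed
  also have "\<dots> = ennreal (12 * real (card ?J) * s)"
    using assms by (simp add: ennreal_of_nat_eq_real_of_nat ennreal_mult[symmetric] mult_ac)
  finally show ?thesis
    using assms by (simp add: circ.emeasure_eq_measure)
qed (use assms in \<open>simp add: near_discont_def\<close>)

lemma mnorm_transfer_diff:
  assumes "\<bar>f t' - f t\<bar> \<le> a" "cmod (z' - z) \<le> b"
  shows "mnorm (transfer_matrix f z' t' - transfer_matrix f z t) \<le> a + b"
proof -
  have "cmod (z' - complex_of_real (f t') - (z - complex_of_real (f t))) = cmod ((z' - z) - complex_of_real (f t' - f t))"
    by (simp add: algebra_simps)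
  also have "\<dots> \<le> cmod (z' - z) + cmod (complex_of_real (f t' - f t))" by (rule norm_triangle_ineq4)
  finally show ?thesis using assms unfolding mnorm_def by (simp del: of_real_diff)
qed

lemma matrix_diff_split:
  fixes A A' B B' :: "complex ^ 2 ^ 2"
  shows "A' ** B' - A ** B = A' ** (B' - B) + (A' - A) ** B"
  by (rule mat2_eqI) (simp_all add: matrix_mult_2 algebra_simps)

text \<open>Telescoping: the factors are exchanged one at a time, each costing \<open>\<tau>\<close>
  times bounds for the others; the 2 is \<open>mnorm (mat 1)\<close>.\<close>

lemma cocycle_perturb:
  assumes z: "cmod z \<le> Z" "cmod z' \<le> Z" and
    close: "\<And>j. j < k \<Longrightarrow> mnorm (transfer_matrix f z' (\<theta>' + real j * \<omega>) - transfer_matrix f z (\<theta> + real j * \<omega>)) \<le> \<tau>"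
    and \<tau>: "\<tau> \<ge> 0"
  shows "mnorm (cocycle f \<omega> z' k \<theta>' - cocycle f \<omega> z k \<theta>) \<le> 2 * real k * \<tau> * (Z + F + 2) ^ k"
  using close
proof (induction k)
  case 0
  show ?case by (simp add: mnorm_def)
next
  case (Suc k)
  let ?G = "Z + F + 2"
  have G: "?G \<ge> 1" using z(1) norm_ge_zero[of z] F_nonneg by linarith
  let ?T' = "transfer_matrix f z' (\<theta>' + real k * \<omega>)" and ?T = "transfer_matrix f z (\<theta> + real k * \<omega>)"
  let ?A' = "cocycle f \<omega> z' k \<theta>'" and ?A = "cocycle f \<omega> z k \<theta>"
  have "mnorm (?T' ** ?A' - ?T ** ?A) \<le> mnorm (?T' ** (?A' - ?A)) + mnorm ((?T' - ?T) ** ?A)"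
    unfolding matrix_diff_split by (rule mnorm_triangle)
  also have "\<dots> \<le> mnorm ?T' * mnorm (?A' - ?A) + mnorm (?T' - ?T) * mnorm ?A"
    by (intro add_mono mnorm_mult)
  also have "\<dots> \<le> ?G * (2 * real k * \<tau> * ?G ^ k) + \<tau> * (2 * ?G ^ k)"
    using G \<tau> Suc by (intro add_mono mult_mono mnorm_transfer mnorm_cocycle_le z) (auto simp: mnorm_nonneg)
  also have "\<dots> \<le> ?G * (2 * real k * \<tau> * ?G ^ k) + \<tau> * (2 * (?G * ?G ^ k))"
  proof -
    have "1 * ?G ^ k \<le> ?G * ?G ^ k" using G by (intro mult_right_mono) auto
    then show ?thesis using \<tau> by (intro add_left_mono mult_left_mono) auto
  qed
  also have "\<dots> = 2 * real (Suc k) * \<tau> * ?G ^ Suc k" by (simp add: algebra_simps)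
  finally show ?case by simp
qed

text \<open>A phase at which all blocks are typical. Such phases exist by the convergence in measure, and
  their defining inequalities survive perturbations that are small compared with the growth over
  two blocks.\<close>

lemma good_phase_exists:
  assumes irr: "\<omega> \<notin> \<rat>" and d: "d > 0"
    and r: "\<And>n. r n > 0" and rlim: "(\<lambda>n. real n * r n) \<longlonglongrightarrow> 0"
  shows "\<forall>\<^sub>F n in sequentially. \<exists>\<theta>.
    (\<forall>i\<le>M. lognorm f \<omega> z n (\<theta> + real (i * n) * \<omega>) \<le> real n * (lyapunov f \<omega> z + d)) \<and>
    (\<forall>i\<le>M. lognorm f \<omega> z (2 * n) (\<theta> + real (i * n) * \<omega>) \<ge> real (2 * n) * (lyapunov f \<omega> z - d)) \<and>
    (\<forall>j\<le>(M + 2) * n. \<theta> + real j * \<omega> \<notin> near_discont (2 * r n))"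
proof -
  let ?L = "lyapunov f \<omega> z"
  \<comment> \<open>The two families of \<open>M + 1\<close> deviation events together have measure
    at most 1/2, which leaves room for the visits near discontinuities.\<close>
  define e where "e = 1 / (4 * (real M + 1))"
  have e: "e > 0" by (simp add: e_def add_pos_nonneg)
  define J where "J = real (card (discont f \<inter> {0..<1}))"
  have J: "J \<ge> 0" by (simp add: J_def)
  let ?hi = "\<lambda>n. {x. lognorm f \<omega> z n x > real n * (?L + d)}"
  let ?lo = "\<lambda>n. {x. lognorm f \<omega> z n x < real n * (?L - d)}"
  have hi: "\<forall>\<^sub>F n in sequentially. measure circ (?hi n) \<le> e" by (rule lognorm_upper_deviation[OF irr d e])
  have "\<forall>\<^sub>F n in sequentially. measure circ (?lo n) \<le> e" by (rule lognorm_lower_deviation[OF irr d e])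
  then have lo: "\<forall>\<^sub>F n in sequentially. measure circ (?lo (2 * n)) \<le> e"
    unfolding eventually_sequentially by (metis le_add2 mult_2 order_trans)
  have "(\<lambda>n. ((real M + 2) * 48 * J + 48 * J + 2) * (real n * r n)) \<longlonglongrightarrow> ((real M + 2) * 48 * J + 48 * J + 2) * 0"
    by (intro tendsto_mult tendsto_const rlim)
  then have small: "\<forall>\<^sub>F n in sequentially. ((real M + 2) * 48 * J + 48 * J + 2) * (real n * r n) < 1 / 4"
    by (intro order_tendstoD(2)) auto
  show ?thesis
    using hi lo small eventually_gt_at_top[of 0]
  proof eventually_elim
    case (elim n)
    have n: "n > 0" "real n \<ge> 1" using elim(4) by auto
    have rn: "r n > 0" by (rule r)
    have nr: "real n * r n > 0" using n rn by simp
    have "2 * (real n * r n) < 1 / 4"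
    proof -
      have "0 \<le> ((real M + 2) * 48 * J + 48 * J) * (real n * r n)" using J nr by simp
      then show ?thesis using elim(3) by (simp add: algebra_simps)
    qed
    moreover have "r n \<le> real n * r n" using n rn by simp
    ultimately have r2: "2 * r n < 1 / 2" by linarith
    have shift: "measure circ {x. x + t \<in> A} = measure circ A" if A: "A \<in> sets borel" "\<And>x. x + 1 \<in> A \<longleftrightarrow> x \<in> A" for A t
    proof -
      have [measurable]: "{x. x + t \<in> A} \<in> sets borel" using A(1) by measurable
      have "emeasure circ {x. x + t \<in> A} = (\<integral>\<^sup>+x. indicator {x. x + t \<in> A} x \<partial>circ)" by simp
      also have "\<dots> = (\<integral>\<^sup>+x. indicator A (x + t) \<partial>circ)"
        by (intro nn_integral_cong) (simp add: indicator_def)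
      also have "\<dots> = (\<integral>\<^sup>+x. indicator A x \<partial>circ)"
        by (rule circ_shift) (use A in \<open>auto simp: periodic1_def indicator_def\<close>)
      also have "\<dots> = emeasure circ A" using A(1) by simp
      finally show ?thesis by (simp add: measure_def)
    qed
    have per: "lognorm f \<omega> z k (x + 1) = lognorm f \<omega> z k x" for k x
      using lognorm_periodic by (simp add: periodic1_def)
    let ?H = "\<lambda>i. {x. x + real (i * n) * \<omega> \<in> ?hi n}" and ?W = "\<lambda>i. {x. x + real (i * n) * \<omega> \<in> ?lo (2 * n)}"
    let ?D = "\<lambda>j. {x. x + real j * \<omega> \<in> near_discont (2 * r n)}"
    have [measurable]: "?hi n \<in> sets borel" "?lo (2 * n) \<in> sets borel" by measurable
    have mH: "?H i \<in> sets borel" "?W i \<in> sets borel" "?D j \<in> sets borel" for i j by measurable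
    have sH: "measure circ (?H i) \<le> e" for i
      using elim(1) by (subst shift) (auto simp: per)
    have sW: "measure circ (?W i) \<le> e" for i
      using elim(2) by (subst shift) (auto simp: per)
    have sD: "measure circ (?D j) \<le> 24 * J * r n" for j
    proof -
      have "measure circ (?D j) = measure circ (near_discont (2 * r n))"
        by (rule shift[OF near_discont_borel]) (use infdist_discont_periodic[of _ 1] in \<open>simp add: near_discont_def\<close>)
      also have "\<dots> \<le> 12 * J * (2 * r n)"
        unfolding J_def by (rule measure_near_discont) (use rn r2 in auto)
      finally show ?thesis by simp
    qed
    let ?bad = "(\<Union>i\<le>M. ?H i) \<union> (\<Union>i\<le>M. ?W i) \<union> (\<Union>j\<le>(M + 2) * n. ?D j)"
    have "measure circ ?bad \<le> measure circ (\<Union>i\<le>M. ?H i) + measure circ (\<Union>i\<le>M. ?W i) + measure circ (\<Union>j\<le>(M + 2) * n. ?D j)"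
      using mH by (intro order_trans[OF measure_Un_le] add_mono measure_Un_le order_refl) auto
    also have "\<dots> \<le> (\<Sum>i\<le>M. measure circ (?H i)) + (\<Sum>i\<le>M. measure circ (?W i)) + (\<Sum>j\<le>(M + 2) * n. measure circ (?D j))"
      using mH by (intro add_mono circ.finite_measure_subadditive_finite) auto
    also have "\<dots> \<le> (\<Sum>i\<le>M. e) + (\<Sum>i\<le>M. e) + (\<Sum>j\<le>(M + 2) * n. 24 * J * r n)"
      by (intro add_mono sum_mono sH sW sD)
    also have "\<dots> = 1 / 2 + (real ((M + 2) * n) + 1) * (24 * J * r n)"
    proof -
      have "(real M + 1) * e = 1 / 4" by (simp add: e_def)
      then show ?thesis by (simp add: algebra_simps)
    qed
    also have "\<dots> \<le> 1 / 2 + ((real M + 2) * 48 * J + 48 * J + 2) * (real n * r n)"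
    proof -
      have "(real ((M + 2) * n) + 1) * (24 * J * r n) \<le> (real ((M + 2) * n) + real n) * (24 * J * r n)"
        using n J rn by (intro mult_right_mono) auto
      also have "\<dots> = ((real M + 2) * 24 * J + 24 * J) * (real n * r n)" by (simp add: algebra_simps)
      also have "\<dots> \<le> ((real M + 2) * 48 * J + 48 * J + 2) * (real n * r n)"
      proof (rule mult_right_mono)
        have "0 \<le> real M * J" using J by simp
        then show "(real M + 2) * 24 * J + 24 * J \<le> (real M + 2) * 48 * J + 48 * J + 2" using J by (simp add: algebra_simps)
      qed (use nr in simp)
      finally show ?thesis by simp
    qed
    also have "\<dots> < 1" using elim(3) by linarith
    finally have "measure circ ?bad < 1" .
    then have "?bad \<noteq> UNIV" by auto
    then obtain \<theta> where "\<theta> \<notin> ?bad" by blast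
    then show ?case by (intro exI[of _ \<theta>]) (auto simp: not_less)
  qed
qed

end

context hoelder_sampling begin

text \<open>Blocks of length \<open>n\<close>, proportional to \<open>ln N\<close> with a small constant, are stable under perturbations
  of size \<open>N powr - a\<close>; a fixed number of them already produces any power of \<open>N\<close>.\<close>

lemma block_growth:
  assumes irr: "\<omega> \<notin> \<rat>" and L: "lyapunov f \<omega> z > 0" and a: "a > 0"
    and c: "c > 0" "8 * ln (cmod z + 1 + F + 2) * c \<le> a * min g 1"
  shows "\<forall>\<^sub>F n in sequentially. \<exists>\<theta>0. \<forall>\<theta> z'. \<bar>\<theta> - \<theta>0\<bar> \<le> exp (- (a / c) * real n) \<longrightarrow> cmod (z' - z) \<le> exp (- (a / c) * real n) \<longrightarrow>
    mnorm (cocycle f \<omega> z' (M * n) \<theta>) \<ge> exp (real M * (real n * lyapunov f \<omega> z / 2))"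
proof -
  let ?L = "lyapunov f \<omega> z"
  \<comment> \<open>Two-block growth divided by the one-block bound is
    \<open>exp (n * (L - 3 * d))\<close> up to constants, and here
    \<open>L - 3 * d = L / 2 + L / 8\<close>.\<close>
  define d where "d = ?L / 8"
  have d: "d > 0" using L by (simp add: d_def)
  define G where "G = cmod z + 1 + F + 2"
  have G: "G \<ge> 3" using F_nonneg by (simp add: G_def)
  define \<Lambda> where "\<Lambda> = ln G"
  have \<Lambda>: "\<Lambda> > 0" using G by (simp add: \<Lambda>_def)
  have expG: "exp \<Lambda> = G" using G by (simp add: \<Lambda>_def)
  define \<rho> where "\<rho> = (\<lambda>n::nat. exp (- (a / c) * real n))"
  have \<rho>0: "\<rho> n > 0" for n by (simp add: \<rho>_def)
  have \<rho>1: "\<rho> n \<le> 1" for n using a c by (simp add: \<rho>_def)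
  have lim: "(\<lambda>n. real n * exp (- \<kappa> * real n)) \<longlonglongrightarrow> 0" if "\<kappa> > 0" for \<kappa> :: real
  proof -
    have "(\<lambda>n. of_nat n * exp (- \<kappa>) ^ n) \<longlonglongrightarrow> 0"
      by (rule powser_times_n_limit_0) (use that in simp)
    moreover have "exp (- \<kappa>) ^ n = exp (- \<kappa> * real n)" for n
      by (simp add: exp_of_nat_mult[symmetric] mult.commute)
    ultimately show ?thesis by simp
  qed
  have "(\<lambda>n. real n * \<rho> n) \<longlonglongrightarrow> 0"
    unfolding \<rho>_def by (rule lim) (use a c in simp)
  note good = good_phase_exists[where r=\<rho> and z=z and M=M, OF irr d \<rho>0 this]
  have "(\<lambda>n. (4 * (K + 1)) * (real n * exp (- (6 * \<Lambda>) * real n))) \<longlonglongrightarrow> (4 * (K + 1)) * 0"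
    by (intro tendsto_mult tendsto_const lim) (use \<Lambda> in simp)
  then have small: "\<forall>\<^sub>F n in sequentially. (4 * (K + 1)) * (real n * exp (- (6 * \<Lambda>) * real n)) < 1"
    by (intro order_tendstoD(2)) auto
  have "filterlim (\<lambda>n. (?L / 8) * real n) at_top sequentially"
    using L by (intro filterlim_tendsto_pos_mult_at_top[OF tendsto_const] filterlim_real_sequentially) auto
  then have "filterlim (\<lambda>n. exp ((?L / 8) * real n)) at_top sequentially"
    by (rule filterlim_compose[OF exp_at_top])
  then have big: "\<forall>\<^sub>F n in sequentially. exp ((?L / 8) * real n) \<ge> 128"
    by (simp add: filterlim_at_top)
  show ?thesis
    using good small big
  proof eventually_elim
    case (elim n)
    obtain \<theta>0 where hi: "\<And>i. i \<le> M \<Longrightarrow> lognorm f \<omega> z n (\<theta>0 + real (i * n) * \<omega>) \<le> real n * (?L + d)"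
      and lo: "\<And>i. i \<le> M \<Longrightarrow> lognorm f \<omega> z (2 * n) (\<theta>0 + real (i * n) * \<omega>) \<ge> real (2 * n) * (?L - d)"
      and nd: "\<And>j. j \<le> (M + 2) * n \<Longrightarrow> \<theta>0 + real j * \<omega> \<notin> near_discont (2 * \<rho> n)"
      using elim(1) by blast
    show ?case
    proof (intro exI allI impI)
      fix \<theta> z' assume \<theta>: "\<bar>\<theta> - \<theta>0\<bar> \<le> exp (- (a / c) * real n)" and z': "cmod (z' - z) \<le> exp (- (a / c) * real n)"
      note \<theta> = \<theta>[folded \<rho>_def[THEN fun_cong]] and z' = z'[folded \<rho>_def[THEN fun_cong]]
      have zz: "cmod z \<le> cmod z + 1" "cmod z' \<le> cmod z + 1"
        using z' \<rho>1[of n] norm_triangle_ineq2[of z' z] by auto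
      define \<tau> where "\<tau> = K * \<rho> n powr g + \<rho> n"
      have \<tau>0: "\<tau> \<ge> 0" using K \<rho>0[of n] by (simp add: \<tau>_def)
      \<comment> \<open>The smallness of \<open>c\<close> makes one-step errors of order
        \<open>exp (- 8 * \<Lambda> * n)\<close>, while products of up to \<open>2 * n\<close>
        factors amplify them only by \<open>exp (2 * \<Lambda> * n)\<close>. The minimum of
        \<open>g\<close> and 1 covers phase and energy at once.\<close>
      have \<tau>: "\<tau> \<le> (K + 1) * exp (- (8 * \<Lambda>) * real n)"
      proof -
        have e: "\<rho> n powr s \<le> exp (- (8 * \<Lambda>) * real n)" if "s \<ge> min g 1" for s
        proof -
          have "8 * \<Lambda> * c \<le> a * s"
            using c(2) mult_left_mono[OF that, of a] a unfolding G_def[symmetric] \<Lambda>_def[symmetric] by linarith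
          then have "8 * \<Lambda> \<le> s * (a / c)" using c(1) by (simp add: field_simps)
          then have "8 * \<Lambda> * real n \<le> s * (a / c) * real n" by (rule mult_right_mono) simp
          then have "exp (s * (- (a / c) * real n)) \<le> exp (- (8 * \<Lambda>) * real n)" by simp
          moreover have "\<rho> n powr s = exp (s * (- (a / c) * real n))" by (simp add: \<rho>_def powr_def)
          ultimately show ?thesis by simp
        qed
        have "\<rho> n powr 1 = \<rho> n" using \<rho>0[of n] by simp
        then have "\<rho> n \<le> exp (- (8 * \<Lambda>) * real n)" using e[of 1] by simp
        moreover have "K * \<rho> n powr g \<le> K * exp (- (8 * \<Lambda>) * real n)" by (intro mult_left_mono e K) simp
        ultimately show ?thesis by (simp add: \<tau>_def distrib_right)
      qed
      have close: "mnorm (cocycle f \<omega> z' k (\<theta> + real (i * n) * \<omega>) - cocycle f \<omega> z k (\<theta>0 + real (i * n) * \<omega>)) \<le> 1"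
        if ik: "i \<le> M" "k \<le> 2 * n" for i k
      proof -
        have "mnorm (cocycle f \<omega> z' k (\<theta> + real (i * n) * \<omega>) - cocycle f \<omega> z k (\<theta>0 + real (i * n) * \<omega>))
            \<le> 2 * real k * \<tau> * (cmod z + 1 + F + 2) ^ k"
        proof (rule cocycle_perturb[OF zz _ \<tau>0])
          fix j assume "j < k"
          then have "i * n + j \<le> M * n + 2 * n" using ik by (intro add_mono mult_right_mono) auto
          then have "i * n + j \<le> (M + 2) * n" by (simp add: algebra_simps)
          from nd[OF this] have "discont f = {} \<or> infdist (\<theta>0 + real (i * n) * \<omega> + real j * \<omega>) (discont f) > 2 * \<rho> n"
            by (auto simp: near_discont_def algebra_simps)
          then have "\<bar>f (\<theta> + real (i * n) * \<omega> + real j * \<omega>) - f (\<theta>0 + real (i * n) * \<omega> + real j * \<omega>)\<bar> \<le> K * \<rho> n powr g"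
            by (intro hoelder_close \<rho>0) (use \<theta> in auto)
          then show "mnorm (transfer_matrix f z' (\<theta> + real (i * n) * \<omega> + real j * \<omega>) - transfer_matrix f z (\<theta>0 + real (i * n) * \<omega> + real j * \<omega>)) \<le> \<tau>"
            unfolding \<tau>_def by (rule mnorm_transfer_diff[OF _ z'])
        qed
        also have "\<dots> \<le> 2 * real (2 * n) * ((K + 1) * exp (- (8 * \<Lambda>) * real n)) * G ^ (2 * n)"
          unfolding G_def[symmetric] using ik(2) \<tau> \<tau>0 G
          by (intro mult_mono power_increasing) auto
        also have "G ^ (2 * n) = exp (2 * \<Lambda> * real n)"
          using exp_of_nat_mult[of "2 * n" \<Lambda>] expG by (simp add: mult_ac)
        also have "2 * real (2 * n) * ((K + 1) * exp (- (8 * \<Lambda>) * real n)) * exp (2 * \<Lambda> * real n) =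
            (4 * (K + 1)) * (real n * (exp (- (8 * \<Lambda>) * real n) * exp (2 * \<Lambda> * real n)))" by simp
        also have "exp (- (8 * \<Lambda>) * real n) * exp (2 * \<Lambda> * real n) = exp (- (6 * \<Lambda>) * real n)"
          by (simp add: exp_add[symmetric] algebra_simps)
        also have "(4 * (K + 1)) * (real n * exp (- (6 * \<Lambda>) * real n)) \<le> 1" using elim(2) by simp
        finally show ?thesis .
      qed
      define \<beta> where "\<beta> = 2 * exp (real n * (?L + d))"
      define \<alpha> where "\<alpha> = exp (real (2 * n) * (?L - d)) / 2"
      have \<beta>0: "\<beta> > 0" by (simp add: \<beta>_def)
      have up: "mnorm (cocycle f \<omega> z' n (\<theta> + real (i * n) * \<omega>)) \<le> \<beta>" if "i \<le> M" for i
      proof -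
        have "mnorm (cocycle f \<omega> z n (\<theta>0 + real (i * n) * \<omega>)) \<le> exp (real n * (?L + d))"
          using hi[OF that] unfolding exp_lognorm[symmetric] by simp
        moreover have "1 \<le> exp (real n * (?L + d))" using L d by simp
        ultimately show ?thesis
          using close[OF that, of n] mnorm_triangle_sub[of "cocycle f \<omega> z' n (\<theta> + real (i * n) * \<omega>)" "cocycle f \<omega> z n (\<theta>0 + real (i * n) * \<omega>)"]
          unfolding \<beta>_def by linarith
      qed
      have E8: "exp (real n * ?L / 8) \<ge> 128" using elim(3) by (simp add: mult.commute)
      have E2: "exp (real (2 * n) * (?L - d)) \<ge> 2"
      proof -
        have "real n * ?L / 8 \<le> real (2 * n) * (?L - d)" using L by (simp add: d_def field_simps)
        then have "exp (real n * ?L / 8) \<le> exp (real (2 * n) * (?L - d))" by simp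
        then show ?thesis using E8 by linarith
      qed
      have low: "mnorm (cocycle f \<omega> z' (2 * n) (\<theta> + real (i * n) * \<omega>)) \<ge> \<alpha>" if "i \<le> M" for i
      proof -
        have "mnorm (cocycle f \<omega> z (2 * n) (\<theta>0 + real (i * n) * \<omega>)) \<ge> exp (real (2 * n) * (?L - d))"
          using lo[OF that] unfolding exp_lognorm[symmetric] by simp
        then show ?thesis
          using close[OF that, of "2 * n"] mnorm_triangle_sub[of "cocycle f \<omega> z (2 * n) (\<theta>0 + real (i * n) * \<omega>)" "cocycle f \<omega> z' (2 * n) (\<theta> + real (i * n) * \<omega>)"]
            mnorm_minus_commute[of "cocycle f \<omega> z' (2 * n) (\<theta> + real (i * n) * \<omega>)" "cocycle f \<omega> z (2 * n) (\<theta>0 + real (i * n) * \<omega>)"] E2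
          unfolding \<alpha>_def by linarith
      qed
      \<comment> \<open>The spare factor \<open>exp (n * L / 8)\<close> absorbs
        \<open>128 = 2 * 32 * 2\<close>, which comes from \<open>\<alpha>\<close>, the avalanche
        constant and \<open>\<beta>\<close>.\<close>
      have ratio: "\<alpha> / (32 * \<beta>) = exp (real n * ?L / 2) * (exp (real n * ?L / 8) / 128)"
      proof -
        have "exp (real (2 * n) * (?L - d)) = exp (real n * ?L / 2) * exp (real n * ?L / 8) * exp (real n * (?L + d))"
          by (simp add: exp_add[symmetric] d_def field_simps)
        then show ?thesis by (simp add: \<alpha>_def \<beta>_def)
      qed
      have ge: "exp (real n * ?L / 2) \<le> \<alpha> / (32 * \<beta>)"
        unfolding ratio using E8 by simp
      have "1 \<le> exp (real n * ?L / 2)" using L by simp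
      then have "1 \<le> \<alpha> / (32 * \<beta>)" using ge by linarith
      then have \<alpha>\<beta>: "32 * \<beta> \<le> \<alpha>" using \<beta>0 by (simp add: field_simps)
      have "mnorm (cocycle f \<omega> z' (M * n) \<theta>) \<ge> (\<alpha> / (32 * \<beta>)) ^ M"
      proof (rule avalanche[where B="\<lambda>i. cocycle f \<omega> z' n (\<theta> + real (i * n) * \<omega>)" and C="\<lambda>i. cocycle f \<omega> z' n (\<theta> + real (Suc i * n) * \<omega>)"
            and Q="\<lambda>i. cocycle f \<omega> z' (i * n) \<theta>" and M=M, OF det_cocycle _ _ _ _ _ _ \<alpha>\<beta> \<beta>0])
        show "mnorm (cocycle f \<omega> z' n (\<theta> + real (i * n) * \<omega>)) \<le> \<beta>" if "i < M" for i using up[of i] that by simp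
        show "mnorm (cocycle f \<omega> z' n (\<theta> + real (Suc i * n) * \<omega>)) \<le> \<beta>" if "i < M" for i using up[of "Suc i"] that by simp
        show "\<alpha> \<le> mnorm (cocycle f \<omega> z' n (\<theta> + real (Suc i * n) * \<omega>) ** cocycle f \<omega> z' n (\<theta> + real (i * n) * \<omega>))" if "i < M" for i
        proof -
          have "\<theta> + real (Suc i * n) * \<omega> = \<theta> + real (i * n) * \<omega> + real n * \<omega>" by (simp add: algebra_simps)
          then show ?thesis
            unfolding \<open>\<theta> + real (Suc i * n) * \<omega> = _\<close> cocycle_add[symmetric] using low[of i] that by (simp add: mult_2)
        qed
        show "cocycle f \<omega> z' (Suc i * n) \<theta> = cocycle f \<omega> z' n (\<theta> + real (i * n) * \<omega>) ** cocycle f \<omega> z' (i * n) \<theta>" for i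
          using cocycle_add[of f \<omega> z' n "i * n" \<theta>] by simp
      qed simp_all
      moreover have "exp (real M * (real n * ?L / 2)) \<le> (\<alpha> / (32 * \<beta>)) ^ M"
        unfolding exp_of_nat_mult using ge by (intro power_mono) auto
      ultimately show "mnorm (cocycle f \<omega> z' (M * n) \<theta>) \<ge> exp (real M * (real n * ?L / 2))" by linarith
    qed
  qed
qed

text \<open>From any \<open>\<theta>\<close> the good phase is approached after some
  \<open>j < N\<close> steps. There \<open>M\<close> blocks give \<open>N powr (2 * C)\<close>, and
  by \<open>mnorm_left_factor\<close> either the first \<open>j\<close> or all
  \<open>M * n + j\<close> steps give \<open>N powr C\<close>. As \<open>n\<close> is of order
  \<open>ln N\<close>, \<open>M * n \<le> N\<close>.\<close>

theorem orbit_growth: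
  assumes irr: "\<omega> \<notin> \<rat>" and L: "lyapunov f \<omega> z > 0" and a: "a > 0" and C: "C > 0"
  shows "\<forall>\<^sub>F N in sequentially. orbit_dense \<omega> N (real N powr - a) \<longrightarrow>
    (\<forall>\<theta> z'. cmod (z' - z) \<le> real N powr - a \<longrightarrow> (\<exists>k\<le>2 * N. mnorm (cocycle f \<omega> z' k \<theta>) \<ge> real N powr C))"
proof -
  let ?L = "lyapunov f \<omega> z"
  define \<Lambda> where "\<Lambda> = ln (cmod z + 1 + F + 2)"
  have \<Lambda>: "\<Lambda> > 0" using F_nonneg by (simp add: \<Lambda>_def add_pos_nonneg)
  \<comment> \<open>The largest value that \<open>block_growth\<close> admits; the number
    \<open>M\<close> of blocks is then dictated by \<open>C\<close>.\<close>
  define c where "c = a * min g 1 / (8 * \<Lambda>)"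
  have c: "c > 0" using a g \<Lambda> by (simp add: c_def)
  have c8: "8 * ln (cmod z + 1 + F + 2) * c \<le> a * min g 1"
    unfolding \<Lambda>_def[symmetric] using \<Lambda> by (simp add: c_def)
  define M where "M = nat \<lceil>8 * C / (c * ?L)\<rceil>"
  have M: "8 * C / (c * ?L) \<le> real M" unfolding M_def by linarith
  obtain n1 where n1: "\<And>n. n \<ge> n1 \<Longrightarrow> \<exists>\<theta>0. \<forall>\<theta> z'. \<bar>\<theta> - \<theta>0\<bar> \<le> exp (- (a / c) * real n) \<longrightarrow> cmod (z' - z) \<le> exp (- (a / c) * real n) \<longrightarrow>
      mnorm (cocycle f \<omega> z' (M * n) \<theta>) \<ge> exp (real M * (real n * ?L / 2))"
    using block_growth[OF irr L a c c8, of M] unfolding eventually_sequentially by blast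
  have "filterlim (\<lambda>N. c * ln (real N)) at_top sequentially"
    by (intro filterlim_tendsto_pos_mult_at_top[OF tendsto_const c] filterlim_compose[OF ln_at_top filterlim_real_sequentially])
  then have big: "\<forall>\<^sub>F N in sequentially. c * ln (real N) \<ge> real n1 + 2"
    by (simp add: filterlim_at_top)
  have "(\<lambda>N. (real M * c + 1) * (ln (real N) / real N)) \<longlonglongrightarrow> (real M * c + 1) * 0"
    by (intro tendsto_mult tendsto_const lim_ln_over_n)
  then have lnN: "\<forall>\<^sub>F N in sequentially. (real M * c + 1) * (ln (real N) / real N) < 1"
    by (intro order_tendstoD(2)) auto
  show ?thesis
    using big lnN eventually_gt_at_top[of 1]
  proof eventually_elim
    case (elim N)
    define n where "n = nat \<lfloor>c * ln (real N)\<rfloor>"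
    have lnpos: "ln (real N) > 0" using elim(3) by simp
    have n: "real n \<le> c * ln (real N)" "c * ln (real N) - 1 < real n" "n \<ge> n1"
      using elim(1) unfolding n_def by linarith+
    have n2: "real n \<ge> c * ln (real N) / 2" using n elim(1) by linarith
    have rho: "real N powr - a \<le> exp (- (a / c) * real n)"
    proof -
      have "(a / c) * real n \<le> (a / c) * (c * ln (real N))" using n(1) a c by (intro mult_left_mono) auto
      then have "- a * ln (real N) \<le> - (a / c) * real n" using c by simp
      then have "exp (- a * ln (real N)) \<le> exp (- (a / c) * real n)" by simp
      moreover have "real N powr - a = exp (- a * ln (real N))" using elim(3) by (simp add: powr_def)
      ultimately show ?thesis by simp
    qed
    have MnN: "M * n \<le> N"
    proof -
      have "real M * real n \<le> real M * (c * ln (real N))" using n(1) by (intro mult_left_mono) auto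
      also have "\<dots> \<le> (real M * c + 1) * ln (real N)" using lnpos by (simp add: distrib_right)
      also have "\<dots> \<le> real N" using elim(2,3) by (simp add: field_simps)
      finally show ?thesis by (metis of_nat_le_iff of_nat_mult)
    qed
    have pow: "real N powr (2 * C) \<le> exp (real M * (real n * ?L / 2))"
    proof -
      have "8 * C \<le> real M * (c * ?L)" using M c L by (simp add: field_simps)
      then have "2 * C \<le> real M * (c * ?L) / 4" by simp
      then have "2 * C * ln (real N) \<le> real M * (c * ?L) / 4 * ln (real N)" using lnpos by (intro mult_right_mono) auto
      also have "\<dots> = real M * ((c * ln (real N) / 2) * ?L / 2)" by simp
      also have "\<dots> \<le> real M * (real n * ?L / 2)" using n2 L by (intro mult_left_mono divide_right_mono mult_right_mono) auto
      finally show ?thesis using elim(3) by (simp add: powr_def)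
    qed
    show ?case
    proof (intro impI allI)
      fix \<theta> z' assume dense: "orbit_dense \<omega> N (real N powr - a)" and z': "cmod (z' - z) \<le> real N powr - a"
      obtain \<theta>0 where \<theta>0: "\<And>\<theta> z'. \<bar>\<theta> - \<theta>0\<bar> \<le> exp (- (a / c) * real n) \<Longrightarrow> cmod (z' - z) \<le> exp (- (a / c) * real n) \<Longrightarrow>
          mnorm (cocycle f \<omega> z' (M * n) \<theta>) \<ge> exp (real M * (real n * ?L / 2))"
        using n1[OF n(3)] by blast
      obtain j m where j: "j < N" "\<bar>\<theta> + real j * \<omega> + real_of_int m - \<theta>0\<bar> \<le> real N powr - a"
        using dense unfolding orbit_dense_def by blast
      have "mnorm (cocycle f \<omega> z' (M * n) (\<theta> + real j * \<omega> + real_of_int m)) \<ge> real N powr (2 * C)"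
        using \<theta>0[of "\<theta> + real j * \<omega> + real_of_int m" z'] j(2) z' rho pow by linarith
      then have "real N powr (2 * C) \<le> mnorm (cocycle f \<omega> z' (M * n) (\<theta> + real j * \<omega>))"
        by (simp add: cocycle_periodic)
      also have "\<dots> \<le> mnorm (cocycle f \<omega> z' (M * n + j) \<theta>) * mnorm (cocycle f \<omega> z' j \<theta>)"
        unfolding cocycle_add by (rule mnorm_left_factor[OF det_cocycle])
      finally have prod: "real N powr C * real N powr C \<le> mnorm (cocycle f \<omega> z' (M * n + j) \<theta>) * mnorm (cocycle f \<omega> z' j \<theta>)"
        by (simp add: powr_add[symmetric])
      have "mnorm (cocycle f \<omega> z' (M * n + j) \<theta>) \<ge> real N powr C \<or> mnorm (cocycle f \<omega> z' j \<theta>) \<ge> real N powr C"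
      proof (rule ccontr)
        assume "\<not> ?thesis"
        then have "mnorm (cocycle f \<omega> z' (M * n + j) \<theta>) * mnorm (cocycle f \<omega> z' j \<theta>) < real N powr C * real N powr C"
          by (intro mult_strict_mono') (auto simp: mnorm_nonneg)
        then show False using prod by linarith
      qed
      moreover have "M * n + j \<le> 2 * N" "j \<le> 2 * N" using MnN j(1) by auto
      ultimately show "\<exists>k\<le>2 * N. mnorm (cocycle f \<omega> z' k \<theta>) \<ge> real N powr C" by blast
    qed
  qed
qed

end

section \<open>Localized Green functions\<close>

text \<open>Finiteness of the extended norm yields real constants, and \<open>f\<close> is
  measurable because its discontinuities are countable.\<close>

lemma piecewise_Hoelder_sampling:
  assumes "piecewise_Hoelder f"
  shows "\<exists>F K g. hoelder_sampling f F K g"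
proof -
  from assms obtain g where per: "periodic1 f" and fin: "finite (discont f \<inter> {0..<1})" and g: "g > 0" and PL: "PL_norm g f < \<infinity>"
    unfolding piecewise_Hoelder_def by blast
  define A where "A = (SUP t. ennreal \<bar>f t\<bar>)"
  define B where "B = (SUP h\<in>{0<..}. SUP t\<in>{t. discont f = {} \<or> infdist t (discont f) > \<bar>h\<bar>}. ennreal (\<bar>f (t + h) - f t\<bar> / \<bar>h\<bar> powr g))"
  have "A + B < top" using PL by (simp add: PL_norm_def A_def B_def)
  then have top: "A < top" "B < top" by (auto simp: less_top[symmetric])
  have "discont f \<subseteq> (\<Union>m::int. (\<lambda>t. t + real_of_int m) ` (discont f \<inter> {0..<1}))"
  proof
    fix t assume t: "t \<in> discont f"
    have "t - real_of_int \<lfloor>t\<rfloor> \<in> {0..<1}" by simp linarith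
    moreover have "t - real_of_int \<lfloor>t\<rfloor> \<in> discont f" using t discont_periodic[OF per, of t "- \<lfloor>t\<rfloor>"] by simp
    ultimately show "t \<in> (\<Union>m::int. (\<lambda>t. t + real_of_int m) ` (discont f \<inter> {0..<1}))"
      by (intro UN_I[of "\<lfloor>t\<rfloor>"] image_eqI[of _ _ "t - real_of_int \<lfloor>t\<rfloor>"]) auto
  qed
  moreover have "countable (\<Union>m::int. (\<lambda>t. t + real_of_int m) ` (discont f \<inter> {0..<1}))"
    using countable_finite[OF fin] by (intro countable_UN countable_image) auto
  ultimately have "countable (discont f)" by (rule countable_subset)
  moreover have "continuous_on (- discont f) f"
    by (rule continuous_at_imp_continuous_on) (auto simp: discont_def)
  ultimately have "f \<in> borel_measurable borel"
    by (rule borel_measurable_continuous_countable_exceptions)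
  moreover have "\<bar>f t\<bar> \<le> enn2real A" for t
  proof -
    have "ennreal \<bar>f t\<bar> \<le> A" unfolding A_def by (rule SUP_upper) simp
    then show ?thesis using enn2real_mono[OF _ top(1)] by fastforce
  qed
  moreover have "\<bar>f (t + h) - f t\<bar> \<le> enn2real B * h powr g"
    if h: "h > 0" "discont f = {} \<or> infdist t (discont f) > h" for t h
  proof -
    have "ennreal (\<bar>f (t + h) - f t\<bar> / \<bar>h\<bar> powr g) \<le> B"
      unfolding B_def by (rule SUP_upper2[of h], use h in simp, rule SUP_upper) (use h in simp)
    then have "\<bar>f (t + h) - f t\<bar> / \<bar>h\<bar> powr g \<le> enn2real B"
      using enn2real_mono[OF _ top(2)] by fastforce
    then show ?thesis using h(1) by (simp add: field_simps)
  qed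
  ultimately have "hoelder_sampling f (enn2real A) (enn2real B) g"
    using per fin g by unfold_locales auto
  then show ?thesis by blast
qed

context bounded_sampling begin

text \<open>Each column of the cocycle, read through its second row, solves the eigenvalue equation
  and vanishes at site 0 or 1. The largest entry selects the column \<open>s\<close> and, by its
  row, the site \<open>k + 1\<close> or \<open>k\<close>. The cocycle starts at
  \<open>\<theta> + \<omega>\<close> because site 1 is the first one to the right of the
  origin.\<close>

lemma green_tail_right:
  assumes z: "Im z > 0" and M: "M > 4" "mnorm (cocycle f \<omega> z k (\<theta> + \<omega>)) \<ge> M"
  shows "(\<Sum>n\<in>{int k + 1..N}. (cmod (greens \<omega> \<theta> z n))\<^sup>2) \<le> 16 / (M\<^sup>2 * Im z ^ 4)"
proof -
  let ?V = "orbit_potential f \<omega> \<theta>" and ?w = "greens \<omega> \<theta> z"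
  interpret B: bounded_potential ?V F by (rule bounded_orbit)
  let ?A = "\<lambda>n. cocycle f \<omega> z n (\<theta> + \<omega>)"
  obtain r s where rs: "M / 4 \<le> cmod (?A k $ r $ s)"
  proof -
    obtain r s where "\<And>i j. cmod (?A k $ i $ j) \<le> cmod (?A k $ r $ s)" using max_entry_exists[of "?A k"] by blast
    from this[of 1 1] this[of 1 2] this[of 2 1] this[of 2 2] M(2) have "M \<le> 4 * cmod (?A k $ r $ s)"
      by (simp add: mnorm_def)
    then show thesis by (intro that[of r s]) simp
  qed
  define \<phi> where "\<phi> = (\<lambda>n::int. ?A (nat n) $ 2 $ s)"
  have A2: "?A (Suc n) $ 2 $ s = ?A n $ 1 $ s" for n by (simp add: matrix_mult_2)
  have sol: "jacobi ?V \<phi> n = z * \<phi> n" if "n > 0" for n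
  proof -
    obtain m where m: "n = int (Suc m)" by (rule that[of "nat (n - 1)"]) (use \<open>n > 0\<close> in simp)
    have "?A (Suc m) $ 1 $ s = (z - complex_of_real (f (\<theta> + \<omega> + real m * \<omega>))) * ?A m $ 1 $ s - ?A m $ 2 $ s"
      by (simp add: matrix_mult_2)
    moreover have \<theta>: "\<theta> + \<omega> + real m * \<omega> = real_of_int n * \<omega> + \<theta>" using m by (simp add: algebra_simps)
    moreover have "\<phi> (n - 1) = ?A m $ 2 $ s" "\<phi> n = ?A m $ 1 $ s" "\<phi> (n + 1) = ?A (Suc m) $ 1 $ s"
      using A2[of m] A2[of "Suc m"] m by (simp_all add: \<phi>_def nat_add_distrib)
    ultimately have "\<phi> (n + 1) = (z - complex_of_real (f (real_of_int n * \<omega> + \<theta>))) * \<phi> n - \<phi> (n - 1)" by (simp only: \<theta>)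
    then show ?thesis by (simp add: jacobi_def scaleR_conv_of_real left_diff_distrib)
  qed
  define j where "j = (if r = 1 then int k + 1 else int k)"
  have "\<phi> j = ?A k $ r $ s"
    using A2[of k] exhaust_2[of r] by (auto simp: j_def \<phi>_def nat_add_distrib)
  then have j: "M / 4 \<le> cmod (\<phi> j)" using rs by simp
  have start: "\<phi> 0 = ?A 0 $ 2 $ s" "\<phi> 1 = ?A 0 $ 1 $ s" "\<phi> 2 = ?A (Suc 0) $ 1 $ s"
    using A2[of 0] A2[of 1] by (simp_all add: \<phi>_def numeral_2_eq_2)
  have "cmod (\<phi> 0) \<le> 1" "cmod (\<phi> 1) \<le> 1"
    unfolding start by (simp_all add: mat_def)
  \<comment> \<open>\<open>M > 4\<close> pushes \<open>j\<close> beyond the initial sites and thus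
    to the right of the Dirichlet point \<open>b\<close>.\<close>
  moreover have "cmod (\<phi> j) > 1" using j M by simp
  ultimately have "j \<noteq> 0" "j \<noteq> 1" by auto
  moreover have "j \<ge> 0" by (simp add: j_def)
  ultimately have j2: "j \<ge> 2" by linarith
  have "\<exists>b\<ge>0. b < 2 \<and> \<phi> b = 0 \<and> cmod (\<phi> (b + 1)) = 1"
  proof (cases "s = 1")
    case True
    then show ?thesis by (intro exI[of _ 0]) (simp add: start mat_def)
  next
    case False
    then have "s = 2" using exhaust_2[of s] by simp
    then show ?thesis by (intro exI[of _ 1]) (simp add: start mat_def matrix_mult_2)
  qed
  then obtain b where b: "b \<ge> 0" "b < 2" "\<phi> b = 0" "cmod (\<phi> (b + 1)) = 1" by blast
  have w: "jacobi ?V ?w n = z * ?w n" if "n > b" for n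
    using B.green_eq[OF z, of n] that b(1) by (simp add: delta_def)
  have "(M / 4)\<^sup>2 * (\<Sum>n\<in>{int k + 1..N}. (cmod (?w n))\<^sup>2) \<le> (cmod (\<phi> j))\<^sup>2 * (\<Sum>n\<in>{j..N}. (cmod (?w n))\<^sup>2)"
    using j M(1) by (intro mult_mono power_mono sum_mono2) (auto simp: j_def sum_nonneg split: if_splits)
  also have "\<dots> \<le> (cmod (?w b) / Im z)\<^sup>2"
    by (rule halfline_decay[OF B.green_l2[OF z] w b(3,4) _ z]) (use sol b j2 in auto)
  also have "\<dots> \<le> (1 / Im z / Im z)\<^sup>2"
    using z B.green_norm_le[OF z, of b] by (intro power_mono divide_right_mono) auto
  also have "\<dots> = 1 / Im z ^ 4" by (simp add: power2_eq_square power4_eq_xxxx)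
  finally have "(\<Sum>n\<in>{int k + 1..N}. (cmod (?w n))\<^sup>2) \<le> 1 / Im z ^ 4 / (M / 4)\<^sup>2"
    using M(1) by (subst pos_le_divide_eq) (auto simp: mult.commute)
  also have "\<dots> = 16 / (M\<^sup>2 * Im z ^ 4)" by (simp add: power_divide)
  finally show ?thesis .
qed

lemma green_tail_left:
  assumes z: "Im z > 0" and M: "M > 4" "mnorm (cocycle f (- \<omega>) z k (\<theta> - \<omega>)) \<ge> M"
  shows "(\<Sum>n\<in>{- N..- int k - 1}. (cmod (greens \<omega> \<theta> z n))\<^sup>2) \<le> 16 / (M\<^sup>2 * Im z ^ 4)"
proof -
  interpret B: bounded_potential "orbit_potential f \<omega> \<theta>" F by (rule bounded_orbit)
  have r: "greens (- \<omega>) \<theta> z n = greens \<omega> \<theta> z (- n)" for n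
    using B.green_reflect[OF z, of n] by simp
  have "(\<Sum>n\<in>{- N..- int k - 1}. (cmod (greens \<omega> \<theta> z n))\<^sup>2) = (\<Sum>n\<in>{int k + 1..N}. (cmod (greens (- \<omega>) \<theta> z n))\<^sup>2)"
    unfolding r by (rule sum.reindex_bij_witness[of _ uminus uminus]) auto
  also have "\<dots> \<le> 16 / (M\<^sup>2 * Im z ^ 4)"
    by (rule green_tail_right[OF z M(1)]) (use M(2) in simp)
  finally show ?thesis .
qed

text \<open>By \<open>green_energy\<close> the total mass is \<open>Im G(0) / Im z\<close>, and only
  the two tails lie outside the box.\<close>

lemma green_box:
  assumes z: "Im z > 0" and M: "M > 4"
    and R: "k \<le> K" "mnorm (cocycle f \<omega> z k (\<theta> + \<omega>)) \<ge> M"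
    and L: "l \<le> K" "mnorm (cocycle f (- \<omega>) z l (\<theta> - \<omega>)) \<ge> M"
  shows "Im (greens \<omega> \<theta> z 0) \<le> Im z * (\<Sum>n\<in>{- int K..int K}. (cmod (greens \<omega> \<theta> z n))\<^sup>2) + 32 / (M\<^sup>2 * Im z ^ 3)"
proof -
  let ?w = "\<lambda>n. (cmod (greens \<omega> \<theta> z n))\<^sup>2"
  interpret B: bounded_potential "orbit_potential f \<omega> \<theta>" F by (rule bounded_orbit)
  have "(\<Sum>\<^sub>\<infinity>n. ?w n) \<le> (\<Sum>n\<in>{- int K..int K}. ?w n) + 32 / (M\<^sup>2 * Im z ^ 4)"
  proof (rule infsum_le_finite_sums[OF B.green_summable[OF z]])
    fix A :: "int set" assume A: "finite A"
    then obtain N where N: "A \<subseteq> {- N..N}"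
    proof -
      have "A \<subseteq> {- (\<Sum>a\<in>A. \<bar>a\<bar>)..\<Sum>a\<in>A. \<bar>a\<bar>}"
        using member_le_sum[of _ A abs] A by fastforce
      then show thesis by (rule that)
    qed
    have "A \<subseteq> {- int K..int K} \<union> ({int k + 1..N} \<union> {- N..- int l - 1})"
      using N R(1) L(1) by force
    then have "(\<Sum>n\<in>A. ?w n) \<le> (\<Sum>n\<in>{- int K..int K} \<union> ({int k + 1..N} \<union> {- N..- int l - 1}). ?w n)"
      by (intro sum_mono2) auto
    also have "\<dots> \<le> (\<Sum>n\<in>{- int K..int K}. ?w n) + ((\<Sum>n\<in>{int k + 1..N}. ?w n) + (\<Sum>n\<in>{- N..- int l - 1}. ?w n))"
    proof -
      have un: "sum ?w (X \<union> Y) \<le> sum ?w X + sum ?w Y" if "finite X" "finite Y" for X Y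
        using sum.union_inter[OF that, of ?w] sum_nonneg[of "X \<inter> Y" ?w] by simp
      show ?thesis by (intro order_trans[OF un] add_mono order_refl) auto
    qed
    also have "\<dots> \<le> (\<Sum>n\<in>{- int K..int K}. ?w n) + (16 / (M\<^sup>2 * Im z ^ 4) + 16 / (M\<^sup>2 * Im z ^ 4))"
      by (intro add_mono order_refl green_tail_right[OF z M R(2)] green_tail_left[OF z M L(2)])
    finally show "(\<Sum>n\<in>A. ?w n) \<le> (\<Sum>n\<in>{- int K..int K}. ?w n) + 32 / (M\<^sup>2 * Im z ^ 4)" by simp
  qed
  then have "Im z * (\<Sum>\<^sub>\<infinity>n. ?w n) \<le> Im z * ((\<Sum>n\<in>{- int K..int K}. ?w n) + 32 / (M\<^sup>2 * Im z ^ 4))"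
    using z by (intro mult_left_mono) auto
  moreover have "Im z * (32 / (M\<^sup>2 * Im z ^ 4)) = 32 / (M\<^sup>2 * Im z ^ 3)"
    using z by (simp add: field_simps power_numeral_reduce)
  ultimately show ?thesis using B.green_energy[OF z] by (simp add: distrib_left)
qed

end

context hoelder_sampling begin

text \<open>The same \<open>N\<close> serves both sides: reversing the frequency changes neither the
  exponent nor the density of the orbit.\<close>

lemma green_localized:
  assumes irr: "\<omega> \<notin> \<rat>" and L: "lyapunov f \<omega> (complex_of_real E) > 0" and a: "a > 0" and C: "C > 0"
  shows "\<forall>\<^sub>F N in sequentially. orbit_dense \<omega> N (real N powr - a) \<longrightarrow>
    (\<forall>\<theta> z. Im z > 0 \<longrightarrow> cmod (z - complex_of_real E) \<le> real N powr - a \<longrightarrow>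
      Im (greens \<omega> \<theta> z 0) \<le> Im z * (\<Sum>n\<in>{- int (2 * N)..int (2 * N)}. (cmod (greens \<omega> \<theta> z n))\<^sup>2) + 32 / ((real N powr C)\<^sup>2 * Im z ^ 3))"
proof -
  have "- \<omega> \<notin> \<rat>" using irr Rats_minus_iff[of \<omega>] by simp
  note left = orbit_growth[OF this _ a C, of "complex_of_real E", unfolded lyapunov_uminus, OF L]
  have "filterlim (\<lambda>N. real N powr C) at_top sequentially"
    by (rule filterlim_compose[OF filterlim_powr_at_top[OF C] filterlim_real_sequentially])
  then have "\<forall>\<^sub>F N in sequentially. real N powr C > 4" by (simp add: filterlim_at_top_dense)
  with orbit_growth[OF irr L a C] left show ?thesis
  proof eventually_elim
    case (elim N)
    show ?case
    proof (intro impI allI)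
      fix \<theta> z assume d: "orbit_dense \<omega> N (real N powr - a)" and z: "Im z > 0" "cmod (z - complex_of_real E) \<le> real N powr - a"
      obtain k where "k \<le> 2 * N" "mnorm (cocycle f \<omega> z k (\<theta> + \<omega>)) \<ge> real N powr C"
        using elim(1) d z(2) by blast
      moreover obtain l where "l \<le> 2 * N" "mnorm (cocycle f (- \<omega>) z l (\<theta> - \<omega>)) \<ge> real N powr C"
        using elim(2) orbit_dense_uminus[OF d] z(2) by blast
      ultimately show "Im (greens \<omega> \<theta> z 0) \<le> Im z * (\<Sum>n\<in>{- int (2 * N)..int (2 * N)}. (cmod (greens \<omega> \<theta> z n))\<^sup>2) + 32 / ((real N powr C)\<^sup>2 * Im z ^ 3)"
        by (intro green_box z elim(3))
    qed
  qed
qed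

end

section \<open>Time-averaged dynamics\<close>

context bounded_sampling begin

text \<open>For \<open>e = 1 / T\<close> this is, up to normalisation, the averaged probability of
  the site for one of the two initial states.\<close>

definition dwell :: "real \<Rightarrow> real \<Rightarrow> real \<Rightarrow> int \<Rightarrow> real" where
  "dwell \<omega> \<theta> e n = (LINT t:{0..}|lborel. exp (- (2 * e) * t) * (cmod (evolution \<omega> \<theta> t n))\<^sup>2)"

lemma dwell_integrable:
  assumes "e > 0"
  shows "set_integrable lborel {0..} (\<lambda>t. exp (- (2 * e) * t) * (cmod (evolution \<omega> \<theta> t n))\<^sup>2)"
proof -
  interpret B: bounded_potential "orbit_potential f \<omega> \<theta>" F by (rule bounded_orbit)
  show ?thesis
  proof (rule set_integrable_exp_dominated(1)[of "2 * e" _ 1])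
    fix t :: real assume "t \<ge> 0"
    then show "norm (exp (- (2 * e) * t) * (cmod (evolution \<omega> \<theta> t n))\<^sup>2) \<le> 1 * exp (- (2 * e) * t)"
      using B.evol_le_1[of t n] by (simp add: mult_left_le power_le_one)
  qed (use assms in auto)
qed

lemma dwell_nonneg: "dwell \<omega> \<theta> e n \<ge> 0"
  unfolding dwell_def set_lebesgue_integral_def by (rule Bochner_Integration.integral_nonneg) (simp add: indicator_def)

text \<open>Through \<open>box_prob_pos\<close> it supplies the strict inequality when
  \<open>U\<close> is null for both phases.\<close>

lemma dwell_pos:
  assumes e: "e > 0"
  shows "dwell \<omega> \<theta> e 0 > 0"
proof -
  interpret B: bounded_potential "orbit_potential f \<omega> \<theta>" F by (rule bounded_orbit)
  obtain d where d: "d > 0" "\<And>t. \<bar>t\<bar> < d \<Longrightarrow> cmod (B.evol t 0 - 1) < 1 / 2"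
    using B.evol_cont[of 0 0] unfolding continuous_at_eps_delta B.evol_0
    by (auto simp: delta_def dist_norm elim: allE[of _ "1/2"])
  define c where "c = exp (- (2 * e) * d) * (1 / 2)\<^sup>2"
  have c: "c > 0" by (simp add: c_def)
  have "(LINT t|lborel. indicator {0..d / 2} t * c) \<le> dwell \<omega> \<theta> e 0"
    unfolding dwell_def set_lebesgue_integral_def
  proof (rule integral_mono)
    show "integrable lborel (\<lambda>t. indicator {0..d / 2} t * c)"
      by (intro integrable_mult_left integrable_real_indicator) (auto simp: emeasure_lborel_Icc_eq)
    show "integrable lborel (\<lambda>t. indicator {0..} t *\<^sub>R (exp (- (2 * e) * t) * (cmod (B.evol t 0))\<^sup>2))"
      using dwell_integrable[OF e, of \<omega> \<theta> 0] unfolding set_integrable_def .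
    fix t :: real
    show "indicator {0..d / 2} t * c \<le> indicator {0..} t *\<^sub>R (exp (- (2 * e) * t) * (cmod (B.evol t 0))\<^sup>2)"
    proof (cases "t \<in> {0..d / 2}")
      case True
      then have "cmod (B.evol t 0 - 1) < 1 / 2" using d by auto
      then have "1 / 2 \<le> cmod (B.evol t 0)" using norm_triangle_ineq3[of "B.evol t 0" 1] by auto
      moreover have "e * t \<le> e * d" using True e d by (intro mult_left_mono) auto
      ultimately show ?thesis using True unfolding c_def by (simp, intro mult_mono power_mono) auto
    qed (simp add: indicator_def)
  qed
  moreover have "(LINT t|lborel. indicator {0..d / 2} t * c) = d / 2 * c" using d(1) by simp
  ultimately show ?thesis using mult_pos_pos[OF d(1) c] by linarith
qed

text \<open>The evolution of \<open>delta 1\<close> is that of \<open>delta 0\<close> at the phase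
  \<open>\<theta> + \<omega>\<close>, displaced by one site.\<close>

lemma avg_site_prob_eq:
  assumes T: "T > 0"
  shows "avg_site_prob f \<omega> \<theta> T n = (dwell \<omega> \<theta> (1 / T) n + dwell \<omega> (\<theta> + \<omega>) (1 / T) (n - 1)) / T"
proof -
  interpret B: bounded_potential "orbit_potential f \<omega> \<theta>" F by (rule bounded_orbit)
  interpret B1: bounded_potential "orbit_potential f \<omega> (\<theta> + \<omega>)" F by (rule bounded_orbit)
  have e0: "l2_inner (op_exp (schroedinger f \<omega> \<theta>) (- \<i> * complex_of_real t) (delta 0)) (delta n) = B.evol t n" for t
    by (simp add: l2_inner_delta schroedinger_eq_jacobi B.evol_def)
  have e1: "l2_inner (op_exp (schroedinger f \<omega> \<theta>) (- \<i> * complex_of_real t) (delta 1)) (delta n) = B1.evol t (n - 1)" for t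
  proof -
    have "(\<lambda>n. f (real_of_int (n + 1) * \<omega> + \<theta>)) = orbit_potential f \<omega> (\<theta> + \<omega>)" by (simp add: algebra_simps)
    then show ?thesis
      unfolding l2_inner_delta schroedinger_eq_jacobi B1.evol_def op_exp_def jacobi_pow_shift[where m=1] by simp
  qed
  have "(\<lambda>t. exp (- 2 * t / T) * site_prob f \<omega> \<theta> n t) =
     (\<lambda>t. 1 / 2 * (exp (- (2 * (1 / T)) * t) * (cmod (B.evol t n))\<^sup>2 + exp (- (2 * (1 / T)) * t) * (cmod (B1.evol t (n - 1)))\<^sup>2))"
  proof
    fix t
    have "a * (1 / 2 * (b + c)) = 1 / 2 * (a * b + a * c)" for a b c :: real by (simp add: distrib_left)
    moreover have "exp (- 2 * t / T) = exp (- (2 * (1 / T)) * t)" by simp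
    ultimately show "exp (- 2 * t / T) * site_prob f \<omega> \<theta> n t =
       1 / 2 * (exp (- (2 * (1 / T)) * t) * (cmod (B.evol t n))\<^sup>2 + exp (- (2 * (1 / T)) * t) * (cmod (B1.evol t (n - 1)))\<^sup>2)"
      unfolding site_prob_def e0 e1 by (simp only:)
  qed
  then show ?thesis
    unfolding avg_site_prob_def using dwell_integrable[of "1 / T"] T
    by (simp only: set_integral_mult_right set_integral_add dwell_def[symmetric]) (simp add: set_integral_add(2) dwell_def add_divide_distrib)
qed

lemma avg_site_prob_nonneg: "T > 0 \<Longrightarrow> avg_site_prob f \<omega> \<theta> T n \<ge> 0"
  by (simp add: avg_site_prob_eq dwell_nonneg)

lemma finite_box: "finite {n::int. \<bar>real_of_int n\<bar> \<le> L}"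
  by (rule finite_subset[of _ "{- \<lceil>L\<rceil>..\<lceil>L\<rceil>}"]) (auto simp: abs_le_iff, linarith+)

lemma box_prob_mono: "T > 0 \<Longrightarrow> L \<le> L' \<Longrightarrow> box_prob f \<omega> \<theta> T L \<le> box_prob f \<omega> \<theta> T L'"
  unfolding box_prob_def by (intro sum_mono2 finite_box avg_site_prob_nonneg) auto

lemma box_prob_pos:
  assumes "T > 0" "L \<ge> 0"
  shows "box_prob f \<omega> \<theta> T L > 0"
  unfolding box_prob_def
proof (rule sum_pos2[OF finite_box])
  show "avg_site_prob f \<omega> \<theta> T 0 > 0"
    unfolding avg_site_prob_eq[OF assms(1)] using dwell_pos[of "1 / T" \<omega> \<theta>] dwell_nonneg[of \<omega> "\<theta> + \<omega>" "1 / T" "- 1"] assms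
    by (intro divide_pos_pos add_pos_nonneg) auto
qed (use assms avg_site_prob_nonneg in auto)

text \<open>The additional 1 makes up for the displacement by one site at the second phase.\<close>

lemma box_prob_ge_dwell:
  assumes T: "T > 0" and L: "real_of_int k + 1 \<le> L"
  shows "(\<Sum>n\<in>{- k..k}. dwell \<omega> \<theta> (1 / T) n) + (\<Sum>n\<in>{- k..k}. dwell \<omega> (\<theta> + \<omega>) (1 / T) n) \<le> T * box_prob f \<omega> \<theta> T L"
proof -
  let ?A = "{n::int. \<bar>real_of_int n\<bar> \<le> L}"
  have A: "n \<in> ?A" if "\<bar>n\<bar> \<le> k + 1" for n
  proof -
    have "real_of_int \<bar>n\<bar> \<le> real_of_int (k + 1)" using that by (simp only: of_int_le_iff)
    then show ?thesis using L by simp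
  qed
  have "(\<Sum>n\<in>{- k..k}. dwell \<omega> \<theta> (1 / T) n) \<le> (\<Sum>n\<in>?A. dwell \<omega> \<theta> (1 / T) n)"
    by (intro sum_mono2 finite_box dwell_nonneg) (auto intro!: A[simplified])
  moreover have "(\<Sum>n\<in>{- k..k}. dwell \<omega> (\<theta> + \<omega>) (1 / T) n) = (\<Sum>n\<in>{- k + 1..k + 1}. dwell \<omega> (\<theta> + \<omega>) (1 / T) (n - 1))"
    by (rule sum.reindex_bij_witness[of _ "\<lambda>n. n - 1" "\<lambda>n. n + 1"]) auto
  moreover have "\<dots> \<le> (\<Sum>n\<in>?A. dwell \<omega> (\<theta> + \<omega>) (1 / T) (n - 1))"
    by (intro sum_mono2 finite_box dwell_nonneg) (auto intro!: A[simplified])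
  moreover have "T * box_prob f \<omega> \<theta> T L = (\<Sum>n\<in>?A. dwell \<omega> \<theta> (1 / T) n) + (\<Sum>n\<in>?A. dwell \<omega> (\<theta> + \<omega>) (1 / T) (n - 1))"
    using T by (simp add: box_prob_def avg_site_prob_eq sum_distrib_left sum.distrib)
  ultimately show ?thesis by linarith
qed

lemma greens_measurable [measurable]:
  "e > 0 \<Longrightarrow> (\<lambda>E. greens \<omega> \<theta> (Complex E e) n) \<in> borel_measurable borel"
  by (rule bounded_potential.green_measurable[OF bounded_orbit])

lemma greens_plancherel_sum:
  assumes e: "e > 0" and S: "S \<in> sets borel" "S \<subseteq> {-R..R}"
  shows "(\<integral>\<^sup>+E\<in>S. ennreal (\<Sum>n\<in>A. (cmod (greens \<omega> \<theta> (Complex E e) n))\<^sup>2) \<partial>lborel) \<le>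
    ennreal (2 * pi * (\<Sum>n\<in>A. dwell \<omega> \<theta> e n))"
proof -
  note [measurable] = greens_measurable[OF e] S(1)
  have "(\<integral>\<^sup>+E\<in>S. ennreal (\<Sum>n\<in>A. (cmod (greens \<omega> \<theta> (Complex E e) n))\<^sup>2) \<partial>lborel) =
      (\<Sum>n\<in>A. (\<integral>\<^sup>+E\<in>S. ennreal ((cmod (greens \<omega> \<theta> (Complex E e) n))\<^sup>2) \<partial>lborel))"
    by (subst nn_integral_sum[symmetric]) (auto simp: sum_ennreal sum_distrib_right[symmetric])
  also have "\<dots> \<le> (\<Sum>n\<in>A. ennreal (2 * pi * dwell \<omega> \<theta> e n))"
    unfolding dwell_def by (intro sum_mono bounded_potential.green_plancherel[OF bounded_orbit e S])
  also have "\<dots> = ennreal (2 * pi * (\<Sum>n\<in>A. dwell \<omega> \<theta> e n))"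
    by (simp add: sum_ennreal dwell_nonneg sum_distrib_left)
  finally show ?thesis .
qed

text \<open>Here the box accounts for \<open>Im G(0)\<close> up to \<open>\<eta>\<close>. The energy
  range exceeds the spectral bound \<open>2 + F\<close> by 1, so it contains
  \<open>{x - e..x + e}\<close> for spectral \<open>x\<close> and \<open>e \<le> 1\<close>.\<close>

definition localized_energies :: "real \<Rightarrow> real \<Rightarrow> real \<Rightarrow> int \<Rightarrow> real \<Rightarrow> real set" where
  "localized_energies \<omega> \<theta> e k \<eta> = {E \<in> {- (3 + F)..3 + F}.
     Im (greens \<omega> \<theta> (Complex E e) 0) \<le> e * (\<Sum>n\<in>{- k..k}. (cmod (greens \<omega> \<theta> (Complex E e) n))\<^sup>2) + \<eta>}"

lemma localized_energies_measurable:
  assumes "e > 0" shows "localized_energies \<omega> \<theta> e k \<eta> \<in> sets borel"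
proof -
  note [measurable] = greens_measurable[OF assms]
  have [measurable]: "Im \<in> borel_measurable borel" by (intro borel_measurable_continuous_onI continuous_intros)
  show ?thesis unfolding localized_energies_def by measurable
qed

abbreviation poisson_mass :: "real set \<Rightarrow> real \<Rightarrow> real \<Rightarrow> ennreal" where
  "poisson_mass S e x \<equiv> \<integral>\<^sup>+E\<in>S. ennreal (e / ((x - E)\<^sup>2 + e\<^sup>2)) \<partial>lborel"

text \<open>On localized energies \<open>Im G(0)\<close> is bounded by the mass in the box, which
  Plancherel converts into dwell times; \<open>2 * (3 + F)\<close> is the length of the energy
  range.\<close>

lemma spectral_poisson_mass_le:
  assumes e: "e > 0" and \<eta>: "\<eta> \<ge> 0" and S: "S \<in> sets borel" "S \<subseteq> localized_energies \<omega> \<theta> e k \<eta>"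
  shows "(\<integral>\<^sup>+x. poisson_mass S e x \<partial>spectral_measure f \<omega> \<theta>) \<le>
    ennreal (2 * pi * e * (\<Sum>n\<in>{- k..k}. dwell \<omega> \<theta> e n) + 2 * (3 + F) * \<eta>)"
proof -
  note [measurable] = greens_measurable[OF e] S(1)
  have F0: "F \<ge> 0" using f_bound[of 0] by linarith
  have S2: "S \<subseteq> {- (3 + F)..3 + F}" using S(2) by (auto simp: localized_energies_def)
  let ?\<mu> = "spectral_measure f \<omega> \<theta>" and ?g = "\<lambda>E. greens \<omega> \<theta> (Complex E e)"
  interpret prob_space ?\<mu> by (rule spectral_measure_props)
  have "(\<integral>\<^sup>+x. poisson_mass S e x \<partial>?\<mu>) = (\<integral>\<^sup>+E\<in>S. ennreal (Im (stieltjes ?\<mu> (Complex E e))) \<partial>lborel)"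
    by (rule stieltjes_window[symmetric]) (use e S spectral_measure_props in \<open>auto intro: finite_measure_axioms\<close>)
  also have "\<dots> = (\<integral>\<^sup>+E\<in>S. ennreal (Im (?g E 0)) \<partial>lborel)"
    using bounded_potential.spectral_green[OF bounded_orbit spectral_measure_spectral] e by simp
  also have "\<dots> \<le> (\<integral>\<^sup>+E. ennreal e * (ennreal (\<Sum>n\<in>{- k..k}. (cmod (?g E n))\<^sup>2) * indicator S E) + ennreal \<eta> * indicator S E \<partial>lborel)"
  proof (rule nn_integral_mono)
    fix E
    show "ennreal (Im (?g E 0)) * indicator S E \<le> ennreal e * (ennreal (\<Sum>n\<in>{- k..k}. (cmod (?g E n))\<^sup>2) * indicator S E) + ennreal \<eta> * indicator S E"
      using S(2) e \<eta> by (auto simp: localized_energies_def indicator_def ennreal_mult'[symmetric] ennreal_plus[symmetric] sum_nonneg simp del: ennreal_plus intro!: ennreal_leI)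
  qed
  also have "\<dots> = ennreal e * (\<integral>\<^sup>+E\<in>S. ennreal (\<Sum>n\<in>{- k..k}. (cmod (?g E n))\<^sup>2) \<partial>lborel) + ennreal \<eta> * emeasure lborel S"
    by (simp add: nn_integral_add nn_integral_cmult)
  also have "\<dots> \<le> ennreal e * ennreal (2 * pi * (\<Sum>n\<in>{- k..k}. dwell \<omega> \<theta> e n)) + ennreal \<eta> * ennreal (2 * (3 + F))"
  proof (intro add_mono mult_left_mono)
    show "(\<integral>\<^sup>+E\<in>S. ennreal (\<Sum>n\<in>{- k..k}. (cmod (?g E n))\<^sup>2) \<partial>lborel) \<le> ennreal (2 * pi * (\<Sum>n\<in>{- k..k}. dwell \<omega> \<theta> e n))"
      by (rule greens_plancherel_sum[OF e S(1) S2])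
    have "emeasure lborel S \<le> emeasure lborel {- (3 + F)..3 + F}" by (intro emeasure_mono S2) simp
    also have "\<dots> = ennreal (2 * (3 + F))" using F0 by (simp add: algebra_simps)
    finally show "emeasure lborel S \<le> ennreal (2 * (3 + F))" .
  qed auto
  also have "\<dots> = ennreal (2 * pi * e * (\<Sum>n\<in>{- k..k}. dwell \<omega> \<theta> e n) + 2 * (3 + F) * \<eta>)"
    using e \<eta> F0 by (simp add: ennreal_mult'[symmetric] ennreal_plus[symmetric] sum_nonneg dwell_nonneg mult_ac del: ennreal_plus)
  finally show ?thesis .
qed

text \<open>The window around \<open>x\<close> is localized from an index on that depends on
  \<open>x\<close>, which Fatou's lemma tolerates. A constant strictly below \<open>pi / 2\<close>
  turns the lower limit into an eventual inequality.\<close>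

lemma poisson_mass_fatou:
  assumes U: "U \<in> sets borel" "measure (spectral_measure f \<omega> \<theta>) U > 0" and c: "0 \<le> c" "c < pi / 2"
    and e: "\<And>i. e i > 0" and S: "\<And>i. S i \<in> sets borel"
    and win: "\<And>x. x \<in> U \<Longrightarrow> \<bar>x\<bar> \<le> 2 + F \<Longrightarrow> \<forall>\<^sub>F i in sequentially. {x - e i..x + e i} \<subseteq> S i"
  shows "\<forall>\<^sub>F i in sequentially. ennreal (c * measure (spectral_measure f \<omega> \<theta>) U) < (\<integral>\<^sup>+x. poisson_mass (S i) (e i) x \<partial>spectral_measure f \<omega> \<theta>)"
proof -
  let ?\<mu> = "spectral_measure f \<omega> \<theta>"
  note sets [measurable_cong] = spectral_measure_props(2)[of \<omega> \<theta>]
  note [measurable] = S U(1)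
  interpret prob_space ?\<mu> by (rule spectral_measure_props)
  have "ennreal (c * measure ?\<mu> U) < ennreal (pi / 2 * measure ?\<mu> U)"
    using U(2) c by (intro ennreal_lessI mult_strict_right_mono) auto
  also have "\<dots> = (\<integral>\<^sup>+x. ennreal (pi / 2) * indicator U x \<partial>?\<mu>)"
    by (simp add: nn_integral_cmult emeasure_eq_measure ennreal_mult'[symmetric])
  also have "\<dots> \<le> (\<integral>\<^sup>+x. liminf (\<lambda>i. poisson_mass (S i) (e i) x) \<partial>?\<mu>)"
  proof (rule nn_integral_mono_AE)
    show "AE x in ?\<mu>. ennreal (pi / 2) * indicator U x \<le> liminf (\<lambda>i. poisson_mass (S i) (e i) x)"
      using spectral_measure_props(3)[of \<omega> \<theta>]
    proof eventually_elim
      case (elim x)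
      show ?case
      proof (cases "x \<in> U")
        case True
        from win[OF True elim] have "\<forall>\<^sub>F i in sequentially. ennreal (pi / 2) \<le> poisson_mass (S i) (e i) x"
          by eventually_elim (rule poisson_window_ge[OF e])
        then show ?thesis using True by (simp add: Liminf_bounded)
      qed simp
    qed
  qed
  also have "\<dots> \<le> liminf (\<lambda>i. \<integral>\<^sup>+x. poisson_mass (S i) (e i) x \<partial>?\<mu>)"
    by (rule nn_integral_liminf) measurable
  finally show ?thesis by (rule less_LiminfD)
qed

end

context hoelder_sampling begin

text \<open>\<open>N\<close> is a third of \<open>T powr \<zeta>\<close> so that the radius
  \<open>2 * N + 1\<close> fits into the box. The Poisson mass is at least \<open>3 * pi / 8\<close>
  times the spectral mass, whereas the claim needs \<open>2 * pi / 8\<close>; the difference covers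
  the error of order \<open>1 / T\<close>.\<close>

theorem box_prob_lower_bound:
  assumes irr: "\<omega> \<notin> \<rat>" and U: "U \<in> sets borel" and L: "\<And>E. E \<in> U \<Longrightarrow> lyapunov f \<omega> (complex_of_real E) > 0"
    and a: "0 < a" "a \<le> 1" and \<zeta>: "0 < \<zeta>" "\<zeta> \<le> 1" and T: "filterlim T at_top sequentially"
  defines "N \<equiv> \<lambda>i. nat \<lfloor>T i powr \<zeta> / 3\<rfloor>"
  assumes dense: "\<forall>\<^sub>F i in sequentially. orbit_dense \<omega> (N i) (real (N i) powr - a)"
  shows "\<forall>\<^sub>F i in sequentially. box_prob f \<omega> \<theta> (T i) (T i powr \<zeta>) >
    (measure (spectral_measure f \<omega> \<theta>) U + measure (spectral_measure f \<omega> (\<theta> + \<omega>)) U) / 8"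
proof -
  let ?m = "\<lambda>\<phi>. measure (spectral_measure f \<omega> \<phi>) U"
  have T1: "\<forall>\<^sub>F i in sequentially. T i > 1" using T by (simp add: filterlim_at_top_dense)
  have Nlim: "filterlim (\<lambda>i. real (N i)) at_top sequentially"
  proof (rule filterlim_at_top_mono)
    show "filterlim (\<lambda>i. - 1 + (1 / 3) * T i powr \<zeta>) at_top sequentially"
      by (intro filterlim_tendsto_add_at_top[OF tendsto_const] filterlim_tendsto_pos_mult_at_top[OF tendsto_const]
          filterlim_compose[OF filterlim_powr_at_top[OF \<zeta>(1)] T]) simp
    show "\<forall>\<^sub>F i in sequentially. - 1 + (1 / 3) * T i powr \<zeta> \<le> real (N i)"
      unfolding N_def by (intro always_eventually allI) linarith
  qed
  then have Nlim': "filterlim N sequentially sequentially"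
    by (simp add: filterlim_sequentially_iff_filterlim_real)
  have N1: "\<forall>\<^sub>F i in sequentially. N i \<ge> 1" using Nlim' by (simp add: filterlim_at_top)
  have N3: "\<forall>\<^sub>F i in sequentially. 3 * real (N i) \<le> T i powr \<zeta>"
  proof (intro always_eventually allI)
    fix i
    have "T i powr \<zeta> / 3 \<ge> 0" by simp
    then show "3 * real (N i) \<le> T i powr \<zeta>" unfolding N_def by linarith
  qed
  have "filterlim (\<lambda>i. T i powr (\<zeta> / 2)) at_top sequentially"
    using \<zeta> by (intro filterlim_compose[OF filterlim_powr_at_top T]) simp
  then have "\<forall>\<^sub>F i in sequentially. T i powr (\<zeta> / 2) > 6" by (simp add: filterlim_at_top_dense)
  then have Nge: "\<forall>\<^sub>F i in sequentially. T i powr (\<zeta> / 2) \<le> real (N i)"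
  proof eventually_elim
    case (elim i)
    have "6 * T i powr (\<zeta> / 2) \<le> T i powr (\<zeta> / 2) * T i powr (\<zeta> / 2)"
      using elim by (intro mult_right_mono) auto
    also have "\<dots> = T i powr \<zeta>" by (simp add: powr_add[symmetric])
    finally show ?case using elim unfolding N_def by linarith
  qed
  \<comment> \<open>As \<open>N \<ge> T powr (\<zeta> / 2)\<close>, this gives
    \<open>N powr (2 * C) \<ge> T ^ 4\<close>, one power more than the \<open>T ^ 3\<close> lost in
    \<open>green_localized\<close>.\<close>
  define C where "C = 4 / \<zeta>"
  have C: "C > 0" using \<zeta> by (simp add: C_def)
  define S where "S = (\<lambda>i. localized_energies \<omega> \<theta> (1 / T i) (int (2 * N i)) (32 / T i) \<inter> localized_energies \<omega> (\<theta> + \<omega>) (1 / T i) (int (2 * N i)) (32 / T i))"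
  have win: "\<forall>\<^sub>F i in sequentially. {x - 1 / T i..x + 1 / T i} \<subseteq> S i" if x: "x \<in> U" "\<bar>x\<bar> \<le> 2 + F" for x
  proof -
    note ev = eventually_compose_filterlim[OF green_localized[OF irr L[OF x(1)] a(1) C] Nlim']
    show ?thesis
      using ev dense T1 N1 N3 Nge
    proof eventually_elim
      case (elim i)
      let ?T = "T i" and ?N = "real (N i)"
      have T: "?T > 1" by fact
      have "?N powr a \<le> ?N powr 1" using elim a by (intro powr_mono) auto
      moreover have "?T powr \<zeta> \<le> ?T powr 1" using T \<zeta> by (intro powr_mono) auto
      ultimately have Na: "2 * ?N powr a \<le> ?T" using elim T by simp
      then have close: "2 / ?T \<le> ?N powr - a" using elim T by (simp add: powr_minus field_simps)
      have "?T ^ 4 = (?T powr (\<zeta> / 2)) powr (2 * C)" using T \<zeta> by (simp add: powr_powr C_def powr_numeral)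
      also have "\<dots> \<le> ?N powr (2 * C)" using elim(6) C by (intro powr_mono2) auto
      also have "\<dots> = (?N powr C)\<^sup>2" by (simp add: powr_add[symmetric] power2_eq_square)
      finally have T4: "?T ^ 4 \<le> (?N powr C)\<^sup>2" .
      have "0 < ?T ^ 4" using T by simp
      then have "0 < (?N powr C)\<^sup>2" using T4 by (rule less_le_trans)
      then have "32 / ((?N powr C)\<^sup>2 * (1 / ?T) ^ 3) \<le> 32 / (?T ^ 4 * (1 / ?T) ^ 3)"
        using T T4 by (intro divide_left_mono mult_right_mono mult_pos_pos) auto
      also have "\<dots> = 32 / ?T" using T by (simp add: field_simps power_numeral_reduce)
      finally have err: "32 / ((?N powr C)\<^sup>2 * (1 / ?T) ^ 3) \<le> 32 / ?T" .
      show ?case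
      proof
        fix E assume E: "E \<in> {x - 1 / ?T..x + 1 / ?T}"
        have "cmod (Complex E (1 / ?T) - complex_of_real x) \<le> \<bar>E - x\<bar> + \<bar>1 / ?T\<bar>"
          using cmod_le[of "Complex E (1 / ?T) - complex_of_real x"] by simp
        also have "\<dots> \<le> ?N powr - a" using E T close by (auto simp: abs_le_iff)
        finally have near: "cmod (Complex E (1 / ?T) - complex_of_real x) \<le> ?N powr - a" .
        have "Im (greens \<omega> \<phi> (Complex E (1 / ?T)) 0) \<le> 1 / ?T * (\<Sum>n\<in>{- int (2 * N i)..int (2 * N i)}. (cmod (greens \<omega> \<phi> (Complex E (1 / ?T)) n))\<^sup>2) + 32 / ?T" for \<phi>
          using elim(1)[rule_format, OF elim(2) _ near, of \<phi>] T err by (simp del: of_nat_mult)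
        moreover have "1 / ?T \<le> 1" using T by simp
        then have "E \<in> {- (3 + F)..3 + F}" using E x(2) by (auto simp: abs_le_iff)
        ultimately show "E \<in> S i" by (simp add: S_def localized_energies_def)
      qed
    qed
  qed
  \<comment> \<open>Adjusted where \<open>T i \<le> 1\<close>, so that positivity and measurability
    hold at every index.\<close>
  define e where "e = (\<lambda>i. if T i > 1 then 1 / T i else 1)"
  define S' where "S' = (\<lambda>i. if T i > 1 then S i else {})"
  have e: "e i > 0" for i by (simp add: e_def)
  have S': "S' i \<in> sets borel" for i
    by (auto simp: S'_def S_def intro!: sets.Int localized_energies_measurable)
  have win': "\<forall>\<^sub>F i in sequentially. {x - e i..x + e i} \<subseteq> S' i" if "x \<in> U" "\<bar>x\<bar> \<le> 2 + F" for x
    using win[OF that] T1 by eventually_elim (simp add: e_def S'_def)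
  have low: "\<forall>\<^sub>F i in sequentially. ennreal (3 * pi / 8 * ?m \<phi>) \<le> (\<integral>\<^sup>+x. poisson_mass (S' i) (e i) x \<partial>spectral_measure f \<omega> \<phi>)" for \<phi>
  proof (cases "?m \<phi> = 0")
    case False
    then have "?m \<phi> > 0" by (simp add: zero_less_measure_iff)
    have "\<forall>\<^sub>F i in sequentially. ennreal (3 * pi / 8 * ?m \<phi>) < (\<integral>\<^sup>+x. poisson_mass (S' i) (e i) x \<partial>spectral_measure f \<omega> \<phi>)"
      by (rule poisson_mass_fatou[OF U \<open>?m \<phi> > 0\<close> _ _ e S' win']) auto
    then show ?thesis by (rule eventually_mono) (rule less_imp_le)
  qed simp
  have main: "\<forall>\<^sub>F i in sequentially. 3 * pi / 8 * (?m \<theta> + ?m (\<theta> + \<omega>)) \<le>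
      2 * pi * box_prob f \<omega> \<theta> (T i) (T i powr \<zeta>) + 128 * (3 + F) / T i"
    using low[of \<theta>] low[of "\<theta> + \<omega>"] T1 N1 N3
  proof eventually_elim
    case (elim i)
    have T: "T i > 1" by fact
    let ?D = "\<lambda>\<phi>. \<Sum>n\<in>{- int (2 * N i)..int (2 * N i)}. dwell \<omega> \<phi> (1 / T i) n"
    have D0: "?D \<phi> \<ge> 0" for \<phi> by (intro sum_nonneg dwell_nonneg)
    have S: "S i \<in> sets borel" using S'[of i] T by (simp add: S'_def)
    have up: "(\<integral>\<^sup>+x. poisson_mass (S i) (1 / T i) x \<partial>spectral_measure f \<omega> \<phi>) \<le> ennreal (2 * pi * (1 / T i) * ?D \<phi> + 2 * (3 + F) * (32 / T i))"
      if "\<phi> \<in> {\<theta>, \<theta> + \<omega>}" for \<phi>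
      using T that by (intro spectral_poisson_mass_le S) (auto simp: S_def)
    have *: "ennreal (3 * pi / 8 * ?m \<phi>) \<le> ennreal (2 * pi * (1 / T i) * ?D \<phi> + 2 * (3 + F) * (32 / T i))" if "\<phi> \<in> {\<theta>, \<theta> + \<omega>}" for \<phi>
      using that elim(1,2) up[OF that] T by (auto simp: e_def S'_def intro: order_trans)
    have "3 * pi / 8 * ?m \<phi> \<le> 2 * pi * (1 / T i) * ?D \<phi> + 2 * (3 + F) * (32 / T i)" if "\<phi> \<in> {\<theta>, \<theta> + \<omega>}" for \<phi>
    proof (rule ennreal_le_iff[THEN iffD1])
      show "0 \<le> 2 * pi * (1 / T i) * ?D \<phi> + 2 * (3 + F) * (32 / T i)"
        using T F_nonneg by (intro add_nonneg_nonneg mult_nonneg_nonneg D0) auto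
    qed (use that in \<open>rule *\<close>)
    from this[OF insertI1] this[OF insertI2[OF singletonI]]
    have "3 * pi / 8 * (?m \<theta> + ?m (\<theta> + \<omega>)) \<le> 2 * pi * (1 / T i) * (?D \<theta> + ?D (\<theta> + \<omega>)) + 4 * (3 + F) * (32 / T i)"
      unfolding distrib_left[of "3 * pi / 8"] distrib_left[of "2 * pi * (1 / T i)"] by linarith
    also have "2 * pi * (1 / T i) * (?D \<theta> + ?D (\<theta> + \<omega>)) \<le> 2 * pi * (1 / T i) * (T i * box_prob f \<omega> \<theta> (T i) (T i powr \<zeta>))"
      using T elim(4,5) by (intro mult_left_mono box_prob_ge_dwell) auto
    finally show ?case using T by simp
  qed
  show ?thesis
  proof (cases "?m \<theta> + ?m (\<theta> + \<omega>) = 0")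
    case True
    show ?thesis
      using T1 by eventually_elim (simp add: True box_prob_pos)
  next
    case False
    then have m: "?m \<theta> + ?m (\<theta> + \<omega>) > 0" by (simp add: less_le)
    have "(\<lambda>i. 128 * (3 + F) / T i) \<longlonglongrightarrow> 0"
      by (rule tendsto_divide_0[OF tendsto_const filterlim_at_top_imp_at_infinity[OF T]])
    then have "\<forall>\<^sub>F i in sequentially. 128 * (3 + F) / T i < pi / 8 * (?m \<theta> + ?m (\<theta> + \<omega>))"
      by (rule order_tendstoD(2)) (use m in simp)
    with main show ?thesis
    proof eventually_elim
      case (elim i)
      then have "(2 * pi) * ((?m \<theta> + ?m (\<theta> + \<omega>)) / 8) < (2 * pi) * box_prob f \<omega> \<theta> (T i) (T i powr \<zeta>)"
        by (simp add: field_simps)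
      then show ?case by (subst (asm) mult_less_cancel_left_pos) auto
    qed
  qed
qed

lemma box_prob_frequently:
  assumes irr: "\<omega> \<notin> \<rat>" and U: "U \<in> sets borel" and L: "\<And>E. E \<in> U \<Longrightarrow> lyapunov f \<omega> (complex_of_real E) > 0" and \<zeta>: "\<zeta> > 0"
  shows "\<exists>T. filterlim T at_top sequentially \<and> (\<forall>k. box_prob f \<omega> \<theta> (T k) (T k powr \<zeta>) >
    (measure (spectral_measure f \<omega> \<theta>) U + measure (spectral_measure f \<omega> (\<theta> + \<omega>)) U) / 8)"
proof -
  let ?m = "(measure (spectral_measure f \<omega> \<theta>) U + measure (spectral_measure f \<omega> (\<theta> + \<omega>)) U) / 8"
  \<comment> \<open>The lower bound is available for exponents up to 1; enlarging the box afterwards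
    only gains probability.\<close>
  define \<eta> where "\<eta> = min \<zeta> 1"
  have \<eta>: "0 < \<eta>" "\<eta> \<le> 1" "\<eta> \<le> \<zeta>" using \<zeta> by (auto simp: \<eta>_def)
  obtain q where q: "\<And>k. q k \<ge> k \<and> q k > 0 \<and> orbit_dense \<omega> (q k) (real (q k) powr - (1 / 2))"
    using orbit_dense_frequently_powr[OF irr] by metis
  \<comment> \<open>Makes \<open>T k powr \<eta> / 3\<close> equal to \<open>q k\<close>, so the
    orbit length in \<open>box_prob_lower_bound\<close> is exactly the one known to be
    dense.\<close>
  define T where "T = (\<lambda>k. (3 * real (q k)) powr (1 / \<eta>))"
  have Tp: "T k powr \<eta> = 3 * real (q k)" for k
    using q[of k] \<eta> by (simp add: T_def powr_powr)
  have "filterlim (\<lambda>k. real (q k)) at_top sequentially"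
    by (rule filterlim_at_top_mono[OF filterlim_real_sequentially]) (use q in auto)
  then have T: "filterlim T at_top sequentially"
    unfolding T_def using \<eta>(1)
    by (intro filterlim_compose[OF filterlim_powr_at_top] filterlim_tendsto_pos_mult_at_top[OF tendsto_const]) auto
  have "\<forall>\<^sub>F k in sequentially. box_prob f \<omega> \<theta> (T k) (T k powr \<eta>) > ?m"
    by (rule box_prob_lower_bound[OF irr U L, where a="1 / 2"]) (use \<eta> T q in \<open>auto simp: Tp\<close>)
  moreover have "\<forall>\<^sub>F k in sequentially. T k \<ge> 1" using T by (simp add: filterlim_at_top)
  ultimately have "\<forall>\<^sub>F k in sequentially. box_prob f \<omega> \<theta> (T k) (T k powr \<zeta>) > ?m"
  proof eventually_elim
    case (elim k)
    have "box_prob f \<omega> \<theta> (T k) (T k powr \<eta>) \<le> box_prob f \<omega> \<theta> (T k) (T k powr \<zeta>)"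
      using elim \<eta>(3) by (intro box_prob_mono powr_mono) auto
    then show ?case using elim by linarith
  qed
  then obtain k0 where "\<And>k. k \<ge> k0 \<Longrightarrow> box_prob f \<omega> \<theta> (T k) (T k powr \<zeta>) > ?m"
    unfolding eventually_sequentially by blast
  moreover have "filterlim (\<lambda>k. T (k + k0)) at_top sequentially"
    by (rule filterlim_compose[OF T filterlim_add_const_nat_at_top])
  ultimately show ?thesis by (intro exI[of _ "\<lambda>k. T (k + k0)"]) simp
qed

lemma box_prob_eventually:
  assumes irr: "\<omega> \<notin> \<rat>" and dio: "diophantine \<omega>" and U: "U \<in> sets borel" and L: "\<And>E. E \<in> U \<Longrightarrow> lyapunov f \<omega> (complex_of_real E) > 0" and \<zeta>: "\<zeta> > 0"
  shows "\<forall>\<^sub>F T in at_top. box_prob f \<omega> \<theta> T (T powr \<zeta>) >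
    (measure (spectral_measure f \<omega> \<theta>) U + measure (spectral_measure f \<omega> (\<theta> + \<omega>)) U) / 8" (is "\<forall>\<^sub>F T in at_top. ?P T")
proof (rule ccontr)
  let ?m = "(measure (spectral_measure f \<omega> \<theta>) U + measure (spectral_measure f \<omega> (\<theta> + \<omega>)) U) / 8"
  define \<eta> where "\<eta> = min \<zeta> 1"
  have \<eta>: "0 < \<eta>" "\<eta> \<le> 1" "\<eta> \<le> \<zeta>" using \<zeta> by (auto simp: \<eta>_def)
  obtain a where a: "0 < a" "a \<le> 1 / 2" "\<forall>\<^sub>F N in sequentially. orbit_dense \<omega> N (real N powr - a)"
    using orbit_dense_diophantine[OF irr dio] by blast
  assume "\<not> (\<forall>\<^sub>F T in at_top. ?P T)"
  then have "\<forall>i::nat. \<exists>T\<ge>real i. \<not> ?P T" unfolding eventually_at_top_linorder by blast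
  then obtain T where Ti: "\<And>i. T i \<ge> real i" and nP: "\<And>i. \<not> ?P (T i)" by metis
  have T: "filterlim T at_top sequentially"
    by (rule filterlim_at_top_mono[OF filterlim_real_sequentially]) (use Ti in auto)
  have "filterlim (\<lambda>i. nat \<lfloor>T i powr \<eta> / 3\<rfloor>) sequentially sequentially"
    unfolding filterlim_sequentially_iff_filterlim_real
  proof (rule filterlim_at_top_mono)
    show "filterlim (\<lambda>i. - 1 + (1 / 3) * T i powr \<eta>) at_top sequentially"
      by (intro filterlim_tendsto_add_at_top[OF tendsto_const] filterlim_tendsto_pos_mult_at_top[OF tendsto_const]
          filterlim_compose[OF filterlim_powr_at_top[OF \<eta>(1)] T]) simp
    show "\<forall>\<^sub>F i in sequentially. - 1 + (1 / 3) * T i powr \<eta> \<le> real (nat \<lfloor>T i powr \<eta> / 3\<rfloor>)"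
      by (intro always_eventually allI) linarith
  qed
  from eventually_compose_filterlim[OF a(3) this]
  have "\<forall>\<^sub>F i in sequentially. box_prob f \<omega> \<theta> (T i) (T i powr \<eta>) > ?m"
    by (intro box_prob_lower_bound[OF irr U L, where a=a]) (use \<eta> T a in auto)
  moreover have "\<forall>\<^sub>F i in sequentially. T i \<ge> 1" using T by (simp add: filterlim_at_top)
  ultimately have "\<forall>\<^sub>F i in sequentially. False"
  proof eventually_elim
    case (elim i)
    have "box_prob f \<omega> \<theta> (T i) (T i powr \<eta>) \<le> box_prob f \<omega> \<theta> (T i) (T i powr \<zeta>)"
      using elim \<eta>(3) by (intro box_prob_mono powr_mono) auto
    then show ?case using elim nP[of i] by linarith
  qed
  then show False by simp
qed

end

section \<open>Scaling exponents\<close>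

text \<open>If no box carries mass \<open>\<delta>\<close>, then \<open>log_spread\<close> is the unspecified number \<open>ln (Inf {})\<close> divided by
  \<open>ln T\<close>, which still tends to 0.\<close>

lemma log_spread_ge:
  assumes "T > 1"
  shows "log_spread f \<omega> \<theta> \<delta> T \<ge> min 0 (ln (Inf {}) / ln T)"
proof (cases "{L::real. L \<ge> 1 \<and> box_prob f \<omega> \<theta> T L > \<delta>} = {}")
  case True
  then show ?thesis unfolding log_spread_def by (simp only: min.cobounded2)
next
  case False
  then have "Inf {L::real. L \<ge> 1 \<and> box_prob f \<omega> \<theta> T L > \<delta>} \<ge> 1" by (intro cInf_greatest) auto
  then have "log_spread f \<omega> \<theta> \<delta> T \<ge> 0" using assms unfolding log_spread_def by (intro divide_nonneg_nonneg ln_ge_zero) auto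
  then show ?thesis by linarith
qed

lemma log_spread_le:
  assumes "T > 1" "\<zeta> \<ge> 0" "box_prob f \<omega> \<theta> T (T powr \<zeta>) > \<delta>"
  shows "log_spread f \<omega> \<theta> \<delta> T \<le> \<zeta>"
proof -
  let ?A = "{L::real. L \<ge> 1 \<and> box_prob f \<omega> \<theta> T L > \<delta>}"
  have mem: "T powr \<zeta> \<in> ?A" using assms by (simp add: ge_one_powr_ge_zero)
  have "Inf ?A \<le> T powr \<zeta>" using mem by (intro cInf_lower bdd_belowI[of _ 1]) auto
  moreover have "Inf ?A \<ge> 1" using mem by (intro cInf_greatest) auto
  ultimately have "ln (Inf ?A) \<le> ln (T powr \<zeta>)" by (intro ln_mono) auto
  also have "\<dots> = \<zeta> * ln T" using assms by (simp add: ln_powr)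
  finally show ?thesis using assms(1) unfolding log_spread_def by (simp add: divide_le_eq)
qed

lemma Liminf_log_spread_ge: "Liminf at_top (\<lambda>T. ereal (log_spread f \<omega> \<theta> \<delta> T)) \<ge> 0"
proof -
  have "((\<lambda>T::real. ln (Inf {}) / ln T) \<longlongrightarrow> 0) at_top"
    by (rule tendsto_divide_0[OF tendsto_const filterlim_at_top_imp_at_infinity[OF ln_at_top]])
  then have "((\<lambda>T::real. min 0 (ln (Inf {}) / ln T)) \<longlongrightarrow> min 0 0) at_top" by (intro tendsto_min tendsto_const)
  then have "((\<lambda>T::real. ereal (min 0 (ln (Inf {}) / ln T))) \<longlongrightarrow> 0) at_top"
    unfolding zero_ereal_def by (intro tendsto_ereal) simp
  then have "Liminf at_top (\<lambda>T::real. ereal (min 0 (ln (Inf {}) / ln T))) = 0"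
    by (intro lim_imp_Liminf) simp_all
  moreover have "Liminf at_top (\<lambda>T::real. ereal (min 0 (ln (Inf {}) / ln T))) \<le> Liminf at_top (\<lambda>T. ereal (log_spread f \<omega> \<theta> \<delta> T))"
    by (intro Liminf_mono) (use eventually_gt_at_top[of 1] in eventually_elim, simp only: ereal_less_eq log_spread_ge)
  ultimately show ?thesis by simp
qed

text \<open>The lower limit over \<open>T\<close> is 0 for every \<open>\<delta> < m\<close>, so
  nothing is left to the limit in \<open>\<delta>\<close>. A single sequence of times for each
  \<open>\<zeta>\<close> is enough.\<close>

lemma lower_xi_zero:
  assumes m: "m > 0" and fr: "\<And>\<zeta>. \<zeta> > 0 \<Longrightarrow> \<exists>T. filterlim T at_top sequentially \<and> (\<forall>k. box_prob f \<omega> \<theta> (T k) (T k powr \<zeta>) > m)"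
  shows "lower_xi f \<omega> \<theta> = 0"
proof -
  have "Liminf at_top (\<lambda>T. ereal (log_spread f \<omega> \<theta> \<delta> T)) = 0" if \<delta>: "\<delta> < m" for \<delta>
  proof (rule antisym[OF ereal_le_epsilon2 Liminf_log_spread_ge])
    show "Liminf at_top (\<lambda>T. ereal (log_spread f \<omega> \<theta> \<delta> T)) \<le> 0 + ereal \<zeta>" if \<zeta>: "\<zeta> > 0" for \<zeta> :: real
    proof -
      obtain T where T: "filterlim T at_top sequentially" "\<And>k. box_prob f \<omega> \<theta> (T k) (T k powr \<zeta>) > m"
        using fr[OF \<zeta>] by blast
      show "Liminf at_top (\<lambda>T. ereal (log_spread f \<omega> \<theta> \<delta> T)) \<le> 0 + ereal \<zeta>"
      proof (rule ccontr)
        assume "\<not> ?thesis"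
        then have "ereal \<zeta> < Liminf at_top (\<lambda>T. ereal (log_spread f \<omega> \<theta> \<delta> T))" by simp
        then have "\<forall>\<^sub>F T in at_top. ereal \<zeta> < ereal (log_spread f \<omega> \<theta> \<delta> T)" by (rule less_LiminfD)
        from eventually_compose_filterlim[OF this T(1)]
        have "\<forall>\<^sub>F k in sequentially. \<zeta> < log_spread f \<omega> \<theta> \<delta> (T k)" by simp
        moreover have "\<forall>\<^sub>F k in sequentially. T k > 1" using T(1) by (simp add: filterlim_at_top_dense)
        ultimately have "\<forall>\<^sub>F k in sequentially. False"
        proof eventually_elim
          case (elim k)
          then show ?case using log_spread_le[of "T k" \<zeta> \<delta> f \<omega> \<theta>] T(2)[of k] \<delta> \<zeta> by simp
        qed
        then show False by simp
      qed
    qed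
  qed
  then have "\<forall>\<^sub>F \<delta> in at_right 0. Liminf at_top (\<lambda>T. ereal (log_spread f \<omega> \<theta> \<delta> T)) = 0"
    using eventually_at_right_less eventually_at_right[of 0 m "\<lambda>\<delta>. \<delta> < m"] m by (auto intro: eventually_mono)
  then show ?thesis
    unfolding lower_xi_def by (intro tendsto_Lim tendsto_eventually) simp_all
qed

lemma upper_xi_zero:
  assumes m: "m > 0" and ev: "\<And>\<zeta>. \<zeta> > 0 \<Longrightarrow> \<forall>\<^sub>F T in at_top. box_prob f \<omega> \<theta> T (T powr \<zeta>) > m"
  shows "upper_xi f \<omega> \<theta> = 0"
proof -
  have "Limsup at_top (\<lambda>T. ereal (log_spread f \<omega> \<theta> \<delta> T)) = 0" if \<delta>: "\<delta> < m" for \<delta>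
  proof (rule antisym[OF ereal_le_epsilon2 order_trans[OF Liminf_log_spread_ge Liminf_le_Limsup]])
    show "Limsup at_top (\<lambda>T. ereal (log_spread f \<omega> \<theta> \<delta> T)) \<le> 0 + ereal \<zeta>" if \<zeta>: "\<zeta> > 0" for \<zeta> :: real
    proof -
      have "\<forall>\<^sub>F T in at_top. ereal (log_spread f \<omega> \<theta> \<delta> T) \<le> 0 + ereal \<zeta>"
        using ev[OF \<zeta>] eventually_gt_at_top[of 1]
      proof eventually_elim
        case (elim T)
        then show ?case using log_spread_le[of T \<zeta> \<delta> f \<omega> \<theta>] \<delta> \<zeta> by simp
      qed
      then show "Limsup at_top (\<lambda>T. ereal (log_spread f \<omega> \<theta> \<delta> T)) \<le> 0 + ereal \<zeta>" by (rule Limsup_bounded)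
    qed
  qed simp
  then have "\<forall>\<^sub>F \<delta> in at_right 0. Limsup at_top (\<lambda>T. ereal (log_spread f \<omega> \<theta> \<delta> T)) = 0"
    using eventually_at_right[of 0 m "\<lambda>\<delta>. \<delta> < m"] m by (auto intro: eventually_mono)
  then show ?thesis
    unfolding upper_xi_def by (intro tendsto_Lim tendsto_eventually) simp_all
qed

text \<open>The phases whose orbit meets a phase of positive spectral mass form an invariant set of
  positive measure, hence almost everything. If the mass vanished at \<open>\<theta>\<close> and
  \<open>\<theta> + \<omega>\<close>, \<open>spectral_null_orbit\<close> would make it vanish along
  the whole orbit.\<close>

lemma (in hoelder_sampling) spectral_pair_positive:
  assumes irr: "\<omega> \<notin> \<rat>" and U: "U \<in> sets borel" and pos: "emeasure (ids_measure f \<omega>) U > 0"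
  shows "AE \<theta> in lborel. measure (spectral_measure f \<omega> \<theta>) U + measure (spectral_measure f \<omega> (\<theta> + \<omega>)) U > 0"
proof -
  let ?m = "\<lambda>\<theta>. measure (spectral_measure f \<omega> \<theta>) U"
  note [measurable] = spectral_measure_measurable[OF U, of \<omega>]
  have em: "emeasure (spectral_measure f \<omega> \<theta>) U = ennreal (?m \<theta>)" for \<theta>
    using finite_measure.emeasure_eq_measure[OF prob_space.finite_measure[OF spectral_measure_props(1)]] .
  \<comment> \<open>A measure given by \<open>measure_of\<close> is 0 when its set function is not a
    measure, so a positive value already guarantees that it is the integral.\<close>
  have int: "(\<integral>\<^sup>+\<theta>\<in>{0..<1}. emeasure (spectral_measure f \<omega> \<theta>) U \<partial>lborel) > 0"
    using pos unfolding ids_measure_def emeasure_measure_of_conv by (simp split: if_splits)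
  define A where "A = (\<Union>n::int. {\<theta>. ?m (\<theta> + real_of_int n * \<omega>) > 0})"
  have A: "A \<in> sets borel" unfolding A_def by measurable
  have per: "spectral_measure f \<omega> (\<theta> + 1) = spectral_measure f \<omega> \<theta>" for \<theta>
  proof -
    have "f (real_of_int n * \<omega> + (\<theta> + 1)) = f (real_of_int n * \<omega> + \<theta>)" for n
      using f_periodic unfolding periodic1_def by (metis add.assoc)
    then have "schroedinger f \<omega> (\<theta> + 1) = schroedinger f \<omega> \<theta>" by (simp add: schroedinger_def fun_eq_iff)
    then show ?thesis by (simp only: spectral_measure_def)
  qed
  have p: "\<theta> + 1 \<in> A \<longleftrightarrow> \<theta> \<in> A" for \<theta>
    using per[of "\<theta> + real_of_int _ * \<omega>"] by (simp add: A_def algebra_simps)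
  have inv: "\<theta> + \<omega> \<in> A \<longleftrightarrow> \<theta> \<in> A" for \<theta>
  proof -
    have e: "\<theta> + \<omega> + real_of_int n * \<omega> = \<theta> + real_of_int (n + 1) * \<omega>" "\<theta> + real_of_int n * \<omega> = \<theta> + \<omega> + real_of_int (n - 1) * \<omega>" for n
      by (simp_all add: algebra_simps)
    have "(\<exists>n::int. ?m (\<theta> + \<omega> + real_of_int n * \<omega>) > 0) \<longleftrightarrow> (\<exists>n::int. ?m (\<theta> + real_of_int n * \<omega>) > 0)"
      by (metis e)
    then show ?thesis by (simp add: A_def)
  qed
  have "emeasure circ A > 0"
  proof (rule ccontr)
    assume "\<not> ?thesis"
    then have "emeasure circ A = 0" by simp
    then have "AE \<theta> in circ. \<theta> \<notin> A" using A by (intro AE_not_in) (simp add: null_sets_def)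
    then have "AE \<theta> in circ. ennreal (?m \<theta>) = 0"
    proof eventually_elim
      case (elim \<theta>)
      then have "\<not> ?m (\<theta> + real_of_int 0 * \<omega>) > 0" unfolding A_def by blast
      then show ?case by (simp add: ennreal_eq_0_iff)
    qed
    then have "(\<integral>\<^sup>+\<theta>. ennreal (?m \<theta>) \<partial>circ) = 0" by (subst nn_integral_0_iff_AE) auto
    then show False using int by (simp add: nn_integral_circ em)
  qed
  from rotation_ergodic[OF irr A p inv this] show ?thesis
  proof eventually_elim
    case (elim \<theta>)
    then obtain n :: int where n: "?m (\<theta> + real_of_int n * \<omega>) > 0" by (auto simp: A_def)
    show ?case
    proof (rule ccontr)
      assume "\<not> ?thesis"
      then have "?m \<theta> = 0" "?m (\<theta> + \<omega>) = 0"
        using measure_nonneg[of "spectral_measure f \<omega> \<theta>" U] measure_nonneg[of "spectral_measure f \<omega> (\<theta> + \<omega>)" U] by linarith+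
      from spectral_null_orbit[OF U this, of n] n show False by simp
    qed
  qed
qed

theorem theorem1p1:
  fixes f :: "real \<Rightarrow> real" and \<omega> :: real and U :: "real set"
  assumes "piecewise_Hoelder f"
    and "\<omega> \<notin> \<rat>"
    and "U \<in> sets borel"
    and "emeasure (ids_measure f \<omega>) U > 0"
    and "\<And>E. E \<in> U \<Longrightarrow> lyapunov f \<omega> (complex_of_real E) > 0"
  shows "(AE \<theta> in lborel. lower_xi f \<omega> \<theta> = 0) \<and>
    (diophantine \<omega> \<longrightarrow> (AE \<theta> in lborel. upper_xi f \<omega> \<theta> = 0)) \<and>
    (\<exists>C>0. \<forall>\<theta>. \<forall>\<zeta>>0.
       (\<exists>T :: nat \<Rightarrow> real. filterlim T at_top sequentially \<and>
          (\<forall>k. box_prob f \<omega> \<theta> (T k) (T k powr \<zeta>) > C * measure (spectral_measure f \<omega> \<theta>) U)) \<and>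
       (diophantine \<omega> \<longrightarrow>
          (\<forall>\<^sub>F T in at_top. box_prob f \<omega> \<theta> T (T powr \<zeta>) > C * measure (spectral_measure f \<omega> \<theta>) U)))"
proof -
  obtain F K g where "hoelder_sampling f F K g" using piecewise_Hoelder_sampling[OF assms(1)] by blast
  then interpret hoelder_sampling f F K g .
  let ?m = "\<lambda>\<theta>. (measure (spectral_measure f \<omega> \<theta>) U + measure (spectral_measure f \<omega> (\<theta> + \<omega>)) U) / 8"
  note freq = box_prob_frequently[OF assms(2,3,5)] and ev = box_prob_eventually[OF assms(2) _ assms(3,5)]
  have pos: "AE \<theta> in lborel. ?m \<theta> > 0"
    using spectral_pair_positive[OF assms(2,3,4)] by eventually_elim simp
  \<comment> \<open>The constant 1/8 of the box estimate is kept and the nonnegative mass at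
    \<open>\<theta> + \<omega>\<close> is dropped.\<close>
  have m: "1 / 8 * measure (spectral_measure f \<omega> \<theta>) U \<le> ?m \<theta>" for \<theta> by simp
  have "AE \<theta> in lborel. lower_xi f \<omega> \<theta> = 0"
    using pos by eventually_elim (rule lower_xi_zero, assumption, rule freq)
  moreover have "AE \<theta> in lborel. upper_xi f \<omega> \<theta> = 0" if "diophantine \<omega>"
    using pos by eventually_elim (rule upper_xi_zero, assumption, rule ev[OF that])
  moreover have "\<exists>T. filterlim T at_top sequentially \<and> (\<forall>k. box_prob f \<omega> \<theta> (T k) (T k powr \<zeta>) > 1 / 8 * measure (spectral_measure f \<omega> \<theta>) U)"
    if "\<zeta> > 0" for \<theta> \<zeta> :: real
    using freq[OF _ that, of \<theta>] m[of \<theta>] by (meson le_less_trans)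
  moreover have "\<forall>\<^sub>F T in at_top. box_prob f \<omega> \<theta> T (T powr \<zeta>) > 1 / 8 * measure (spectral_measure f \<omega> \<theta>) U"
    if "diophantine \<omega>" "\<zeta> > 0" for \<theta> \<zeta> :: real
    by (rule eventually_mono[OF ev[OF that(1) _ that(2)]]) (assumption, rule le_less_trans[OF m])
  ultimately show ?thesis
    by (intro conjI impI exI[of _ "1 / 8"] allI) simp_all
qed

end
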